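(* For each $k \in \{0,1,2,\ldots\}$ the following holds: every language in $\mathrm{NE}$ has (nonuniform) $\mathrm{ACC}^k$ circuits if and only if every language in $\mathrm{NE}$ has $\mathrm{P}^{\mathrm{NE}}$-uniform $\mathrm{ACC}^k$ circuits.
   Context: $\mathrm{NE} = \mathrm{NTIME}[2^{O(n)}]$, the class of languages accepted by nondeterministic Turing machines in time $2^{O(n)}$. $\mathrm{ACC}^k$ circuits are families $\{C_j\}_{j\ge 0}$ of Boolean circuits of size polynomial in $j$ and depth $O((\log j)^k)$, built from NOT gates and unbounded fan-in AND, OR, and $\mathrm{MOD}_m$ gates (for some fixed constant $m$); a language $A$ "has $\mathrm{ACC}^k$ circuits" if there is such a family with $C_j$ deciding membership in $A$ for all inputs of length $j$. The family is $\mathrm{P}^{\mathrm{NE}}$-uniform if there is a function in $\mathrm{FP}^{\mathrm{NE}}$ (computable in deterministic polynomial time with an oracle for a set in $\mathrm{NE}$) that on input $1^j$ outputs a description of $C_j$. *)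

theory Defs
  imports Complex_Main "HOL-Library.Landau_Symbols"
begin

type_synonym language = "bool list set"

definition poly_bounded :: "(nat \<Rightarrow> nat) \<Rightarrow> bool" where
  "poly_bounded f \<longleftrightarrow> (\<exists>c::nat. (\<lambda>n. real (f n)) \<in> O(\<lambda>n. real n ^ c))"


section \<open>Turing machines\<close>

text \<open>
  Machines have several two-way infinite tapes. States are natural numbers. The transition
  relation of a machine is finite, so that only finitely many states and tape symbols matter.
\<close>

datatype symbol = Blank | Bit bool | Aux nat

datatype move = Move_Left | Move_Stay | Move_Right

type_synonym tape = "(int \<Rightarrow> symbol) \<times> int"  \<comment> \<open>contents and head position\<close>

type_synonym config = "nat \<times> tape list"

text \<open>
  An element \<open>((q, ss), (q', as))\<close> of \<open>delta\<close> is applicable in state \<open>q\<close> when the heads scan the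
  symbols \<open>ss\<close>; the \<open>i\<close>-th entry of \<open>as\<close> is the symbol written and the move made on tape \<open>i\<close>.
\<close>

record tm =
  tapes :: nat
  start :: nat
  final :: nat
  delta :: "((nat \<times> symbol list) \<times> (nat \<times> (symbol \<times> move) list)) set"

definition wf_tm :: "'a tm_scheme \<Rightarrow> bool" where
  "wf_tm M \<longleftrightarrow> tapes M \<ge> 1 \<and> finite (delta M) \<and>
    (\<forall>((q, ss), (q', as)) \<in> delta M.
       q \<noteq> final M \<and> length ss = tapes M \<and> length as = tapes M)"

fun scan :: "tape \<Rightarrow> symbol" where
  "scan (t, p) = t p"

fun offset :: "move \<Rightarrow> int" where
  "offset Move_Left = -1"
| "offset Move_Stay = 0"
| "offset Move_Right = 1"

fun act :: "symbol \<times> move \<Rightarrow> tape \<Rightarrow> tape" where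
  "act (s, d) (t, p) = (t(p := s), p + offset d)"

fun step :: "'a tm_scheme \<Rightarrow> config \<Rightarrow> config \<Rightarrow> bool" where
  "step M (q, ts) (q', ts') \<longleftrightarrow>
     (\<exists>as. ((q, map scan ts), (q', as)) \<in> delta M \<and> ts' = map2 act as ts)"

definition blank_tape :: tape where
  "blank_tape = (\<lambda>_. Blank, 0)"

definition input_tape :: "bool list \<Rightarrow> tape" where
  "input_tape x = (\<lambda>i. if 0 \<le> i \<and> i < int (length x) then Bit (x ! nat i) else Blank, 0)"

definition init :: "'a tm_scheme \<Rightarrow> bool list \<Rightarrow> config" where
  "init M x = (start M, input_tape x # replicate (tapes M - 1) blank_tape)"

text \<open>The binary word written from cell 0 up to the first cell that does not hold a bit.\<close>

definition tape_word :: "tape \<Rightarrow> bool list" where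
  "tape_word T = map (\<lambda>i. fst T (int i) = Bit True) [0..<(LEAST i. \<forall>b. fst T (int i) \<noteq> Bit b)]"


subsection \<open>Nondeterministic time\<close>

definition accepts_in :: "'a tm_scheme \<Rightarrow> bool list \<Rightarrow> nat \<Rightarrow> bool" where
  "accepts_in M x s \<longleftrightarrow> (\<exists>ts. (step M ^^ s) (init M x) (final M, ts))"

text \<open>
  The machine accepts exactly the members of the language, with no time limit on the paths
  considered; each member has in addition an accepting path obeying the time bound.
\<close>

definition NTIME :: "(nat \<Rightarrow> nat) \<Rightarrow> language set" where
  "NTIME t = {A. \<exists>M::tm. wf_tm M \<and> A = {x. \<exists>s. accepts_in M x s} \<and>
                  (\<forall>x\<in>A. \<exists>s \<le> t (length x). accepts_in M x s)}"

definition NE :: "language set" where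
  "NE = {A. \<exists>t f. f \<in> O(\<lambda>n. real n) \<and> (\<forall>n. real (t n) \<le> 2 powr f n) \<and> A \<in> NTIME t}"


subsection \<open>Polynomial-time functions with an oracle\<close>

text \<open>
  Tape 0 holds the input, tape 1 is the query tape and tape 2 the output tape. In state \<open>query\<close>
  the machine moves in one step, with all tapes unchanged, to \<open>yes\<close> or \<open>no\<close> according to
  whether the word on the query tape belongs to the oracle. The final state has no successors
  (by \<open>wf_tm\<close> and \<open>query M \<noteq> final M\<close>), so a deterministic machine has at most one output per input.
\<close>

record otm = tm +
  query :: nat
  yes :: nat
  no :: nat

definition wf_det_otm :: "otm \<Rightarrow> bool" where
  "wf_det_otm M \<longleftrightarrow> wf_tm M \<and> tapes M \<ge> 3 \<and> query M \<noteq> final M \<and> single_valued (delta M)"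

fun ostep :: "language \<Rightarrow> otm \<Rightarrow> config \<Rightarrow> config \<Rightarrow> bool" where
  "ostep B M (q, ts) c' \<longleftrightarrow>
     (if q = query M then c' = (if tape_word (ts ! 1) \<in> B then yes M else no M, ts)
      else step M (q, ts) c')"

definition FP :: "language \<Rightarrow> (bool list \<Rightarrow> bool list) set" where
  "FP B = {f. \<exists>M t. wf_det_otm M \<and> poly_bounded t \<and>
               (\<forall>x. \<exists>s \<le> t (length x). \<exists>ts.
                  (ostep B M ^^ s) (init M x) (final M, ts) \<and> tape_word (ts ! 2) = f x)}"

definition FP_NE :: "(bool list \<Rightarrow> bool list) set" where
  "FP_NE = (\<Union>B\<in>NE. FP B)"


section \<open>Circuits\<close>

text \<open>
  A circuit with \<open>n\<close> inputs is a topologically sorted list of gates. Nodes \<open>0, \<dots>, n - 1\<close> are the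
  inputs and node \<open>n + i\<close> is the \<open>i\<close>-th gate; a gate lists the nodes feeding it, possibly with
  repetitions. The last gate is the output. The modulus of the MOD gates is not part of the
  circuit but a parameter of its evaluation, as it is the same throughout a circuit family.
\<close>

datatype gate_type = Not_Gate | And_Gate | Or_Gate | Mod_Gate

type_synonym gate = "gate_type \<times> nat list"

type_synonym circuit = "gate list"

definition wf_circuit :: "nat \<Rightarrow> circuit \<Rightarrow> bool" where
  "wf_circuit n C \<longleftrightarrow> C \<noteq> [] \<and>
     (\<forall>i < length C. (\<forall>w \<in> set (snd (C ! i)). w < n + i) \<and>
                      (fst (C ! i) = Not_Gate \<longrightarrow> length (snd (C ! i)) = 1))"

fun gate_value :: "nat \<Rightarrow> gate_type \<Rightarrow> bool list \<Rightarrow> bool" where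
  "gate_value m Not_Gate bs = (\<not> hd bs)"
| "gate_value m And_Gate bs = (\<forall>b \<in> set bs. b)"
| "gate_value m Or_Gate bs = (\<exists>b \<in> set bs. b)"
| "gate_value m Mod_Gate bs = (m dvd length (filter (\<lambda>b. b) bs))"

definition node_values :: "nat \<Rightarrow> circuit \<Rightarrow> bool list \<Rightarrow> bool list" where
  "node_values m C x = foldl (\<lambda>vs (g, ws). vs @ [gate_value m g (map ((!) vs) ws)]) x C"

definition circuit_eval :: "nat \<Rightarrow> circuit \<Rightarrow> bool list \<Rightarrow> bool" where
  "circuit_eval m C x = last (node_values m C x)"

definition circuit_size :: "circuit \<Rightarrow> nat" where  \<comment> \<open>number of gates and wires\<close>
  "circuit_size C = (\<Sum>(g, ws) \<leftarrow> C. 1 + length ws)"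

definition node_depths :: "nat \<Rightarrow> circuit \<Rightarrow> nat list" where
  "node_depths n C =
     foldl (\<lambda>ds (g, ws). ds @ [Suc (Max (insert 0 ((!) ds ` set ws)))]) (replicate n 0) C"

definition circuit_depth :: "nat \<Rightarrow> circuit \<Rightarrow> nat" where
  "circuit_depth n C = Max (set (node_depths n C))"


subsection \<open>Descriptions of circuits\<close>

text \<open>
  Node numbers are written in unary; for circuits of polynomial size this costs only a
  polynomial factor.
\<close>

fun encode_gate_type :: "gate_type \<Rightarrow> bool list" where
  "encode_gate_type Not_Gate = [False, False]"
| "encode_gate_type And_Gate = [False, True]"
| "encode_gate_type Or_Gate = [True, False]"
| "encode_gate_type Mod_Gate = [True, True]"

definition encode_wire :: "nat \<Rightarrow> bool list" where
  "encode_wire w = replicate (Suc w) True @ [False]"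

fun encode_gate :: "gate \<Rightarrow> bool list" where
  "encode_gate (g, ws) = encode_gate_type g @ concat (map encode_wire ws) @ [False]"

definition encode_circuit :: "circuit \<Rightarrow> bool list" where
  "encode_circuit C = concat (map encode_gate C)"

lemma encode_wire_append_eq:
  "encode_wire v @ r = encode_wire w @ s \<Longrightarrow> v = w \<and> r = s"
proof (induction v arbitrary: w)
  case 0
  then show ?case by (cases w) (auto simp: encode_wire_def)
next
  case (Suc v)
  then show ?case by (cases w) (auto simp: encode_wire_def)
qed

lemma encode_wires_append_eq:
  "concat (map encode_wire vs) @ False # r = concat (map encode_wire ws) @ False # s
    \<Longrightarrow> vs = ws \<and> r = s"
proof (induction vs arbitrary: ws)
  case Nil
  then show ?case by (cases ws) (auto simp: encode_wire_def)
next
  case (Cons v vs)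
  show ?case
  proof (cases ws)
    case Nil
    with Cons.prems show ?thesis by (simp add: encode_wire_def)
  next
    case (Cons w ws')
    with Cons.prems have "v = w \<and> concat (map encode_wire vs) @ False # r
        = concat (map encode_wire ws') @ False # s"
      by (intro encode_wire_append_eq) simp
    with Cons.IH Cons show ?thesis by blast
  qed
qed

lemma encode_gate_append_eq:
  "encode_gate g @ r = encode_gate h @ s \<Longrightarrow> g = h \<and> r = s"
  by (cases g; cases h; cases "fst g"; cases "fst h")
     (auto dest: encode_wires_append_eq)

lemma inj_encode_circuit: "inj encode_circuit"
proof (rule injI)
  fix C D
  assume "encode_circuit C = encode_circuit D"
  then show "C = D"
  proof (induction C arbitrary: D)
    case Nil
    then show ?case by (cases D) (auto simp: encode_circuit_def)
  next
    case (Cons g C)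
    show ?case
    proof (cases D)
      case Nil
      with Cons.prems show ?thesis by (cases g) (simp add: encode_circuit_def)
    next
      case D: (Cons h D')
      with Cons.prems have "g = h \<and> encode_circuit C = encode_circuit D'"
        by (intro encode_gate_append_eq) (simp add: encode_circuit_def)
      with Cons.IH D show ?thesis by blast
    qed
  qed
qed


subsection \<open>The circuit classes\<close>

definition ACC_family :: "nat \<Rightarrow> (nat \<Rightarrow> circuit) \<Rightarrow> bool" where
  "ACC_family k C \<longleftrightarrow>
     (\<forall>j. wf_circuit j (C j)) \<and>
     poly_bounded (\<lambda>j. circuit_size (C j)) \<and>
     (\<lambda>j. real (circuit_depth j (C j))) \<in> O(\<lambda>j. ln (real j) ^ k)"

definition family_decides :: "nat \<Rightarrow> (nat \<Rightarrow> circuit) \<Rightarrow> language \<Rightarrow> bool" where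
  "family_decides m C A \<longleftrightarrow> (\<forall>x. x \<in> A \<longleftrightarrow> circuit_eval m (C (length x)) x)"

definition PNE_uniform :: "(nat \<Rightarrow> circuit) \<Rightarrow> bool" where
  "PNE_uniform C \<longleftrightarrow> (\<exists>f\<in>FP_NE. \<forall>j. f (replicate j True) = encode_circuit (C j))"

definition has_ACC_circuits :: "nat \<Rightarrow> language \<Rightarrow> bool" where
  "has_ACC_circuits k A \<longleftrightarrow>
     (\<exists>m C. m \<ge> 2 \<and> ACC_family k C \<and> family_decides m C A)"

definition has_PNE_uniform_ACC_circuits :: "nat \<Rightarrow> language \<Rightarrow> bool" where
  "has_PNE_uniform_ACC_circuits k A \<longleftrightarrow>
     (\<exists>m C. m \<ge> 2 \<and> ACC_family k C \<and> family_decides m C A \<and> PNE_uniform C)"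

end

theory Submission
  imports Defs "HOL-Library.Countable" "HOL-Library.FuncSet"
begin

text \<open>
  A circuit that accepts only members of \<open>A\<close> can be certified in \<open>NE\<close>: guess accepting
  computations for the inputs that it accepts. Hence so can a pair of such a circuit and the number
  of inputs that it accepts, and by lexicographic maximality of the number the circuit is exact;
  writing the depth bound next, in unary with zeros first, then forces the depth to be at most
  that of the given nonuniform circuit. A machine in \<open>FP\<close> finds the lexicographically
  largest certified string bit by bit, with the set of its prefixes as oracle.
\<close>

section \<open>Multihead checks of a guessed word\<close>

text \<open>That a circuit rejects only nonmembers cannot be certified directly, since NE is not
  known to be closed under complement; the census stands in for it. Neither \<open>k\<close> nor the
  constant hidden in the depth bound is available to the verifier, so depth is minimized rather than
  compared with a bound, and pointwise domination settles every \<open>k\<close> at once. The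
  laborious part is to place the prefix language in NE with concrete Turing machines. The machine
  guesses the whole certificate, a word of exponential length, writing it on one tape per head, and
  does not alter it afterwards. What remains is a two-way multihead automaton on a fixed word. Such
  automata compose like regular expressions, so the verifier is written as an expression and
  analysed as a relation between head positions, without further mention of machines. Head positions
  double as counters up to the length of the track, which suffices because certificates are padded.
  Nondeterministic loops are harmless: a loop left at the wrong moment fails at the next
  test.\<close>

type_synonym heads = "nat \<Rightarrow> nat"

type_synonym check = "symbol list \<Rightarrow> heads \<Rightarrow> heads \<Rightarrow> bool"

definition skip :: check where
  "skip T h h' \<longleftrightarrow> h' = h"

definition test :: "nat \<Rightarrow> symbol set \<Rightarrow> check" where
  "test i S T h h' \<longleftrightarrow> h i < length T \<and> T ! h i \<in> S \<and> h' = h"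

definition right :: "nat \<Rightarrow> check" where
  "right i T h h' \<longleftrightarrow> Suc (h i) < length T \<and> h' = h(i := Suc (h i))"

definition left :: "nat \<Rightarrow> check" where
  "left i T h h' \<longleftrightarrow> 0 < h i \<and> h' = h(i := h i - 1)"

definition seq :: "check \<Rightarrow> check \<Rightarrow> check"  (infixr ";;" 60) where
  "(P ;; Q) T = P T OO Q T"

definition alt :: "check \<Rightarrow> check \<Rightarrow> check"  (infixr "\<squnion>" 55) where
  "(P \<squnion> Q) T h h' \<longleftrightarrow> P T h h' \<or> Q T h h'"

definition star :: "check \<Rightarrow> check" where
  "star P T = (P T)\<^sup>*\<^sup>*"

lemma star_refl: "star P T h h"
  by (simp add: star_def)

lemma star_snoc: "star P T h g \<Longrightarrow> P T g g' \<Longrightarrow> star P T h g'"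
  by (simp add: star_def)

text \<open>There is no complement among the constructors, as acceptance is nondeterministic: a
  negative condition needs a positive check of its own, such as \<open>differ\<close> for unequal
  heads or the remainders tested in \<open>eval_chk\<close>.\<close>

inductive realizable :: "check \<Rightarrow> bool" where
  skip: "realizable skip"
| test: "realizable (test i S)"
| right: "realizable (right i)"
| left: "realizable (left i)"
| seq: "realizable P \<Longrightarrow> realizable Q \<Longrightarrow> realizable (P ;; Q)"
| alt: "realizable P \<Longrightarrow> realizable Q \<Longrightarrow> realizable (P \<squnion> Q)"
| star: "realizable P \<Longrightarrow> realizable (star P)"


subsection \<open>Multihead automata\<close>

text \<open>The primitive checks once more as data: the Turing machine needs a finite set of edges
  whose labels can be inspected, which a relation on heads does not offer.\<close>

datatype instr = Skip | Test nat "symbol set" | Right nat | Left nat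

fun perform :: "instr \<Rightarrow> check" where
  "perform Skip = skip"
| "perform (Test i S) = test i S"
| "perform (Right i) = right i"
| "perform (Left i) = left i"

text \<open>States are lists so that a disjoint union of automata merely prefixes a tag to each
  state. Lists of numbers are countable, and \<open>to_nat\<close> later turns them into states of a
  Turing machine.\<close>

type_synonym edges = "(nat list \<times> instr \<times> nat list) set"

inductive edge_step :: "edges \<Rightarrow> symbol list \<Rightarrow> nat list \<times> heads \<Rightarrow> nat list \<times> heads \<Rightarrow> bool"
  for E T where
  "(q, I, q') \<in> E \<Longrightarrow> perform I T h h' \<Longrightarrow> edge_step E T (q, h) (q', h')"

abbreviation reach :: "edges \<Rightarrow> symbol list \<Rightarrow> nat list \<times> heads \<Rightarrow> nat list \<times> heads \<Rightarrow> bool" where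
  "reach E T \<equiv> (edge_step E T)\<^sup>*\<^sup>*"

definition lift :: "nat \<Rightarrow> edges \<Rightarrow> edges" where
  "lift n E = (\<lambda>(q, I, q'). (n # q, I, n # q')) ` E"

lemma finite_lift [simp]: "finite E \<Longrightarrow> finite (lift n E)"
  by (simp add: lift_def)

lemma lift_iff [simp]:
  "(p, I, p') \<in> lift n E \<longleftrightarrow> (\<exists>q q'. p = n # q \<and> p' = n # q' \<and> (q, I, q') \<in> E)"
  by (force simp: lift_def)

lemma reach_lift:
  assumes "reach E T (q, h) (q', h')" "lift n E \<subseteq> E'"
  shows "reach E' T (n # q, h) (n # q', h')"
  using assms(1)
proof (induction "(q', h')" arbitrary: q' h' rule: rtranclp_induct)
  case base
  then show ?case by simp
next
  case (step c)
  obtain p g where c: "c = (p, g)" by fastforce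
  from step(2) c obtain I where "(p, I, q') \<in> E" "perform I T g h'"
    by (auto elim: edge_step.cases)
  with assms(2) have "edge_step E' T (n # p, g) (n # q', h')"
    by (intro edge_step.intros[where I = I]) auto
  with step(3)[OF c] show ?case by simp
qed

lemma reach_skip: "(q, Skip, q') \<in> E \<Longrightarrow> reach E T (q, h) (q', h)"
  by (intro r_into_rtranclp edge_step.intros[where I = Skip]) (auto simp: skip_def)

lemma reach_edge: "(q, I, q') \<in> E \<Longrightarrow> perform I T h h' \<Longrightarrow> reach E T (q, h) (q', h')"
  by (intro r_into_rtranclp edge_step.intros)

lemma reach_step:
  "reach E T c (q, h) \<Longrightarrow> (q, I, q') \<in> E \<Longrightarrow> perform I T h h' \<Longrightarrow> reach E T c (q', h')"
  using reach_edge rtranclp_trans by metis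

definition automaton_for :: "edges \<Rightarrow> nat list \<Rightarrow> nat list \<Rightarrow> check \<Rightarrow> bool" where
  "automaton_for E s f P \<longleftrightarrow>
     finite E \<and> (\<forall>T h h'. reach E T (s, h) (f, h') \<longleftrightarrow> P T h h')"

lemma reach_invariant:
  assumes "reach E T (s, h) (q, h')" "Inv s h"
    and "\<And>p I p' g g'. Inv p g \<Longrightarrow> (p, I, p') \<in> E \<Longrightarrow> perform I T g g' \<Longrightarrow> Inv p' g'"
  shows "Inv q h'"
  using assms(1)
proof (induction "(q, h')" arbitrary: q h' rule: rtranclp_induct)
  case base
  then show ?case using assms(2) by simp
next
  case (step c)
  then show ?case using assms(3) by (cases c) (auto elim!: edge_step.cases)
qed

lemma automaton_instr: "automaton_for {([], I, [0])} [] [0] (perform I)"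
  unfolding automaton_for_def
proof (intro conjI allI)
  fix T h h'
  show "reach {([], I, [0])} T ([], h) ([0], h') \<longleftrightarrow> perform I T h h'"
  proof
    assume reach: "reach {([], I, [0])} T ([], h) ([0], h')"
    define Inv where "Inv = (\<lambda>q g. q = [] \<and> g = h \<or> q = [0::nat] \<and> perform I T h g)"
    from reach have "Inv [0] h'"
      by (rule reach_invariant[where Inv = Inv]) (auto simp: Inv_def)
    then show "perform I T h h'" by (simp add: Inv_def)
  qed (simp add: reach_edge)
qed simp

text \<open>Thompson's construction. The only edge between the two copies leads from the first to
  the second and moves no head, so every path splits there into a run of \<open>P\<close> and a run
  of \<open>Q\<close>.\<close>

lemma automaton_seq:
  assumes "automaton_for E s f P" "automaton_for E' s' f' Q"
  shows "automaton_for (lift 0 E \<union> lift 1 E' \<union> {(0 # f, Skip, 1 # s')}) (0 # s) (1 # f') (P ;; Q)"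
    (is "automaton_for ?E _ _ _")
  unfolding automaton_for_def
proof (intro conjI allI)
  fix T h h'
  note [simp] = assms[unfolded automaton_for_def, THEN conjunct2, rule_format]
  show "reach ?E T (0 # s, h) (1 # f', h') \<longleftrightarrow> (P ;; Q) T h h'"
  proof
    assume reach: "reach ?E T (0 # s, h) (1 # f', h')"
    define Inv where "Inv = (\<lambda>q g. (\<exists>p. q = 0 # p \<and> reach E T (s, h) (p, g)) \<or>
        (\<exists>p h''. q = 1 # p \<and> P T h h'' \<and> reach E' T (s', h'') (p, g)))"
    from reach have "Inv (1 # f') h'"
    proof (rule reach_invariant[where Inv = Inv])
      fix p I p' g g'
      assume Inv: "Inv p g" and e: "(p, I, p') \<in> ?E" and I: "perform I T g g'"
      from e consider (l) q q' where "p = 0 # q" "p' = 0 # q'" "(q, I, q') \<in> E"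
        | (r) q q' where "p = 1 # q" "p' = 1 # q'" "(q, I, q') \<in> E'"
        | (m) "p = 0 # f" "p' = 1 # s'" "I = Skip"
        by auto
      then show "Inv p' g'"
      proof cases
        case l
        then have "reach E T c (q', g')" if "reach E T c (q, g)" for c
          using I that by (blast intro: reach_step)
        with Inv l show ?thesis by (auto simp: Inv_def)
      next
        case r
        then have "reach E' T c (q', g')" if "reach E' T c (q, g)" for c
          using I that by (blast intro: reach_step)
        with Inv r show ?thesis by (auto simp: Inv_def)
      qed (use Inv I in \<open>auto simp: Inv_def skip_def alt_def\<close>)
    qed (simp add: Inv_def)
    then show "(P ;; Q) T h h'" by (auto simp: Inv_def seq_def)
  next
    assume "(P ;; Q) T h h'"
    then obtain h'' where "P T h h''" "Q T h'' h'" by (auto simp: seq_def)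
    then have "reach ?E T (0 # s, h) (0 # f, h'')" "reach ?E T (1 # s', h'') (1 # f', h')"
      using reach_lift[of E T s h f h'' 0 ?E] reach_lift[of E' T s' h'' f' h' 1 ?E]
      by (simp_all, blast+)
    moreover have "reach ?E T (0 # f, h'') (1 # s', h'')" by (rule reach_skip) simp
    ultimately show "reach ?E T (0 # s, h) (1 # f', h')" by (meson rtranclp_trans)
  qed
qed (use assms in \<open>auto simp: automaton_for_def\<close>)

lemma automaton_alt:
  assumes "automaton_for E s f P" "automaton_for E' s' f' Q"
  shows "automaton_for (lift 0 E \<union> lift 1 E' \<union> {([], Skip, 0 # s), ([], Skip, 1 # s'),
    (0 # f, Skip, [2]), (1 # f', Skip, [2])}) [] [2] (P \<squnion> Q)"
    (is "automaton_for ?E _ _ _")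
  unfolding automaton_for_def
proof (intro conjI allI)
  fix T h h'
  note [simp] = assms[unfolded automaton_for_def, THEN conjunct2, rule_format]
  show "reach ?E T ([], h) ([2], h') \<longleftrightarrow> (P \<squnion> Q) T h h'"
  proof
    assume reach: "reach ?E T ([], h) ([2], h')"
    define Inv where "Inv = (\<lambda>q g. (q = [] \<and> g = h) \<or> (\<exists>p. q = 0 # p \<and> reach E T (s, h) (p, g)) \<or>
        (\<exists>p. q = 1 # p \<and> reach E' T (s', h) (p, g)) \<or> (q = [2] \<and> (P \<squnion> Q) T h g))"
    from reach have "Inv [2] h'"
    proof (rule reach_invariant[where Inv = Inv])
      fix p I p' g g'
      assume Inv: "Inv p g" and e: "(p, I, p') \<in> ?E" and I: "perform I T g g'"
      from e consider (l) q q' where "p = 0 # q" "p' = 0 # q'" "(q, I, q') \<in> E"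
        | (r) q q' where "p = 1 # q" "p' = 1 # q'" "(q, I, q') \<in> E'"
        | (a) "p = []" "p' = 0 # s" "I = Skip"
        | (b) "p = []" "p' = 1 # s'" "I = Skip"
        | (c) "p = 0 # f" "p' = [2]" "I = Skip"
        | (d) "p = 1 # f'" "p' = [2]" "I = Skip"
        by auto
      then show "Inv p' g'"
      proof cases
        case l
        then have "reach E T c (q', g')" if "reach E T c (q, g)" for c
          using I that by (blast intro: reach_step)
        with Inv l show ?thesis by (auto simp: Inv_def)
      next
        case r
        then have "reach E' T c (q', g')" if "reach E' T c (q, g)" for c
          using I that by (blast intro: reach_step)
        with Inv r show ?thesis by (auto simp: Inv_def)
      qed (use Inv I in \<open>auto simp: Inv_def skip_def alt_def\<close>)
    qed (simp add: Inv_def)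
    then show "(P \<squnion> Q) T h h'" by (auto simp: Inv_def seq_def)
  next
    assume "(P \<squnion> Q) T h h'"
    then have "reach ?E T (0 # s, h) (0 # f, h') \<or> reach ?E T (1 # s', h) (1 # f', h')"
      using reach_lift[of E T s h f h' 0 ?E] reach_lift[of E' T s' h f' h' 1 ?E]
      by (simp add: alt_def) blast
    moreover have "reach ?E T ([], h) (0 # s, h)" "reach ?E T ([], h) (1 # s', h)"
      "reach ?E T (0 # f, h') ([2], h')" "reach ?E T (1 # f', h') ([2], h')"
      by (auto intro: reach_skip)
    ultimately show "reach ?E T ([], h) ([2], h')" by (meson rtranclp_trans)
  qed
qed (use assms in \<open>auto simp: automaton_for_def\<close>)

text \<open>The state \<open>[]\<close> is both start and end, so that each return to it closes one
  iteration.\<close>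

lemma automaton_star:
  assumes "automaton_for E s f P"
  shows "automaton_for (lift 0 E \<union> {([], Skip, 0 # s), (0 # f, Skip, [])}) [] [] (star P)"
    (is "automaton_for ?E _ _ _")
  unfolding automaton_for_def
proof (intro conjI allI)
  fix T h h'
  note [simp] = assms[unfolded automaton_for_def, THEN conjunct2, rule_format]
  show "reach ?E T ([], h) ([], h') \<longleftrightarrow> star P T h h'"
  proof
    assume reach: "reach ?E T ([], h) ([], h')"
    \<comment> \<open>Inside the body the invariant remembers \<open>h''\<close>, the heads at the
      latest visit of the state \<open>[]\<close>.\<close>
    define Inv where "Inv = (\<lambda>q g. (q = [] \<and> star P T h g) \<or>
        (\<exists>p h''. q = 0 # p \<and> star P T h h'' \<and> reach E T (s, h'') (p, g)))"
    from reach have "Inv [] h'"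
    proof (rule reach_invariant[where Inv = Inv])
      fix p I p' g g'
      assume Inv: "Inv p g" and e: "(p, I, p') \<in> ?E" and I: "perform I T g g'"
      from e consider (l) q q' where "p = 0 # q" "p' = 0 # q'" "(q, I, q') \<in> E"
        | (a) "p = []" "p' = 0 # s" "I = Skip"
        | (b) "p = 0 # f" "p' = []" "I = Skip"
        by auto
      then show "Inv p' g'"
      proof cases
        case l
        then have "reach E T c (q', g')" if "reach E T c (q, g)" for c
          using I that by (blast intro: reach_step)
        with Inv l show ?thesis by (auto simp: Inv_def)
      qed (use Inv I in \<open>auto simp: Inv_def skip_def alt_def star_snoc\<close>)
    qed (simp add: Inv_def star_refl)
    then show "star P T h h'" by (auto simp: Inv_def seq_def)
  next
    assume "star P T h h'"
    then show "reach ?E T ([], h) ([], h')" unfolding star_def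
    proof (induction rule: rtranclp_induct)
      case (step g g')
      then have "reach ?E T (0 # s, g) (0 # f, g')"
        using reach_lift[of E T s g f g' 0 ?E] by simp blast
      moreover have "reach ?E T ([], g) (0 # s, g)" "reach ?E T (0 # f, g') ([], g')"
        by (auto intro: reach_skip)
      ultimately show ?case using step.IH by (meson rtranclp_trans)
    qed simp
  qed
qed (use assms in \<open>auto simp: automaton_for_def\<close>)

lemma realizable_automaton: "realizable P \<Longrightarrow> \<exists>E s f. automaton_for E s f P"
proof (induction rule: realizable.induct)
  case skip
  then show ?case using automaton_instr[of Skip] by auto
next
  case (test i S)
  then show ?case using automaton_instr[of "Test i S"] by auto
next
  case (right i)
  then show ?case using automaton_instr[of "Right i"] by auto
next
  case (left i)
  then show ?case using automaton_instr[of "Left i"] by auto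
next
  case (seq P Q)
  then show ?case using automaton_seq by metis
next
  case (alt P Q)
  then show ?case using automaton_alt by metis
next
  case (star P)
  then show ?case using automaton_star by metis
qed


subsection \<open>The Turing machine of a check\<close>

abbreviation LM :: symbol where "LM \<equiv> Aux 0"

abbreviation RM :: symbol where "RM \<equiv> Aux 1"

definition track :: "symbol list \<Rightarrow> symbol list" where
  "track u = LM # u @ [RM]"

definition contents :: "symbol list \<Rightarrow> int \<Rightarrow> symbol" where
  "contents T i = (if 0 \<le> i \<and> i < int (length T) then T ! nat i else Blank)"

lemma contents_nat [simp]: "i < length T \<Longrightarrow> contents T (int i) = T ! i"
  by (simp add: contents_def)

lemma contents_outside [simp]: "contents T (int (length T)) = Blank"
  by (simp add: contents_def)

lemma contents_snoc [simp]: "(contents T)(int (length T) := a) = contents (T @ [a])"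
  by (auto simp: contents_def fun_eq_iff nth_append nat_eq_iff)

lemma contents_same [simp]: "i < length T \<Longrightarrow> (contents T)(int i := T ! i) = contents T"
  by (auto simp: contents_def fun_eq_iff)

lemma input_tape_contents: "input_tape x = (contents (map Bit x), 0)"
  by (auto simp: input_tape_def contents_def fun_eq_iff)

lemma blank_tape_contents: "blank_tape = (contents [], 0)"
  by (auto simp: blank_tape_def contents_def fun_eq_iff)

text \<open>A machine sees symbols and not positions: a head may move right unless it scans
  \<open>RM\<close>, and left unless it scans \<open>LM\<close>. This agrees with
  \<open>perform\<close> because the markers occur only at the two ends of the track.\<close>

fun admissible :: "instr \<Rightarrow> symbol list \<Rightarrow> bool" where
  "admissible Skip ss \<longleftrightarrow> True"
| "admissible (Test i S) ss \<longleftrightarrow> ss ! i \<in> S"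
| "admissible (Right i) ss \<longleftrightarrow> ss ! i \<noteq> RM"
| "admissible (Left i) ss \<longleftrightarrow> ss ! i \<noteq> LM"

fun head_move :: "instr \<Rightarrow> nat \<Rightarrow> move" where
  "head_move (Right i) j = (if i = j then Move_Right else Move_Stay)"
| "head_move (Left i) j = (if i = j then Move_Left else Move_Stay)"
| "head_move _ j = Move_Stay"

fun uses_head :: "instr \<Rightarrow> nat \<Rightarrow> bool" where
  "uses_head Skip j \<longleftrightarrow> False"
| "uses_head (Test i S) j \<longleftrightarrow> i = j"
| "uses_head (Right i) j \<longleftrightarrow> i = j"
| "uses_head (Left i) j \<longleftrightarrow> i = j"

text \<open>Several heads on one track are simulated by one work tape per head, all with the same
  contents. The alphabet \<open>G\<close> of the guess avoids the end markers, so they cannot be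
  forged in the middle.\<close>

locale check_machine =
  fixes P :: check and E :: edges and s f :: "nat list" and k :: nat and G :: "symbol set"
  assumes automaton: "automaton_for E s f P"
    and k: "0 < k" "\<And>q I q' j. (q, I, q') \<in> E \<Longrightarrow> uses_head I j \<Longrightarrow> j < k"
    and G: "finite G" "LM \<notin> G" "RM \<notin> G"
begin

definition symbols :: "symbol set" where
  "symbols = G \<union> range Bit \<union> {LM, RM}"

abbreviation stay :: "symbol \<times> move" where
  "stay \<equiv> (Blank, Move_Stay)"

text \<open>State 0 writes the left marker, state 1 copies the input and then guesses symbols of
  \<open>G\<close>, state 2 rewinds, the states from 4 on simulate the automaton, and state 3
  accepts. Each guessed symbol is written on all \<open>k\<close> tapes in the same step, so the
  copies agree without a check.\<close>

definition D0 where
  "D0 = (\<lambda>a. ((0::nat, a # replicate k Blank),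
     (1::nat, (a, Move_Stay) # replicate k (LM, Move_Right)))) ` (insert Blank (range Bit))"

definition D1 where
  "D1 = (\<lambda>b. ((1::nat, Bit b # replicate k Blank),
     (1::nat, (Bit b, Move_Right) # replicate k (Bit b, Move_Right)))) ` UNIV"

definition D2 where
  "D2 = (\<lambda>g. ((1::nat, Blank # replicate k Blank), (1::nat, stay # replicate k (g, Move_Right)))) ` G"

definition D3 where
  "D3 = {((1::nat, Blank # replicate k Blank), (2::nat, stay # replicate k (RM, Move_Left)))}"

definition D4 where
  "D4 = (\<lambda>g. ((2::nat, Blank # replicate k g), (2::nat, stay # replicate k (g, Move_Left))))
     ` (G \<union> range Bit)"

definition D5 where
  "D5 = {((2::nat, Blank # replicate k LM), (4 + to_nat s, stay # replicate k (LM, Move_Stay)))}"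

definition D6 where
  "D6 = (\<lambda>((q, I, q'), ss). ((4 + to_nat q, Blank # ss),
     (4 + to_nat q', stay # map (\<lambda>i. (ss ! i, head_move I i)) [0..<k])))
     ` {((q, I, q'), ss). (q, I, q') \<in> E \<and> (set ss \<subseteq> symbols \<and> length ss = k) \<and> admissible I ss}"

definition D7 where
  "D7 = (\<lambda>ss. ((4 + to_nat f, Blank # ss), (3::nat, stay # map (\<lambda>a. (a, Move_Stay)) ss)))
     ` {ss. set ss \<subseteq> symbols \<and> length ss = k}"

definition M :: tm where
  "M = \<lparr>tapes = Suc k, start = 0, final = 3,
        delta = D0 \<union> D1 \<union> D2 \<union> D3 \<union> D4 \<union> D5 \<union> D6 \<union> D7\<rparr>"

lemma finite_symbols: "finite symbols"
  using G by (simp add: symbols_def)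

lemma wf_M: "wf_tm M"
proof -
  have "finite {ss. set ss \<subseteq> symbols \<and> length ss = k}"
    by (rule finite_lists_length_eq[OF finite_symbols])
  moreover have "finite E" using automaton by (simp add: automaton_for_def)
  ultimately have "finite (E \<times> {ss. set ss \<subseteq> symbols \<and> length ss = k})" by simp
  then have "finite {((q, I, q'), ss). (q, I, q') \<in> E \<and> (set ss \<subseteq> symbols \<and> length ss = k) \<and> admissible I ss}"
    by (rule rev_finite_subset) auto
  then have "finite D6" "finite D7"
    using \<open>finite {ss. set ss \<subseteq> symbols \<and> length ss = k}\<close> by (auto simp: D6_def D7_def)
  moreover have "finite D0" "finite D1" "finite D2" "finite D3" "finite D4" "finite D5"
    using G by (simp_all add: D0_def D1_def D2_def D3_def D4_def D5_def)
  ultimately show ?thesis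
    by (auto simp: wf_tm_def M_def D0_def D1_def D2_def D3_def D4_def D5_def D6_def D7_def)
qed

lemma reach_iff: "reach E T (s, h) (f, h') \<longleftrightarrow> P T h h'"
  using automaton by (simp add: automaton_for_def)

section \<open>Reachable configurations of the machine\<close>

definition read_tape :: "bool list \<Rightarrow> tape" where
  "read_tape x = (contents (map Bit x), int (length x))"

definition head_tapes :: "symbol list \<Rightarrow> heads \<Rightarrow> tape list" where
  "head_tapes T h = map (\<lambda>i. (contents T, int (h i))) [0..<k]"

definition track_of :: "bool list \<Rightarrow> symbol list \<Rightarrow> symbol list" where
  "track_of x w = track (map Bit x @ w)"

definition writing :: "bool list \<Rightarrow> nat \<Rightarrow> symbol list \<Rightarrow> tape list" where
  "writing x n u = (contents (map Bit x), int n) # replicate k (contents (LM # u), int (length u + 1))"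

definition rewinding :: "bool list \<Rightarrow> symbol list \<Rightarrow> nat \<Rightarrow> tape list" where
  "rewinding x T p = read_tape x # replicate k (contents T, int p)"

definition running :: "bool list \<Rightarrow> symbol list \<Rightarrow> heads \<Rightarrow> tape list" where
  "running x T h = read_tape x # head_tapes T h"

lemma nth_track_of_iff:
  assumes "w \<in> lists G" "p < length (track_of x w)"
  shows "track_of x w ! p = LM \<longleftrightarrow> p = 0" "track_of x w ! p = RM \<longleftrightarrow> p = length (track_of x w) - 1"
    "track_of x w ! p \<in> symbols"
    "p \<noteq> 0 \<Longrightarrow> p \<noteq> length (track_of x w) - 1 \<Longrightarrow> track_of x w ! p \<in> G \<union> range Bit"
proof -
  have *: "a \<noteq> LM \<and> a \<noteq> RM \<and> a \<in> G \<union> range Bit" if "a \<in> set (map Bit x @ w)" for a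
    using that assms(1) G by auto
  have **: "(map Bit x @ w) ! q \<in> set (map Bit x @ w)" if "q < length (map Bit x @ w)" for q
    using that by (rule nth_mem)
  define u where "u = map Bit x @ w"
  have t: "track_of x w = LM # u @ [RM]" by (simp add: track_of_def track_def u_def)
  have u: "u ! q \<noteq> LM \<and> u ! q \<noteq> RM \<and> u ! q \<in> G \<union> range Bit" if "q < length u" for q
    using that * ** unfolding u_def by blast
  have p: "p < length u + 2" using assms(2) by (simp add: t)
  show "track_of x w ! p = LM \<longleftrightarrow> p = 0" "track_of x w ! p = RM \<longleftrightarrow> p = length (track_of x w) - 1"
    using p u[of "p - 1"] by (auto simp: t nth_Cons' nth_append)
  show c: "track_of x w ! p \<in> G \<union> range Bit" if "p \<noteq> 0" "p \<noteq> length (track_of x w) - 1"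
    using p u[of "p - 1"] that by (auto simp: t nth_Cons' nth_append)
  show "track_of x w ! p \<in> symbols"
    using p u[of "p - 1"] by (auto simp: t nth_Cons' nth_append symbols_def)
qed

lemma map2_replicate [simp]: "map2 g (replicate n a) (replicate n b) = replicate n (g a b)"
  by (induction n) auto

lemma delta_0_iff: "((0, ss), (q', as)) \<in> delta M \<longleftrightarrow>
    (\<exists>a\<in>insert Blank (range Bit). ss = a # replicate k Blank \<and> q' = 1 \<and>
       as = (a, Move_Stay) # replicate k (LM, Move_Right))"
  unfolding M_def D0_def D1_def D2_def D3_def D4_def D5_def D6_def D7_def by auto

lemma delta_1_iff: "((1, ss), (q', as)) \<in> delta M \<longleftrightarrow>
    (\<exists>b. ss = Bit b # replicate k Blank \<and> q' = 1 \<and> as = replicate (Suc k) (Bit b, Move_Right)) \<or>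
    (ss = Blank # replicate k Blank \<and>
       ((\<exists>g\<in>G. q' = 1 \<and> as = stay # replicate k (g, Move_Right)) \<or>
        q' = 2 \<and> as = stay # replicate k (RM, Move_Left)))"
  unfolding M_def D0_def D1_def D2_def D3_def D4_def D5_def D6_def D7_def by auto

lemma delta_2_iff: "((2, ss), (q', as)) \<in> delta M \<longleftrightarrow>
    (\<exists>g\<in>G \<union> range Bit. ss = Blank # replicate k g \<and> q' = 2 \<and>
       as = stay # replicate k (g, Move_Left)) \<or>
    ss = Blank # replicate k LM \<and> q' = 4 + to_nat s \<and> as = stay # replicate k (LM, Move_Stay)"
  unfolding M_def D0_def D1_def D2_def D3_def D4_def D5_def D6_def D7_def by auto

lemma delta_3_iff: "((3, ss), (q', as)) \<notin> delta M"
  unfolding M_def D0_def D1_def D2_def D3_def D4_def D5_def D6_def D7_def by auto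

lemma delta_4_iff: "((4 + to_nat q, ss), (q', as)) \<in> delta M \<longleftrightarrow>
    (\<exists>r. ss = Blank # r \<and> set r \<subseteq> symbols \<and> length r = k \<and>
      ((\<exists>I p. (q, I, p) \<in> E \<and> admissible I r \<and> q' = 4 + to_nat p \<and>
          as = stay # map (\<lambda>i. (r ! i, head_move I i)) [0..<k]) \<or>
       q = f \<and> q' = 3 \<and> as = stay # map (\<lambda>a. (a, Move_Stay)) r))"
  unfolding M_def D0_def D1_def D2_def D3_def D4_def D5_def D6_def D7_def
  by (auto simp: image_iff; blast)

lemma contents_blank [simp]: "(contents T)(int (length T) := Blank) = contents T"
  by (rule ext) (simp add: contents_def del: contents_snoc)

lemma contents_blank_map [simp]:
  "contents (map g x) (int (length x)) = Blank"
  "(contents (map g x))(int (length x) := Blank) = contents (map g x)"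
  using contents_outside[of "map g x"] contents_blank[of "map g x"] by simp_all

lemma contents_first:
  "contents (LM # u) (1 + int (length u)) = Blank"
  "(contents (LM # u))(1 + int (length u) := a) = contents (LM # (u @ [a]))"
  using contents_outside[of "LM # u"] contents_snoc[of "LM # u" a] by simp_all

lemma replicate_k [simp]: "replicate k a = replicate k b \<longleftrightarrow> a = b"
  using k(1) by (cases k) auto

lemma step_0_iff:
  "step M (0, input_tape x # replicate k blank_tape) c \<longleftrightarrow> c = (1, writing x 0 [])"
proof -
  have "(contents [])(0 := LM) = contents [LM]" using contents_snoc[of "[]" LM] by simp
  moreover have "contents (map Bit x) 0 \<in> insert Blank (range Bit)" by (auto simp: contents_def)
  ultimately show ?thesis
    by (cases c) (auto simp: delta_0_iff input_tape_contents blank_tape_contents writing_def contents_def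
        cong: conj_cong)
qed

lemma step_1_iff_less:
  assumes "n < length x"
  shows "step M (1, writing x n u) c \<longleftrightarrow> c = (1, writing x (Suc n) (u @ [Bit (x ! n)]))"
  using assms contents_same[of n "map Bit x"] contents_nat[of n "map Bit x"]
  by (cases c) (auto simp: delta_1_iff[unfolded One_nat_def] writing_def contents_first)

lemma step_1_iff_end:
  "step M (1, writing x (length x) u) c \<longleftrightarrow> (\<exists>g\<in>G. c = (1, writing x (length x) (u @ [g]))) \<or>
     c = (2, rewinding x (track u) (length u))"
  by (cases c) (auto simp: delta_1_iff[unfolded One_nat_def] writing_def contents_first rewinding_def read_tape_def track_def)

lemma step_2_iff_pos:
  assumes "p < length T" "0 < p" "T ! p \<in> G \<union> range Bit"
  shows "step M (2, rewinding x T p) c \<longleftrightarrow> c = (2, rewinding x T (p - 1))"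
proof -
  define g where "g = T ! p"
  have "contents T (int p) = g" "(contents T)(int p := g) = contents T"
    using assms(1) by (simp_all add: g_def)
  moreover have "g \<noteq> LM" "g \<in> G \<union> range Bit" using assms(3) G by (auto simp: g_def)
  ultimately show ?thesis using assms(2) k(1)
    by (cases c) (auto simp: delta_2_iff rewinding_def read_tape_def of_nat_diff cong: conj_cong)
qed

lemma step_2_iff_zero:
  assumes "0 < length T" "T ! 0 = LM"
  shows "step M (2, rewinding x T 0) c \<longleftrightarrow> c = (4 + to_nat s, running x T (\<lambda>_. 0))"
proof -
  have "contents T 0 = LM" "(contents T)(0 := LM) = contents T"
    using assms contents_nat[of 0 T] contents_same[of 0 T] by simp_all
  then show ?thesis
    using assms G k(1) by (cases c) (auto simp: delta_2_iff rewinding_def running_def head_tapes_def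
      read_tape_def map_replicate_const)
qed

lemma act_heads:
  assumes "\<And>i. h i < length T"
  shows "map scan (head_tapes T h) = map (\<lambda>i. T ! h i) [0..<k]"
    "map2 act (map (\<lambda>i. (map (\<lambda>i. T ! h i) [0..<k] ! i, d i)) [0..<k]) (head_tapes T h) =
      map (\<lambda>i. (contents T, int (h i) + offset (d i))) [0..<k]"
  using assms by (auto simp: head_tapes_def intro!: nth_equalityI)

text \<open>Heads from \<open>k\<close> on are pinned to 0: a function on all of \<open>nat\<close>
  is then determined by its first \<open>k\<close> values, which leaves finitely many of them to
  count.\<close>

definition bounded :: "symbol list \<Rightarrow> heads \<Rightarrow> bool" where
  "bounded T h \<longleftrightarrow> (\<forall>i. h i < length T) \<and> (\<forall>i\<ge>k. h i = 0)"

lemma perform_iff: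
  assumes "w \<in> lists G" "bounded (track_of x w) h" "(q, I, q') \<in> E"
  defines "T \<equiv> track_of x w"
  shows "perform I T h h' \<longleftrightarrow> admissible I (map (\<lambda>i. T ! h i) [0..<k]) \<and>
    h' = (\<lambda>i. nat (int (h i) + offset (head_move I i)))"
    "admissible I (map (\<lambda>i. T ! h i) [0..<k]) \<Longrightarrow> 0 \<le> int (h i) + offset (head_move I i)"
proof -
  have h: "h i < length T" for i using assms by (auto simp: bounded_def)
  note T = nth_track_of_iff[OF assms(1), of _ x, folded T_def]
  show "perform I T h h' \<longleftrightarrow> admissible I (map (\<lambda>i. T ! h i) [0..<k]) \<and>
    h' = (\<lambda>i. nat (int (h i) + offset (head_move I i)))"
  proof (cases I)
    case (Right i)
    moreover have "T ! h i = RM \<longleftrightarrow> \<not> Suc (h i) < length T"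
      using T(2)[OF h[of i]] h[of i] by linarith
    ultimately show ?thesis using k(2)[OF assms(3), of i] by (auto simp: right_def nat_add_distrib)
  next
    case (Left i)
    moreover have "T ! h i = LM \<longleftrightarrow> \<not> 0 < h i"
      using T(1)[OF h[of i]] by simp
    ultimately show ?thesis using k(2)[OF assms(3), of i]
      by (auto simp: left_def fun_eq_iff nat_diff_distrib)
  qed (use k(2)[OF assms(3)] h in \<open>auto simp: skip_def test_def\<close>)
  show "0 \<le> int (h i) + offset (head_move I i)" if "admissible I (map (\<lambda>i. T ! h i) [0..<k])"
    using that T(1)[OF h] k(2)[OF assms(3)] by (cases I) (auto simp: Suc_le_eq intro: ccontr)
qed

lemma perform_bounded:
  assumes "bounded T h" "(q, I, q') \<in> E" "perform I T h h'"
  shows "bounded T h'"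
proof (cases I)
  case (Right i)
  with assms k(2)[OF assms(2), of i] show ?thesis by (auto simp: bounded_def right_def)
next
  case (Left i)
  moreover have "h i - 1 < length T" using assms(1) by (simp add: bounded_def less_imp_diff_less)
  ultimately show ?thesis using assms k(2)[OF assms(2), of i] by (auto simp: bounded_def left_def)
qed (use assms in \<open>auto simp: skip_def test_def\<close>)

lemma step_4_iff:
  assumes "w \<in> lists G" "bounded (track_of x w) h"
  shows "step M (4 + to_nat q, running x (track_of x w) h) c \<longleftrightarrow>
    (\<exists>p h'. edge_step E (track_of x w) (q, h) (p, h') \<and> c = (4 + to_nat p, running x (track_of x w) h')) \<or>
    q = f \<and> c = (3, running x (track_of x w) h)" (is "?L \<longleftrightarrow> ?R")
proof -
  define T where "T = track_of x w"
  define r where "r = map (\<lambda>i. T ! h i) [0..<k]"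
  have h: "h i < length T" for i using assms by (auto simp: bounded_def T_def)
  have r: "set r \<subseteq> symbols" "length r = k"
    using nth_track_of_iff(3)[OF assms(1), of _ x] h by (auto simp: r_def T_def)
  note act = act_heads[of h T, OF h, folded r_def]
  have a3: "map2 act (map (\<lambda>a. (a, Move_Stay)) r) (head_tapes T h) = head_tapes T h"
    using h by (auto simp: head_tapes_def r_def intro!: nth_equalityI)
  have "?L \<longleftrightarrow> (\<exists>I p. (q, I, p) \<in> E \<and> admissible I r \<and> c = (4 + to_nat p,
      read_tape x # map (\<lambda>i. (contents T, int (h i) + offset (head_move I i))) [0..<k])) \<or>
    q = f \<and> c = (3, running x T h)"
  proof -
    have "?L \<longleftrightarrow> (\<exists>q' as. ((4 + to_nat q, Blank # r), (q', as)) \<in> delta M \<and>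
        c = (q', map2 act as (running x T h)))"
      by (cases c) (auto simp: running_def act read_tape_def T_def[symmetric])
    also have "\<dots> \<longleftrightarrow> (\<exists>q' as. ((\<exists>I p. (q, I, p) \<in> E \<and> admissible I r \<and> q' = 4 + to_nat p \<and>
          as = stay # map (\<lambda>i. (r ! i, head_move I i)) [0..<k]) \<or>
       q = f \<and> q' = 3 \<and> as = stay # map (\<lambda>a. (a, Move_Stay)) r) \<and>
       c = (q', map2 act as (running x T h)))"
      using r by (simp add: delta_4_iff)
    also have "\<dots> \<longleftrightarrow> (\<exists>I p. (q, I, p) \<in> E \<and> admissible I r \<and> c = (4 + to_nat p,
        map2 act (stay # map (\<lambda>i. (r ! i, head_move I i)) [0..<k]) (running x T h))) \<or>
      q = f \<and> c = (3, map2 act (stay # map (\<lambda>a. (a, Move_Stay)) r) (running x T h))"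
      by blast
    finally show ?thesis by (simp add: running_def act a3 read_tape_def)
  qed
  also have "\<dots> \<longleftrightarrow> ?R"
  proof -
    have *: "map (\<lambda>i. (contents T, int (h i) + offset (head_move I i))) [0..<k] =
        head_tapes T (\<lambda>i. nat (int (h i) + offset (head_move I i)))"
      if "(q, I, p) \<in> E" "admissible I r" for I p
      using perform_iff(2)[OF assms that(1), folded T_def] that(2)
      by (auto simp: head_tapes_def r_def)
    have **: "perform I T h h' \<longleftrightarrow> admissible I r \<and>
        h' = (\<lambda>i. nat (int (h i) + offset (head_move I i)))" if "(q, I, p) \<in> E" for I p h'
      using perform_iff(1)[OF assms that, folded T_def] by (simp add: r_def)
    show ?thesis unfolding T_def[symmetric] edge_step.simps running_def
      using * ** by (auto; metis)
  qed
  finally show ?thesis .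
qed

context
  notes step.simps [simp del] and One_nat_def [simp del]
begin

text \<open>In state 1 guessing has not begun before the input is copied, hence
  \<open>w = []\<close> or \<open>n = length x\<close>. In the final state the tapes are forgotten,
  as only the success of \<open>P\<close> on some guess is of interest.\<close>

definition invariant :: "bool list \<Rightarrow> config \<Rightarrow> bool" where
  "invariant x c \<longleftrightarrow>
     c = (0, input_tape x # replicate k blank_tape) \<or>
     (\<exists>n w. n \<le> length x \<and> w \<in> lists G \<and> (w = [] \<or> n = length x) \<and>
        c = (1, writing x n (take n (map Bit x) @ w))) \<or>
     (\<exists>w\<in>lists G. \<exists>p < length (track_of x w) - 1. c = (2, rewinding x (track_of x w) p)) \<or>
     (\<exists>w\<in>lists G. \<exists>q h. reach E (track_of x w) (s, \<lambda>_. 0) (q, h) \<and> bounded (track_of x w) h \<and>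
        c = (4 + to_nat q, running x (track_of x w) h)) \<or>
     (\<exists>w\<in>lists G. \<exists>ts h. P (track_of x w) (\<lambda>_. 0) h \<and> c = (3, ts))"

lemma length_track_of [simp]: "length (track_of x w) = length x + length w + 2"
  by (simp add: track_of_def track_def)

lemma invariant_step:
  assumes "invariant x c" "step M c c'"
  shows "invariant x c'"
proof -
  consider (a) "c = (0, input_tape x # replicate k blank_tape)"
    | (b) n w where "n \<le> length x" "w \<in> lists G" "w = [] \<or> n = length x"
        "c = (1, writing x n (take n (map Bit x) @ w))"
    | (c) w p where "w \<in> lists G" "p < length (track_of x w) - 1" "c = (2, rewinding x (track_of x w) p)"
    | (d) w q h where "w \<in> lists G" "reach E (track_of x w) (s, \<lambda>_. 0) (q, h)"
        "bounded (track_of x w) h" "c = (4 + to_nat q, running x (track_of x w) h)"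
    | (e) ts where "c = (3, ts)"
    using assms(1) unfolding invariant_def by blast
  then show ?thesis
  proof cases
    case a
    then have "c' = (1, writing x 0 (take 0 (map Bit x) @ []))"
      using assms(2) step_0_iff by simp
    then show ?thesis unfolding invariant_def by blast
  next
    case b
    show ?thesis
    proof (cases "n = length x")
      case False
      with b have "n < length x" "w = []" by auto
      with b assms(2) have "c' = (1, writing x (Suc n) (take (Suc n) (map Bit x) @ []))"
        by (simp add: step_1_iff_less take_Suc_conv_app_nth)
      moreover have "Suc n \<le> length x" "[] \<in> lists G" using \<open>n < length x\<close> by auto
      ultimately show ?thesis unfolding invariant_def by blast
    next
      case True
      with b have "c = (1, writing x (length x) (map Bit x @ w))" by simp
      with assms(2) consider g where "g \<in> G" "c' = (1, writing x (length x) ((map Bit x @ w) @ [g]))"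
        | "c' = (2, rewinding x (track (map Bit x @ w)) (length (map Bit x @ w)))"
        using step_1_iff_end by blast
      then show ?thesis
      proof cases
        case 1
        then have "c' = (1, writing x (length x) (take (length x) (map Bit x) @ (w @ [g])))" by simp
        moreover have "w @ [g] \<in> lists G" using 1 b by simp
        ultimately show ?thesis unfolding invariant_def by blast
      next
        case 2
        then have "c' = (2, rewinding x (track_of x w) (length x + length w))"
          by (simp add: track_of_def)
        moreover have "length x + length w < length (track_of x w) - 1" by simp
        ultimately show ?thesis using b(2) unfolding invariant_def by blast
      qed
    qed
  next
    case c
    note T = nth_track_of_iff[OF c(1), of _ x]
    show ?thesis
    proof (cases "p = 0")
      case True
      with c assms(2) T(1)[of 0] have "c' = (4 + to_nat s, running x (track_of x w) (\<lambda>_. 0))"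
        using step_2_iff_zero[of "track_of x w" x c'] by auto
      moreover have "bounded (track_of x w) (\<lambda>_. 0)" by (simp add: bounded_def)
      ultimately show ?thesis using c(1) unfolding invariant_def by blast
    next
      case False
      with c assms(2) T(4)[of p] have "c' = (2, rewinding x (track_of x w) (p - 1))"
        using step_2_iff_pos[of p "track_of x w" x c'] by auto
      moreover have "p - 1 < length (track_of x w) - 1" using c by simp
      ultimately show ?thesis using c(1) unfolding invariant_def by blast
    qed
  next
    case d
    from assms(2) consider q' h' where "edge_step E (track_of x w) (q, h) (q', h')"
        "c' = (4 + to_nat q', running x (track_of x w) h')"
      | "q = f" "c' = (3, running x (track_of x w) h)"
      using step_4_iff[OF d(1,3), of q c'] unfolding d(4) by blast
    then show ?thesis
    proof cases
      case 1
      from 1(1) have "bounded (track_of x w) h'"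
        using perform_bounded[OF d(3)] by (auto elim!: edge_step.cases)
      moreover from d(2) 1(1) have "reach E (track_of x w) (s, \<lambda>_. 0) (q', h')" by simp
      ultimately show ?thesis using d(1) 1(2) unfolding invariant_def by blast
    next
      case 2
      then have "P (track_of x w) (\<lambda>_. 0) h" using d reach_iff by simp
      then show ?thesis using d(1) 2(2) unfolding invariant_def by blast
    qed
  next
    case e
    then show ?thesis using assms(2) delta_3_iff by (cases c') (auto simp: step.simps)
  qed
qed

lemma init_M: "init M x = (0, input_tape x # replicate k blank_tape)"
  by (simp add: init_def M_def)

lemma accepts_sound:
  assumes "accepts_in M x n"
  obtains w h where "w \<in> lists G" "P (track_of x w) (\<lambda>_. 0) h"
proof -
  obtain ts where *: "(step M ^^ n) (init M x) (3, ts)"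
    using assms by (auto simp: accepts_in_def M_def)
  have inv: "invariant x c" if "(step M ^^ n) (init M x) c" for n c
    using that
  proof (induction n arbitrary: c)
    case 0
    then show ?case by (simp add: invariant_def init_M)
  next
    case (Suc n)
    then show ?case by (metis invariant_step relpowp_Suc_E)
  qed
  show ?thesis using inv[OF *] that unfolding invariant_def by auto
qed

lemma steps_writing_input:
  "n \<le> length x \<Longrightarrow> (step M ^^ n) (1, writing x 0 []) (1, writing x n (take n (map Bit x)))"
proof (induction n)
  case (Suc n)
  then have "step M (1, writing x n (take n (map Bit x))) (1, writing x (Suc n) (take (Suc n) (map Bit x)))"
    by (simp add: step_1_iff_less take_Suc_conv_app_nth)
  with Suc show ?case by (intro relpowp_Suc_I) auto
qed simp

lemma steps_writing_guess:
  "w \<in> lists G \<Longrightarrow>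
    (step M ^^ length w) (1, writing x (length x) u) (1, writing x (length x) (u @ w))"
proof (induction w rule: rev_induct)
  case (snoc g w)
  then have "step M (1, writing x (length x) (u @ w)) (1, writing x (length x) (u @ w @ [g]))"
    using step_1_iff_end[of x "u @ w"] by auto
  with snoc show ?case by (auto intro: relpowp_Suc_I simp del: One_nat_def)
qed simp

lemma steps_rewinding:
  assumes "w \<in> lists G"
  shows "p < length (track_of x w) - 1 \<Longrightarrow>
    (step M ^^ p) (2, rewinding x (track_of x w) p) (2, rewinding x (track_of x w) 0)"
proof (induction p)
  case (Suc p)
  then have "step M (2, rewinding x (track_of x w) (Suc p)) (2, rewinding x (track_of x w) p)"
    using nth_track_of_iff(4)[OF assms, of "Suc p" x] by (simp add: step_2_iff_pos)
  with Suc show ?case by (intro relpowp_Suc_I2) auto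
qed simp

definition states :: "nat list set" where
  "states = insert s ((\<lambda>(q, I, q'). q') ` E)"

lemma finite_states: "finite states"
  using automaton by (simp add: states_def automaton_for_def)

lemma bounded_card: "finite {h. bounded T h}" "card {h. bounded T h} \<le> length T ^ k"
proof -
  let ?F = "{..<k} \<rightarrow>\<^sub>E {..<length T}"
  have "{h. bounded T h} \<subseteq> (\<lambda>g i. if i < k then g i else 0) ` ?F"
  proof
    fix h assume "h \<in> {h. bounded T h}"
    then show "h \<in> (\<lambda>g i. if i < k then g i else 0) ` ?F"
      by (intro image_eqI[of _ _ "restrict h {..<k}"]) (auto simp: bounded_def fun_eq_iff)
  qed
  moreover have "finite ?F" "card ?F = length T ^ k"
    by (simp_all add: finite_PiE card_PiE)
  ultimately show "finite {h. bounded T h}" "card {h. bounded T h} \<le> length T ^ k"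
    using surj_card_le[of ?F "{h. bounded T h}"] by (auto intro: finite_subset)
qed

text \<open>Loops can be cut out of a path, so its length is at most the number of pairs in the step
  relation restricted to the finite set \<open>V\<close>. This is the origin of the square; for
  fixed \<open>k\<close> the bound is polynomial in the length of the track.\<close>

lemma steps_running:
  assumes "w \<in> lists G" "P (track_of x w) (\<lambda>_. 0) h'"
  obtains n where "n \<le> (card states * length (track_of x w) ^ k) ^ 2"
    "(step M ^^ n) (4 + to_nat s, running x (track_of x w) (\<lambda>_. 0)) (4 + to_nat f, running x (track_of x w) h')"
    "bounded (track_of x w) h'"
proof -
  define T where "T = track_of x w"
  define V where "V = states \<times> {h. bounded T h}"
  define R where "R = {(c, c'). edge_step E T c c' \<and> c \<in> V \<and> c' \<in> V}"
  have V: "finite V" "card V \<le> card states * length T ^ k"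
    using finite_states bounded_card[of T] by (auto simp: V_def card_cartesian_product)
  have "R \<subseteq> V \<times> V" by (auto simp: R_def)
  then have R: "finite R" "card R \<le> card V ^ 2"
    using V(1) card_mono[of "V \<times> V" R] by (auto simp: finite_subset card_cartesian_product power2_eq_square)
  have reach: "c \<in> V \<and> ((s, \<lambda>_. 0), c) \<in> R\<^sup>*" if "reach E T (s, \<lambda>_. 0) c" for c
    using that
  proof (induction rule: rtranclp_induct)
    case base
    then show ?case by (simp add: V_def states_def bounded_def T_def)
  next
    case (step c c')
    from step(2) have "c' \<in> V"
    proof (cases rule: edge_step.cases)
      case (1 q I q' h h')
      with step.IH have "bounded T h'" using perform_bounded by (auto simp: V_def)
      moreover have "q' \<in> states" using 1(3) by (force simp: states_def)
      ultimately show ?thesis using 1(2) by (simp add: V_def)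
    qed
    with step show ?case by (auto simp: R_def intro: rtrancl_into_rtrancl)
  qed
  from assms(2) have f: "(f, h') \<in> V \<and> ((s, \<lambda>_. 0), (f, h')) \<in> R\<^sup>*"
    by (intro reach) (simp add: reach_iff T_def)
  then obtain n where n: "n \<le> card R" "((s, \<lambda>_. 0), (f, h')) \<in> R ^^ n"
    using rtrancl_finite_eq_relpow[OF R(1)] by auto
  have "(step M ^^ n) (4 + to_nat s, running x T (\<lambda>_. 0)) (4 + to_nat (fst c), running x T (snd c))"
    if "((s, \<lambda>_. 0), c) \<in> R ^^ n" for c n
    using that
  proof (induction n arbitrary: c)
    case (Suc n)
    then obtain d where d: "((s, \<lambda>_. 0), d) \<in> R ^^ n" "(d, c) \<in> R" by auto
    then have "step M (4 + to_nat (fst d), running x T (snd d)) (4 + to_nat (fst c), running x T (snd c))"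
      using step_4_iff[OF assms(1), of x "snd d" "fst d", folded T_def]
      by (auto simp: R_def V_def simp del: step.simps)
    with Suc.IH[OF d(1)] show ?case by (rule relpowp_Suc_I)
  qed simp
  from this[OF n(2)] have "(step M ^^ n) (4 + to_nat s, running x T (\<lambda>_. 0)) (4 + to_nat f, running x T h')"
    by simp
  moreover have "n \<le> (card states * length T ^ k) ^ 2"
    by (intro order_trans[OF n(1)] order_trans[OF R(2)] power_mono V(2)) simp
  moreover have "bounded T h'" using f by (simp add: V_def)
  ultimately show ?thesis using that by (simp add: T_def)
qed

lemma accepts_complete:
  assumes "w \<in> lists G" "P (track_of x w) (\<lambda>_. 0) h'"
  obtains n where "n \<le> 2 * length (track_of x w) + (card states * length (track_of x w) ^ k) ^ 2"
    "accepts_in M x n"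
proof -
  obtain n where n: "n \<le> (card states * length (track_of x w) ^ k) ^ 2"
    "(step M ^^ n) (4 + to_nat s, running x (track_of x w) (\<lambda>_. 0)) (4 + to_nat f, running x (track_of x w) h')"
    "bounded (track_of x w) h'" by (rule steps_running[OF assms])
  let ?T = "track_of x w"
  let ?c = "[(0, input_tape x # replicate k blank_tape), (1, writing x 0 []),
    (1, writing x (length x) (map Bit x)), (1, writing x (length x) (map Bit x @ w)),
    (2, rewinding x ?T (length x + length w)), (2, rewinding x ?T 0),
    (4 + to_nat s, running x ?T (\<lambda>_. 0)), (4 + to_nat f, running x ?T h'), (3, running x ?T h')]"
  have 0: "(step M ^^ 1) (?c!0) (?c!1)" using step_0_iff by simp
  have 1: "(step M ^^ length x) (?c!1) (?c!2)" using steps_writing_input[of "length x" x] by simp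
  have 2: "(step M ^^ length w) (?c!2) (?c!3)" using steps_writing_guess[OF assms(1)] by simp
  have 3: "(step M ^^ 1) (?c!3) (?c!4)" using step_1_iff_end[of x "map Bit x @ w"] by (simp add: track_of_def)
  have 4: "(step M ^^ (length x + length w)) (?c!4) (?c!5)"
    using steps_rewinding[OF assms(1), of "length x + length w" x] by simp
  have 5: "(step M ^^ 1) (?c!5) (?c!6)"
    using step_2_iff_zero[of ?T x] nth_track_of_iff(1)[OF assms(1), of 0 x] by auto
  have 6: "(step M ^^ n) (?c!6) (?c!7)" using n(2) by simp
  have 7: "(step M ^^ 1) (?c!7) (?c!8)" using step_4_iff[OF assms(1) n(3)] by simp
  have trans: "(step M ^^ (a + b)) c e" if "(step M ^^ a) c d" "(step M ^^ b) d e" for a b c d e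
    using that by (auto simp: relpowp_add)
  \<comment> \<open>One pass writes the track and one rewinds it; with the four single steps between
    and after the phases they add up to exactly twice the length of the track.\<close>
  let ?n = "1 + (length x + (length w + (1 + ((length x + length w) + (1 + (n + 1))))))"
  have "(step M ^^ ?n) (?c!0) (?c!8)"
    by (rule trans[OF 0 trans[OF 1 trans[OF 2 trans[OF 3 trans[OF 4 trans[OF 5 trans[OF 6 7]]]]]]])
  then have "accepts_in M x ?n" unfolding accepts_in_def init_M by (auto simp: M_def)
  moreover have "?n \<le> 2 * length ?T + (card states * length ?T ^ k) ^ 2"
    using n(1) by simp
  ultimately show ?thesis using that by blast
qed

end

end

text \<open>
  A path of the machine through a check never repeats a configuration without loss of generality,
  and the tapes do not change during a check. So the running time is polynomial in the length of
  the track, whatever the check does.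
\<close>

theorem NE_if_realizable:
  assumes "realizable P" and G: "finite G" "LM \<notin> G" "RM \<notin> G"
    and short: "\<And>x. x \<in> B \<Longrightarrow> \<exists>w\<in>lists G. length w \<le> 2 ^ (c * length x + c) \<and>
      (\<exists>h. P (track (map Bit x @ w)) (\<lambda>_. 0) h)"
    and sound: "\<And>x w h. w \<in> lists G \<Longrightarrow> P (track (map Bit x @ w)) (\<lambda>_. 0) h \<Longrightarrow> x \<in> B"
  shows "B \<in> NE"
proof -
  obtain E s f where E: "automaton_for E s f P" using realizable_automaton[OF assms(1)] by blast
  then have "finite E" by (simp add: automaton_for_def)
  have "finite {j. uses_head I j}" for I by (cases I) auto
  then have "finite (\<Union>(q, I, q')\<in>E. {j. uses_head I j})" using \<open>finite E\<close> by auto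
  \<comment> \<open>Finitely many edges mention finitely many heads, whatever numbers the check has
    given to them.\<close>
  then obtain k0 where k0: "\<forall>j\<in>(\<Union>(q, I, q')\<in>E. {j. uses_head I j}). j \<le> k0"
    unfolding finite_nat_set_iff_bounded_le by blast
  define k where "k = Suc k0"
  interpret check_machine P E s f k G
  proof
    show "j < k" if "(q, I, q') \<in> E" "uses_head I j" for q I q' j
      using k0 that unfolding k_def by fastforce
  qed (use E G in \<open>auto simp: k_def\<close>)
  \<comment> \<open>\<open>2 ^ e n\<close> bounds the length of the track: its two parts,
    \<open>n + 2\<close> for input and markers and \<open>2 ^ (c * n + c)\<close> for the guess, are
    each at most half of it.\<close>
  define e where "e n = (c + 1) * n + (c + 2)" for n
  define t where "t n = 2 * 2 ^ e n + (card states * (2 ^ e n) ^ k) ^ 2" for n :: nat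
  have B: "B = {x. \<exists>s. accepts_in M x s}"
  proof (intro set_eqI iffI)
    fix x assume "x \<in> B"
    then show "x \<in> {x. \<exists>s. accepts_in M x s}"
    proof -
      obtain w h where "w \<in> lists G" "P (track_of x w) (\<lambda>_. 0) h"
        using short[OF \<open>x \<in> B\<close>] by (auto simp: track_of_def)
      from accepts_complete[OF this] show ?thesis by blast
    qed
  next
    show "x \<in> B" if "x \<in> {x. \<exists>s. accepts_in M x s}" for x
    proof -
      from that obtain n where "accepts_in M x n" by auto
      then obtain w h where "w \<in> lists G" "P (track_of x w) (\<lambda>_. 0) h" by (rule accepts_sound)
      then show ?thesis unfolding track_of_def by (rule sound)
    qed
  qed
  have "\<exists>n \<le> t (length x). accepts_in M x n" if "x \<in> B" for x
  proof -
    obtain w h where w: "w \<in> lists G" "length w \<le> 2 ^ (c * length x + c)" "P (track_of x w) (\<lambda>_. 0) h"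
      using short[OF \<open>x \<in> B\<close>] by (auto simp: track_of_def)
    obtain n where n: "n \<le> 2 * length (track_of x w) + (card states * length (track_of x w) ^ k) ^ 2"
      "accepts_in M x n" by (rule accepts_complete[OF w(1,3)])
    have "length (track_of x w) \<le> (length x + 2) + 2 ^ (c * length x + c)" using w(2) by simp
    also have "\<dots> \<le> 2 ^ (length x + 1) + 2 ^ (c * length x + c)"
      using less_exp[of "length x + 1"] by (intro add_mono) (simp_all add: Suc_leI)
    also have "\<dots> \<le> 2 ^ (e (length x) - 1) + 2 ^ (e (length x) - 1)"
      by (intro add_mono power_increasing) (simp_all add: e_def algebra_simps)
    also have "\<dots> = 2 ^ e (length x)"
    proof -
      have "e (length x) = Suc (e (length x) - 1)" by (simp add: e_def)
      then show ?thesis by (metis mult_2 power_Suc)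
    qed
    finally have "length (track_of x w) \<le> 2 ^ e (length x)" .
    then have "2 * length (track_of x w) + (card states * length (track_of x w) ^ k) ^ 2 \<le> t (length x)"
      unfolding t_def by (intro add_mono mult_le_mono2 power_mono) simp_all
    with n show ?thesis by (meson le_trans)
  qed
  then have "B \<in> NTIME t" unfolding NTIME_def
    by (intro CollectI exI[of _ M] conjI ballI wf_M B) auto
  \<comment> \<open>The exponent has to be linear in \<open>n\<close>. The constant
    \<open>card states\<close> is absorbed by \<open>2 ^ card states\<close>, and the final 2 leaves
    room for the factor 2 and for the sum of the two terms of \<open>t\<close>.\<close>
  moreover define a where "a n = (2 * k + 1) * e n + 2 * card states + 2" for n
  have t_le: "t n \<le> 2 ^ a n" for n
  proof -
    have "2 * 2 ^ e n \<le> (2::nat) ^ (a n - 1)"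
      unfolding power_Suc[symmetric] by (rule power_increasing) (auto simp: a_def)
    moreover have "(card states * (2 ^ e n) ^ k) ^ 2 \<le> (2::nat) ^ (a n - 1)"
    proof -
      have "(card states * (2 ^ e n) ^ k) ^ 2 \<le> (2 ^ card states * (2 ^ e n) ^ k) ^ 2"
        using less_exp[of "card states"] by (intro power_mono mult_mono) auto
      also have "\<dots> = 2 ^ (2 * card states + 2 * k * e n)"
        by (simp add: power_mult_distrib power_add flip: power_mult) (simp add: mult_ac)
      also have "\<dots> \<le> 2 ^ (a n - 1)" by (rule power_increasing) (auto simp: a_def algebra_simps)
      finally show ?thesis .
    qed
    ultimately have "t n \<le> 2 ^ (a n - 1) + 2 ^ (a n - 1)" unfolding t_def by (rule add_mono)
    also have "\<dots> = 2 ^ a n" 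
    proof -
      have "a n = Suc (a n - 1)" by (simp add: a_def)
      then show ?thesis by (metis mult_2 power_Suc)
    qed
    finally show ?thesis .
  qed
  have "real (t n) \<le> 2 powr real (a n)" for n
    using of_nat_mono[OF t_le[of n], where 'a = real] by (simp add: powr_realpow)
  moreover have "(\<lambda>n. real (a n)) \<in> O(\<lambda>n. real n)"
  proof (rule bigoI)
    show "\<forall>\<^sub>F n in sequentially. norm (real (a n)) \<le> real (a 1) * norm (real n)"
    proof (rule eventually_sequentiallyI)
      fix n :: nat assume "1 \<le> n"
      then have "a n \<le> a 1 * n"
      proof -
        have "e n \<le> e 1 * n" using \<open>1 \<le> n\<close> by (cases n) (auto simp: e_def algebra_simps)
        then have "(2 * k + 1) * e n \<le> (2 * k + 1) * e 1 * n" by (metis mult.assoc mult_le_mono2)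
        moreover have "2 * card states + 2 \<le> (2 * card states + 2) * n"
          using mult_le_mono2[OF \<open>1 \<le> n\<close>, of "2 * card states + 2"] by simp
        ultimately have "a n \<le> (2 * k + 1) * e 1 * n + (2 * card states + 2) * n"
          unfolding a_def by linarith
        also have "\<dots> = a 1 * n" by (simp add: a_def algebra_simps)
        finally show ?thesis .
      qed
      then show "norm (real (a n)) \<le> real (a 1) * norm (real n)"
        by (simp flip: of_nat_mult)
    qed
  qed
  ultimately show ?thesis unfolding NE_def by blast
qed


section \<open>A library of checks\<close>

lemma seq_iff: "(P ;; Q) T h h' \<longleftrightarrow> (\<exists>g. P T h g \<and> Q T g h')"
  by (auto simp: seq_def)

lemma exec [simp]:
  "(test i S ;; P) T h h' \<longleftrightarrow> h i < length T \<and> T ! h i \<in> S \<and> P T h h'"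
  "(right i ;; P) T h h' \<longleftrightarrow> Suc (h i) < length T \<and> P T (h(i := Suc (h i))) h'"
  "(left i ;; P) T h h' \<longleftrightarrow> 0 < h i \<and> P T (h(i := h i - 1)) h'"
  "((P \<squnion> Q) ;; R) T h h' \<longleftrightarrow> (P ;; R) T h h' \<or> (Q ;; R) T h h'"
  "((P' ;; Q) ;; R) T h h' \<longleftrightarrow> (P' ;; (Q ;; R)) T h h'"
  "(P \<squnion> Q) T h h' \<longleftrightarrow> P T h h' \<or> Q T h h'"
  by (auto simp: seq_iff test_def right_def left_def alt_def)

text \<open>Eliminates the intermediate heads of a composition whose first part has the outcomes
  \<open>F n\<close>; this is the form in which \<open>star_family\<close> describes loops.\<close>

lemma ex_family [simp]: "(\<exists>g. (\<exists>n. c n \<and> g = F n) \<and> Q g) \<longleftrightarrow> (\<exists>n. c n \<and> Q (F n))"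
  by blast

text \<open>For loops without choice: after \<open>m\<close> iterations the heads can only be
  \<open>F m\<close>, so the sole freedom left is the number of iterations, and the check that
  follows the loop pins it down.\<close>

lemma star_family:
  assumes "\<And>m g. (\<And>l. l < m \<Longrightarrow> c l) \<Longrightarrow> P T (F m) g \<longleftrightarrow> c m \<and> g = F (Suc m)"
    and "F 0 = h"
  shows "star P T h h' \<longleftrightarrow> (\<exists>n. (\<forall>m<n. c m) \<and> h' = F n)"
proof
  assume "star P T h h'"
  then show "\<exists>n. (\<forall>m<n. c m) \<and> h' = F n" unfolding star_def
  proof (induction rule: rtranclp_induct)
    case base
    then show ?case using assms(2) by (intro exI[of _ 0]) simp
  next
    case (step g g')
    then obtain n where n: "\<forall>m<n. c m" "g = F n" by blast
    with step(2) assms(1)[of n g'] have "c n" "g' = F (Suc n)" by auto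
    with n show ?case by (auto simp: less_Suc_eq intro!: exI[of _ "Suc n"])
  qed
next
  assume "\<exists>n. (\<forall>m<n. c m) \<and> h' = F n"
  then obtain n where "\<forall>m<n. c m" "h' = F n" by blast
  moreover have "star P T h (F n)" if "\<forall>m<n. c m" for n
    using that
  proof (induction n)
    case 0
    then show ?case using assms(2) by (simp add: star_refl)
  next
    case (Suc n)
    then show ?case using assms(1)[of n "F (Suc n)"] by (auto intro: star_snoc)
  qed
  ultimately show "star P T h h'" by simp
qed

fun chain :: "('a \<Rightarrow> heads \<Rightarrow> bool) \<Rightarrow> ('a \<Rightarrow> heads \<Rightarrow> heads) \<Rightarrow> 'a list \<Rightarrow> heads \<Rightarrow> bool" where
  "chain c f [] h \<longleftrightarrow> True"
| "chain c f (a # as) h \<longleftrightarrow> c a h \<and> chain c f as (f a h)"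

text \<open>For loops that parse: each iteration chooses an item, such as a wire or a gate, and an
  execution of the loop is a list of items. The invariant \<open>I\<close> provides the
  preconditions of the next iteration.\<close>

lemma star_list:
  assumes "\<And>h h'. I h \<Longrightarrow> P T h h' \<longleftrightarrow> (\<exists>a. c a h \<and> h' = f a h)"
    and "\<And>a h. I h \<Longrightarrow> c a h \<Longrightarrow> I (f a h)"
    and "I h"
  shows "star P T h h' \<longleftrightarrow> (\<exists>as. chain c f as h \<and> h' = fold f as h)"
proof
  assume "star P T h h'"
  then show "\<exists>as. chain c f as h \<and> h' = fold f as h" using assms(3) unfolding star_def
  proof (induction rule: converse_rtranclp_induct)
    case base
    then show ?case by (intro exI[of _ "[]"]) simp
  next
    case (step g g')
    then obtain a where a: "c a g" "g' = f a g" using assms(1) by blast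
    with step assms(2) obtain as where "chain c f as g'" "h' = fold f as g'" by metis
    with a show ?case by (intro exI[of _ "a # as"]) simp
  qed
next
  assume "\<exists>as. chain c f as h \<and> h' = fold f as h"
  then obtain as where "chain c f as h" "h' = fold f as h" by blast
  then show "star P T h h'" using assms(3)
  proof (induction as arbitrary: h)
    case Nil
    then show ?case by (simp add: star_refl)
  next
    case (Cons a as)
    then have "P T h (f a h)" "star P T (f a h) h'" using assms(1,2) by auto
    then show ?case by (auto simp: star_def intro: converse_rtranclp_into_rtranclp)
  qed
qed

named_theorems realizable_intros

declare realizable.intros [realizable_intros]

section \<open>Counter arithmetic with heads\<close>

abbreviation (input) Jh :: nat where "Jh \<equiv> 2"  \<comment> \<open>walks over the ones at the beginning of the track\<close>
text \<open>Heads are pointers as well as counters. \<open>Ah\<close> is the scratch counter of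
  \<open>eq\<close>. \<open>Eh\<close> reads the circuit code that begins at \<open>Ch\<close>,
  while \<open>Vh\<close> runs along the cells to be checked; \<open>Wh\<close> resolves wires
  relative to the row at \<open>Bh\<close>, and \<open>Ph\<close> and \<open>Nh\<close> count the
  true and false inputs of a gate. \<open>Sh\<close>, \<open>Qh\<close> and \<open>Rh\<close> serve
  the runs of the machine. \<open>Xh\<close> is the number of the input under test,
  \<open>Kh\<close> counts acceptances and \<open>Uh\<close> holds the claimed census.
  \<open>Dh\<close> walks through header, census and depth bound; \<open>Zh\<close> and
  \<open>Yh\<close> are for arithmetic.\<close>

abbreviation (input) Ah :: nat where "Ah \<equiv> 3"
abbreviation (input) Eh :: nat where "Eh \<equiv> 4"
abbreviation (input) Ch :: nat where "Ch \<equiv> 5"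
abbreviation (input) Bh :: nat where "Bh \<equiv> 6"
abbreviation (input) Vh :: nat where "Vh \<equiv> 7"
abbreviation (input) Wh :: nat where "Wh \<equiv> 8"
abbreviation (input) Ph :: nat where "Ph \<equiv> 9"
abbreviation (input) Nh :: nat where "Nh \<equiv> 10"
abbreviation (input) Sh :: nat where "Sh \<equiv> 11"
abbreviation (input) Qh :: nat where "Qh \<equiv> 12"
abbreviation (input) Rh :: nat where "Rh \<equiv> 13"
abbreviation (input) Xh :: nat where "Xh \<equiv> 14"
abbreviation (input) Kh :: nat where "Kh \<equiv> 15"
abbreviation (input) Dh :: nat where "Dh \<equiv> 16"
abbreviation (input) Zh :: nat where "Zh \<equiv> 17"
abbreviation (input) Yh :: nat where "Yh \<equiv> 18"
abbreviation (input) Uh :: nat where "Uh \<equiv> 19"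

definition leftmost :: "nat \<Rightarrow> check" where
  "leftmost i = test i {LM}"

definition home :: "nat \<Rightarrow> check" where
  "home i = star (left i) ;; leftmost i"

text \<open>Both heads walk to the left end in step while \<open>Ah\<close> counts, so they arrive
  together only if they started together. The walk back by the same count restores them and empties
  \<open>Ah\<close>.\<close>

definition eq :: "nat \<Rightarrow> nat \<Rightarrow> check" where
  "eq i j = star (left i ;; left j ;; right Ah) ;; leftmost i ;; leftmost j ;;
     star (right i ;; right j ;; left Ah) ;; leftmost Ah"

text \<open>The target position is guessed by a walk to the right and then confirmed by
  \<open>eq\<close>.\<close>

definition copy :: "nat \<Rightarrow> nat \<Rightarrow> check" where
  "copy i j = home i ;; star (right i) ;; eq i j"

text \<open>The obligatory first step turns this into a strict comparison: it fails unless
  \<open>i\<close> starts to the left of \<open>j\<close>.\<close>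

definition move_up :: "nat \<Rightarrow> nat \<Rightarrow> check" where
  "move_up i j = right i ;; star (right i) ;; eq i j"

text \<open>The ones of the header are a unary copy of the input length; walking over them yields a
  loop with exactly that many iterations.\<close>

definition along :: "check \<Rightarrow> check" where
  "along P = right Jh ;; star (test Jh {Bit True} ;; right Jh ;; P) ;; test Jh {Bit False} ;; home Jh"

text \<open>Multiplication by a fixed factor: each unit taken from \<open>Zh\<close> lets
  \<open>P\<close> add that factor to \<open>Yh\<close>, and the total is then carried back to
  \<open>Zh\<close>.\<close>

definition scale :: "check \<Rightarrow> check" where
  "scale P = star (left Zh ;; P) ;; leftmost Zh ;; star (left Yh ;; right Zh) ;; leftmost Yh"

definition double :: check where
  "double = scale (right Yh ;; right Yh)"

text \<open>The factor is \<open>j + 2\<close>, to which the header contributes \<open>j\<close>. It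
  is at least 2 even for the empty input, so its powers can absorb constant factors.\<close>

definition times_length :: check where
  "times_length = scale (along (right Yh) ;; right Yh ;; right Yh)"

text \<open>One step of Horner's scheme, with \<open>Zh\<close> holding the value of the bits read
  so far.\<close>

definition read_bit :: "nat \<Rightarrow> check" where
  "read_bit i = double ;; (test i {Bit True} ;; right Zh \<squnion> test i {Bit False}) ;; right i"

lemma realizable_library [realizable_intros]:
  "realizable (leftmost i)" "realizable (home i)" "realizable (eq i j)" "realizable (copy i j)" "realizable (move_up i j)"
  "realizable P \<Longrightarrow> realizable (along P)" "realizable P \<Longrightarrow> realizable (scale P)"
  "realizable double" "realizable times_length" "realizable (read_bit i)"
  unfolding leftmost_def home_def eq_def copy_def move_up_def along_def scale_def double_def times_length_def
    read_bit_def
  by ((intro realizable.intros; (assumption)?)+)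

text \<open>The most significant bit comes first, so that numeric and lexicographic order agree on
  words of equal length.\<close>

definition value_of :: "bool list \<Rightarrow> nat" where
  "value_of = foldl (\<lambda>a b. 2 * a + of_bool b) 0"

lemma value_of_Nil [simp]: "value_of [] = 0"
  by (simp add: value_of_def)

lemma value_of_snoc [simp]: "value_of (bs @ [b]) = 2 * value_of bs + of_bool b"
  by (simp add: value_of_def)

text \<open>The inequality is strict so that a head can stand on the cell after the word; in
  particular the empty word occurs exactly at the positions of the track.\<close>

definition occurs :: "symbol list \<Rightarrow> nat \<Rightarrow> symbol list \<Rightarrow> bool" where
  "occurs T p u \<longleftrightarrow> p + length u < length T \<and> (\<forall>i < length u. T ! (p + i) = u ! i)"

lemma occurs_Nil [simp]: "occurs T p [] \<longleftrightarrow> p < length T"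
  by (simp add: occurs_def)

lemma occurs_Cons: "occurs T p (a # u) \<longleftrightarrow> T ! p = a \<and> occurs T (Suc p) u"
  by (auto simp: occurs_def less_Suc_eq_0_disj)

lemma occurs_append: "occurs T p (u @ v) \<longleftrightarrow> occurs T p u \<and> occurs T (p + length u) v"
proof (induction u arbitrary: p)
  case Nil
  then show ?case by (auto simp: occurs_def)
next
  case (Cons a u)
  then show ?case by (simp add: occurs_Cons conj_assoc)
qed

lemma occurs_replicate:
  "occurs T p (replicate n a) \<longleftrightarrow> p + n < length T \<and> (\<forall>i<n. T ! (p + i) = a)"
  by (auto simp: occurs_def)

lemma occurs_snoc:
  "occurs T p (u @ [a]) \<longleftrightarrow> occurs T p u \<and> Suc (p + length u) < length T \<and> T ! (p + length u) = a"
  by (auto simp: occurs_append occurs_Cons)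

lemma occurs_less: "occurs T p u \<Longrightarrow> p + length u < length T"
  by (simp add: occurs_def)

section \<open>Meaning of the basic checks on a track that begins with a unary header\<close>

locale headed_track =
  fixes T :: "symbol list" and j :: nat
  assumes header: "occurs T 0 (LM # replicate j (Bit True) @ [Bit False])"
    and LM_unique: "\<And>p. p < length T \<Longrightarrow> T ! p = LM \<Longrightarrow> p = 0"
begin

lemma long: "j + 2 \<le> length T"
  using header by (simp add: occurs_def)

lemma nth_0 [simp]: "T ! 0 = LM" "T \<noteq> []" "0 < length T"
  using header by (auto simp: occurs_def)

lemma nth_ones: "0 < p \<Longrightarrow> p \<le> j \<Longrightarrow> T ! p = Bit True"
  using header by (auto simp: occurs_Cons occurs_append occurs_def nth_append dest!: spec[of _ "p - 1"])

lemma nth_zero: "T ! Suc j = Bit False"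
  using header by (auto simp: occurs_Cons occurs_append)

definition inside :: "heads \<Rightarrow> bool" where
  "inside h \<longleftrightarrow> (\<forall>i. h i < length T)"

lemma inside_upd [simp]: "inside h \<Longrightarrow> n < length T \<Longrightarrow> inside (h(i := n))"
  by (simp add: inside_def)

lemma insideD [simp]: "inside h \<Longrightarrow> h i < length T"
  by (simp add: inside_def)

lemma leftmost_iff [simp]:
  "leftmost i T h h' \<longleftrightarrow> h i = 0 \<and> h' = h" "(leftmost i ;; P) T h h' \<longleftrightarrow> h i = 0 \<and> P T h h'"
  using LM_unique by (auto simp: leftmost_def test_def seq_iff)

lemma home_iff: "home i T h h' \<longleftrightarrow> h' = h(i := 0)"
proof -
  have "star (left i) T h g \<longleftrightarrow> (\<exists>n. (\<forall>m<n. m < h i) \<and> g = h(i := h i - n))" for g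
    by (rule star_family) (auto simp: left_def fun_eq_iff)
  then show ?thesis
    by (auto simp: home_def seq_iff intro!: exI[of _ "h i"])
qed

lemma eq_iff:
  assumes "h Ah = 0" "i \<noteq> i'" "i \<noteq> Ah" "i' \<noteq> Ah"
  shows "eq i i' T h h' \<longleftrightarrow> h i = h i' \<and> h i < length T \<and> h' = h"
proof -
  have 1: "star (left i ;; left i' ;; right Ah) T h g \<longleftrightarrow>
      (\<exists>n. (\<forall>m<n. m < h i \<and> m < h i' \<and> Suc m < length T) \<and> g = h(i := h i - n, i' := h i' - n, Ah := n))" for g
    using assms by (intro star_family) (simp add: left_def right_def, auto simp: fun_eq_iff)
  have 2: "star (right i ;; right i' ;; left Ah) T (h(i := 0, i' := 0, Ah := n)) g \<longleftrightarrow>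
      (\<exists>m. (\<forall>l<m. Suc l < length T \<and> l < n) \<and> g = h(i := m, i' := m, Ah := n - m))" for g n
    using assms by (intro star_family) (simp add: left_def right_def, auto simp: fun_eq_iff)
  have *: "h(i := h i - n, i' := h i' - n, Ah := n) = h(i := 0, i' := 0, Ah := n)" if "h i \<le> n" "h i' \<le> n" for n
    using that by simp
  have "eq i i' T h h' \<longleftrightarrow> (\<exists>n. (\<forall>m<n. m < h i \<and> m < h i' \<and> Suc m < length T) \<and> h i \<le> n \<and> h i' \<le> n \<and>
      star (right i ;; right i' ;; left Ah) T (h(i := 0, i' := 0, Ah := n)) h' \<and> h' Ah = 0)"
    using assms by (simp add: eq_def seq_iff[of "star P" for P] 1 * cong: conj_cong)
  also have "\<dots> \<longleftrightarrow> (\<exists>n. (\<forall>m<n. m < h i \<and> m < h i' \<and> Suc m < length T) \<and> h i \<le> n \<and> h i' \<le> n \<and>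
     (\<exists>m. (\<forall>l<m. Suc l < length T \<and> l < n) \<and> h' = h(i := m, i' := m, Ah := n - m) \<and> n \<le> m))"
    using assms unfolding 2 by (intro ex_cong1) auto
  also have "\<dots> \<longleftrightarrow> (\<exists>n. n = h i \<and> n = h i' \<and> n < length T \<and> h' = h(i := n, i' := n, Ah := 0))"
  proof (intro ex_cong1 iffI conjI; elim conjE exE)
    fix n m
    assume a: "\<forall>m<n. m < h i \<and> m < h i' \<and> Suc m < length T" "h i \<le> n" "h i' \<le> n"
      and m: "\<forall>l<m. Suc l < length T \<and> l < n" "h' = h(i := m, i' := m, Ah := n - m)" "n \<le> m"
    have "\<not> n < m" using m(1) by blast
    then have "m = n" using m(3) by simp
    moreover have "\<not> h i < n" "\<not> h i' < n" using a(1) by blast+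
    then show "n = h i" "n = h i'" using a(2,3) by simp_all
    moreover show "n < length T"
      using a(1) nth_0(3) by (cases n) auto
    ultimately show "h' = h(i := n, i' := n, Ah := 0)" using m(2) by simp
  next
    fix n assume "n = h i" "n = h i'" "n < length T" "h' = h(i := n, i' := n, Ah := 0)"
    then show "\<exists>m. (\<forall>l<m. Suc l < length T \<and> l < n) \<and> h' = h(i := m, i' := m, Ah := n - m) \<and> n \<le> m"
      by (intro exI[of _ n]) auto
  qed auto
  also have "\<dots> \<longleftrightarrow> h i = h i' \<and> h i < length T \<and> h' = h"
  proof -
    have "h(i := h i', i' := h i', Ah := 0) = h" if "h i = h i'"
      using assms that by (simp add: fun_eq_iff)
    moreover have "h(Ah := 0) = h" using assms(1) by (simp add: fun_eq_iff)
    ultimately show ?thesis by auto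
  qed
  finally show ?thesis .
qed

lemma star_right_iff:
  "star (right i) T h h' \<longleftrightarrow> (\<exists>n. (\<forall>m<n. h i + Suc m < length T) \<and> h' = h(i := h i + n))"
  by (rule star_family) (auto simp: right_def fun_eq_iff)

lemma copy_iff:
  assumes "h Ah = 0" "i \<noteq> i'" "i \<noteq> Ah" "i' \<noteq> Ah"
  shows "copy i i' T h h' \<longleftrightarrow> h i' < length T \<and> h' = h(i := h i')"
  using assms unfolding copy_def seq_iff home_iff star_right_iff
  by (auto simp: eq_iff intro!: exI[of _ "h i'"])

lemma move_up_iff:
  assumes "h Ah = 0" "i \<noteq> i'" "i \<noteq> Ah" "i' \<noteq> Ah"
  shows "move_up i i' T h h' \<longleftrightarrow> h i < h i' \<and> h i' < length T \<and> h' = h(i := h i')"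
  using assms unfolding move_up_def seq_iff star_right_iff right_def
  by (auto simp: eq_iff intro!: exI[of _ "h i' - Suc (h i)"])

text \<open>The position \<open>p\<close> is arbitrary because the walk moves \<open>Jh\<close>
  between the calls of \<open>P\<close>, whereas the family \<open>F\<close> describes the heads
  with \<open>Jh\<close> at home.\<close>

lemma along_iff:
  assumes "\<And>m p g. m < j \<Longrightarrow> (\<And>l. l < m \<Longrightarrow> c l) \<Longrightarrow> p < length T \<Longrightarrow>
      P T ((F m)(Jh := p)) g \<longleftrightarrow> c m \<and> g = (F (Suc m))(Jh := p)"
    and "F 0 = h" and J: "\<And>m. F m Jh = 0"
  shows "along P T h h' \<longleftrightarrow> (\<forall>m<j. c m) \<and> h' = F j"
proof -
  have "star (test Jh {Bit True} ;; right Jh ;; P) T ((F 0)(Jh := 1)) g \<longleftrightarrow>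
      (\<exists>n. (\<forall>m<n. T ! Suc m = Bit True \<and> Suc (Suc m) < length T \<and> m < j \<and> c m) \<and> g = (F n)(Jh := Suc n))" for g
  proof (rule star_family)
    fix m g
    assume l: "\<And>l. l < m \<Longrightarrow> T ! Suc l = Bit True \<and> Suc (Suc l) < length T \<and> l < j \<and> c l"
    show "(test Jh {Bit True} ;; right Jh ;; P) T ((F m)(Jh := Suc m)) g \<longleftrightarrow>
        (T ! Suc m = Bit True \<and> Suc (Suc m) < length T \<and> m < j \<and> c m) \<and> g = (F (Suc m))(Jh := Suc (Suc m))"
    proof (cases "m < j")
      case True
      then show ?thesis using l long assms(1)[of m "Suc (Suc m)" g]
        by (auto simp: seq_iff test_def right_def)
    next
      case False
      then have "m = j" using l[of "m - 1"] by (cases m) auto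
      then show ?thesis using nth_zero by (auto simp: seq_iff test_def)
    qed
  qed simp
  then have "along P T h h' \<longleftrightarrow> (\<exists>n. (\<forall>m<n. T ! Suc m = Bit True \<and> Suc (Suc m) < length T \<and> m < j \<and> c m) \<and>
      Suc n < length T \<and> T ! Suc n = Bit False \<and> h' = (F n)(Jh := 0))"
    using assms(2) J[of 0] long
    by (simp add: along_def seq_iff[of "star P" for P] home_iff)
  also have "\<dots> \<longleftrightarrow> (\<exists>n. n = j \<and> (\<forall>m<j. c m) \<and> h' = F n)"
  proof (intro ex_cong1 iffI)
    fix n
    assume a: "(\<forall>m<n. T ! Suc m = Bit True \<and> Suc (Suc m) < length T \<and> m < j \<and> c m) \<and>
      Suc n < length T \<and> T ! Suc n = Bit False \<and> h' = (F n)(Jh := 0)"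
    have "\<not> n < j" using a nth_ones[of "Suc n"] by auto
    moreover have "\<not> j < n" using a by blast
    ultimately have "n = j" by simp
    moreover have "(F n)(Jh := 0) = F n" using J[of n] by (rule fun_upd_idem)
    ultimately show "n = j \<and> (\<forall>m<j. c m) \<and> h' = F n" using a by simp
  next
    fix n
    assume a: "n = j \<and> (\<forall>m<j. c m) \<and> h' = F n"
    moreover have "(F n)(Jh := 0) = F n" using J[of n] by (rule fun_upd_idem)
    ultimately show "(\<forall>m<n. T ! Suc m = Bit True \<and> Suc (Suc m) < length T \<and> m < j \<and> c m) \<and>
      Suc n < length T \<and> T ! Suc n = Bit False \<and> h' = (F n)(Jh := 0)"
      using nth_ones nth_zero long by simp
  qed
  finally show ?thesis by simp
qed

lemma all_less_add_iff: "(a::nat) < L \<Longrightarrow> (\<forall>m<n. Suc (a + m) < L) \<longleftrightarrow> a + n < L"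
  by (cases n) auto

lemma along_right_iff:
  assumes "h Jh = 0" "i \<noteq> Jh" "h i < length T"
  shows "along (right i) T h h' \<longleftrightarrow> h i + j < length T \<and> h' = h(i := h i + j)"
proof -
  have "along (right i) T h h' \<longleftrightarrow> (\<forall>m<j. h i + Suc m < length T) \<and> h' = h(i := h i + j)"
    using assms by (intro along_iff[where F = "\<lambda>m. h(i := h i + m)"]) (auto simp: right_def fun_eq_iff)
  with assms show ?thesis by (simp add: all_less_add_iff)
qed

text \<open>Arithmetic fails on overflow: a product is computed only if it is a position of the
  track. Later checks exploit this to demand room.\<close>

lemma scale_iff:
  assumes "\<And>g g'. inside g \<Longrightarrow> g Jh = h Jh \<Longrightarrow> P T g g' \<longleftrightarrow> g Yh + q < length T \<and> g' = g(Yh := g Yh + q)"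
    and "inside h" "h Yh = 0"
  shows "scale P T h h' \<longleftrightarrow> q * h Zh < length T \<and> h' = h(Zh := q * h Zh)"
proof -
  have 1: "star (left Zh ;; P) T h g \<longleftrightarrow>
      (\<exists>n. (\<forall>m<n. m < h Zh \<and> q * m + q < length T) \<and> g = h(Zh := h Zh - n, Yh := q * n))" for g
  proof (rule star_family)
    fix m g assume "\<And>l. l < m \<Longrightarrow> l < h Zh \<and> q * l + q < length T"
    from this[of "m - 1"] have "q * m < length T" by (cases m) (auto simp: algebra_simps)
    moreover have "h Zh - Suc m < length T" using assms(2) by (simp add: less_imp_diff_less)
    ultimately have "inside (h(Zh := h Zh - Suc m, Yh := q * m))"
      using assms(2) by simp
    then show "(left Zh ;; P) T (h(Zh := h Zh - m, Yh := q * m)) g \<longleftrightarrow>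
      (m < h Zh \<and> q * m + q < length T) \<and> g = h(Zh := h Zh - Suc m, Yh := q * Suc m)"
      using assms(1)[of "h(Zh := h Zh - Suc m, Yh := q * m)" g]
      by (auto simp: seq_iff left_def fun_upd_twist algebra_simps)
  qed (use assms in \<open>auto simp: fun_eq_iff\<close>)
  have 2: "star (left Yh ;; right Zh) T (h(Zh := 0, Yh := n)) g \<longleftrightarrow>
      (\<exists>m. (\<forall>l<m. l < n \<and> Suc l < length T) \<and> g = h(Zh := m, Yh := n - m))" for g n
    by (rule star_family) (simp add: left_def right_def, auto simp: fun_eq_iff)
  have "scale P T h h' \<longleftrightarrow> (\<exists>n. (\<forall>m<n. m < h Zh \<and> q * m + q < length T) \<and> h Zh \<le> n \<and>
      star (left Yh ;; right Zh) T (h(Zh := 0, Yh := q * n)) h' \<and> h' Yh = 0)"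
  proof -
    have "h(Zh := h Zh - n, Yh := q * n) = h(Zh := 0, Yh := q * n)" if "h Zh \<le> n" for n
      using that by simp
    then show ?thesis by (simp add: scale_def seq_iff[of "star P" for P] 1 cong: conj_cong)
  qed
  also have "\<dots> \<longleftrightarrow> (\<exists>n. n = h Zh \<and> (\<forall>m<n. q * m + q < length T) \<and>
      star (left Yh ;; right Zh) T (h(Zh := 0, Yh := q * n)) h' \<and> h' Yh = 0)"
  proof (intro ex_cong1)
    fix n
    have "n = h Zh" if "\<forall>m<n. m < h Zh \<and> q * m + q < length T" "h Zh \<le> n"
      using that by (metis le_neq_implies_less less_irrefl)
    then show "((\<forall>m<n. m < h Zh \<and> q * m + q < length T) \<and> h Zh \<le> n \<and>
        star (left Yh ;; right Zh) T (h(Zh := 0, Yh := q * n)) h' \<and> h' Yh = 0) \<longleftrightarrow>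
      (n = h Zh \<and> (\<forall>m<n. q * m + q < length T) \<and>
        star (left Yh ;; right Zh) T (h(Zh := 0, Yh := q * n)) h' \<and> h' Yh = 0)"
      by auto
  qed
  also have "\<dots> \<longleftrightarrow> q * h Zh < length T \<and> (\<exists>m. (\<forall>l<m. l < q * h Zh \<and> Suc l < length T) \<and>
      h' = h(Zh := m, Yh := q * h Zh - m) \<and> q * h Zh \<le> m)"
  proof -
    have "(\<forall>m<n. q * m + q < length T) \<longleftrightarrow> q * n < length T" for n
    proof
      assume "\<forall>m<n. q * m + q < length T"
      then show "q * n < length T" by (cases n) (auto simp: algebra_simps)
    next
      assume "q * n < length T"
      moreover have "q * m + q \<le> q * n" if "m < n" for m
        using that by (metis Suc_leI add.commute mult_Suc_right mult_le_mono2)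
      ultimately show "\<forall>m<n. q * m + q < length T" by (meson le_less_trans)
    qed
    then show ?thesis unfolding 2 by auto
  qed
  also have "\<dots> \<longleftrightarrow> q * h Zh < length T \<and> h' = h(Zh := q * h Zh)"
  proof (intro conj_cong refl iffI; (elim exE conjE)?)
    fix m assume "\<forall>l<m. l < q * h Zh \<and> Suc l < length T" "q * h Zh \<le> m"
      and m: "h' = h(Zh := m, Yh := q * h Zh - m)"
    then have "\<not> q * h Zh < m" by blast
    then have "m = q * h Zh" using \<open>q * h Zh \<le> m\<close> by simp
    then show "h' = h(Zh := q * h Zh)" using m assms(3) by (auto simp: fun_eq_iff)
  qed (use assms(3) in \<open>auto simp: fun_eq_iff intro!: exI[of _ "q * h Zh"]\<close>)
  finally show ?thesis .
qed

lemma double_iff: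
  assumes "inside h" "h Yh = 0"
  shows "double T h h' \<longleftrightarrow> 2 * h Zh < length T \<and> h' = h(Zh := 2 * h Zh)"
  unfolding double_def
proof (rule scale_iff[OF _ assms])
  show "(right Yh ;; right Yh) T g g' \<longleftrightarrow> g Yh + 2 < length T \<and> g' = g(Yh := g Yh + 2)" for g g'
    by (simp add: right_def) linarith
qed

lemma times_length_iff:
  assumes "inside h" "h Jh = 0" "h Yh = 0"
  shows "times_length T h h' \<longleftrightarrow> (j + 2) * h Zh < length T \<and> h' = h(Zh := (j + 2) * h Zh)"
  unfolding times_length_def
proof (rule scale_iff[OF _ assms(1,3)])
  fix g g' assume "inside g" "g Jh = h Jh"
  with assms(2) have g: "inside g" "g Jh = 0" by simp_all
  have "(along (right Yh) ;; right Yh ;; right Yh) T g g' \<longleftrightarrow>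
      g Yh + j < length T \<and> (right Yh ;; right Yh) T (g(Yh := g Yh + j)) g'"
    using along_right_iff[of g Yh] g by (simp add: seq_iff[of "along P" for P] del: exec)
  then show "(along (right Yh) ;; right Yh ;; right Yh) T g g' \<longleftrightarrow>
      g Yh + (j + 2) < length T \<and> g' = g(Yh := g Yh + (j + 2))"
    by (simp add: right_def) linarith
qed

lemma read_bit_iff:
  assumes "inside h" "h Yh = 0" "i \<noteq> Jh" "i \<noteq> Yh" "i \<noteq> Zh"
  shows "read_bit i T h h' \<longleftrightarrow> (\<exists>b. T ! h i = Bit b \<and> 2 * h Zh + of_bool b < length T \<and>
    Suc (h i) < length T \<and> h' = h(i := Suc (h i), Zh := 2 * h Zh + of_bool b))"
proof -
  define g where "g = h(Zh := 2 * h Zh)"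
  have "read_bit i T h h' \<longleftrightarrow> 2 * h Zh < length T \<and>
      ((test i {Bit True} ;; right Zh \<squnion> test i {Bit False}) ;; right i) T g h'"
    using double_iff[OF assms(1,2)]
    by (simp add: read_bit_def seq_iff[of double] g_def del: exec)
  also have "\<dots> \<longleftrightarrow> (\<exists>b. T ! h i = Bit b \<and> 2 * h Zh + of_bool b < length T \<and>
    Suc (h i) < length T \<and> h' = g(i := Suc (h i), Zh := 2 * h Zh + of_bool b))"
    using assms by (simp add: g_def right_def ex_bool_eq fun_upd_twist[of i Zh]) fastforce
  finally show ?thesis using assms by (simp add: g_def fun_upd_twist[of i Zh])
qed

end


section \<open>Checking the gates of a circuit\<close>

abbreviation (input) MARK :: symbol where "MARK \<equiv> Aux 2"

abbreviation (input) STOP :: symbol where "STOP \<equiv> Aux 3"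

definition read_type :: "gate_type \<Rightarrow> check" where
  "read_type ty = test Eh {Bit (encode_gate_type ty ! 0)} ;; right Eh ;;
     test Eh {Bit (encode_gate_type ty ! 1)} ;; right Eh"

text \<open>The code of a wire to node \<open>w\<close> has \<open>w + 1\<close> ones. Moving
  \<open>Wh\<close> along with them from the marker cell \<open>Bh\<close> of a row leads to the
  cell of node \<open>w\<close>, so unary numbers address the row directly. With
  \<open>ordered\<close> this cell must lie before that of the gate itself, which is the topological
  order required of a circuit.\<close>

definition wire :: "bool \<Rightarrow> check" where
  "wire ordered = test Eh {Bit True} ;; copy Wh Bh ;;
     star (test Eh {Bit True} ;; right Eh ;; right Wh) ;; test Eh {Bit False} ;; right Eh ;;
     (test Wh {Bit True} ;; right Ph \<squnion> test Wh {Bit False} ;; right Nh) ;;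
     (if ordered then move_up Wh Vh else skip) ;; home Wh"

definition gate_of :: "bool \<Rightarrow> (gate_type \<Rightarrow> check) \<Rightarrow> gate_type \<Rightarrow> check" where
  "gate_of ordered chk ty = read_type ty ;; star (wire ordered) ;; test Eh {Bit False} ;; right Eh ;;
     chk ty ;; right Vh"

definition any_gate :: "bool \<Rightarrow> (gate_type \<Rightarrow> check) \<Rightarrow> check" where
  "any_gate ordered chk = gate_of ordered chk Not_Gate \<squnion> gate_of ordered chk And_Gate \<squnion>
     gate_of ordered chk Or_Gate \<squnion> gate_of ordered chk Mod_Gate"

text \<open>A pass over the circuit code goes along with a pass over a row. The test for a bit at
  the beginning excludes the empty circuit, and \<open>along (right Vh)\<close> skips the cells of
  the inputs.\<close>

definition gates :: "bool \<Rightarrow> (gate_type \<Rightarrow> check) \<Rightarrow> check" where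
  "gates ordered chk = copy Eh Ch ;; test Eh (range Bit) ;; along (right Vh) ;;
     star (any_gate ordered chk) ;; test Eh {STOP} ;; right Eh ;; home Eh"

lemma realizable_gates [realizable_intros]:
  assumes "\<And>ty. realizable (chk ty)"
  shows "realizable (gates ordered chk)"
  using assms unfolding gates_def any_gate_def gate_of_def wire_def read_type_def
  by (auto intro!: realizable_intros)

context headed_track
begin

definition wire_ok :: "bool \<Rightarrow> nat \<Rightarrow> nat \<Rightarrow> nat \<Rightarrow> bool" where
  "wire_ok ordered b v w \<longleftrightarrow> b + w + 1 < length T \<and> T ! (b + w + 1) \<in> range Bit \<and>
     (ordered \<longrightarrow> b + w + 1 < v)"

definition count :: "bool \<Rightarrow> nat \<Rightarrow> nat list \<Rightarrow> nat" where
  "count a b ws = length (filter (\<lambda>w. T ! (b + w + 1) = Bit a) ws)"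

fun gate_ok :: "(gate_type \<Rightarrow> nat \<Rightarrow> nat \<Rightarrow> symbol \<Rightarrow> bool) \<Rightarrow> bool \<Rightarrow> nat \<Rightarrow> nat \<Rightarrow> gate \<Rightarrow> bool" where
  "gate_ok \<Phi> ordered b v (ty, ws) \<longleftrightarrow> (\<forall>w\<in>set ws. wire_ok ordered b v w) \<and>
     \<Phi> ty (count True b ws) (count False b ws) (T ! v)"

definition read_wire :: "nat \<Rightarrow> heads \<Rightarrow> heads" where
  "read_wire w h = h(Eh := h Eh + w + 2, Ph := h Ph + count True (h Bh) [w],
     Nh := h Nh + count False (h Bh) [w])"

lemma read_wire_simps [simp]:
  "read_wire w h Eh = h Eh + w + 2" "read_wire w h Bh = h Bh" "read_wire w h Vh = h Vh"
  by (simp_all add: read_wire_def)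

text \<open>A wire takes at least two cells of the code but raises \<open>Ph\<close> or
  \<open>Nh\<close> by at most one, so the counters stay behind \<open>Eh\<close> and cannot run off
  the track.\<close>

definition scratch :: "heads \<Rightarrow> bool" where
  "scratch h \<longleftrightarrow> inside h \<and> h Ah = 0 \<and> h Wh = 0 \<and> h Ph \<le> h Eh \<and> h Nh \<le> h Eh"

lemma wire_iff:
  assumes "scratch h"
  shows "wire ordered T h h' \<longleftrightarrow> (\<exists>w. (occurs T (h Eh) (map Bit (encode_wire w)) \<and>
    wire_ok ordered (h Bh) (h Vh) w) \<and> h' = read_wire w h)"
proof -
  have h: "inside h" "h Ah = 0" "h Wh = 0" "h Ph \<le> h Eh" "h Nh \<le> h Eh"
    using assms by (simp_all add: scratch_def)
  have loop: "star (test Eh {Bit True} ;; right Eh ;; right Wh) T (h(Wh := h Bh)) g \<longleftrightarrow>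
    (\<exists>n. (\<forall>m<n. T ! (h Eh + m) = Bit True \<and> Suc (h Eh + m) < length T \<and> Suc (h Bh + m) < length T) \<and>
      g = h(Wh := h Bh + n, Eh := h Eh + n))" for g
  proof (rule star_family)
    fix m g
    assume "\<And>l. l < m \<Longrightarrow> T ! (h Eh + l) = Bit True \<and> Suc (h Eh + l) < length T \<and> Suc (h Bh + l) < length T"
    from this[of "m - 1"] have "h Eh + m < length T" using h(1) by (cases m) auto
    then show "(test Eh {Bit True} ;; right Eh ;; right Wh) T (h(Wh := h Bh + m, Eh := h Eh + m)) g \<longleftrightarrow>
      (T ! (h Eh + m) = Bit True \<and> Suc (h Eh + m) < length T \<and> Suc (h Bh + m) < length T) \<and>
      g = h(Wh := h Bh + Suc m, Eh := h Eh + Suc m)"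
      by (simp add: right_def fun_upd_twist[of Eh Wh])
  qed (simp add: fun_eq_iff)
  define rest where "rest w = ((test Wh {Bit True} ;; right Ph \<squnion> test Wh {Bit False} ;; right Nh) ;;
     (if ordered then move_up Wh Vh else skip) ;; home Wh) T
     (h(Wh := h Bh + Suc w, Eh := h Eh + w + 2)) h'" for w
  have "wire ordered T h h' \<longleftrightarrow> T ! h Eh = Bit True \<and> (\<exists>n.
     (\<forall>m<n. T ! (h Eh + m) = Bit True \<and> Suc (h Eh + m) < length T \<and> Suc (h Bh + m) < length T) \<and>
     (test Eh {Bit False} ;; right Eh ;;
     (test Wh {Bit True} ;; right Ph \<squnion> test Wh {Bit False} ;; right Nh) ;;
     (if ordered then move_up Wh Vh else skip) ;; home Wh) T (h(Wh := h Bh + n, Eh := h Eh + n)) h')"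
    using h by (simp add: wire_def seq_iff[of "copy i j" for i j] seq_iff[of "star P" for P] copy_iff loop
      del: exec(2-)) 
  also have "\<dots> \<longleftrightarrow> (\<exists>w. (\<forall>m<Suc w. T ! (h Eh + m) = Bit True \<and> Suc (h Eh + m) < length T \<and>
      Suc (h Bh + m) < length T) \<and> T ! (h Eh + Suc w) = Bit False \<and> Suc (h Eh + Suc w) < length T \<and> rest w)"
    (is "?l \<longleftrightarrow> (\<exists>w. ?r w)")
  proof
    assume ?l
    then obtain n where n: "T ! h Eh = Bit True"
      "\<forall>m<n. T ! (h Eh + m) = Bit True \<and> Suc (h Eh + m) < length T \<and> Suc (h Bh + m) < length T"
      "(test Eh {Bit False} ;; right Eh ;;
     (test Wh {Bit True} ;; right Ph \<squnion> test Wh {Bit False} ;; right Nh) ;;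
     (if ordered then move_up Wh Vh else skip) ;; home Wh) T (h(Wh := h Bh + n, Eh := h Eh + n)) h'"
      by blast
    \<comment> \<open>The initial test found a one in the cell where an empty loop would require the
      closing zero.\<close>
    then have "n \<noteq> 0" by (intro notI) simp
    then obtain w where "n = Suc w" by (cases n) auto
    with n have "?r w" by (simp add: rest_def del: exec(4,5))
    then show "\<exists>w. ?r w" ..
  next
    assume "\<exists>w. ?r w"
    then obtain w where w: "?r w" ..
    then have "T ! h Eh = Bit True" by (metis add.right_neutral zero_less_Suc)
    with w show ?l by (intro conjI exI[of _ "Suc w"]) (simp_all add: rest_def del: exec(4,5))
  qed
  also have "\<dots> \<longleftrightarrow> (\<exists>w. occurs T (h Eh) (map Bit (encode_wire w)) \<and> h Bh + w + 1 < length T \<and> rest w)"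
  proof (intro ex_cong1)
    fix w
    have "(\<forall>m<Suc w. T ! (h Eh + m) = Bit True \<and> Suc (h Eh + m) < length T \<and> Suc (h Bh + m) < length T) \<longleftrightarrow>
      (\<forall>m<Suc w. T ! (h Eh + m) = Bit True) \<and> h Eh + Suc w < length T \<and> h Bh + Suc w < length T"
      using all_less_add_iff[of "h Eh" "length T" "Suc w"] all_less_add_iff[of "h Bh" "length T" "Suc w"] h(1)
      by (auto simp del: add_Suc_right)
    then show "((\<forall>m<Suc w. T ! (h Eh + m) = Bit True \<and> Suc (h Eh + m) < length T \<and>
      Suc (h Bh + m) < length T) \<and> T ! (h Eh + Suc w) = Bit False \<and> Suc (h Eh + Suc w) < length T \<and> rest w) \<longleftrightarrow>
      (occurs T (h Eh) (map Bit (encode_wire w)) \<and> h Bh + w + 1 < length T \<and> rest w)"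
      unfolding encode_wire_def map_append map_replicate list.map occurs_snoc occurs_replicate
      by auto
  qed
  also have "\<dots> \<longleftrightarrow> (\<exists>w. (occurs T (h Eh) (map Bit (encode_wire w)) \<and>
    wire_ok ordered (h Bh) (h Vh) w) \<and> h' = read_wire w h)"
  proof (intro ex_cong1)
    fix w
    have "(h Bh + w + 1 < length T \<and> rest w) \<longleftrightarrow> wire_ok ordered (h Bh) (h Vh) w \<and> h' = read_wire w h"
      if "occurs T (h Eh) (map Bit (encode_wire w))"
    proof -
      have E: "h Eh + w + 2 < length T" using occurs_less[OF that] by (simp add: encode_wire_def)
      define b where "b = h Bh + Suc w"
      have "(h(Wh := x, Eh := y, i := p))(Wh := 0) = h(Eh := y, i := p)" if "i \<noteq> Wh" for x y i p
        using h(3) that by (simp add: fun_eq_iff)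
      then have "rest w \<longleftrightarrow> b < length T \<and> (ordered \<longrightarrow> b < h Vh) \<and>
        (T ! b = Bit True \<and> h' = h(Eh := h Eh + w + 2, Ph := Suc (h Ph)) \<or>
         T ! b = Bit False \<and> h' = h(Eh := h Eh + w + 2, Nh := Suc (h Nh)))"
        using E h unfolding rest_def b_def
        by (cases ordered) (simp_all add: seq_iff[of "move_up i j" for i j] seq_iff[of skip] move_up_iff
          skip_def home_iff right_def, blast+)
      moreover have "h(Eh := y, Ph := p, Nh := h Nh) = h(Eh := y, Ph := p)"
        "h(Eh := y, Ph := h Ph, Nh := n) = h(Eh := y, Nh := n)" for y n p
        by (simp_all add: fun_eq_iff)
      ultimately show ?thesis unfolding wire_ok_def read_wire_def count_def b_def
        by auto
    qed
    then show "(occurs T (h Eh) (map Bit (encode_wire w)) \<and> h Bh + w + 1 < length T \<and> rest w) \<longleftrightarrow>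
      ((occurs T (h Eh) (map Bit (encode_wire w)) \<and> wire_ok ordered (h Bh) (h Vh) w) \<and> h' = read_wire w h)"
      by blast
  qed
  finally show ?thesis .
qed

lemma count_Cons: "count a b (w # ws) = count a b [w] + count a b ws"
  by (simp add: count_def)

lemma read_wire_scratch:
  assumes "scratch h" "occurs T (h Eh) (map Bit (encode_wire w))"
  shows "scratch (read_wire w h)"
proof -
  have "h Eh + w + 2 < length T" using occurs_less[OF assms(2)] by (simp add: encode_wire_def)
  moreover have "count a (h Bh) [w] \<le> 1" for a by (simp add: count_def)
  from this[of True] this[of False]
  have "h Ph + count True (h Bh) [w] \<le> h Eh + w + 2" "h Nh + count False (h Bh) [w] \<le> h Eh + w + 2"
    using assms(1) by (simp_all add: scratch_def)
  ultimately show ?thesis using assms(1) by (simp add: scratch_def read_wire_def)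
qed

definition read_wires :: "nat list \<Rightarrow> heads \<Rightarrow> heads" where
  "read_wires ws h = h(Eh := h Eh + length (concat (map encode_wire ws)),
     Ph := h Ph + count True (h Bh) ws, Nh := h Nh + count False (h Bh) ws)"

lemma wires_iff:
  assumes "scratch h"
  shows "star (wire ordered) T h h' \<longleftrightarrow> (\<exists>ws. occurs T (h Eh) (map Bit (concat (map encode_wire ws))) \<and>
    (\<forall>w\<in>set ws. wire_ok ordered (h Bh) (h Vh) w) \<and> h' = read_wires ws h)"
proof -
  let ?c = "\<lambda>w h. occurs T (h Eh) (map Bit (encode_wire w)) \<and> wire_ok ordered (h Bh) (h Vh) w"
  have "chain ?c read_wire ws h \<longleftrightarrow> occurs T (h Eh) (map Bit (concat (map encode_wire ws))) \<and>
    (\<forall>w\<in>set ws. wire_ok ordered (h Bh) (h Vh) w)" if "scratch h" for ws h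
    using that
  proof (induction ws arbitrary: h)
    case Nil
    then show ?case by (simp add: scratch_def)
  next
    case (Cons w ws)
    show ?case
    proof (cases "occurs T (h Eh) (map Bit (encode_wire w))")
      case True
      have enc: "map Bit (concat (map encode_wire (w # ws))) =
          map Bit (encode_wire w) @ map Bit (concat (map encode_wire ws))"
        "length (map Bit (encode_wire w)) = w + 2"
        by (simp_all add: encode_wire_def)
      show ?thesis
        using True unfolding chain.simps Cons.IH[OF read_wire_scratch[OF Cons.prems True]]
          enc(1) occurs_append enc(2) by (simp add: add.assoc) blast
    qed (simp add: occurs_append)
  qed
  moreover have "fold read_wire ws h = read_wires ws h" for ws h
  proof (induction ws arbitrary: h)
    case Nil
    then show ?case by (simp add: read_wires_def count_def)
  next
    case (Cons w ws)
    have "fold read_wire (w # ws) h = read_wires ws (read_wire w h)" by (simp add: Cons.IH)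
    also have "\<dots> = read_wires (w # ws) h"
      by (rule ext) (simp add: read_wires_def read_wire_def count_Cons[of _ _ w ws] encode_wire_def)
    finally show ?case .
  qed
  ultimately show ?thesis
    using star_list[of scratch "wire ordered" T ?c read_wire h h'] assms wire_iff read_wire_scratch
    by (auto simp: conj_assoc)
qed

definition idle :: "heads \<Rightarrow> bool" where
  "idle h \<longleftrightarrow> inside h \<and> h Ah = 0 \<and> h Wh = 0 \<and> h Ph = 0 \<and> h Nh = 0"

text \<open>The interface between parser and gate check: it lets the same pass over the code serve
  for evaluation, for depth layers and for rows that have to be constant.\<close>

definition chk_spec :: "(gate_type \<Rightarrow> check) \<Rightarrow> (gate_type \<Rightarrow> nat \<Rightarrow> nat \<Rightarrow> symbol \<Rightarrow> bool) \<Rightarrow> bool" where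
  "chk_spec chk \<Phi> \<longleftrightarrow> (\<forall>ty h h'. inside h \<longrightarrow> h Ah = 0 \<longrightarrow>
     chk ty T h h' \<longleftrightarrow> \<Phi> ty (h Ph) (h Nh) (T ! h Vh) \<and> h' = h(Ph := 0, Nh := 0))"

lemma gate_of_iff:
  assumes "idle h" "chk_spec chk \<Phi>"
  shows "gate_of ordered chk ty T h h' \<longleftrightarrow> (\<exists>ws. occurs T (h Eh) (map Bit (encode_gate (ty, ws))) \<and>
    gate_ok \<Phi> ordered (h Bh) (h Vh) (ty, ws) \<and> Suc (h Vh) < length T \<and>
    h' = h(Eh := h Eh + length (encode_gate (ty, ws)), Vh := Suc (h Vh)))"
proof -
  have h: "inside h" "h Ah = 0" "h Wh = 0" "h Ph = 0" "h Nh = 0"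
    using assms(1) by (simp_all add: idle_def)
  obtain a b where ab: "encode_gate_type ty = [a, b]" by (cases ty) auto
  define h2 where "h2 = h(Eh := h Eh + 2)"
  have "scratch h2" if "h Eh + 2 < length T"
    using h that by (simp add: scratch_def h2_def)
  then have wires: "star (wire ordered) T h2 g \<longleftrightarrow> (\<exists>ws. (occurs T (h2 Eh) (map Bit (concat (map encode_wire ws))) \<and>
      (\<forall>w\<in>set ws. wire_ok ordered (h2 Bh) (h2 Vh) w)) \<and> g = read_wires ws h2)"
    if "h Eh + 2 < length T" for g
    using wires_iff[of h2 ordered g] that by (simp add: conj_assoc)
  have type: "occurs T (h Eh) [Bit a, Bit b] \<longleftrightarrow> T ! h Eh = Bit a \<and> T ! Suc (h Eh) = Bit b \<and> h Eh + 2 < length T"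
    by (simp add: occurs_Cons)
  have h2: "h(Eh := Suc (Suc (h Eh))) = h2" by (simp add: h2_def)
  have "gate_of ordered chk ty T h h' \<longleftrightarrow> occurs T (h Eh) [Bit a, Bit b] \<and>
    (star (wire ordered) ;; test Eh {Bit False} ;; right Eh ;; chk ty ;; right Vh) T h2 h'"
    using h by (auto simp: gate_of_def read_type_def ab type h2)
  also have "\<dots> \<longleftrightarrow> occurs T (h Eh) [Bit a, Bit b] \<and>
    (\<exists>ws. (occurs T (h2 Eh) (map Bit (concat (map encode_wire ws))) \<and>
      (\<forall>w\<in>set ws. wire_ok ordered (h2 Bh) (h2 Vh) w)) \<and>
      (test Eh {Bit False} ;; right Eh ;; chk ty ;; right Vh) T (read_wires ws h2) h')"
    unfolding seq_iff[of "star P" for P] using wires by (auto simp: type simp del: exec)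
  also have "\<dots> \<longleftrightarrow> (\<exists>ws. occurs T (h Eh) (map Bit (encode_gate (ty, ws))) \<and>
    gate_ok \<Phi> ordered (h Bh) (h Vh) (ty, ws) \<and> Suc (h Vh) < length T \<and>
    h' = h(Eh := h Eh + length (encode_gate (ty, ws)), Vh := Suc (h Vh)))"
  proof -
    have "(occurs T (h Eh) [Bit a, Bit b] \<and> (occurs T (h2 Eh) (map Bit (concat (map encode_wire ws))) \<and>
      (\<forall>w\<in>set ws. wire_ok ordered (h2 Bh) (h2 Vh) w)) \<and>
      (test Eh {Bit False} ;; right Eh ;; chk ty ;; right Vh) T (read_wires ws h2) h') \<longleftrightarrow>
      (occurs T (h Eh) (map Bit (encode_gate (ty, ws))) \<and>
        gate_ok \<Phi> ordered (h Bh) (h Vh) (ty, ws) \<and> Suc (h Vh) < length T \<and>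
        h' = h(Eh := h Eh + length (encode_gate (ty, ws)), Vh := Suc (h Vh)))" for ws
    proof -
      let ?u = "concat (map encode_wire ws)"
      let ?e = "h Eh + 2 + length ?u"
      have code: "map Bit (encode_gate (ty, ws)) = [Bit a, Bit b] @ map Bit ?u @ [Bit False]"
        by (simp add: ab)
      have len: "h Eh + length (encode_gate (ty, ws)) = Suc ?e" by (simp add: ab)
      have *: "occurs T (h Eh) (map Bit (encode_gate (ty, ws))) \<longleftrightarrow> occurs T (h Eh) [Bit a, Bit b] \<and>
        occurs T (h Eh + 2) (map Bit ?u) \<and> ?e < length T \<and> T ! ?e = Bit False \<and> Suc ?e < length T"
        unfolding code occurs_append by (auto simp: occurs_Cons)
      define g where "g = h(Eh := Suc ?e, Ph := count True (h Bh) ws, Nh := count False (h Bh) ws)"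
      \<comment> \<open>The counts fit on the track because the wires that they count take up at
        least as many cells of the code.\<close>
      have counts: "count a (h Bh) ws \<le> length ?u" for a
      proof (induction ws)
        case (Cons w ws)
        have "count a (h Bh) [w] \<le> length (encode_wire w)" by (simp add: count_def encode_wire_def)
        then show ?case using Cons by (simp add: count_Cons[of _ _ w ws])
      qed (simp add: count_def)
      have read: "(test Eh {Bit False} ;; right Eh ;; chk ty ;; right Vh) T (read_wires ws h2) h' \<longleftrightarrow>
        ?e < length T \<and> T ! ?e = Bit False \<and> Suc ?e < length T \<and> (chk ty ;; right Vh) T g h'"
      proof -
        have 1: "read_wires ws h2 = h(Eh := ?e, Ph := count True (h Bh) ws, Nh := count False (h Bh) ws)"
          using h by (simp add: read_wires_def h2_def)
        have 2: "(h(Eh := ?e, Ph := p, Nh := n))(Eh := Suc ?e) = h(Eh := Suc ?e, Ph := p, Nh := n)" for p n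
          by (simp add: fun_eq_iff)
        show ?thesis by (simp add: 1 2[simplified] g_def)
      qed
      have "(chk ty ;; right Vh) T g h' \<longleftrightarrow> \<Phi> ty (count True (h Bh) ws) (count False (h Bh) ws) (T ! h Vh) \<and>
        Suc (h Vh) < length T \<and> h' = h(Eh := Suc ?e, Vh := Suc (h Vh))" if "Suc ?e < length T"
      proof -
        have "inside g" "g Ah = 0" using h that counts[of True] counts[of False]
          by (simp_all add: g_def)
        then have "chk ty T g x \<longleftrightarrow> \<Phi> ty (g Ph) (g Nh) (T ! g Vh) \<and> x = g(Ph := 0, Nh := 0)" for x
          using assms(2) unfolding chk_spec_def by blast
        then have "(chk ty ;; right Vh) T g h' \<longleftrightarrow> \<Phi> ty (g Ph) (g Nh) (T ! g Vh) \<and>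
          right Vh T (g(Ph := 0, Nh := 0)) h'"
          unfolding seq_iff by auto
        moreover have "(g(Ph := 0, Nh := 0))(Vh := v) = h(Eh := Suc ?e, Vh := v)" for v
          using h by (simp add: g_def fun_eq_iff)
        ultimately show ?thesis by (simp add: right_def g_def)
      qed
      then show ?thesis unfolding * len read by (auto simp: h2_def)
    qed
    then show ?thesis by blast
  qed
  finally show ?thesis .
qed

definition read_gate :: "gate \<Rightarrow> heads \<Rightarrow> heads" where
  "read_gate g h = h(Eh := h Eh + length (encode_gate g), Vh := Suc (h Vh))"

lemma read_gate_simps [simp]:
  "read_gate g h Eh = h Eh + length (encode_gate g)" "read_gate g h Bh = h Bh"
  "read_gate g h Vh = Suc (h Vh)"
  by (simp_all add: read_gate_def)

lemma any_gate_iff: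
  assumes "idle h" "chk_spec chk \<Phi>"
  shows "any_gate ordered chk T h h' \<longleftrightarrow> (\<exists>g. (occurs T (h Eh) (map Bit (encode_gate g)) \<and>
    gate_ok \<Phi> ordered (h Bh) (h Vh) g \<and> Suc (h Vh) < length T) \<and> h' = read_gate g h)"
proof -
  have "any_gate ordered chk T h h' \<longleftrightarrow> (\<exists>ty. gate_of ordered chk ty T h h')"
    unfolding any_gate_def exec by (metis gate_type.exhaust)
  then show ?thesis unfolding gate_of_iff[OF assms] read_gate_def by (auto simp del: gate_ok.simps)
qed

lemma read_gate_idle:
  assumes "idle h" "occurs T (h Eh) (map Bit (encode_gate g))" "Suc (h Vh) < length T"
  shows "idle (read_gate g h)"
  using assms occurs_less[OF assms(2)] by (simp add: idle_def read_gate_def)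

definition circuit_ok :: "(gate_type \<Rightarrow> nat \<Rightarrow> nat \<Rightarrow> symbol \<Rightarrow> bool) \<Rightarrow> bool \<Rightarrow> nat \<Rightarrow> nat \<Rightarrow> circuit \<Rightarrow> bool" where
  "circuit_ok \<Phi> ordered b v C \<longleftrightarrow> v + length C < length T \<and>
     (\<forall>i < length C. gate_ok \<Phi> ordered b (v + i) (C ! i))"

lemma circuit_ok_Cons:
  "circuit_ok \<Phi> ordered b v (g # C) \<longleftrightarrow> gate_ok \<Phi> ordered b v g \<and> circuit_ok \<Phi> ordered b (Suc v) C"
  by (auto simp: circuit_ok_def less_Suc_eq_0_disj)

lemma any_gates_iff:
  assumes "idle h" "chk_spec chk \<Phi>"
  shows "star (any_gate ordered chk) T h h' \<longleftrightarrow> (\<exists>C. occurs T (h Eh) (map Bit (encode_circuit C)) \<and>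
    circuit_ok \<Phi> ordered (h Bh) (h Vh) C \<and>
    h' = h(Eh := h Eh + length (encode_circuit C), Vh := h Vh + length C))"
proof -
  let ?c = "\<lambda>g h. occurs T (h Eh) (map Bit (encode_gate g)) \<and>
    gate_ok \<Phi> ordered (h Bh) (h Vh) g \<and> Suc (h Vh) < length T"
  have "chain ?c read_gate C h \<longleftrightarrow> occurs T (h Eh) (map Bit (encode_circuit C)) \<and>
    circuit_ok \<Phi> ordered (h Bh) (h Vh) C" if "idle h" for C h
    using that
  proof (induction C arbitrary: h)
    case Nil
    then show ?case by (simp add: encode_circuit_def circuit_ok_def idle_def)
  next
    case (Cons g C)
    have enc: "map Bit (encode_circuit (g # C)) = map Bit (encode_gate g) @ map Bit (encode_circuit C)"
      by (simp add: encode_circuit_def)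
    show ?case
    proof (cases "occurs T (h Eh) (map Bit (encode_gate g)) \<and> Suc (h Vh) < length T")
      case True
      then have IH: "chain ?c read_gate C (read_gate g h) \<longleftrightarrow>
          occurs T (h Eh + length (encode_gate g)) (map Bit (encode_circuit C)) \<and>
          circuit_ok \<Phi> ordered (h Bh) (Suc (h Vh)) C"
        using Cons.IH[OF read_gate_idle[of h g]] Cons.prems by simp
      show ?thesis using True
        unfolding chain.simps IH enc occurs_append circuit_ok_Cons length_map by blast
    next
      case False
      then show ?thesis unfolding chain.simps enc occurs_append by (auto simp: circuit_ok_def)
    qed
  qed
  moreover have "fold read_gate C h = h(Eh := h Eh + length (encode_circuit C), Vh := h Vh + length C)" for C h
  proof (induction C arbitrary: h)
    case Nil
    then show ?case by (simp add: encode_circuit_def)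
  next
    case (Cons g C)
    have "fold read_gate (g # C) h =
        (read_gate g h)(Eh := read_gate g h Eh + length (encode_circuit C), Vh := read_gate g h Vh + length C)"
      by (simp only: fold_simps Cons.IH)
    also have "\<dots> = h(Eh := h Eh + length (encode_circuit (g # C)), Vh := h Vh + length (g # C))"
      by (rule ext) (simp add: read_gate_def encode_circuit_def)
    finally show ?case .
  qed
  ultimately show ?thesis
    using star_list[of idle "any_gate ordered chk" T ?c read_gate h h'] assms(1)
      any_gate_iff[OF _ assms(2)] read_gate_idle
    by (auto simp: conj_assoc simp del: gate_ok.simps)
qed

lemma gates_iff:
  assumes "idle h" "chk_spec chk \<Phi>" "h Jh = 0" "h Eh = 0"
  shows "gates ordered chk T h h' \<longleftrightarrow> (\<exists>C. C \<noteq> [] \<and> occurs T (h Ch) (map Bit (encode_circuit C) @ [STOP]) \<and>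
    circuit_ok \<Phi> ordered (h Bh) (h Vh + j) C \<and> h' = h(Vh := h Vh + j + length C))"
proof -
  define g where "g = h(Eh := h Ch, Vh := h Vh + j)"
  have h: "inside h" "h Ah = 0" using assms(1) by (simp_all add: idle_def)
  have "gates ordered chk T h h' \<longleftrightarrow> T ! h Ch \<in> range Bit \<and> h Vh + j < length T \<and>
    (star (any_gate ordered chk) ;; test Eh {STOP} ;; right Eh ;; home Eh) T g h'"
  proof -
    have "along (right Vh) T (h(Eh := h Ch)) g' \<longleftrightarrow> h Vh + j < length T \<and> g' = g" for g'
      using along_right_iff[of "h(Eh := h Ch)" Vh g'] h assms(3) by (simp add: g_def)
    then show ?thesis using h
      by (simp add: gates_def seq_iff[of "copy i j" for i j] seq_iff[of "along P" for P] copy_iff)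
  qed
  also have "\<dots> \<longleftrightarrow> T ! h Ch \<in> range Bit \<and> h Vh + j < length T \<and>
    (\<exists>C. occurs T (h Ch) (map Bit (encode_circuit C)) \<and> circuit_ok \<Phi> ordered (h Bh) (h Vh + j) C \<and>
     (test Eh {STOP} ;; right Eh ;; home Eh) T
       (g(Eh := g Eh + length (encode_circuit C), Vh := g Vh + length C)) h')"
  proof -
    have "idle g" if "h Vh + j < length T" using assms(1) that by (simp add: idle_def g_def)
    moreover have "g Eh = h Ch" "g Vh = h Vh + j" "g Bh = h Bh" by (simp_all add: g_def)
    ultimately show ?thesis
      using any_gates_iff[OF _ assms(2), of g]
      by (cases "h Vh + j < length T") (auto simp: seq_iff[of "star P" for P] simp del: exec)
  qed
  also have "\<dots> \<longleftrightarrow> (\<exists>C. C \<noteq> [] \<and> occurs T (h Ch) (map Bit (encode_circuit C) @ [STOP]) \<and>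
    circuit_ok \<Phi> ordered (h Bh) (h Vh + j) C \<and> h' = h(Vh := h Vh + j + length C))"
  proof -
    have a: "(test Eh {STOP} ;; right Eh ;; home Eh) T
        (g(Eh := g Eh + length (encode_circuit C), Vh := g Vh + length C)) h' \<longleftrightarrow>
      Suc (h Ch + length (encode_circuit C)) < length T \<and> T ! (h Ch + length (encode_circuit C)) = STOP \<and>
      h' = h(Vh := h Vh + j + length C)" for C
    proof -
      have "(g(Eh := x, Vh := y))(Eh := z, Eh := 0) = h(Vh := y)" for x y z
        using assms(4) by (simp add: fun_eq_iff g_def)
      moreover have "g Eh = h Ch" "g Vh = h Vh + j" by (simp_all add: g_def)
      ultimately show ?thesis by (auto simp: home_iff)
    qed
    \<comment> \<open>A nonempty circuit starts with the two bits of a gate type, the empty one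
      immediately with \<open>STOP\<close>.\<close>
    have b: "T ! h Ch \<in> range Bit \<longleftrightarrow> C \<noteq> []" if "occurs T (h Ch) (map Bit (encode_circuit C))"
      "T ! (h Ch + length (encode_circuit C)) = STOP" for C
    proof (cases C)
      case Nil
      then show ?thesis using that by (auto simp: encode_circuit_def)
    next
      case (Cons g C')
      obtain ty ws where g: "g = (ty, ws)" by fastforce
      have "encode_circuit C \<noteq> []" using Cons by (cases ty) (auto simp: encode_circuit_def g)
      then obtain x xs where "encode_circuit C = x # xs" by (cases "encode_circuit C") auto
      then show ?thesis using that Cons by (simp add: occurs_Cons)
    qed
    show ?thesis
    proof (intro iffI; elim conjE exE)
      fix C
      assume "T ! h Ch \<in> range Bit" "h Vh + j < length T" "occurs T (h Ch) (map Bit (encode_circuit C))"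
        "circuit_ok \<Phi> ordered (h Bh) (h Vh + j) C"
        "(test Eh {STOP} ;; right Eh ;; home Eh) T (g(Eh := g Eh + length (encode_circuit C), Vh := g Vh + length C)) h'"
      then show "\<exists>C. C \<noteq> [] \<and> occurs T (h Ch) (map Bit (encode_circuit C) @ [STOP]) \<and>
        circuit_ok \<Phi> ordered (h Bh) (h Vh + j) C \<and> h' = h(Vh := h Vh + j + length C)"
        unfolding a using b[of C]
        by (intro exI[of _ C]) (simp add: occurs_snoc)
    next
      fix C
      assume C: "C \<noteq> []" "occurs T (h Ch) (map Bit (encode_circuit C) @ [STOP])"
        "circuit_ok \<Phi> ordered (h Bh) (h Vh + j) C" "h' = h(Vh := h Vh + j + length C)"
      then have "h Vh + j < length T" by (simp add: circuit_ok_def)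
      then show "T ! h Ch \<in> range Bit \<and> h Vh + j < length T \<and>
        (\<exists>C. occurs T (h Ch) (map Bit (encode_circuit C)) \<and> circuit_ok \<Phi> ordered (h Bh) (h Vh + j) C \<and>
         (test Eh {STOP} ;; right Eh ;; home Eh) T
         (g(Eh := g Eh + length (encode_circuit C), Vh := g Vh + length C)) h')"
        unfolding a using C b[of C] by (intro conjI exI[of _ C]) (simp_all add: occurs_snoc)
    qed
  qed
  finally show ?thesis .
qed

end


subsection \<open>Values and depths of nodes\<close>

lemma node_values_Nil [simp]: "node_values m [] x = x"
  by (simp add: node_values_def)

lemma node_values_snoc:
  "node_values m (C @ [g]) x =
    node_values m C x @ [gate_value m (fst g) (map ((!) (node_values m C x)) (snd g))]"
  by (simp add: node_values_def split: prod.splits)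

lemma length_node_values [simp]: "length (node_values m C x) = length x + length C"
  by (induction C rule: rev_induct) (simp_all add: node_values_snoc)

lemma node_values_prefix: "i < length C \<Longrightarrow> u < length x + i \<Longrightarrow>
    node_values m C x ! u = node_values m (take i C) x ! u"
proof (induction C rule: rev_induct)
  case (snoc g C)
  show ?case
  proof (cases "i = length C")
    case True
    then show ?thesis using snoc.prems by (simp add: node_values_snoc nth_append)
  next
    case False
    then show ?thesis using snoc by (simp add: node_values_snoc nth_append)
  qed
qed simp

lemma node_values_input: "u < length x \<Longrightarrow> node_values m C x ! u = x ! u"
  by (induction C rule: rev_induct) (simp_all add: node_values_snoc nth_append)

text \<open>Later gates only append values, so the equation of each gate survives in the complete
  list. These equations are what a certificate can be checked against locally.\<close>

lemma node_values_gate: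
  assumes "i < length C" "C ! i = (ty, ws)" "\<And>w. w \<in> set ws \<Longrightarrow> w < length x + i"
  shows "node_values m C x ! (length x + i) = gate_value m ty (map ((!) (node_values m C x)) ws)"
proof -
  have "node_values m C x ! (length x + i) = node_values m (take (Suc i) C) x ! (length x + i)"
  proof (cases "Suc i < length C")
    case True
    then show ?thesis by (rule node_values_prefix) simp
  qed (use assms(1) in simp)
  also have "take (Suc i) C = take i C @ [(ty, ws)]"
    using assms by (simp add: take_Suc_conv_app_nth)
  also have "node_values m \<dots> x ! (length x + i) = gate_value m ty (map ((!) (node_values m (take i C) x)) ws)"
    using assms(1) by (simp add: node_values_snoc nth_append)
  also have "map ((!) (node_values m (take i C) x)) ws = map ((!) (node_values m C x)) ws"
    using assms by (simp add: node_values_prefix)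
  finally show ?thesis .
qed

lemma node_depths_Nil [simp]: "node_depths n [] = replicate n 0"
  by (simp add: node_depths_def)

lemma node_depths_snoc:
  "node_depths n (C @ [g]) =
    node_depths n C @ [Suc (Max (insert 0 ((!) (node_depths n C) ` set (snd g))))]"
  by (simp add: node_depths_def split: prod.splits)

lemma length_node_depths [simp]: "length (node_depths n C) = n + length C"
  by (induction C rule: rev_induct) (simp_all add: node_depths_snoc)

lemma node_depths_prefix: "i < length C \<Longrightarrow> u < n + i \<Longrightarrow>
    node_depths n C ! u = node_depths n (take i C) ! u"
proof (induction C rule: rev_induct)
  case (snoc g C)
  show ?case
  proof (cases "i = length C")
    case True
    then show ?thesis using snoc.prems by (simp add: node_depths_snoc nth_append)
  next
    case False
    then show ?thesis using snoc by (simp add: node_depths_snoc nth_append)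
  qed
qed simp

lemma node_depths_input: "u < n \<Longrightarrow> node_depths n C ! u = 0"
  by (induction C rule: rev_induct) (simp_all add: node_depths_snoc nth_append)

text \<open>Comparison with a threshold turns the maximum in the depth of a gate into a condition on
  single wires, which a scan of the code can test.\<close>

lemma node_depths_gate:
  assumes "i < length C" "C ! i = (ty, ws)" "\<And>w. w \<in> set ws \<Longrightarrow> w < n + i"
  shows "node_depths n C ! (n + i) \<le> Suc t \<longleftrightarrow> (\<forall>w\<in>set ws. node_depths n C ! w \<le> t)"
    "0 < node_depths n C ! (n + i)"
proof -
  have "node_depths n C ! (n + i) = node_depths n (take (Suc i) C) ! (n + i)"
  proof (cases "Suc i < length C")
    case True
    then show ?thesis by (rule node_depths_prefix) simp
  qed (use assms(1) in simp)
  also have "take (Suc i) C = take i C @ [(ty, ws)]"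
    using assms by (simp add: take_Suc_conv_app_nth)
  also have "node_depths n \<dots> ! (n + i) = Suc (Max (insert 0 ((!) (node_depths n (take i C)) ` set ws)))"
    using assms(1) by (simp add: node_depths_snoc nth_append)
  also have "(!) (node_depths n (take i C)) ` set ws = (!) (node_depths n C) ` set ws"
    using assms by (intro image_cong) (simp_all add: node_depths_prefix)
  finally have *: "node_depths n C ! (n + i) = Suc (Max (insert 0 ((!) (node_depths n C) ` set ws)))" .
  show "node_depths n C ! (n + i) \<le> Suc t \<longleftrightarrow> (\<forall>w\<in>set ws. node_depths n C ! w \<le> t)"
    "0 < node_depths n C ! (n + i)"
    unfolding * by auto
qed

lemma circuit_depth_le_iff:
  assumes "C \<noteq> []"
  shows "circuit_depth n C \<le> d \<longleftrightarrow> (\<forall>u < n + length C. node_depths n C ! u \<le> d)"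
proof -
  have "set (node_depths n C) \<noteq> {}" using assms by (auto simp: set_conv_nth)
  then show ?thesis unfolding circuit_depth_def by (auto simp: set_conv_nth)
qed

lemma circuit_eval_nth: "C \<noteq> [] \<Longrightarrow> circuit_eval m C x = node_values m C x ! (length x + length C - 1)"
  unfolding circuit_eval_def by (subst last_conv_nth) (auto simp flip: length_greater_0_conv)


subsection \<open>Conditions on a single gate\<close>

text \<open>For a NOT gate \<open>p + n = 1\<close> enforces in addition the single wire that
  \<open>wf_circuit\<close> demands.\<close>

fun eval_rule :: "nat \<Rightarrow> gate_type \<Rightarrow> nat \<Rightarrow> nat \<Rightarrow> symbol \<Rightarrow> bool" where
  "eval_rule m Not_Gate p n s \<longleftrightarrow> p + n = 1 \<and> s = Bit (p = 0)"
| "eval_rule m And_Gate p n s \<longleftrightarrow> s = Bit (n = 0)"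
| "eval_rule m Or_Gate p n s \<longleftrightarrow> s = Bit (0 < p)"
| "eval_rule m Mod_Gate p n s \<longleftrightarrow> s = Bit (m dvd p)"

text \<open>Marks may be omitted freely: soundness asks only that marked gates have small depth, and
  the last row will insist on all marks.\<close>

definition layer_rule :: "gate_type \<Rightarrow> nat \<Rightarrow> nat \<Rightarrow> symbol \<Rightarrow> bool" where
  "layer_rule ty p n s \<longleftrightarrow> s = Bit False \<or> s = Bit True \<and> n = 0"

definition const_rule :: "bool \<Rightarrow> gate_type \<Rightarrow> nat \<Rightarrow> nat \<Rightarrow> symbol \<Rightarrow> bool" where
  "const_rule b ty p n s \<longleftrightarrow> s = Bit b"

lemma eval_rule_iff:
  "eval_rule m ty (length (filter f ws)) (length (filter (\<lambda>w. \<not> f w) ws)) s \<longleftrightarrow>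
    (ty = Not_Gate \<longrightarrow> length ws = 1) \<and> s = Bit (gate_value m ty (map f ws))"
proof (cases ty)
  case Not_Gate
  have len: "length (filter f ws) + length (filter (\<lambda>w. \<not> f w) ws) = length ws"
    by (rule sum_length_filter_compl)
  show ?thesis
  proof (cases "length ws = 1")
    case True
    then obtain w where "ws = [w]" by (auto simp: length_Suc_conv)
    then show ?thesis using Not_Gate by auto
  qed (use Not_Gate len in simp)
next
  case Mod_Gate
  have "filter (\<lambda>b. b) (map f ws) = map f (filter f ws)" by (induction ws) auto
  then show ?thesis using Mod_Gate by simp
qed (auto simp: filter_empty_conv)

primrec lefts :: "nat \<Rightarrow> nat \<Rightarrow> check" where
  "lefts i 0 = skip"
| "lefts i (Suc m) = left i ;; lefts i m"

text \<open>\<open>test 0 {}\<close> never succeeds and is thus the neutral element of the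
  alternative.\<close>

definition any_of :: "check list \<Rightarrow> check" where
  "any_of Ps = foldr (\<squnion>) Ps (test 0 {})"

lemma any_of_iff: "any_of Ps T h h' \<longleftrightarrow> (\<exists>P\<in>set Ps. P T h h')"
  by (induction Ps) (auto simp: any_of_def test_def)

lemma lefts_iff: "lefts i m T h h' \<longleftrightarrow> m \<le> h i \<and> h' = h(i := h i - m)"
proof (induction m arbitrary: h)
  case 0
  then show ?case by (simp add: skip_def)
next
  case (Suc m)
  show ?case by (auto simp: Suc)
qed

lemma realizable_lefts [realizable_intros]: "realizable (lefts i m)"
  by (induction m) (simp_all only: lefts.simps realizable.intros)

lemma realizable_any_of [realizable_intros]:
  "(\<And>P. P \<in> set Ps \<Longrightarrow> realizable P) \<Longrightarrow> realizable (any_of Ps)"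
  by (induction Ps) (auto intro: realizable.intros simp: any_of_def)

definition clear :: check where
  "clear = home Ph ;; home Nh"

text \<open>The modulus is a constant, so a residue can be found by repeated subtraction and a case
  distinction. A false MOD gate needs a positive proof that \<open>m\<close> does not divide the
  count: a remainder between 1 and \<open>m - 1\<close>.\<close>

fun eval_chk :: "nat \<Rightarrow> gate_type \<Rightarrow> check" where
  "eval_chk m Not_Gate = (test Vh {Bit True} ;; leftmost Ph ;; left Nh ;; leftmost Nh \<squnion>
     test Vh {Bit False} ;; left Ph ;; leftmost Ph ;; leftmost Nh) ;; clear"
| "eval_chk m And_Gate = (test Vh {Bit True} ;; leftmost Nh \<squnion> test Vh {Bit False} ;; left Nh) ;; clear"
| "eval_chk m Or_Gate = (test Vh {Bit True} ;; left Ph \<squnion> test Vh {Bit False} ;; leftmost Ph) ;; clear"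
| "eval_chk m Mod_Gate = star (lefts Ph m) ;; (test Vh {Bit True} ;; leftmost Ph \<squnion>
     test Vh {Bit False} ;; any_of (map (\<lambda>r. lefts Ph r ;; leftmost Ph) [1..<m])) ;; clear"

definition layer_chk :: "gate_type \<Rightarrow> check" where
  "layer_chk ty = (test Vh {Bit False} \<squnion> test Vh {Bit True} ;; leftmost Nh) ;; clear"

definition const_chk :: "bool \<Rightarrow> gate_type \<Rightarrow> check" where
  "const_chk b ty = test Vh {Bit b} ;; clear"

lemma realizable_chk [realizable_intros]:
  "realizable (eval_chk m ty)" "realizable (layer_chk ty)" "realizable (const_chk b ty)"
  unfolding clear_def layer_chk_def const_chk_def
  by (cases ty; auto intro!: realizable_intros simp: clear_def)+

context headed_track
begin

lemma clear_iff: "clear T h h' \<longleftrightarrow> h' = h(Ph := 0, Nh := 0)"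
  by (simp add: clear_def seq_iff home_iff)

lemma layer_chk_spec: "chk_spec layer_chk layer_rule"
  unfolding chk_spec_def layer_chk_def layer_rule_def by (auto simp: clear_iff)

lemma const_chk_spec: "chk_spec (const_chk b) (const_rule b)"
  unfolding chk_spec_def const_chk_def const_rule_def by (auto simp: clear_iff)

lemma eval_chk_spec:
  assumes "0 < m"
  shows "chk_spec (eval_chk m) (eval_rule m)"
  unfolding chk_spec_def
proof (intro allI impI)
  fix ty h h'
  assume h: "inside h" "h Ah = 0"
  have upd: "h(Ph := x, Ph := y, Nh := z) = h(Ph := y, Nh := z)" "h(Nh := x, Ph := y, Nh := z) = h(Ph := y, Nh := z)" for x y z
    by (simp_all add: fun_eq_iff)
  show "eval_chk m ty T h h' \<longleftrightarrow> eval_rule m ty (h Ph) (h Nh) (T ! h Vh) \<and> h' = h(Ph := 0, Nh := 0)"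
  proof (cases ty)
    case Not_Gate
    then show ?thesis using h by (auto simp: clear_iff upd)
  next
    case And_Gate
    then show ?thesis using h by (auto simp: clear_iff upd)
  next
    case Or_Gate
    then show ?thesis using h by (auto simp: clear_iff upd)
  next
    case Mod_Gate
    have loop: "star (lefts Ph m) T h g \<longleftrightarrow>
        (\<exists>n. (\<forall>l<n. l * m + m \<le> h Ph) \<and> g = h(Ph := h Ph - n * m))" for g
    proof (rule star_family)
      fix l g assume "\<And>k. k < l \<Longrightarrow> k * m + m \<le> h Ph"
      from this[of "l - 1"] have "l * m \<le> h Ph" by (cases l) (auto simp: add.commute)
      then have "m \<le> h Ph - l * m \<longleftrightarrow> l * m + m \<le> h Ph" by linarith
      then show "lefts Ph m T (h(Ph := h Ph - l * m)) g \<longleftrightarrow> l * m + m \<le> h Ph \<and> g = h(Ph := h Ph - Suc l * m)"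
        by (simp add: lefts_iff add.commute)
    qed (simp add: fun_eq_iff)
    have tail: "((test Vh {Bit True} ;; leftmost Ph \<squnion>
        test Vh {Bit False} ;; any_of (map (\<lambda>r. lefts Ph r ;; leftmost Ph) [1..<m])) ;; clear) T
          (h(Ph := p)) h' \<longleftrightarrow>
        (T ! h Vh = Bit True \<and> p = 0 \<or> T ! h Vh = Bit False \<and> 0 < p \<and> p < m) \<and> h' = h(Ph := 0, Nh := 0)" for p
    proof -
      have "(any_of (map (\<lambda>r. lefts Ph r ;; leftmost Ph) [1..<m])) T (h(Ph := p)) g \<longleftrightarrow>
          0 < p \<and> p < m \<and> g = h(Ph := 0)" for g
        by (auto simp: any_of_iff seq_iff[of "lefts i r" for i r] lefts_iff)
      then show ?thesis using h
        by (auto simp: clear_iff upd seq_iff[of "any_of Ps" for Ps])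
    qed
    have "eval_chk m ty T h h' \<longleftrightarrow> (\<exists>n. (\<forall>l<n. l * m + m \<le> h Ph) \<and>
        (T ! h Vh = Bit True \<and> h Ph - n * m = 0 \<or> T ! h Vh = Bit False \<and> 0 < h Ph - n * m \<and> h Ph - n * m < m) \<and>
        h' = h(Ph := 0, Nh := 0))"
      unfolding Mod_Gate eval_chk.simps seq_iff[of "star P" for P] loop ex_family tail by blast
    also have "\<dots> \<longleftrightarrow> T ! h Vh = Bit (m dvd h Ph) \<and> h' = h(Ph := 0, Nh := 0)"
    proof -
      have n: "n * m \<le> h Ph" if "\<forall>l<n. l * m + m \<le> h Ph" for n
        using that by (cases n) (auto simp: add.commute)
      have m: "(h Ph div m) * m \<le> h Ph" by simp
      have d: "\<forall>l < h Ph div m. l * m + m \<le> h Ph"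
      proof (intro allI impI)
        fix l assume "l < h Ph div m"
        then have "Suc l * m \<le> h Ph div m * m" by (intro mult_le_mono1) simp
        from le_trans[OF this m] show "l * m + m \<le> h Ph" by (simp add: add.commute)
      qed
      have rest: "h Ph - (h Ph div m) * m = h Ph mod m" by (simp add: minus_div_mult_eq_mod)
      have 1: "m dvd h Ph" if "n * m \<le> h Ph" "h Ph - n * m = 0" for n
        using that by (metis diff_is_0_eq dvd_triv_right le_antisym)
      have 2: "\<not> m dvd h Ph" if "n * m \<le> h Ph" "0 < h Ph - n * m" "h Ph - n * m < m" for n
      proof
        assume "m dvd h Ph"
        then have "m dvd h Ph - n * m" by (simp add: dvd_diff_nat)
        with that show False by (auto dest: dvd_imp_le)
      qed
      show ?thesis
      proof (intro iffI; (elim exE conjE)?)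
        fix n assume a: "\<forall>l<n. l * m + m \<le> h Ph" "h' = h(Ph := 0, Nh := 0)"
          "T ! h Vh = Bit True \<and> h Ph - n * m = 0 \<or> T ! h Vh = Bit False \<and> 0 < h Ph - n * m \<and> h Ph - n * m < m"
        then show "T ! h Vh = Bit (m dvd h Ph) \<and> h' = h(Ph := 0, Nh := 0)"
          using 1[OF n[OF a(1)]] 2[OF n[OF a(1)]] by auto
      next
        assume a: "T ! h Vh = Bit (m dvd h Ph)" "h' = h(Ph := 0, Nh := 0)"
        show "\<exists>n. (\<forall>l<n. l * m + m \<le> h Ph) \<and>
        (T ! h Vh = Bit True \<and> h Ph - n * m = 0 \<or> T ! h Vh = Bit False \<and> 0 < h Ph - n * m \<and> h Ph - n * m < m) \<and>
        h' = h(Ph := 0, Nh := 0)"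
          using a d rest assms by (intro exI[of _ "h Ph div m"]) (auto simp: dvd_eq_mod_eq_0)
      qed
    qed
    finally show ?thesis unfolding Mod_Gate by simp
  qed
qed

abbreviation code :: "circuit \<Rightarrow> symbol list" where
  "code C \<equiv> map Bit (encode_circuit C) @ [STOP]"

text \<open>\<open>STOP\<close> is not a bit, so two delimited words at the same place have to end
  together.\<close>

lemma bits_unique:
  assumes "occurs T p (map Bit u @ [STOP])" "occurs T p (map Bit v @ [STOP])"
  shows "u = v"
proof -
  have nth: "T ! (p + i) = Bit (u ! i)" if "i < length u" "occurs T p (map Bit u @ [STOP])" for i u
    using that by (simp add: occurs_snoc) (simp add: occurs_def)
  have stop: "T ! (p + length u) = STOP" if "occurs T p (map Bit u @ [STOP])" for u
    using that by (simp add: occurs_snoc)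
  have len: "length u = length v"
    using nth[of "length u" v] nth[of "length v" u] stop[of u] stop[of v] assms
    by (metis linorder_neqE_nat symbol.distinct(5))
  then show ?thesis
  proof (rule nth_equalityI)
    fix i assume "i < length u"
    then have "Bit (u ! i) = Bit (v ! i)" using nth[of i u] nth[of i v] assms len by simp
    then show "u ! i = v ! i" by simp
  qed
qed

lemma code_unique: "occurs T p (code C) \<Longrightarrow> occurs T p (code D) \<Longrightarrow> C = D"
  using bits_unique[of p "encode_circuit C" "encode_circuit D"] inj_encode_circuit by (auto dest: injD)

text \<open>Each pass guesses its circuit anew. By unique readability of the code it is always the
  same one, so the existential quantifier of \<open>gates_iff\<close> disappears.\<close>

lemma gates_code_iff:
  assumes "idle h" "chk_spec chk \<Phi>" "h Jh = 0" "h Eh = 0" "C \<noteq> []" "occurs T (h Ch) (code C)"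
  shows "gates ordered chk T h h' \<longleftrightarrow>
    circuit_ok \<Phi> ordered (h Bh) (h Vh + j) C \<and> h' = h(Vh := h Vh + j + length C)"
  unfolding gates_iff[OF assms(1-4)] using code_unique assms(5,6) by blast

text \<open>In topological order every cell is determined by earlier ones, so the only row that
  passes is the list of node values. A passing row also proves the code well-formed; this is how
  well-formedness gets into the verification.\<close>

lemma circuit_ok_eval_iff:
  assumes "C \<noteq> []" "length x = j" "occurs T (Suc b) (map Bit x)"
  shows "circuit_ok (eval_rule m) True b (Suc b + j) C \<longleftrightarrow>
    wf_circuit j C \<and> occurs T (Suc b) (map Bit (node_values m C x))"
proof -
  let ?v = "node_values m C x"
  have gate: "gate_ok (eval_rule m) True b (Suc b + j + i) (ty, ws) \<longleftrightarrow>
      (\<forall>w\<in>set ws. w < j + i) \<and> (ty = Not_Gate \<longrightarrow> length ws = 1) \<and> T ! (Suc b + j + i) = Bit (?v ! (j + i))"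
    if i: "i < length C" "C ! i = (ty, ws)" and "Suc b + j + i < length T"
      and v: "\<And>u. u < j + i \<Longrightarrow> T ! (Suc b + u) = Bit (?v ! u)" for i ty ws
  proof -
    have wires: "wire_ok True b (Suc b + j + i) w \<longleftrightarrow> w < j + i" for w
      using v[of w] that(3) by (auto simp: wire_ok_def)
    show ?thesis
    proof (cases "\<forall>w\<in>set ws. w < j + i")
      case True
      then have f: "filter (\<lambda>w. T ! (b + w + 1) = Bit True) ws = filter ((!) ?v) ws"
        "filter (\<lambda>w. T ! (b + w + 1) = Bit False) ws = filter (\<lambda>w. \<not> ?v ! w) ws"
        using v by (auto intro!: filter_cong)
      have "?v ! (j + i) = gate_value m ty (map ((!) ?v) ws)"
        using node_values_gate[of i C ty ws x m] i True assms(2) by simp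
      then show ?thesis using True
        unfolding gate_ok.simps count_def f eval_rule_iff wires by simp
    qed (use wires in \<open>auto simp del: eval_rule.simps\<close>)
  qed
  have input: "T ! (Suc b + u) = Bit (?v ! u)" if "u < j" for u
    using that assms(2,3) by (simp add: node_values_input occurs_def)
  show ?thesis
  proof (intro iffI conjI)
    assume ok: "circuit_ok (eval_rule m) True b (Suc b + j) C"
    have v: "T ! (Suc b + u) = Bit (?v ! u)" if "u < j + length C" for u
      using that
    \<comment> \<open>Strong induction, because the wires of a gate may lead to any of the earlier
      cells.\<close>
    proof (induction u rule: less_induct)
      case (less u)
      show ?case
      proof (cases "u < j")
        case False
        then obtain i where i: "u = j + i" "i < length C" using less.prems by (metis add_less_cancel_left le_Suc_ex not_less)
        obtain ty ws where g: "C ! i = (ty, ws)" by fastforce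
        then show ?thesis using gate[OF i(2) g] less i ok by (auto simp: circuit_ok_def add.assoc simp del: gate_ok.simps)
      qed (rule input)
    qed
    then show "occurs T (Suc b) (map Bit ?v)"
      using ok assms(2) by (auto simp: occurs_def circuit_ok_def)
    have "(\<forall>w\<in>set (snd (C ! i)). w < j + i) \<and> (fst (C ! i) = Not_Gate \<longrightarrow> length (snd (C ! i)) = 1)"
      if "i < length C" for i
    proof -
      obtain ty ws where g: "C ! i = (ty, ws)" by fastforce
      then show ?thesis using gate[OF that g] v that ok by (auto simp: circuit_ok_def add.assoc simp del: gate_ok.simps)
    qed
    then show "wf_circuit j C" using assms(1) by (simp add: wf_circuit_def)
  next
    assume a: "wf_circuit j C \<and> occurs T (Suc b) (map Bit ?v)"
    then have v: "T ! (Suc b + u) = Bit (?v ! u)" if "u < j + length C" for u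
      using that assms(2) by (auto simp: occurs_def)
    show "circuit_ok (eval_rule m) True b (Suc b + j) C" unfolding circuit_ok_def
    proof (intro conjI allI impI)
      show "Suc b + j + length C < length T" using a assms(2) by (auto dest: occurs_less)
      fix i assume i: "i < length C"
      obtain ty ws where g: "C ! i = (ty, ws)" by fastforce
      show "gate_ok (eval_rule m) True b (Suc b + j + i) (C ! i)"
        unfolding g using gate[OF i g] v[of "j + i"] v i a g \<open>Suc b + j + length C < length T\<close>
        by (auto simp: wf_circuit_def add.assoc simp del: gate_ok.simps)
    qed
  qed
qed

end


subsection \<open>Checking the depth of a circuit\<close>

lemma wf_circuit_wire:
  assumes "wf_circuit n C" "i < length C" "C ! i = (ty, ws)" "w \<in> set ws"
  shows "w < n + i"
proof -
  have "\<forall>w \<in> set (snd (C ! i)). w < n + i" using assms(1,2) unfolding wf_circuit_def by blast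
  then show ?thesis using assms(3,4) by simp
qed

text \<open>
  Row \<open>t\<close> marks nodes of depth at most \<open>t\<close>: a gate may be marked in row \<open>t + 1\<close> only if all
  its wires are marked in row \<open>t\<close>, and the last row marks every gate.
\<close>

definition layer_step :: check where
  "layer_step = test Dh {Bit False} ;; right Dh ;; test Vh {MARK} ;; copy Qh Vh ;; right Vh ;;
     gates False layer_chk ;; copy Bh Qh ;; home Qh"

definition find_code :: check where
  "find_code = copy Ch Dh ;; star (test Ch {Bit False} ;; right Ch) ;; test Ch {Bit True} ;; right Ch"

text \<open>Row 0 has no marked gate, each later row consumes one zero of the depth bound, and the
  last row is scanned a second time to see that all its gates are marked.\<close>

definition depth_chk :: check where
  "depth_chk = find_code ;; test Vh {MARK} ;; copy Bh Vh ;; right Vh ;; gates False (const_chk False) ;;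
     star layer_step ;; test Dh {Bit True} ;; copy Vh Bh ;; right Vh ;; gates False (const_chk True)"

lemma realizable_depth_chk [realizable_intros]: "realizable depth_chk"
  unfolding depth_chk_def layer_step_def find_code_def by (intro realizable_intros)

definition layer_row :: "nat \<Rightarrow> circuit \<Rightarrow> nat \<Rightarrow> symbol list" where
  "layer_row j C t = MARK # map (\<lambda>u. Bit (node_depths j C ! u \<le> t)) [0..<j + length C]"

context headed_track
begin

text \<open>The state of rest between checks: scratch heads are at the left end, while the pointers
  that carry information from one check to the next are anywhere on the track.\<close>

definition ready :: "heads \<Rightarrow> bool" where
  "ready h \<longleftrightarrow> idle h \<and> h Jh = 0 \<and> h Eh = 0 \<and> h Qh = 0 \<and> h Zh = 0 \<and> h Yh = 0 \<and> h Sh = 0 \<and> h Rh = 0"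

lemma readyD:
  assumes "ready h"
  shows "idle h" "inside h" "h Ah = 0" "h Jh = 0" "h Eh = 0" "h Qh = 0" "h Zh = 0" "h Yh = 0"
    "h Sh = 0" "h Rh = 0" "h Wh = 0" "h Ph = 0" "h Nh = 0"
  using assms by (simp_all add: ready_def idle_def)

lemma find_code_iff:
  assumes "ready h"
  shows "find_code T h h' \<longleftrightarrow> (\<exists>d. occurs T (h Dh) (map Bit (replicate d False @ [True])) \<and>
    h' = h(Ch := h Dh + d + 1))"
proof -
  note h = readyD[OF assms]
  have loop: "star (test Ch {Bit False} ;; right Ch) T (h(Ch := h Dh)) g \<longleftrightarrow>
    (\<exists>d. (\<forall>i<d. T ! (h Dh + i) = Bit False \<and> Suc (h Dh + i) < length T) \<and> g = h(Ch := h Dh + d))" for g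
  proof (rule star_family)
    fix m g
    assume "\<And>l. l < m \<Longrightarrow> T ! (h Dh + l) = Bit False \<and> Suc (h Dh + l) < length T"
    from this[of "m - 1"] have "h Dh + m < length T" using h by (cases m) auto
    then show "(test Ch {Bit False} ;; right Ch) T (h(Ch := h Dh + m)) g \<longleftrightarrow>
      (T ! (h Dh + m) = Bit False \<and> Suc (h Dh + m) < length T) \<and> g = h(Ch := h Dh + Suc m)"
      by (simp add: right_def)
  qed simp
  have "find_code T h h' \<longleftrightarrow> (\<exists>d. (\<forall>i<d. T ! (h Dh + i) = Bit False \<and> Suc (h Dh + i) < length T) \<and>
     h Dh + d < length T \<and> T ! (h Dh + d) = Bit True \<and> Suc (h Dh + d) < length T \<and> h' = h(Ch := Suc (h Dh + d)))"
    using h by (simp add: find_code_def seq_iff[of "copy i k" for i k] seq_iff[of "star P" for P] copy_iff loop right_def)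
  also have "\<dots> \<longleftrightarrow> (\<exists>d. occurs T (h Dh) (map Bit (replicate d False @ [True])) \<and> h' = h(Ch := h Dh + d + 1))"
    by (intro ex_cong1) (auto simp: occurs_snoc occurs_replicate)
  finally show ?thesis .
qed

text \<open>Row \<open>t\<close> begins with its marker at \<open>b + t * L\<close>. The wires of
  row \<open>Suc t\<close> are resolved in row \<open>t\<close>, those of the two constant
  conditions in the row itself.\<close>

definition layers_ok :: "nat \<Rightarrow> nat \<Rightarrow> circuit \<Rightarrow> bool" where
  "layers_ok b d C \<longleftrightarrow> (let L = Suc j + length C in
     T ! b = MARK \<and> circuit_ok (const_rule False) False b (b + Suc j) C \<and>
     (\<forall>t<d. T ! (b + Suc t * L) = MARK \<and>
        circuit_ok layer_rule False (b + t * L) (b + Suc t * L + Suc j) C) \<and>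
     circuit_ok (const_rule True) False (b + d * L) (b + d * L + Suc j) C)"

lemma layer_step_iff:
  assumes "ready h" "C \<noteq> []" "occurs T (h Ch) (code C)"
  shows "layer_step T h h' \<longleftrightarrow> T ! h Dh = Bit False \<and> Suc (h Dh) < length T \<and> T ! h Vh = MARK \<and>
    circuit_ok layer_rule False (h Bh) (h Vh + Suc j) C \<and>
    h' = h(Dh := Suc (h Dh), Bh := h Vh, Vh := h Vh + (Suc j + length C))"
proof -
  note h = readyD[OF assms(1)]
  define g where "g = h(Dh := Suc (h Dh), Qh := h Vh, Vh := Suc (h Vh))"
  have gates: "gates False layer_chk T g g' \<longleftrightarrow> circuit_ok layer_rule False (h Bh) (h Vh + Suc j) C \<and>
      g' = g(Vh := h Vh + (Suc j + length C))" if "Suc (h Dh) < length T" "Suc (h Vh) < length T" for g'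
  proof -
    have "idle g" using h(1) that by (simp add: g_def idle_def)
    then show ?thesis
      using gates_code_iff[OF _ layer_chk_spec, of g C False g'] h assms(2,3) by (simp add: g_def add.assoc)
  qed
  have "layer_step T h h' \<longleftrightarrow> T ! h Dh = Bit False \<and> Suc (h Dh) < length T \<and> T ! h Vh = MARK \<and>
     Suc (h Vh) < length T \<and> (gates False layer_chk ;; copy Bh Qh ;; home Qh) T g h'"
    using h by (simp add: layer_step_def seq_iff[of "copy i k" for i k] copy_iff g_def)
  also have "\<dots> \<longleftrightarrow> T ! h Dh = Bit False \<and> Suc (h Dh) < length T \<and> T ! h Vh = MARK \<and> Suc (h Vh) < length T \<and>
     circuit_ok layer_rule False (h Bh) (h Vh + Suc j) C \<and>
     (copy Bh Qh ;; home Qh) T (g(Vh := h Vh + (Suc j + length C))) h'"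
    unfolding seq_iff[of "gates r P" for r P] using gates by auto
  also have "\<dots> \<longleftrightarrow> T ! h Dh = Bit False \<and> Suc (h Dh) < length T \<and> T ! h Vh = MARK \<and> Suc (h Vh) < length T \<and>
     circuit_ok layer_rule False (h Bh) (h Vh + Suc j) C \<and>
     h' = h(Dh := Suc (h Dh), Bh := h Vh, Vh := h Vh + (Suc j + length C))"
  proof -
    have "(g(Vh := x))(Bh := h Vh, Qh := 0) = h(Dh := Suc (h Dh), Bh := h Vh, Vh := x)" for x
      using h by (simp add: g_def fun_eq_iff)
    moreover have "(g(Vh := x)) Ah = 0" "(g(Vh := x)) Qh = h Vh" for x using h by (simp_all add: g_def)
    ultimately show ?thesis using h by (simp add: seq_iff[of "copy i k" for i k] copy_iff home_iff)
  qed
  finally show ?thesis by (auto simp: circuit_ok_def)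
qed

lemma depth_chk_iff:
  assumes "ready h"
  shows "depth_chk T h h' \<longleftrightarrow> (\<exists>d C. C \<noteq> [] \<and>
    occurs T (h Dh) (map Bit (replicate d False @ [True]) @ code C) \<and> layers_ok (h Vh) d C \<and>
    h' = h(Ch := h Dh + d + 1, Dh := h Dh + d, Bh := h Vh + d * (Suc j + length C),
      Vh := h Vh + Suc d * (Suc j + length C)))"
proof -
  note h = readyD[OF assms]
  define b where "b = h Vh"
  define g where "g c = h(Ch := c, Bh := b, Vh := Suc b)" for c
  define F where "F c L t = h(Ch := c, Dh := h Dh + t, Bh := b + t * L, Vh := b + Suc t * L)" for c L t
  define tail where "tail = star layer_step ;; test Dh {Bit True} ;; copy Vh Bh ;; right Vh ;; gates False (const_chk True)"
  have Lpos: "Suc b < length T" if "circuit_ok \<Phi> r x (b + Suc j) C" for \<Phi> r x C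
    using that by (simp add: circuit_ok_def)
  have "depth_chk T h h' \<longleftrightarrow> (\<exists>d. occurs T (h Dh) (map Bit (replicate d False @ [True])) \<and>
    T ! b = MARK \<and> Suc b < length T \<and> (gates False (const_chk False) ;; tail) T (g (h Dh + d + 1)) h')"
  proof -
    have "(test Vh {MARK} ;; copy Bh Vh ;; right Vh ;; P) T (h(Ch := c)) h' \<longleftrightarrow>
      T ! b = MARK \<and> Suc b < length T \<and> P T (g c) h'" for c P
      using h by (auto simp: seq_iff[of "copy i k" for i k] copy_iff g_def b_def)
    then have "(test Vh {MARK} ;; copy Bh Vh ;; right Vh ;; gates False (const_chk False) ;; tail) T (h(Ch := c)) h' \<longleftrightarrow>
      T ! b = MARK \<and> Suc b < length T \<and> (gates False (const_chk False) ;; tail) T (g c) h'" for c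
      by blast
    moreover have "depth_chk T h h' \<longleftrightarrow> (\<exists>d. occurs T (h Dh) (map Bit (replicate d False @ [True])) \<and>
      (test Vh {MARK} ;; copy Bh Vh ;; right Vh ;; gates False (const_chk False) ;; tail) T (h(Ch := h Dh + d + 1)) h')"
      unfolding depth_chk_def tail_def seq_iff[of find_code] find_code_iff[OF assms] by blast
    ultimately show ?thesis by simp
  qed
  also have "\<dots> \<longleftrightarrow> (\<exists>d C. occurs T (h Dh) (map Bit (replicate d False @ [True])) \<and>
    T ! b = MARK \<and> C \<noteq> [] \<and> occurs T (h Dh + d + 1) (code C) \<and> circuit_ok (const_rule False) False b (b + Suc j) C \<and>
    tail T (F (h Dh + d + 1) (Suc j + length C) 0) h')"
  proof (intro ex_cong1)
    fix d
    define c where "c = h Dh + d + 1"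
    have step: "(gates False (const_chk False) ;; tail) T (g c) h' \<longleftrightarrow> (\<exists>C. C \<noteq> [] \<and> occurs T c (code C) \<and>
        circuit_ok (const_rule False) False b (b + Suc j) C \<and> tail T (F c (Suc j + length C) 0) h')"
      if "Suc b < length T" "c < length T"
    proof -
      have "idle (g c)" using h(1) that by (simp add: g_def idle_def b_def)
      have F: "(g c)(Vh := b + Suc j + length C) = F c (Suc j + length C) 0" for C :: circuit
        by (simp add: g_def F_def fun_eq_iff)
      have g: "g c Jh = 0" "g c Eh = 0" "g c Ch = c" "g c Bh = b" "g c Vh + j = b + Suc j" using h by (simp_all add: g_def)
      have "gates False (const_chk False) T (g c) g' \<longleftrightarrow> (\<exists>C. C \<noteq> [] \<and> occurs T c (code C) \<and>
        circuit_ok (const_rule False) False b (b + Suc j) C \<and> g' = F c (Suc j + length C) 0)" for g'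
        using gates_iff[OF \<open>idle (g c)\<close> const_chk_spec g(1,2), of False False g'] unfolding g(3-5) F .
      then show ?thesis unfolding seq_iff[of "gates r P" for r P] by (simp only:) blast
    qed
    have c: "c < length T" if "occurs T (h Dh) (map Bit (replicate d False @ [True]))"
      using occurs_less[OF that] by (simp add: c_def)
    show "(occurs T (h Dh) (map Bit (replicate d False @ [True])) \<and>
      T ! b = MARK \<and> Suc b < length T \<and> (gates False (const_chk False) ;; tail) T (g (h Dh + d + 1)) h') \<longleftrightarrow>
      (\<exists>C. occurs T (h Dh) (map Bit (replicate d False @ [True])) \<and>
      T ! b = MARK \<and> C \<noteq> [] \<and> occurs T (h Dh + d + 1) (code C) \<and> circuit_ok (const_rule False) False b (b + Suc j) C \<and>
      tail T (F (h Dh + d + 1) (Suc j + length C) 0) h')"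
      unfolding c_def[symmetric]
    proof (intro iffI; elim exE conjE)
      assume a: "occurs T (h Dh) (map Bit (replicate d False @ [True]))" "T ! b = MARK" "Suc b < length T"
        "(gates False (const_chk False) ;; tail) T (g c) h'"
      from step[OF a(3) c[OF a(1)]] a(4) obtain C where "C \<noteq> []" "occurs T c (code C)"
        "circuit_ok (const_rule False) False b (b + Suc j) C" "tail T (F c (Suc j + length C) 0) h'"
        by (blast dest: iffD1)
      with a(1,2) show "\<exists>C. occurs T (h Dh) (map Bit (replicate d False @ [True])) \<and> T ! b = MARK \<and> C \<noteq> [] \<and>
        occurs T c (code C) \<and> circuit_ok (const_rule False) False b (b + Suc j) C \<and>
        tail T (F c (Suc j + length C) 0) h'" by (intro exI[of _ C] conjI)
    next
      fix C
      assume a: "occurs T (h Dh) (map Bit (replicate d False @ [True]))" "T ! b = MARK" "C \<noteq> []"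
        "occurs T c (code C)" "circuit_ok (const_rule False) False b (b + Suc j) C"
        "tail T (F c (Suc j + length C) 0) h'"
      note Lpos[OF a(5)]
      moreover from step[OF this c[OF a(1)]] have "(gates False (const_chk False) ;; tail) T (g c) h'"
        by (rule iffD2) (intro exI[of _ C] conjI a)
      ultimately show "occurs T (h Dh) (map Bit (replicate d False @ [True])) \<and> T ! b = MARK \<and> Suc b < length T \<and>
        (gates False (const_chk False) ;; tail) T (g c) h'" using a(1,2) by (intro conjI)
    qed
  qed
  also have "\<dots> \<longleftrightarrow> (\<exists>d C. C \<noteq> [] \<and>
    occurs T (h Dh) (map Bit (replicate d False @ [True]) @ code C) \<and> layers_ok b d C \<and>
    h' = F (h Dh + d + 1) (Suc j + length C) d)"
  proof (intro ex_cong1)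
    fix d and C :: circuit
    define c where "c = h Dh + d + 1"
    define L where "L = Suc j + length C"
    have occ: "occurs T (h Dh) (map Bit (replicate d False @ [True]) @ code C) \<longleftrightarrow>
      occurs T (h Dh) (map Bit (replicate d False @ [True])) \<and> occurs T c (code C)"
      by (subst occurs_append) (simp add: c_def del: map_append)
    have tail: "tail T (F c L 0) h' \<longleftrightarrow> (\<forall>t<d. T ! (b + Suc t * L) = MARK \<and>
        circuit_ok layer_rule False (b + t * L) (b + Suc t * L + Suc j) C) \<and>
        circuit_ok (const_rule True) False (b + d * L) (b + d * L + Suc j) C \<and> h' = F c L d"
      if occ1: "occurs T (h Dh) (map Bit (replicate d False @ [True]))" and C: "C \<noteq> []" "occurs T c (code C)"
        and first: "circuit_ok (const_rule False) False b (b + Suc j) C"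
    proof -
      have c: "c < length T" and zeros: "\<And>i. i < d \<Longrightarrow> T ! (h Dh + i) = Bit False"
        and one: "T ! (h Dh + d) = Bit True" and D: "Suc (h Dh + d) < length T"
        using occ1 C(2) occurs_less[of T c] by (auto simp: occurs_snoc occurs_replicate)
      have L0: "b + L < length T" using first by (simp add: circuit_ok_def L_def)
      let ?c = "\<lambda>t. T ! (h Dh + t) = Bit False \<and> Suc (h Dh + t) < length T \<and> T ! (b + Suc t * L) = MARK \<and>
        circuit_ok layer_rule False (b + t * L) (b + Suc t * L + Suc j) C"
      have Fready: "ready (F c L m)" if "m \<le> d" "b + Suc m * L < length T" for m
      proof -
        have "b + m * L < length T" using that(2) by simp
        then show ?thesis using assms that c D by (simp add: ready_def idle_def F_def)
      qed
      have bound: "b + Suc m * L < length T" if "\<And>l. l < m \<Longrightarrow>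
        circuit_ok layer_rule False (b + l * L) (b + Suc l * L + Suc j) C" for m
      proof (cases m)
        case (Suc l)
        then show ?thesis using that[of l] by (simp add: circuit_ok_def L_def)
      qed (use L0 in simp)
      have loop: "star layer_step T (F c L 0) g \<longleftrightarrow> (\<exists>n. (\<forall>m<n. ?c m) \<and> g = F c L n)" for g
      proof (rule star_family)
        fix m g assume l: "\<And>l. l < m \<Longrightarrow> ?c l"
        have "\<not> d < m" using l[of d] one by auto
        then have ready: "ready (F c L m)" using Fready[of m] bound[of m] l by simp
        have F: "F c L m Dh = h Dh + m" "F c L m Bh = b + m * L" "F c L m Vh = b + Suc m * L" "F c L m Ch = c"
          using C(1) by (simp_all add: F_def)
        have upd: "(F c L m)(Dh := Suc (h Dh + m), Bh := b + Suc m * L, Vh := b + Suc m * L + L) = F c L (Suc m)"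
          by (rule ext) (simp add: F_def)
        then show "layer_step T (F c L m) g \<longleftrightarrow> ?c m \<and> g = F c L (Suc m)"
          using layer_step_iff[of "F c L m" C g, folded L_def, unfolded F upd] ready C by simp
      qed simp
      have "tail T (F c L 0) h' \<longleftrightarrow> (\<exists>n. (\<forall>m<n. ?c m) \<and>
        (test Dh {Bit True} ;; copy Vh Bh ;; right Vh ;; gates False (const_chk True)) T (F c L n) h')"
        unfolding tail_def seq_iff[of "star P" for P] loop ex_family ..
      also have "\<dots> \<longleftrightarrow> (\<forall>m<d. ?c m) \<and>
        (test Dh {Bit True} ;; copy Vh Bh ;; right Vh ;; gates False (const_chk True)) T (F c L d) h'"
      proof -
        \<comment> \<open>The loop needs a zero for every row and the test after it needs a one, so
          the number of rows is dictated by the depth bound.\<close>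
        have "n = d" if "\<forall>m<n. ?c m"
          "(test Dh {Bit True} ;; copy Vh Bh ;; right Vh ;; gates False (const_chk True)) T (F c L n) h'" for n
        proof -
          have "T ! (h Dh + n) = Bit True" using that(2) by (simp add: F_def)
          then have "\<not> n < d" using zeros[of n] by auto
          moreover have "\<not> d < n" using that(1) one by auto
          ultimately show ?thesis by simp
        qed
        then show ?thesis by blast
      qed
      also have "\<dots> \<longleftrightarrow> (\<forall>m<d. ?c m) \<and> circuit_ok (const_rule True) False (b + d * L) (b + d * L + Suc j) C \<and>
        h' = F c L d"
      proof (intro conj_cong refl)
        assume "\<forall>m<d. ?c m"
        then have bd: "b + Suc d * L < length T" by (intro bound) simp
        define g where "g = (F c L d)(Vh := Suc (b + d * L))"
        have b': "Suc (b + d * L) < length T" using bd C(1) by (simp add: L_def)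
        have "ready (F c L d)" by (rule Fready[OF le_refl bd])
        note F = readyD[OF this]
        have "idle g" using F(1) b' by (simp add: g_def idle_def)
        have g: "g Jh = 0" "g Eh = 0" "g Ch = c" "g Bh = b + d * L" "g Vh + j = b + d * L + Suc j"
          using F by (simp_all add: g_def F_def)
        have upd: "g(Vh := b + d * L + Suc j + length C) = F c L d"
          by (rule ext) (simp add: g_def F_def L_def)
        have gates: "gates False (const_chk True) T g h' \<longleftrightarrow>
          circuit_ok (const_rule True) False (b + d * L) (b + d * L + Suc j) C \<and> h' = F c L d"
          using gates_code_iff[OF \<open>idle g\<close> const_chk_spec g(1,2) C(1), of False True h'] C(2) unfolding g(3-5) upd
          by blast
        have "copy Vh Bh T (F c L d) g' \<longleftrightarrow> g' = (F c L d)(Vh := b + d * L)" for g'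
          using copy_iff[of "F c L d" Vh Bh g'] F b' by (simp add: F_def)
        then have "(test Dh {Bit True} ;; copy Vh Bh ;; right Vh ;; gates False (const_chk True)) T (F c L d) h' \<longleftrightarrow>
          F c L d Dh < length T \<and> T ! F c L d Dh = Bit True \<and> gates False (const_chk True) T g h'"
          using b' by (simp add: seq_iff[of "copy i k" for i k] g_def)
        then show "(test Dh {Bit True} ;; copy Vh Bh ;; right Vh ;; gates False (const_chk True)) T (F c L d) h' \<longleftrightarrow>
          circuit_ok (const_rule True) False (b + d * L) (b + d * L + Suc j) C \<and> h' = F c L d"
          unfolding gates using one D by (simp add: F_def)
      qed
      also have "(\<forall>m<d. ?c m) \<longleftrightarrow> (\<forall>t<d. T ! (b + Suc t * L) = MARK \<and>
        circuit_ok layer_rule False (b + t * L) (b + Suc t * L + Suc j) C)"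
      proof -
        have "T ! (h Dh + m) = Bit False" "Suc (h Dh + m) < length T" if "m < d" for m
          using zeros[OF that] D that by simp_all
        then show ?thesis by blast
      qed
      finally show ?thesis by (simp only: conj_assoc)
    qed
    have regroup: "(P \<Longrightarrow> R \<Longrightarrow> S \<Longrightarrow> U \<Longrightarrow> V = (W1 \<and> W2 \<and> W3)) \<Longrightarrow>
        (P \<and> Q \<and> R \<and> S \<and> U \<and> V) = (R \<and> (P \<and> S) \<and> (Q \<and> U \<and> W1 \<and> W2) \<and> W3)"
      for P Q R S U V W1 W2 W3 :: bool by blast
    show "(occurs T (h Dh) (map Bit (replicate d False @ [True])) \<and>
      T ! b = MARK \<and> C \<noteq> [] \<and> occurs T (h Dh + d + 1) (code C) \<and> circuit_ok (const_rule False) False b (b + Suc j) C \<and>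
      tail T (F (h Dh + d + 1) (Suc j + length C) 0) h') \<longleftrightarrow>
      (C \<noteq> [] \<and> occurs T (h Dh) (map Bit (replicate d False @ [True]) @ code C) \<and> layers_ok b d C \<and>
      h' = F (h Dh + d + 1) (Suc j + length C) d)"
      unfolding occ layers_ok_def Let_def c_def[symmetric] L_def[symmetric]
      by (rule regroup) (rule tail)
  qed
  finally show ?thesis unfolding F_def b_def .
qed

text \<open>By induction on the row number, a mark in row \<open>t\<close> certifies depth at most
  \<open>t\<close>. A wire to an input is harmless whatever its cell says, since inputs have depth
  0.\<close>

lemma layers_depth:
  assumes "layers_ok b d C" "wf_circuit j C"
  shows "circuit_depth j C \<le> d"
proof -
  have C: "C \<noteq> []" and wires: "\<And>i w ty ws. i < length C \<Longrightarrow> C ! i = (ty, ws) \<Longrightarrow> w \<in> set ws \<Longrightarrow> w < j + i"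
    using assms(2) wf_circuit_wire[of j C] by (simp add: wf_circuit_def, blast)
  define L where "L = Suc j + length C"
  note ok = assms(1)[unfolded layers_ok_def Let_def, folded L_def]
  have "node_depths j C ! (j + i) \<le> t"
    if "t \<le> d" "i < length C" "T ! (b + t * L + Suc j + i) = Bit True" for t i
    using that
  proof (induction t arbitrary: i)
    case 0
    then show ?case using ok by (cases "C ! i") (auto simp: circuit_ok_def const_rule_def)
  next
    case (Suc t)
    obtain ty ws where g: "C ! i = (ty, ws)" by fastforce
    have "gate_ok layer_rule False (b + t * L) (b + Suc t * L + Suc j + i) (ty, ws)"
    proof -
      have "circuit_ok layer_rule False (b + t * L) (b + Suc t * L + Suc j) C"
        using ok Suc.prems(1) Suc_le_lessD by blast
      then show ?thesis using Suc.prems(2) unfolding circuit_ok_def g[symmetric] by blast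
    qed
    then have "count False (b + t * L) ws = 0" "\<forall>w\<in>set ws. wire_ok False (b + t * L) (b + Suc t * L + Suc j + i) w"
      using Suc.prems(3) by (auto simp: layer_rule_def)
    then have bits: "T ! (b + t * L + Suc w) = Bit True" if "w \<in> set ws" for w
    proof -
      have "T ! (b + t * L + w + 1) \<in> range Bit"
        using \<open>\<forall>w\<in>set ws. wire_ok False _ _ w\<close> that unfolding wire_ok_def by blast
      then obtain a where a: "T ! (b + t * L + w + 1) = Bit a" by blast
      moreover have "T ! (b + t * L + w + 1) \<noteq> Bit False"
        using \<open>count False _ ws = 0\<close> that unfolding count_def length_0_conv filter_empty_conv by blast
      ultimately show ?thesis by (cases a) simp_all
    qed
    have "node_depths j C ! w \<le> t" if "w \<in> set ws" for w
    proof (cases "w < j")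
      case False
      then obtain i' where i': "w = j + i'" by (metis le_Suc_ex not_less)
      then have "i' < length C" using wires[OF Suc.prems(2) g that] Suc.prems(2) by simp
      then show ?thesis using Suc.IH[of i'] Suc.prems(1) bits[OF that] i' by (simp add: add.assoc)
    qed (simp add: node_depths_input)
    then show ?case using node_depths_gate(1)[OF Suc.prems(2) g, of j t] wires[OF Suc.prems(2) g] by blast
  qed
  moreover have "T ! (b + d * L + Suc j + i) = Bit True" if "i < length C" for i
    using ok that by (cases "C ! i") (auto simp: circuit_ok_def const_rule_def)
  ultimately have last: "node_depths j C ! (j + i) \<le> d" if "i < length C" for i
    using that by blast
  have "node_depths j C ! u \<le> d" if "u < j + length C" for u
  proof (cases "u < j")
    case False
    then obtain i where "u = j + i" by (metis le_Suc_ex not_less)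
    then show ?thesis using last[of i] that by simp
  qed (simp add: node_depths_input)
  then show ?thesis using circuit_depth_le_iff[OF C] by blast
qed

text \<open>The true threshold rows pass because gates have positive depth, have depth at most
  \<open>d\<close>, and are within depth \<open>Suc t\<close> only if their wires are within depth
  \<open>t\<close>.\<close>

lemma layers_complete:
  assumes wf: "wf_circuit j C" and d: "circuit_depth j C \<le> d"
    and rows: "\<And>t. t \<le> d \<Longrightarrow> occurs T (b + t * (Suc j + length C)) (layer_row j C t)"
  shows "layers_ok b d C"
proof -
  have C: "C \<noteq> []" and wires: "\<And>i w ty ws. i < length C \<Longrightarrow> C ! i = (ty, ws) \<Longrightarrow> w \<in> set ws \<Longrightarrow> w < j + i"
    using wf wf_circuit_wire[of j C] by (simp add: wf_circuit_def, blast)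
  define L where "L = Suc j + length C"
  note rows = rows[folded L_def]
  have mark: "T ! (b + t * L) = MARK" and bit: "u < j + length C \<Longrightarrow>
      T ! (b + t * L + Suc u) = Bit (node_depths j C ! u \<le> t)"
    and bound: "b + t * L + L < length T" if "t \<le> d" for t u
    using rows[OF that] by (auto simp: layer_row_def occurs_Cons occurs_def L_def)
  have bit': "T ! (b + t * L + Suc j + i) = Bit (node_depths j C ! (j + i) \<le> t)" if "t \<le> d" "i < length C" for t i
    using bit[OF that(1), of "j + i"] that(2) by (simp add: add.assoc)
  have wire: "wire_ok False (b + t * L) v w" if "t \<le> d" "i < length C" "C ! i = (ty, ws)" "w \<in> set ws" for t i ty ws w v
    using wires[OF that(2-4)] bit[OF that(1), of w] bound[OF that(1)] that(2)
    by (auto simp: wire_ok_def L_def)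
  have ok: "circuit_ok \<Phi> False (b + t * L) (b + t' * L + Suc j) C" if "t \<le> d" "t' \<le> d"
    "\<And>i ty ws. i < length C \<Longrightarrow> C ! i = (ty, ws) \<Longrightarrow>
      \<Phi> ty (count True (b + t * L) ws) (count False (b + t * L) ws) (Bit (node_depths j C ! (j + i) \<le> t'))" for \<Phi> t t'
    unfolding circuit_ok_def
  proof (intro conjI allI impI)
    show "b + t' * L + Suc j + length C < length T" using bound[OF that(2)] by (simp add: L_def)
    fix i assume i: "i < length C"
    obtain ty ws where g: "C ! i = (ty, ws)" by fastforce
    show "gate_ok \<Phi> False (b + t * L) (b + t' * L + Suc j + i) (C ! i)"
      unfolding g using wire[OF that(1) i g] that(3)[OF i g] bit'[OF that(2) i] by simp
  qed
  have pos: "0 < node_depths j C ! (j + i)" if "i < length C" for i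
    using node_depths_gate(2)[OF that] wires[OF that] by (metis prod.exhaust)
  have top: "node_depths j C ! (j + i) \<le> d" if "i < length C" for i
    using d that circuit_depth_le_iff[OF C] by simp
  have "circuit_ok (const_rule False) False (b + 0 * L) (b + 0 * L + Suc j) C"
    using pos by (intro ok) (auto simp: const_rule_def)
  moreover have "circuit_ok (const_rule True) False (b + d * L) (b + d * L + Suc j) C"
    using top by (intro ok) (auto simp: const_rule_def)
  moreover have "circuit_ok layer_rule False (b + t * L) (b + Suc t * L + Suc j) C" if t: "t < d" for t
  proof (rule ok)
    fix i ty ws
    assume g: "i < length C" "C ! i = (ty, ws)"
    have "count False (b + t * L) ws = 0" if "node_depths j C ! (j + i) \<le> Suc t"
    proof -
      have "T ! (b + t * L + Suc w) = Bit True" if w: "w \<in> set ws" for w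
      proof -
        have "node_depths j C ! w \<le> t"
          using \<open>node_depths j C ! (j + i) \<le> Suc t\<close> node_depths_gate(1)[OF g, of j t] wires[OF g] w by blast
        then show ?thesis using bit[of t w] wires[OF g w] g(1) t by simp
      qed
      then show ?thesis by (auto simp: count_def filter_empty_conv)
    qed
    then show "layer_rule ty (count True (b + t * L) ws) (count False (b + t * L) ws)
        (Bit (node_depths j C ! (j + i) \<le> Suc t))" by (auto simp: layer_rule_def)
  qed (use t in auto)
  ultimately show ?thesis unfolding layers_ok_def Let_def L_def[symmetric]
    using mark[of 0] mark[of "Suc t" for t] by auto
qed

end


section \<open>Checking runs of a machine\<close>

type_synonym transition = "(nat \<times> symbol list) \<times> (nat \<times> (symbol \<times> move) list)"

text \<open>
  Runs are lists of transitions, the latest first. The symbol at distance \<open>p\<close> from a head is the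
  one written when the head was there last, or the initial one; it is found by walking back
  through the run.
\<close>

fun lookup :: "bool list \<Rightarrow> nat \<Rightarrow> transition list \<Rightarrow> int \<Rightarrow> symbol" where
  "lookup x i [] p = (if i = 0 then fst (input_tape x) p else Blank)"
| "lookup x i (\<tau> # \<tau>s) p =
    (if p + offset (snd (snd (snd \<tau>) ! i)) = 0 then fst (snd (snd \<tau>) ! i)
     else lookup x i \<tau>s (p + offset (snd (snd (snd \<tau>) ! i))))"

fun state_after :: "'a tm_scheme \<Rightarrow> transition list \<Rightarrow> nat" where
  "state_after M [] = start M"
| "state_after M (\<tau> # \<tau>s) = fst (snd \<tau>)"

fun run :: "'a tm_scheme \<Rightarrow> bool list \<Rightarrow> transition list \<Rightarrow> bool" where
  "run M x [] \<longleftrightarrow> True"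
| "run M x (\<tau> # \<tau>s) \<longleftrightarrow> \<tau> \<in> delta M \<and> run M x \<tau>s \<and> fst (fst \<tau>) = state_after M \<tau>s \<and>
     (\<forall>i < tapes M. snd (fst \<tau>) ! i = lookup x i \<tau>s 0)"

text \<open>Cells are addressed relative to the head, the only reference point that a list of
  transitions provides.\<close>

definition tapes_match :: "'a tm_scheme \<Rightarrow> bool list \<Rightarrow> transition list \<Rightarrow> tape list \<Rightarrow> bool" where
  "tapes_match M x \<tau>s ts \<longleftrightarrow> length ts = tapes M \<and>
     (\<forall>i < tapes M. \<forall>p. fst (ts ! i) (snd (ts ! i) + p) = lookup x i \<tau>s p)"

lemma tapes_match_init:
  assumes "wf_tm M"
  shows "tapes_match M x [] (input_tape x # replicate (tapes M - 1) blank_tape)"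
  using assms by (auto simp: tapes_match_def wf_tm_def nth_Cons input_tape_def blank_tape_def split: nat.split)

lemma tapes_match_scan:
  assumes "tapes_match M x \<tau>s ts"
  shows "map scan ts = ss \<longleftrightarrow> length ss = tapes M \<and> (\<forall>i < tapes M. ss ! i = lookup x i \<tau>s 0)"
proof -
  have "scan (ts ! i) = lookup x i \<tau>s 0" if "i < tapes M" for i
  proof -
    have "fst (ts ! i) (snd (ts ! i) + 0) = lookup x i \<tau>s 0"
      using assms that unfolding tapes_match_def by blast
    then show ?thesis by (cases "ts ! i") simp
  qed
  then show ?thesis using assms by (auto simp: list_eq_iff_nth_eq tapes_match_def)
qed

lemma tapes_match_act:
  assumes "tapes_match M x \<tau>s ts" "length as = tapes M"
  shows "tapes_match M x ((k, (q', as)) # \<tau>s) (map2 act as ts)"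
  unfolding tapes_match_def
proof (intro conjI allI impI)
  show "length (map2 act as ts) = tapes M" using assms by (simp add: tapes_match_def)
  fix i p assume i: "i < tapes M"
  obtain t h where t: "ts ! i = (t, h)" by fastforce
  obtain a d where a: "as ! i = (a, d)" by fastforce
  have "t (h + q) = lookup x i \<tau>s q" for q
  proof -
    have "fst (ts ! i) (snd (ts ! i) + q) = lookup x i \<tau>s q"
      using assms(1) i unfolding tapes_match_def by blast
    then show ?thesis by (simp add: t)
  qed
  moreover have "map2 act as ts ! i = (t(h := a), h + offset d)"
    using assms i by (simp add: tapes_match_def t a)
  ultimately show "fst (map2 act as ts ! i) (snd (map2 act as ts ! i) + p) = lookup x i ((k, (q', as)) # \<tau>s) p"
    by (simp add: a add.assoc add.commute[of p])
qed

lemma run_steps: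
  assumes "wf_tm M" "run M x \<tau>s"
  shows "\<exists>ts. (step M ^^ length \<tau>s) (init M x) (state_after M \<tau>s, ts) \<and> tapes_match M x \<tau>s ts"
  using assms(2)
proof (induction \<tau>s)
  case Nil
  then show ?case using tapes_match_init[OF assms(1)] by (auto simp: init_def)
next
  case (Cons \<tau> \<tau>s)
  obtain q ss q' as where \<tau>: "\<tau> = ((q, ss), (q', as))" by (metis prod.exhaust)
  from Cons obtain ts where ts: "(step M ^^ length \<tau>s) (init M x) (state_after M \<tau>s, ts)"
    "tapes_match M x \<tau>s ts" by auto
  from Cons.prems have "\<tau> \<in> delta M" by simp
  then have d: "((q, ss), (q', as)) \<in> delta M" unfolding \<tau> .
  then have len: "length ss = tapes M" "length as = tapes M" using assms(1) by (auto simp: wf_tm_def)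
  have "map scan ts = ss" using tapes_match_scan[OF ts(2)] len Cons.prems \<tau> by simp
  moreover have q: "q = state_after M \<tau>s" using Cons.prems \<tau> by simp
  from d have "((state_after M \<tau>s, ss), (q', as)) \<in> delta M" unfolding q .
  ultimately have st: "step M (state_after M \<tau>s, ts) (q', map2 act as ts)"
    by auto
  have "(step M ^^ Suc (length \<tau>s)) (init M x) (q', map2 act as ts)"
    by (rule relpowp_Suc_I[OF ts(1) st])
  moreover have "length (\<tau> # \<tau>s) = Suc (length \<tau>s)" "state_after M (\<tau> # \<tau>s) = q'" using \<tau> by simp_all
  moreover have "tapes_match M x (\<tau> # \<tau>s) (map2 act as ts)"
    unfolding \<tau> by (rule tapes_match_act[OF ts(2) len(2)])
  ultimately show ?case by (intro exI[of _ "map2 act as ts"]) (simp only: simp_thms)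
qed

lemma steps_run:
  assumes "wf_tm M" "(step M ^^ n) (init M x) (q, ts)"
  shows "\<exists>\<tau>s. length \<tau>s = n \<and> run M x \<tau>s \<and> state_after M \<tau>s = q \<and> tapes_match M x \<tau>s ts"
  using assms(2)
proof (induction n arbitrary: q ts)
  case 0
  then show ?case using tapes_match_init[OF assms(1)] by (auto simp: init_def)
next
  case (Suc n)
  then obtain q0 ts0 where s: "(step M ^^ n) (init M x) (q0, ts0)" "step M (q0, ts0) (q, ts)" by auto
  from Suc.IH[OF s(1)] obtain \<tau>s where \<tau>s: "length \<tau>s = n" "run M x \<tau>s" "state_after M \<tau>s = q0"
    "tapes_match M x \<tau>s ts0" by blast
  from s(2) obtain as where as: "((q0, map scan ts0), (q, as)) \<in> delta M" "ts = map2 act as ts0" by auto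
  then have len: "length as = tapes M" using assms(1) by (auto simp: wf_tm_def)
  let ?\<tau> = "((q0, map scan ts0), (q, as))"
  have scan: "\<forall>i < tapes M. map scan ts0 ! i = lookup x i \<tau>s 0"
    using tapes_match_scan[OF \<tau>s(4), of "map scan ts0"] by (simp del: nth_map)
  have "run M x (?\<tau> # \<tau>s)"
    unfolding run.simps fst_conv snd_conv by (intro conjI as(1) \<tau>s(2) \<tau>s(3)[symmetric] scan)
  moreover have "tapes_match M x (?\<tau> # \<tau>s) ts" unfolding as(2) by (rule tapes_match_act[OF \<tau>s(4) len])
  moreover have "length (?\<tau> # \<tau>s) = Suc n" "state_after M (?\<tau> # \<tau>s) = q" using \<tau>s(1) by simp_all
  ultimately show ?case by blast
qed

text \<open>What a head reads can be recovered from what has been written, so transitions alone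
  certify acceptance and no configurations have to be put on the track.\<close>

lemma accepts_iff_run:
  assumes "wf_tm M"
  shows "accepts_in M x n \<longleftrightarrow> (\<exists>\<tau>s. length \<tau>s = n \<and> run M x \<tau>s \<and> state_after M \<tau>s = final M)"
proof
  assume "accepts_in M x n"
  then obtain ts where "(step M ^^ n) (init M x) (final M, ts)" unfolding accepts_in_def by blast
  from steps_run[OF assms this] show "\<exists>\<tau>s. length \<tau>s = n \<and> run M x \<tau>s \<and> state_after M \<tau>s = final M" by blast
next
  assume "\<exists>\<tau>s. length \<tau>s = n \<and> run M x \<tau>s \<and> state_after M \<tau>s = final M"
  then obtain \<tau>s where \<tau>s: "length \<tau>s = n" "run M x \<tau>s" "state_after M \<tau>s = final M" by blast
  from run_steps[OF assms \<tau>s(2)] show "accepts_in M x n" unfolding accepts_in_def \<tau>s by blast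
qed

section \<open>Recovering a tape symbol by walking back through a run\<close>

definition head_offset :: "nat \<Rightarrow> transition \<Rightarrow> int" where
  "head_offset i \<tau> = offset (snd (snd (snd \<tau>) ! i))"

text \<open>The cell at distance \<open>p\<close> from the present head position, as seen from where
  the head was \<open>l\<close> transitions earlier.\<close>

definition displacement :: "nat \<Rightarrow> transition list \<Rightarrow> int \<Rightarrow> nat \<Rightarrow> int" where
  "displacement i \<tau>s p l = p + (\<Sum>\<tau>\<leftarrow>take l \<tau>s. head_offset i \<tau>)"

lemma displacement_0 [simp]: "displacement i \<tau>s p 0 = p"
  by (simp add: displacement_def)

lemma displacement_Cons: "displacement i (\<tau> # \<tau>s) p (Suc l) = displacement i \<tau>s (p + head_offset i \<tau>) l"
  by (simp add: displacement_def)

lemma displacement_Suc: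
  "l < length \<tau>s \<Longrightarrow> displacement i \<tau>s p (Suc l) = displacement i \<tau>s p l + head_offset i (\<tau>s ! l)"
  by (simp add: displacement_def take_Suc_conv_app_nth)

text \<open>A head moves by at most one cell per step. This will keep the displaced head on the
  track.\<close>

lemma displacement_le: "l \<le> length \<tau>s \<Longrightarrow> \<bar>displacement i \<tau>s 0 l\<bar> \<le> int l"
proof (induction l)
  case (Suc l)
  have "\<bar>head_offset i \<tau>\<bar> \<le> 1" for \<tau> by (cases "snd (snd (snd \<tau>) ! i)") (simp_all add: head_offset_def)
  from this[of "\<tau>s ! l"] Suc show ?case by (simp add: displacement_Suc)
qed simp

text \<open>The recursion unrolled into a search: either there is a first transition, going back,
  that was made on the cell in question, or the whole run is passed and the initial symbol counts.
  In this form it matches a loop described by \<open>star_family\<close> with an exit test behind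
  it.\<close>

lemma lookup_iff:
  "lookup x i \<tau>s p = s \<longleftrightarrow> (\<exists>l. (\<forall>m<l. m < length \<tau>s \<and> displacement i \<tau>s p (Suc m) \<noteq> 0) \<and>
     (l < length \<tau>s \<and> displacement i \<tau>s p (Suc l) = 0 \<and> fst (snd (snd (\<tau>s ! l)) ! i) = s \<or>
      l = length \<tau>s \<and> lookup x i [] (displacement i \<tau>s p l) = s))"
proof (induction \<tau>s arbitrary: p)
  case Nil
  then show ?case by (auto intro: exI[of _ 0])
next
  case (Cons \<tau> \<tau>s)
  let ?Q = "\<lambda>\<tau>s p l. (\<forall>m<l. m < length \<tau>s \<and> displacement i \<tau>s p (Suc m) \<noteq> 0) \<and>
     (l < length \<tau>s \<and> displacement i \<tau>s p (Suc l) = 0 \<and> fst (snd (snd (\<tau>s ! l)) ! i) = s \<or>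
      l = length \<tau>s \<and> lookup x i [] (displacement i \<tau>s p l) = s)"
  define p' where "p' = p + head_offset i \<tau>"
  have d1: "displacement i (\<tau> # \<tau>s) p (Suc l) = displacement i \<tau>s p' l" for l
    by (simp add: displacement_Cons p'_def)
  have Q0: "?Q (\<tau> # \<tau>s) p 0 \<longleftrightarrow> p' = 0 \<and> fst (snd (snd \<tau>) ! i) = s"
    by (simp add: d1)
  have QS: "?Q (\<tau> # \<tau>s) p (Suc l) \<longleftrightarrow> p' \<noteq> 0 \<and> ?Q \<tau>s p' l" for l
  proof -
    have "(\<forall>m<Suc l. m < length (\<tau> # \<tau>s) \<and> displacement i (\<tau> # \<tau>s) p (Suc m) \<noteq> 0) \<longleftrightarrow>
        p' \<noteq> 0 \<and> (\<forall>m<l. m < length \<tau>s \<and> displacement i \<tau>s p' (Suc m) \<noteq> 0)"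
      by (simp add: All_less_Suc2 d1)
    then show ?thesis by (simp add: d1)
  qed
  have split: "(\<exists>l. P l) \<longleftrightarrow> P 0 \<or> (\<exists>l. P (Suc l))" for P :: "nat \<Rightarrow> bool"
    by (metis not0_implies_Suc)
  have "(\<exists>l. ?Q (\<tau> # \<tau>s) p l) \<longleftrightarrow> ?Q (\<tau> # \<tau>s) p 0 \<or> (\<exists>l. ?Q (\<tau> # \<tau>s) p (Suc l))"
    by (rule split)
  also have "\<dots> \<longleftrightarrow> p' = 0 \<and> fst (snd (snd \<tau>) ! i) = s \<or> p' \<noteq> 0 \<and> (\<exists>l. ?Q \<tau>s p' l)"
    unfolding Q0 QS by (simp only: ex_simps)
  also have "\<dots> \<longleftrightarrow> p' = 0 \<and> fst (snd (snd \<tau>) ! i) = s \<or> p' \<noteq> 0 \<and> lookup x i \<tau>s p' = s"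
    unfolding Cons.IH[of p', symmetric] ..
  also have "\<dots> \<longleftrightarrow> lookup x i (\<tau> # \<tau>s) p = s" by (simp add: p'_def head_offset_def)
  finally show ?case by (rule sym)
qed

text \<open>\<open>Aux 0\<close> to \<open>Aux 3\<close> are taken by the markers \<open>LM\<close>,
  \<open>RM\<close>, \<open>MARK\<close> and \<open>STOP\<close>.\<close>

definition trans_symbol :: "nat \<Rightarrow> symbol" where
  "trans_symbol n = Aux (4 + n)"

definition is_trans :: "transition list \<Rightarrow> symbol \<Rightarrow> bool" where
  "is_trans trs a \<longleftrightarrow> (\<exists>n < length trs. a = trans_symbol n)"

definition decode :: "transition list \<Rightarrow> symbol \<Rightarrow> transition" where
  "decode trs a = trs ! (case a of Aux n \<Rightarrow> n - 4 | _ \<Rightarrow> 0)"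

lemma trans_symbol [simp]: "decode trs (trans_symbol n) = trs ! n"
  by (simp add: decode_def trans_symbol_def)

lemma is_trans_in: "is_trans trs a \<Longrightarrow> decode trs a \<in> set trs"
  by (auto simp: is_trans_def)

definition differ :: check where
  "differ = (copy Wh Rh ;; move_up Wh Sh \<squnion> copy Wh Sh ;; move_up Wh Rh) ;; home Wh"

definition shift :: "transition list \<Rightarrow> nat \<Rightarrow> check" where
  "shift trs i = test Qh {a. is_trans trs a \<and> head_offset i (decode trs a) = -1} ;; left Rh \<squnion>
     test Qh {a. is_trans trs a \<and> head_offset i (decode trs a) = 0} \<squnion>
     test Qh {a. is_trans trs a \<and> head_offset i (decode trs a) = 1} ;; right Rh"

text \<open>A displacement may be negative while a head position may not, so \<open>Rh\<close> holds
  the position of \<open>Sh\<close> plus the displacement; the walk continues as long as the two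
  heads differ.\<close>

definition go_back :: "transition list \<Rightarrow> nat \<Rightarrow> check" where
  "go_back trs i = left Qh ;; shift trs i ;; differ"

definition hit :: "transition list \<Rightarrow> nat \<Rightarrow> symbol \<Rightarrow> check" where
  "hit trs i s = left Qh ;; test Qh {a. fst (snd (snd (decode trs a)) ! i) = s} ;; shift trs i ;; eq Rh Sh"

text \<open>Three heads advance together: \<open>Jh\<close> on the header, \<open>Wh\<close> on the
  input stored in the row, and \<open>Qh\<close> to the right from \<open>Sh\<close>. When
  \<open>Qh\<close> meets \<open>Rh\<close>, \<open>Wh\<close> is on the input bit that the
  displacement addresses.\<close>

definition input_chk :: "symbol \<Rightarrow> check" where
  "input_chk s = copy Qh Sh ;; copy Wh Bh ;; right Wh ;; right Jh ;;
     star (test Jh {Bit True} ;; right Jh ;; right Wh ;; right Qh) ;;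
     test Jh {Bit True} ;; eq Qh Rh ;; test Wh {s} ;; home Wh ;; home Jh"

text \<open>The blank cells of the initial input tape are those with negative displacement and those
  with displacement at least \<open>j\<close>.\<close>

definition outside_chk :: check where
  "outside_chk = copy Wh Rh ;; move_up Wh Sh ;; home Wh \<squnion>
     copy Qh Sh ;; along (right Qh) ;; (eq Qh Rh \<squnion> move_up Qh Rh)"

text \<open>A bit met while walking back is the output value that precedes the run on the track, so
  the run has been passed entirely and the initial contents decide.\<close>

definition origin :: "nat \<Rightarrow> symbol \<Rightarrow> check" where
  "origin i s = left Qh ;; test Qh (range Bit) ;;
     (if i \<noteq> 0 then if s = Blank then skip else test Qh {}
      else case s of Bit b \<Rightarrow> input_chk s | Blank \<Rightarrow> outside_chk | Aux n \<Rightarrow> test Qh {})"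

definition lookup_chk :: "transition list \<Rightarrow> nat \<Rightarrow> symbol \<Rightarrow> check" where
  "lookup_chk trs i s = copy Qh Sh ;; copy Rh Sh ;; star (go_back trs i) ;; (hit trs i s \<squnion> origin i s) ;;
     home Qh ;; home Rh"

lemma realizable_lookup_chk [realizable_intros]: "realizable (lookup_chk trs i s)"
proof -
  have "realizable (input_chk s)" "realizable outside_chk" "realizable (shift trs i)" "realizable differ" for s
    unfolding input_chk_def outside_chk_def shift_def differ_def by (intro realizable_intros)+
  moreover from this have "realizable (origin i s)"
    unfolding origin_def
    by (cases s; cases "i = 0"; cases "s = Blank"; simp del: exec; intro realizable_intros; assumption?)
  ultimately show ?thesis unfolding lookup_chk_def go_back_def hit_def
    by (intro realizable_intros) assumption+
qed

context headed_track
begin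

lemma differ_iff:
  assumes "h Ah = 0" "h Wh = 0" "inside h"
  shows "differ T h h' \<longleftrightarrow> h Rh \<noteq> h Sh \<and> h' = h"
proof -
  have "h(Wh := x, Wh := y, Wh := 0) = h" for x y using assms(2) by (simp add: fun_eq_iff)
  moreover have "h(Wh := 0) = h" using assms(2) by (simp add: fun_eq_iff)
  ultimately show ?thesis using assms
    by (simp add: differ_def seq_iff[of "copy i k" for i k] seq_iff[of "move_up i k" for i k]
      copy_iff move_up_iff home_iff) linarith
qed

lemma shift_iff:
  assumes "0 < h Rh" "Suc (h Rh) < length T" "h Qh < length T"
  shows "shift trs i T h h' \<longleftrightarrow> is_trans trs (T ! h Qh) \<and>
    h' = h(Rh := nat (int (h Rh) + head_offset i (decode trs (T ! h Qh))))"
proof -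
  have "h(Rh := h Rh) = h" by simp
  moreover have "nat (int (h Rh) - 1) = h Rh - 1" "nat (int (h Rh) + 1) = Suc (h Rh)" by simp_all
  ultimately show ?thesis using assms
    by (cases "snd (snd (snd (decode trs (T ! h Qh))) ! i)")
      (simp_all add: shift_def left_def right_def test_def head_offset_def)
qed

lemma input_chk_iff:
  assumes "inside h" "h Ah = 0" "h Wh = 0" "h Jh = 0" "occurs T (Suc (h Bh)) (map Bit x)" "length x = j"
    and "h Sh + j < length T"
  shows "input_chk (Bit b) T h h' \<longleftrightarrow> (\<exists>p<j. h Rh = h Sh + p \<and> x ! p = b) \<and> h' = h(Qh := h Rh)"
proof -
  have B: "Suc (h Bh + j) < length T" and x: "\<And>p. p < j \<Longrightarrow> T ! (Suc (h Bh) + p) = Bit (x ! p)"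
    using assms(5,6) by (auto simp: occurs_def)
  define F where "F m = h(Qh := h Sh + m, Wh := Suc (h Bh) + m, Jh := Suc m)" for m
  have loop: "star (test Jh {Bit True} ;; right Jh ;; right Wh ;; right Qh) T (F 0) g \<longleftrightarrow>
    (\<exists>n. (\<forall>m<n. m < j) \<and> g = F n)" for g
  proof (rule star_family)
    fix m g assume "\<And>l. l < m \<Longrightarrow> l < j"
    from this[of "m - 1"] have m: "m \<le> j" by (cases m) auto
    have upd: "(F m)(Jh := Suc (Suc m), Wh := Suc (Suc (h Bh + m)), Qh := Suc (h Sh + m)) = F (Suc m)"
      by (rule ext) (simp add: F_def)
    show "(test Jh {Bit True} ;; right Jh ;; right Wh ;; right Qh) T (F m) g \<longleftrightarrow> m < j \<and> g = F (Suc m)"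
    proof (cases "m < j")
      case True
      then have "T ! Suc m = Bit True" "Suc (Suc m) < length T" "Suc (Suc (h Bh + m)) < length T"
        "Suc (h Sh + m) < length T"
        using nth_ones[of "Suc m"] long B assms(7) by simp_all
      moreover have "F m Jh = Suc m" "F m Wh = Suc (h Bh + m)" "F m Qh = h Sh + m" by (simp_all add: F_def)
      ultimately show ?thesis using True by (simp add: right_def upd)
    next
      case False
      then have "m = j" using m by simp
      then show ?thesis using nth_zero by (simp add: F_def)
    qed
  qed simp
  have start: "input_chk (Bit b) T h h' \<longleftrightarrow> Suc (h Bh) < length T \<and>
      (star (test Jh {Bit True} ;; right Jh ;; right Wh ;; right Qh) ;;
       test Jh {Bit True} ;; eq Qh Rh ;; test Wh {Bit b} ;; home Wh ;; home Jh) T (F 0) h'"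
    using assms long by (simp add: input_chk_def seq_iff[of "copy i k" for i k] copy_iff F_def)
  have "(test Jh {Bit True} ;; eq Qh Rh ;; test Wh {Bit b} ;; home Wh ;; home Jh) T (F n) h' \<longleftrightarrow>
      n < j \<and> h Rh = h Sh + n \<and> x ! n = b \<and> h' = h(Qh := h Rh)" if "n \<le> j" for n
  proof (cases "n < j")
    case True
    have upd: "(F n)(Wh := 0, Jh := 0) = h(Qh := h Sh + n)"
      by (rule ext) (simp add: F_def assms(3,4))
    have "F n Jh = Suc n" "F n Wh = Suc (h Bh + n)" "F n Qh = h Sh + n" "F n Rh = h Rh" "F n Ah = 0"
      using assms(2) by (simp_all add: F_def)
    moreover have "T ! Suc n = Bit True" "Suc n < length T" "h Sh + n < length T" "Suc (h Bh + n) < length T"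
      "T ! Suc (h Bh + n) = Bit (x ! n)"
      using nth_ones[of "Suc n"] long B True assms(7) x[of n] by simp_all
    ultimately show ?thesis using True upd
      by (auto simp: seq_iff[of "eq i k" for i k] eq_iff seq_iff[of "home i" for i] home_iff)
  next
    case False
    then have "n = j" using that by simp
    then show ?thesis using nth_zero by (simp add: F_def)
  qed
  moreover have "(\<forall>m<n. m < j) \<longleftrightarrow> n \<le> j" for n by (meson less_le_trans not_le order_refl)
  ultimately show ?thesis unfolding start seq_iff[of "star P" for P] loop ex_family
    using B by (simp del: exec cong: conj_cong) auto
qed

lemma outside_chk_iff:
  assumes "inside h" "h Ah = 0" "h Wh = 0" "h Jh = 0" "h Sh + j < length T"
  shows "(\<exists>g. outside_chk T h g \<and> home Qh T g h') \<longleftrightarrow> (h Rh < h Sh \<or> h Sh + j \<le> h Rh) \<and> h' = h(Qh := 0)"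
proof -
  have w: "h(Wh := x, Wh := y, Wh := 0) = h" "h(Wh := 0) = h" for x y
    using assms(3) by (simp_all add: fun_eq_iff)
  have "along (right Qh) T (h(Qh := h Sh)) g \<longleftrightarrow> g = h(Qh := h Sh + j)" for g
    using along_right_iff[of "h(Qh := h Sh)" Qh g] assms by simp
  then have inside_part: "(copy Qh Sh ;; along (right Qh) ;; (eq Qh Rh \<squnion> move_up Qh Rh)) T h g \<longleftrightarrow>
      h Sh + j = h Rh \<and> g = h(Qh := h Sh + j) \<or> h Sh + j < h Rh \<and> g = h(Qh := h Rh)" for g
    using assms by (simp add: seq_iff[of "copy i k" for i k] seq_iff[of "along P" for P] copy_iff
      move_up_iff eq_iff)
  have "(copy Wh Rh ;; move_up Wh Sh ;; home Wh) T h g \<longleftrightarrow> h Rh < h Sh \<and> g = h" for g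
    using assms by (simp add: seq_iff[of "copy i k" for i k] seq_iff[of "move_up i k" for i k]
      copy_iff move_up_iff home_iff w)
  then have "outside_chk T h g \<longleftrightarrow> h Rh < h Sh \<and> g = h \<or>
      h Sh + j = h Rh \<and> g = h(Qh := h Sh + j) \<or> h Sh + j < h Rh \<and> g = h(Qh := h Rh)" for g
    unfolding outside_chk_def exec(6) inside_part by blast
  then have "(\<exists>g. outside_chk T h g \<and> home Qh T g h') \<longleftrightarrow>
      (h Rh < h Sh \<or> h Sh + j = h Rh \<or> h Sh + j < h Rh) \<and> h' = h(Qh := 0)"
    unfolding home_iff by (simp add: conj_disj_distribR ex_disj_distrib)
  then show ?thesis unfolding le_less by blast
qed

lemma origin_iff:
  assumes "inside h" "h Ah = 0" "h Wh = 0" "h Jh = 0" "occurs T (Suc (h Bh)) (map Bit x)" "length x = j"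
    "h Sh + j < length T" "h(Qh := 0) = h0" "0 < h Qh"
  shows "(origin i s ;; home Qh) T h h' \<longleftrightarrow>
    T ! (h Qh - 1) \<in> range Bit \<and> lookup x i [] (int (h Rh) - int (h Sh)) = s \<and> h' = h0"
proof -
  define g where "g = h(Qh := h Qh - 1)"
  have q: "h Qh - 1 < length T" using assms(1) by (simp add: less_imp_diff_less)
  have g: "inside g" "g Ah = 0" "g Wh = 0" "g Jh = 0" "g Bh = h Bh" "g Sh = h Sh" "g Rh = h Rh"
    using assms q by (simp_all add: g_def)
  have g0: "g(Qh := y) = h(Qh := y)" "h(Qh := y, Qh := 0) = h0" for y
    using assms(8) by (simp_all add: g_def)
  have h0: "h0 = h(Qh := 0)" using assms(8) by simp
  have "(origin i s ;; home Qh) T h h' \<longleftrightarrow> T ! (h Qh - 1) \<in> range Bit \<and>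
    ((if i \<noteq> 0 then if s = Blank then skip else test Qh {}
      else case s of Bit b \<Rightarrow> input_chk s | Blank \<Rightarrow> outside_chk | Aux n \<Rightarrow> test Qh {}) ;; home Qh) T g h'"
    using assms(9) q by (simp add: origin_def g_def)
  also have "\<dots> \<longleftrightarrow> T ! (h Qh - 1) \<in> range Bit \<and> lookup x i [] (int (h Rh) - int (h Sh)) = s \<and> h' = h0"
  proof (cases "i = 0")
    case False
    then show ?thesis by (simp add: seq_iff[of skip] skip_def home_iff g0 h0)
  next
    case True
    have lk: "lookup x 0 [] (int (h Rh) - int (h Sh)) =
      (if h Sh \<le> h Rh \<and> h Rh < h Sh + j then Bit (x ! (h Rh - h Sh)) else Blank)"
      using assms(6) by (auto simp: input_tape_def nat_diff_distrib)
    show ?thesis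
    proof (cases s)
      case Blank
      have "(outside_chk ;; home Qh) T g h' \<longleftrightarrow> (h Rh < h Sh \<or> h Sh + j \<le> h Rh) \<and> h' = h(Qh := 0)"
        using outside_chk_iff[OF g(1-4)] assms(7) unfolding seq_iff g g0 by simp
      then show ?thesis using True Blank unfolding True lk h0 by auto
    next
      case (Bit b)
      have "input_chk (Bit b) T g g' \<longleftrightarrow> (\<exists>p<j. h Rh = h Sh + p \<and> x ! p = b) \<and> g' = h(Qh := h Rh)" for g'
        using input_chk_iff[of g x b g'] g assms(5-7) g0 by simp
      then have "(input_chk (Bit b) ;; home Qh) T g h' \<longleftrightarrow> (\<exists>p<j. h Rh = h Sh + p \<and> x ! p = b) \<and> h' = h0"
        by (simp add: seq_iff home_iff h0)
      moreover have "(\<exists>p<j. h Rh = h Sh + p \<and> x ! p = b) \<longleftrightarrow>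
          h Sh \<le> h Rh \<and> h Rh < h Sh + j \<and> x ! (h Rh - h Sh) = b"
        by (auto intro!: exI[of _ "h Rh - h Sh"])
      ultimately show ?thesis using True Bit unfolding True lk by auto
    next
      case (Aux n)
      then show ?thesis using True lk by simp
    qed
  qed
  finally show ?thesis .
qed

end


text \<open>The state is read off the preceding cell: a transition supplies its target, and a bit
  means that the run has not begun, so that the machine is in its start state.\<close>

definition state_chk :: "'a tm_scheme \<Rightarrow> transition list \<Rightarrow> nat \<Rightarrow> check" where
  "state_chk M trs q = left Sh ;;
     test Sh {a. is_trans trs a \<and> fst (snd (decode trs a)) = q \<or> a \<in> range Bit \<and> start M = q} ;; right Sh"

definition read_chk :: "transition list \<Rightarrow> symbol list \<Rightarrow> nat list \<Rightarrow> check" where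
  "read_chk trs ss is = foldr (\<lambda>i P. lookup_chk trs i (ss ! i) ;; P) is skip"

text \<open>The doubled position is thrown away at once. Doubling serves as a test: it succeeds only
  if the track has the room to the right that the displaced head in \<open>lookup_chk\<close>
  needs.\<close>

definition step_chk :: "'a tm_scheme \<Rightarrow> transition list \<Rightarrow> check" where
  "step_chk M trs = copy Zh Sh ;; double ;; home Zh ;;
     any_of (map (\<lambda>k. test Sh {trans_symbol k} ;; state_chk M trs (fst (fst (trs ! k))) ;;
       read_chk trs (snd (fst (trs ! k))) [0..<tapes M]) [0..<length trs]) ;; right Sh"

definition run_chk :: "'a tm_scheme \<Rightarrow> transition list \<Rightarrow> check" where
  "run_chk M trs = copy Sh Vh ;; star (step_chk M trs) ;; state_chk M trs (final M) ;; copy Vh Sh ;; home Sh"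

lemma realizable_run_chk [realizable_intros]: "realizable (run_chk M trs)"
proof -
  have "realizable (read_chk trs ss is)" for ss "is"
    by (induction "is") (simp_all del: exec add: read_chk_def realizable_intros)
  then show ?thesis unfolding run_chk_def step_chk_def state_chk_def
    by (intro realizable_intros) (auto intro!: realizable_intros simp del: exec)
qed

context headed_track
begin

text \<open>On the track a run is written in the order of time, whereas lists of transitions have
  the latest first.\<close>

primrec past :: "transition list \<Rightarrow> nat \<Rightarrow> nat \<Rightarrow> transition list" where
  "past trs s 0 = []"
| "past trs s (Suc n) = decode trs (T ! (s + n)) # past trs s n"

lemma length_past [simp]: "length (past trs s n) = n"
  by (induction n) simp_all

lemma nth_past: "l < n \<Longrightarrow> past trs s n ! l = decode trs (T ! (s + n - Suc l))"
proof (induction n arbitrary: l)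
  case (Suc n)
  then show ?case by (cases l) simp_all
qed simp

lemma is_trans_not_Bit: "is_trans trs a \<Longrightarrow> a \<notin> range Bit"
  by (auto simp: is_trans_def trans_symbol_def)

text \<open>\<open>s\<close> is the first cell of the run and \<open>n\<close> the number of its
  transitions verified so far; the bit at \<open>s - 1\<close> is the output value that delimits the
  run on the left.\<close>

definition in_run :: "transition list \<Rightarrow> bool list \<Rightarrow> nat \<Rightarrow> nat \<Rightarrow> heads \<Rightarrow> bool" where
  "in_run trs x s n h \<longleftrightarrow> ready (h(Sh := 0)) \<and> occurs T (Suc (h Bh)) (map Bit x) \<and> length x = j \<and>
     h Sh = s + n \<and> s + n < length T \<and> 0 < s \<and> j \<le> s \<and> T ! (s - 1) \<in> range Bit \<and>
     (\<forall>m<n. is_trans trs (T ! (s + m)))"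

lemma in_runD:
  assumes "in_run trs x s n h"
  shows "inside h" "h Ah = 0" "h Wh = 0" "h Jh = 0" "h Qh = 0" "h Rh = 0" "h Zh = 0" "h Yh = 0"
    "occurs T (Suc (h Bh)) (map Bit x)" "length x = j" "h Sh = s + n" "s + n < length T" "0 < s" "j \<le> s"
    "T ! (s - 1) \<in> range Bit" "\<And>m. m < n \<Longrightarrow> is_trans trs (T ! (s + m))"
proof -
  have ready: "ready (h(Sh := 0))" and hs: "h Sh = s + n" "s + n < length T"
    using assms unfolding in_run_def by blast+
  have "h(Sh := 0, Sh := s + n) = h" using hs(1) by (simp add: fun_eq_iff)
  then show "inside h" using inside_upd[OF readyD(2)[OF ready] hs(2), of Sh] by simp
  note r = readyD[OF ready]
  show "h Ah = 0" "h Wh = 0" "h Jh = 0" "h Qh = 0" "h Rh = 0" "h Zh = 0" "h Yh = 0"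
    using r by simp_all
qed (use assms in \<open>auto simp: in_run_def\<close>)

lemma lookup_chk_iff:
  assumes r: "in_run trs x s n h" and room: "2 * (s + n) < length T"
  shows "lookup_chk trs i a T h h' \<longleftrightarrow> lookup x i (past trs s n) 0 = a \<and> h' = h"
proof -
  note h = in_runD[OF r]
  define d where "d l = displacement i (past trs s n) 0 l" for l
  define F where "F l = h(Qh := s + n - l, Rh := nat (int (s + n) + d l))" for l
  have d: "\<bar>d l\<bar> \<le> int l" if "l \<le> n" for l
    using displacement_le[of l "past trs s n" i] that by (simp add: d_def)
  \<comment> \<open>From \<open>\<bar>d l\<bar> \<le> l \<le> n\<close> and \<open>0 < s\<close> it
    follows that \<open>Rh\<close> stays right of 0 and left of \<open>2 * (s + n)\<close>, with one
    more cell on either side to move to.\<close>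
  have R: "int (F l Rh) = int (s + n) + d l" "0 < F l Rh" "Suc (F l Rh) < length T" if "l \<le> n" for l
    using d[OF that] that h(13) room by (simp_all add: F_def)
  have F: "F l Qh = s + n - l" "F l Ah = 0" "F l Wh = 0" "F l Jh = 0" "F l Sh = s + n" "F l Bh = h Bh" for l
    using h by (simp_all add: F_def)
  have inF: "inside (F l)" if "l \<le> n" for l
  proof -
    have "nat (int (s + n) + d l) < length T" using R(3)[OF that] by (simp add: F_def)
    then show ?thesis using h by (simp add: F_def less_imp_diff_less)
  qed
  have Suc_d: "d (Suc l) = d l + head_offset i (decode trs (T ! (s + n - Suc l)))" if "l < n" for l
    using that by (simp add: d_def displacement_Suc nth_past)
  have sym: "is_trans trs (T ! (s + n - Suc l))" if "l < n" for l
  proof -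
    have "s + n - Suc l = s + (n - Suc l)" using that by simp
    then show ?thesis using h(16)[of "n - Suc l"] that by simp
  qed
  \<comment> \<open>The cell before the oldest transition is the delimiting bit, on which
    \<open>shift\<close> fails.\<close>
  have first: "\<not> is_trans trs (T ! (s + n - Suc n))" "T ! (s + n - Suc n) \<in> range Bit"
    using h(15) is_trans_not_Bit by auto
  have move: "(left Qh ;; P) T (F l) g \<longleftrightarrow> P T ((F l)(Qh := s + n - Suc l)) g" if "l \<le> n" for l P g
    using that h(13) by (simp add: F)
  have shifted: "shift trs i T ((F l)(Qh := s + n - Suc l)) g \<longleftrightarrow> l < n \<and> g = F (Suc l)" if "l \<le> n" for l g
  proof (cases "l < n")
    case True
    have "nat (int (F l Rh) + head_offset i (decode trs (T ! (s + n - Suc l)))) = nat (int (s + n) + d (Suc l))"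
      unfolding R(1)[OF that] Suc_d[OF True] by (simp add: add.assoc)
    moreover have "(F l)(Qh := s + n - Suc l, Rh := nat (int (s + n) + d (Suc l))) = F (Suc l)"
      by (rule ext) (simp add: F_def)
    ultimately show ?thesis using True sym[OF True] R(2,3)[OF that] h(12)
      by (subst shift_iff) simp_all
  next
    case False
    then have "l = n" using that by simp
    then show ?thesis using first(1) R(2,3)[OF that] h(12) by (subst shift_iff) simp_all
  qed
  have go_back: "go_back trs i T (F l) g \<longleftrightarrow> (l < n \<and> d (Suc l) \<noteq> 0) \<and> g = F (Suc l)" if "l \<le> n" for l g
  proof -
    have "go_back trs i T (F l) g \<longleftrightarrow> l < n \<and> differ T (F (Suc l)) g"
      unfolding go_back_def move[OF that] seq_iff[of "shift ts i" for ts i] shifted[OF that] by blast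
    moreover have "differ T (F (Suc l)) g \<longleftrightarrow> d (Suc l) \<noteq> 0 \<and> g = F (Suc l)" if "l < n"
    proof -
      have "F (Suc l) Rh \<noteq> F (Suc l) Sh \<longleftrightarrow> d (Suc l) \<noteq> 0" using R(1)[of "Suc l"] that by (simp add: F) linarith
      then show ?thesis using differ_iff[OF F(2,3) inF[of "Suc l"], of g] that by simp
    qed
    ultimately show ?thesis by blast
  qed
  have loop: "star (go_back trs i) T (F 0) g \<longleftrightarrow> (\<exists>l. (\<forall>m<l. m < n \<and> d (Suc m) \<noteq> 0) \<and> g = F l)" for g
  proof (rule star_family)
    fix m g assume "\<And>l. l < m \<Longrightarrow> l < n \<and> d (Suc l) \<noteq> 0"
    from this[of "m - 1"] have "m \<le> n" by (cases m) auto
    then show "go_back trs i T (F m) g \<longleftrightarrow> (m < n \<and> d (Suc m) \<noteq> 0) \<and> g = F (Suc m)" by (rule go_back)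
  qed simp
  have restore: "(F l)(Qh := 0, Rh := 0) = h" for l
    by (rule ext) (simp add: F_def h)
  have fin: "(home Qh ;; home Rh) T (F l) h' \<longleftrightarrow> h' = h" for l
    by (simp add: seq_iff[of "home i" for i] home_iff restore)
  have hits: "(hit trs i a ;; home Qh ;; home Rh) T (F l) h' \<longleftrightarrow>
      (l < n \<and> d (Suc l) = 0 \<and> fst (snd (snd (past trs s n ! l)) ! i) = a) \<and> h' = h" if "l \<le> n" for l
  proof -
    have "(eq Rh Sh ;; home Qh ;; home Rh) T (F (Suc l)) h' \<longleftrightarrow> d (Suc l) = 0 \<and> h' = h" if "l < n"
    proof -
      have "F (Suc l) Rh = F (Suc l) Sh \<longleftrightarrow> d (Suc l) = 0" using R(1)[of "Suc l"] that by (simp add: F) linarith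
      moreover have "F (Suc l) Rh < length T" using inF[of "Suc l"] that by simp
      ultimately have "eq Rh Sh T (F (Suc l)) g \<longleftrightarrow> d (Suc l) = 0 \<and> g = F (Suc l)" for g
        using eq_iff[of "F (Suc l)" Rh Sh g] F(2)[of "Suc l"] by simp
      then show ?thesis unfolding seq_iff[of "eq i k" for i k] by (simp add: fin del: exec)
    qed
    moreover have "(hit trs i a ;; home Qh ;; home Rh) T (F l) h' \<longleftrightarrow>
        fst (snd (snd (decode trs (T ! (s + n - Suc l)))) ! i) = a \<and> l < n \<and>
        (eq Rh Sh ;; home Qh ;; home Rh) T (F (Suc l)) h'"
    proof -
      have "s + n - Suc l < length T" using h(12) by simp
      then have "(hit trs i a ;; home Qh ;; home Rh) T (F l) h' \<longleftrightarrow>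
          fst (snd (snd (decode trs (T ! (s + n - Suc l)))) ! i) = a \<and>
          (shift trs i ;; eq Rh Sh ;; home Qh ;; home Rh) T ((F l)(Qh := s + n - Suc l)) h'"
        unfolding hit_def exec(5) move[OF that] by simp
      then show ?thesis unfolding seq_iff[of "shift ts i" for ts i] shifted[OF that] by blast
    qed
    ultimately show ?thesis using nth_past[of l n trs s] by auto
  qed
  have origins: "(origin i a ;; home Qh ;; home Rh) T (F l) h' \<longleftrightarrow>
      (l = n \<and> lookup x i [] (d l) = a) \<and> h' = h" if "l \<le> n" for l
  proof -
    have "T ! (F l Qh - 1) \<in> range Bit \<longleftrightarrow> l = n"
    proof (cases "l = n")
      case True
      then show ?thesis using first(2) F(1)[of l] by simp
    next
      case False
      then have "l < n" using that by simp
      then show ?thesis using is_trans_not_Bit[OF sym, of l] F(1)[of l] False by auto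
    qed
    moreover have "int (F l Rh) - int (F l Sh) = d l" using R(1)[OF that] by (simp add: F)
    moreover have "F l Sh + j < length T" "0 < F l Qh" using room h(13,14) that by (simp_all add: F)
    ultimately have "(origin i a ;; home Qh) T (F l) g \<longleftrightarrow> (l = n \<and> lookup x i [] (d l) = a) \<and> g = (F l)(Qh := 0)" for g
      using origin_iff[OF inF[OF that] F(2,3,4), of x "(F l)(Qh := 0)" i a g] h(9,10) F(6)[of l] by simp
    moreover have "(origin i a ;; home Qh ;; home Rh) T (F l) h' \<longleftrightarrow>
        (\<exists>g. (origin i a ;; home Qh) T (F l) g \<and> home Rh T g h')"
      by (auto simp: seq_iff)
    ultimately show ?thesis by (simp add: home_iff restore)
  qed
  have "lookup_chk trs i a T h h' \<longleftrightarrow>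
    (star (go_back trs i) ;; (hit trs i a \<squnion> origin i a) ;; home Qh ;; home Rh) T (F 0) h'"
  proof -
    have "nat (int s + int n) = s + n" by (simp flip: of_nat_add)
    then have "h(Qh := s + n, Rh := s + n) = F 0" by (simp add: F_def d_def)
    then show ?thesis using h by (simp add: lookup_chk_def seq_iff[of "copy i k" for i k] copy_iff del: exec)
  qed
  also have "\<dots> \<longleftrightarrow> (\<exists>l. (\<forall>m<l. m < n \<and> d (Suc m) \<noteq> 0) \<and>
      ((l < n \<and> d (Suc l) = 0 \<and> fst (snd (snd (past trs s n ! l)) ! i) = a) \<or>
       (l = n \<and> lookup x i [] (d l) = a)) \<and> h' = h)"
    unfolding seq_iff[of "star P" for P] loop ex_family exec(4)
  proof (intro ex_cong1 conj_cong refl)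
    fix l assume "\<forall>m<l. m < n \<and> d (Suc m) \<noteq> 0"
    then have "\<not> n < l" by blast
    then have l: "l \<le> n" by simp
    show "(hit trs i a ;; home Qh ;; home Rh) T (F l) h' \<or> (origin i a ;; home Qh ;; home Rh) T (F l) h' \<longleftrightarrow>
      ((l < n \<and> d (Suc l) = 0 \<and> fst (snd (snd (past trs s n ! l)) ! i) = a) \<or>
       (l = n \<and> lookup x i [] (d l) = a)) \<and> h' = h"
      unfolding hits[OF l] origins[OF l] by blast
  qed
  also have "\<dots> \<longleftrightarrow> lookup x i (past trs s n) 0 = a \<and> h' = h"
    unfolding lookup_iff[of x i "past trs s n" 0 a] length_past d_def by blast
  finally show ?thesis .
qed

lemma state_chk_iff:
  assumes "in_run trs x s n h"
  shows "state_chk M trs q T h h' \<longleftrightarrow> state_after M (past trs s n) = q \<and> h' = h"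
proof -
  note h = in_runD[OF assms]
  have upd: "h(Sh := s + n) = h" using h(11) by (simp add: fun_eq_iff)
  have "state_chk M trs q T h h' \<longleftrightarrow> (is_trans trs (T ! (s + n - 1)) \<and> fst (snd (decode trs (T ! (s + n - 1)))) = q \<or>
      T ! (s + n - 1) \<in> range Bit \<and> start M = q) \<and> h' = h"
    using h(11,12,13) less_imp_diff_less[OF h(12), of 1] by (simp add: state_chk_def right_def upd)
  also have "\<dots> \<longleftrightarrow> state_after M (past trs s n) = q \<and> h' = h"
  proof (cases n)
    case 0
    then show ?thesis using h(15) is_trans_not_Bit[of trs "T ! (s - 1)"] by auto
  next
    case (Suc m)
    then show ?thesis using h(16)[of m] is_trans_not_Bit[of trs "T ! (s + m)"] by auto
  qed
  finally show ?thesis .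
qed

lemma read_chk_iff:
  assumes "in_run trs x s n h" "2 * (s + n) < length T"
  shows "read_chk trs ss is T h h' \<longleftrightarrow> (\<forall>i\<in>set is. ss ! i = lookup x i (past trs s n) 0) \<and> h' = h"
proof (induction "is")
  case Nil
  then show ?case by (simp add: read_chk_def skip_def)
next
  case (Cons i "is")
  have "read_chk trs ss (i # is) T h h' \<longleftrightarrow> (\<exists>g. lookup_chk trs i (ss ! i) T h g \<and> read_chk trs ss is T g h')"
    by (simp add: read_chk_def seq_iff)
  also have "\<dots> \<longleftrightarrow> lookup x i (past trs s n) 0 = ss ! i \<and> read_chk trs ss is T h h'"
    unfolding lookup_chk_iff[OF assms] by blast
  finally show ?case unfolding Cons.IH by auto
qed

lemma step_chk_iff:
  assumes "in_run trs x s n h"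
  shows "step_chk M trs T h h' \<longleftrightarrow> (2 * (s + n) < length T \<and> is_trans trs (T ! (s + n)) \<and>
    fst (fst (decode trs (T ! (s + n)))) = state_after M (past trs s n) \<and>
    (\<forall>i<tapes M. snd (fst (decode trs (T ! (s + n)))) ! i = lookup x i (past trs s n) 0)) \<and>
    h' = h(Sh := Suc (s + n))"
proof -
  note h = in_runD[OF assms]
  define body where "body = any_of (map (\<lambda>k. test Sh {trans_symbol k} ;; state_chk M trs (fst (fst (trs ! k))) ;;
       read_chk trs (snd (fst (trs ! k))) [0..<tapes M]) [0..<length trs])"
  define ok where "ok \<tau> \<longleftrightarrow> fst (fst \<tau>) = state_after M (past trs s n) \<and>
    (\<forall>i<tapes M. snd (fst \<tau>) ! i = lookup x i (past trs s n) 0)" for \<tau> :: transition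
  have z: "h(Zh := x, Zh := y, Zh := 0) = h" for x y using h(7) by (simp add: fun_eq_iff)
  have dbl: "double T (h(Zh := s + n)) g \<longleftrightarrow> 2 * (s + n) < length T \<and> g = h(Zh := s + n, Zh := 2 * (s + n))" for g
    using double_iff[of "h(Zh := s + n)" g] h by simp
  have "step_chk M trs T h h' \<longleftrightarrow> 2 * (s + n) < length T \<and> (body ;; right Sh) T h h'"
  proof -
    have "copy Zh Sh T h g \<longleftrightarrow> g = h(Zh := s + n)" for g
      using copy_iff[of h Zh Sh g] h(2,11,12) by simp
    then have "step_chk M trs T h h' \<longleftrightarrow> (double ;; home Zh ;; body ;; right Sh) T (h(Zh := s + n)) h'"
      unfolding step_chk_def body_def seq_iff[of "copy i k" for i k] by simp
    also have "\<dots> \<longleftrightarrow> 2 * (s + n) < length T \<and> (home Zh ;; body ;; right Sh) T (h(Zh := s + n, Zh := 2 * (s + n))) h'"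
      unfolding seq_iff[of double] dbl by blast
    also have "\<dots> \<longleftrightarrow> 2 * (s + n) < length T \<and> (body ;; right Sh) T h h'"
      unfolding seq_iff[of "home i" for i] home_iff z by simp
    finally show ?thesis .
  qed
  also have "\<dots> \<longleftrightarrow> 2 * (s + n) < length T \<and> (\<exists>k<length trs. T ! (s + n) = trans_symbol k \<and> ok (trs ! k)) \<and>
      h' = h(Sh := Suc (s + n))"
  proof (intro conj_cong refl)
    assume room: "2 * (s + n) < length T"
    define item where "item k = test Sh {trans_symbol k} ;; state_chk M trs (fst (fst (trs ! k))) ;;
       read_chk trs (snd (fst (trs ! k))) [0..<tapes M]" for k
    have item: "item k T h g \<longleftrightarrow> (T ! (s + n) = trans_symbol k \<and> ok (trs ! k)) \<and> g = h" for k g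
    proof -
      have "(state_chk M trs q ;; read_chk trs ss [0..<tapes M]) T h g \<longleftrightarrow> state_after M (past trs s n) = q \<and>
        (\<forall>i<tapes M. ss ! i = lookup x i (past trs s n) 0) \<and> g = h" for q ss
        unfolding seq_iff[of "state_chk M trs q"] state_chk_iff[OF assms]
        by (simp add: read_chk_iff[OF assms room] Ball_def del: exec)
      then show ?thesis using h(11,12) by (auto simp: item_def ok_def)
    qed
    have "body T h g \<longleftrightarrow> (\<exists>k<length trs. T ! (s + n) = trans_symbol k \<and> ok (trs ! k)) \<and> g = h" for g
      unfolding body_def item_def[symmetric] any_of_iff by (auto simp: item)
    moreover have "right Sh T h h' \<longleftrightarrow> h' = h(Sh := Suc (s + n))"
      using room h(11,13) by (simp add: right_def)
    ultimately show "(body ;; right Sh) T h h' \<longleftrightarrow>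
        (\<exists>k<length trs. T ! (s + n) = trans_symbol k \<and> ok (trs ! k)) \<and> h' = h(Sh := Suc (s + n))"
      unfolding seq_iff by (simp del: exec)
  qed
  also have "(\<exists>k<length trs. T ! (s + n) = trans_symbol k \<and> ok (trs ! k)) \<longleftrightarrow>
      is_trans trs (T ! (s + n)) \<and> ok (decode trs (T ! (s + n)))"
    unfolding is_trans_def by (auto simp: trans_symbol)
  finally show ?thesis unfolding ok_def by (simp only: conj_assoc)
qed

definition run_symbols :: "transition list \<Rightarrow> nat \<Rightarrow> nat \<Rightarrow> bool" where
  "run_symbols trs s n \<longleftrightarrow> s + n < length T \<and> (\<forall>m<n. 2 * (s + m) < length T \<and> is_trans trs (T ! (s + m)))"

lemma run_past_iff:
  assumes "set trs = delta M" "\<forall>m<n. is_trans trs (T ! (s + m))"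
  shows "run M x (past trs s n) \<longleftrightarrow> (\<forall>m<n. fst (fst (decode trs (T ! (s + m)))) = state_after M (past trs s m) \<and>
    (\<forall>i<tapes M. snd (fst (decode trs (T ! (s + m)))) ! i = lookup x i (past trs s m) 0))"
  using assms(2)
proof (induction n)
  case (Suc n)
  have "decode trs (T ! (s + n)) \<in> delta M" using is_trans_in[of trs "T ! (s + n)"] Suc.prems assms(1) by simp
  then show ?case using Suc by (simp add: less_Suc_eq all_conj_distrib imp_conjL)
qed simp

lemma run_chk_iff:
  assumes "ready h" "occurs T (Suc (h Bh)) (map Bit x)" "length x = j" "0 < h Vh" "j \<le> h Vh"
    "T ! (h Vh - 1) \<in> range Bit" "set trs = delta M"
  shows "run_chk M trs T h h' \<longleftrightarrow> (\<exists>n. run_symbols trs (h Vh) n \<and> run M x (past trs (h Vh) n) \<and>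
    state_after M (past trs (h Vh) n) = final M \<and> h' = h(Vh := h Vh + n))"
proof -
  note h = readyD[OF assms(1)]
  define s where "s = h Vh"
  have sL: "s < length T" using h(2) by (simp add: s_def)
  define F where "F n = h(Sh := s + n)" for n
  have inr: "in_run trs x s n (F n)" if "s + n < length T" "\<And>m. m < n \<Longrightarrow> is_trans trs (T ! (s + m))" for n
  proof -
    have "(F n)(Sh := 0) = h" using h(9) by (simp add: F_def fun_eq_iff)
    then show ?thesis using assms that by (simp add: in_run_def F_def s_def)
  qed
  let ?c = "\<lambda>n. 2 * (s + n) < length T \<and> is_trans trs (T ! (s + n)) \<and>
    fst (fst (decode trs (T ! (s + n)))) = state_after M (past trs s n) \<and>
    (\<forall>i<tapes M. snd (fst (decode trs (T ! (s + n)))) ! i = lookup x i (past trs s n) 0)"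
  have bound: "s + n < length T" if "\<And>m. m < n \<Longrightarrow> 2 * (s + m) < length T" for n
  proof (cases n)
    case (Suc m)
    then show ?thesis using that[of m] assms(4) by (simp add: s_def)
  qed (use sL in simp)
  have loop: "star (step_chk M trs) T (F 0) g \<longleftrightarrow> (\<exists>n. (\<forall>m<n. ?c m) \<and> g = F n)" for g
  proof (rule star_family)
    fix m g assume c: "\<And>l. l < m \<Longrightarrow> ?c l"
    then have "in_run trs x s m (F m)" by (intro inr bound) blast+
    moreover have "(F m)(Sh := Suc (s + m)) = F (Suc m)" by (simp add: F_def)
    ultimately show "step_chk M trs T (F m) g \<longleftrightarrow> ?c m \<and> g = F (Suc m)"
      using step_chk_iff[of trs x s m "F m" M g] by simp
  qed simp
  have "run_chk M trs T h h' \<longleftrightarrow> (star (step_chk M trs) ;; state_chk M trs (final M) ;; copy Vh Sh ;; home Sh) T (F 0) h'"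
  proof -
    have "copy Sh Vh T h g \<longleftrightarrow> g = F 0" for g
      using copy_iff[of h Sh Vh g] h(3) sL by (simp add: F_def s_def)
    then show ?thesis unfolding run_chk_def seq_iff[of "copy Sh Vh"] by (simp del: exec)
  qed
  also have "\<dots> \<longleftrightarrow> (\<exists>n. (\<forall>m<n. ?c m) \<and> (state_after M (past trs s n) = final M \<and> h' = h(Vh := s + n)))"
    unfolding seq_iff[of "star P" for P] loop ex_family
  proof (intro ex_cong1 conj_cong refl)
    fix n assume c: "\<forall>m<n. ?c m"
    then have i: "in_run trs x s n (F n)" by (intro inr bound) blast+
    have upd: "(F n)(Vh := s + n, Sh := 0) = h(Vh := s + n)" using h(9) by (simp add: F_def fun_eq_iff)
    have "copy Vh Sh T (F n) g \<longleftrightarrow> g = (F n)(Vh := s + n)" for g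
      using copy_iff[of "F n" Vh Sh g] in_runD[OF i] by simp
    then have "(copy Vh Sh ;; home Sh) T (F n) h' \<longleftrightarrow> h' = h(Vh := s + n)"
      unfolding seq_iff home_iff by (simp add: upd)
    then show "(state_chk M trs (final M) ;; copy Vh Sh ;; home Sh) T (F n) h' \<longleftrightarrow>
      state_after M (past trs s n) = final M \<and> h' = h(Vh := s + n)"
      unfolding seq_iff[of "state_chk M trs q" for q] state_chk_iff[OF i] by blast
  qed
  also have "\<dots> \<longleftrightarrow> (\<exists>n. run_symbols trs s n \<and> run M x (past trs s n) \<and>
    state_after M (past trs s n) = final M \<and> h' = h(Vh := s + n))"
  proof (intro ex_cong1)
    fix n
    have "(\<forall>m<n. ?c m) \<longleftrightarrow> run_symbols trs s n \<and> run M x (past trs s n)"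
    proof
      assume c: "\<forall>m<n. ?c m"
      then have "s + n < length T" by (intro bound) blast
      moreover have "run M x (past trs s n)" using c by (subst run_past_iff[OF assms(7)]) blast+
      ultimately show "run_symbols trs s n \<and> run M x (past trs s n)" using c unfolding run_symbols_def by blast
    next
      assume r: "run_symbols trs s n \<and> run M x (past trs s n)"
      then have t: "\<forall>m<n. is_trans trs (T ! (s + m))" unfolding run_symbols_def by blast
      show "\<forall>m<n. ?c m" using r run_past_iff[OF assms(7) t, of x] unfolding run_symbols_def by blast
    qed
    then show "(\<forall>m<n. ?c m) \<and> (state_after M (past trs s n) = final M \<and> h' = h(Vh := s + n)) \<longleftrightarrow>
      run_symbols trs s n \<and> run M x (past trs s n) \<and> state_after M (past trs s n) = final M \<and> h' = h(Vh := s + n)"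
      by blast
  qed
  finally show ?thesis unfolding s_def .
qed

end


section \<open>Checking a witness\<close>

lemma value_of_less: "value_of bs < 2 ^ length bs"
proof (induction bs rule: rev_induct)
  case (snoc b bs)
  then show ?case by (cases b) simp_all
qed simp

lemma value_of_inj: "length bs = length cs \<Longrightarrow> value_of bs = value_of cs \<Longrightarrow> bs = cs"
proof (induction bs arbitrary: cs rule: rev_induct)
  case (snoc b bs)
  then obtain cs' c where cs: "cs = cs' @ [c]" by (cases cs rule: rev_cases) auto
  have eq: "2 * value_of bs + of_bool b = 2 * value_of cs' + of_bool c"
    using snoc.prems(2) cs by simp
  have "b = c"
  proof (rule ccontr)
    assume "b \<noteq> c"
    then show False using eq by (cases b; cases c; simp; presburger)
  qed
  then have "value_of bs = value_of cs'" using eq by simp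
  then show ?case using snoc.IH[of cs'] snoc.prems(1) cs \<open>b = c\<close> by simp
qed simp

primrec bits_of :: "nat \<Rightarrow> nat \<Rightarrow> bool list" where
  "bits_of 0 v = []"
| "bits_of (Suc n) v = bits_of n (v div 2) @ [odd v]"

lemma length_bits_of [simp]: "length (bits_of n v) = n"
  by (induction n arbitrary: v) simp_all

lemma value_of_bits_of: "v < 2 ^ n \<Longrightarrow> value_of (bits_of n v) = v"
proof (induction n arbitrary: v)
  case (Suc n)
  then have "value_of (bits_of n (v div 2)) = v div 2" by simp
  then show ?case by (cases "odd v") (auto elim!: oddE evenE)
qed simp

lemma node_values_append: "\<exists>v. node_values m C x = x @ v \<and> length v = length C"
proof (induction C rule: rev_induct)
  case (snoc g C)
  then show ?case by (auto simp: node_values_snoc)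
qed simp

text \<open>Comparing the input of a row with the counter \<open>Xh\<close> forces the rows to go
  through the inputs in numeric order, so that none is left out and none is counted twice.\<close>

definition value_chk :: check where
  "value_chk = copy Qh Vh ;; along (read_bit Qh) ;; eq Zh Xh ;; home Zh ;; home Qh"

text \<open>After the pass over the gates the cell to the left of \<open>Vh\<close> belongs to the
  last gate, the output. Only an accepted input is counted and followed by a run; a rejected one
  needs no evidence, because the inclusion of the accepted set in the language is all that a
  certificate claims.\<close>

definition row_chk :: "nat \<Rightarrow> 'a tm_scheme \<Rightarrow> transition list \<Rightarrow> check" where
  "row_chk m M trs = test Vh {MARK} ;; copy Bh Vh ;; right Vh ;; value_chk ;; gates True (eval_chk m) ;;
     right Xh ;; left Vh ;; (test Vh {Bit False} ;; right Vh \<squnion>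
       test Vh {Bit True} ;; right Vh ;; right Kh ;; run_chk M trs)"

lemma realizable_row_chk [realizable_intros]: "realizable (row_chk m M trs)" "realizable value_chk"
  unfolding row_chk_def value_chk_def by (intro realizable_intros)+

context headed_track
begin

lemma read_bits_iff:
  assumes "inside h" "h Yh = 0" "h Zh = 0" "h Jh = 0" "i \<noteq> Jh" "i \<noteq> Yh" "i \<noteq> Zh"
  shows "along (read_bit i) T h h' \<longleftrightarrow> (\<exists>x. length x = j \<and> occurs T (h i) (map Bit x) \<and>
    value_of x < length T \<and> h' = h(i := h i + j, Zh := value_of x))"
proof -
  define q where "q = h i"
  define bits where "bits n = map (\<lambda>l. T ! (q + l) = Bit True) [0..<n]" for n
  have bits: "length (bits n) = n" "bits (Suc n) = bits n @ [T ! (q + n) = Bit True]" "bits 0 = []" for n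
    by (simp_all add: bits_def)
  define F where "F n = h(i := q + n, Zh := value_of (bits n))" for n
  let ?c = "\<lambda>n. T ! (q + n) \<in> range Bit \<and> value_of (bits (Suc n)) < length T \<and> Suc (q + n) < length T"
  have step: "read_bit i T ((F n)(Jh := p)) g \<longleftrightarrow> ?c n \<and> g = (F (Suc n))(Jh := p)"
    if n: "n < j" and c: "\<And>l. l < n \<Longrightarrow> ?c l" and p: "p < length T" for n p g
  proof -
    have "q + n < length T \<and> value_of (bits n) < length T"
    proof (cases n)
      case 0
      then show ?thesis using assms(1) bits(3) by (simp add: q_def)
    next
      case (Suc l)
      then show ?thesis using c[of l] by simp
    qed
    then have "inside ((F n)(Jh := p))" using assms(1) p by (simp add: F_def)
    moreover have "((F n)(Jh := p)) Yh = 0" "((F n)(Jh := p)) i = q + n" "((F n)(Jh := p)) Zh = value_of (bits n)"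
      using assms by (simp_all add: F_def)
    ultimately have "read_bit i T ((F n)(Jh := p)) g \<longleftrightarrow> (\<exists>b. T ! (q + n) = Bit b \<and>
        2 * value_of (bits n) + of_bool b < length T \<and> Suc (q + n) < length T \<and>
        g = ((F n)(Jh := p))(i := Suc (q + n), Zh := 2 * value_of (bits n) + of_bool b))"
      using read_bit_iff[of "(F n)(Jh := p)" i g] assms(5-7) by simp
    also have "\<dots> \<longleftrightarrow> (\<exists>b. T ! (q + n) = Bit b \<and> value_of (bits (Suc n)) < length T \<and> Suc (q + n) < length T \<and>
        g = (F (Suc n))(Jh := p))"
    proof (intro ex_cong1 conj_cong refl)
      fix b assume b: "T ! (q + n) = Bit b"
      have v: "value_of (bits (Suc n)) = 2 * value_of (bits n) + of_bool b" using b by (simp add: bits(2))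
      then show "2 * value_of (bits n) + of_bool b < length T \<longleftrightarrow> value_of (bits (Suc n)) < length T" by simp
      have "((F n)(Jh := p))(i := Suc (q + n), Zh := 2 * value_of (bits n) + of_bool b) = (F (Suc n))(Jh := p)"
        unfolding F_def v using assms(5-7) by (simp add: fun_eq_iff)
      then show "g = ((F n)(Jh := p))(i := Suc (q + n), Zh := 2 * value_of (bits n) + of_bool b) \<longleftrightarrow>
        g = (F (Suc n))(Jh := p)" by simp
    qed
    also have "\<dots> \<longleftrightarrow> ?c n \<and> g = (F (Suc n))(Jh := p)" by (simp add: image_iff)
    finally show ?thesis .
  qed
  have "along (read_bit i) T h h' \<longleftrightarrow> (\<forall>n<j. ?c n) \<and> h' = F j"
  proof (rule along_iff)
    show "F 0 = h" using assms(3) by (simp add: F_def q_def bits(3) fun_eq_iff)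
    show "F n Jh = 0" for n using assms by (simp add: F_def)
  qed (rule step)
  also have "\<dots> \<longleftrightarrow> (\<exists>x. length x = j \<and> occurs T q (map Bit x) \<and> value_of x < length T \<and>
      h' = h(i := q + j, Zh := value_of x))"
  proof
    assume a: "(\<forall>n<j. ?c n) \<and> h' = F j"
    have "q + j < length T \<and> value_of (bits j) < length T"
    proof (cases j)
      case 0
      then show ?thesis using assms(1) bits(3) by (simp add: q_def)
    next
      case (Suc l)
      then show ?thesis using a by simp
    qed
    moreover have "T ! (q + n) = Bit (bits j ! n)" if "n < j" for n
    proof -
      from a that obtain b where "T ! (q + n) = Bit b" by blast
      then show ?thesis using that by (simp add: bits_def)
    qed
    ultimately show "\<exists>x. length x = j \<and> occurs T q (map Bit x) \<and> value_of x < length T \<and>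
      h' = h(i := q + j, Zh := value_of x)"
      using a by (intro exI[of _ "bits j"]) (simp add: occurs_def bits(1) F_def)
  next
    assume "\<exists>x. length x = j \<and> occurs T q (map Bit x) \<and> value_of x < length T \<and>
      h' = h(i := q + j, Zh := value_of x)"
    then obtain x where x: "length x = j" "occurs T q (map Bit x)" "value_of x < length T"
      "h' = h(i := q + j, Zh := value_of x)" by blast
    then have T: "\<And>l. l < j \<Longrightarrow> T ! (q + l) = Bit (x ! l)" and len: "q + j < length T" by (auto simp: occurs_def)
    have b: "bits n = take n x" if "n \<le> j" for n
      using that T x(1) by (intro nth_equalityI) (simp_all add: bits_def)
    \<comment> \<open>Prefixes have smaller values, so no intermediate result overflows if the final
      one fits.\<close>
    have mono: "value_of (take n x) \<le> value_of x" for n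
    proof (induction x rule: rev_induct)
      case (snoc b x)
      then show ?case by (cases "n \<le> length x") simp_all
    qed simp
    have "?c n" if "n < j" for n
      using T[OF that] b[of "Suc n"] mono[of "Suc n"] x(3) that len by simp
    moreover have "bits j = x" using b[of j] x(1) by simp
    ultimately show "(\<forall>n<j. ?c n) \<and> h' = F j" using x(4) by (simp add: F_def)
  qed
  finally show ?thesis unfolding q_def .
qed

lemma value_chk_iff:
  assumes "ready h"
  shows "value_chk T h h' \<longleftrightarrow> (\<exists>x. length x = j \<and> occurs T (h Vh) (map Bit x) \<and> value_of x = h Xh) \<and> h' = h"
proof -
  note h = readyD[OF assms]
  define g where "g = h(Qh := h Vh)"
  have g: "inside g" "g Yh = 0" "g Zh = 0" "g Jh = 0" "g Qh = h Vh" using h by (simp_all add: g_def)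
  have bits: "along (read_bit Qh) T g g' \<longleftrightarrow> (\<exists>x. length x = j \<and> occurs T (h Vh) (map Bit x) \<and>
    value_of x < length T \<and> g' = h(Qh := h Vh + j, Zh := value_of x))" for g'
  proof -
    have "g(Qh := q, Zh := v) = h(Qh := q, Zh := v)" for q v by (simp add: g_def)
    then show ?thesis using read_bits_iff[OF g(1-4), of Qh g'] unfolding g(5) by simp
  qed
  have rest: "(eq Zh Xh ;; home Zh ;; home Qh) T (h(Qh := q, Zh := v)) h' \<longleftrightarrow> v = h Xh \<and> h' = h" if "v < length T" for q v
  proof -
    have "eq Zh Xh T (h(Qh := q, Zh := v)) g' \<longleftrightarrow> v = h Xh \<and> g' = h(Qh := q, Zh := v)" for g'
      using eq_iff[of "h(Qh := q, Zh := v)" Zh Xh g'] h(3) that by simp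
    moreover have "h(Qh := q, Zh := v, Zh := 0, Qh := 0) = h" using h(6,7) by (simp add: fun_eq_iff)
    ultimately show ?thesis
      by (simp add: seq_iff[of "eq i k" for i k] seq_iff[of "home i" for i] home_iff)
  qed
  have "copy Qh Vh T h g' \<longleftrightarrow> g' = g" for g'
    using copy_iff[of h Qh Vh g'] h(2,3) by (simp add: g_def)
  then have "value_chk T h h' \<longleftrightarrow> (along (read_bit Qh) ;; eq Zh Xh ;; home Zh ;; home Qh) T g h'"
    unfolding value_chk_def seq_iff[of "copy Qh Vh"] by (simp del: exec)
  also have "\<dots> \<longleftrightarrow> (\<exists>x. (length x = j \<and> occurs T (h Vh) (map Bit x) \<and> value_of x < length T) \<and>
      (eq Zh Xh ;; home Zh ;; home Qh) T (h(Qh := h Vh + j, Zh := value_of x)) h')"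
    unfolding seq_iff[of "along P" for P] bits by blast
  also have "\<dots> \<longleftrightarrow> (\<exists>x. (length x = j \<and> occurs T (h Vh) (map Bit x) \<and> value_of x < length T) \<and>
      value_of x = h Xh \<and> h' = h)"
    using rest by (intro ex_cong1 conj_cong refl) blast
  also have "\<dots> \<longleftrightarrow> (\<exists>x. length x = j \<and> occurs T (h Vh) (map Bit x) \<and> value_of x = h Xh) \<and> h' = h"
    using insideD[OF h(2), of Xh] by auto
  finally show ?thesis .
qed

definition row_end :: "'a tm_scheme \<Rightarrow> transition list \<Rightarrow> bool list \<Rightarrow> bool \<Rightarrow> nat \<Rightarrow> nat \<Rightarrow> bool" where
  "row_end M trs x b e n \<longleftrightarrow> (if b then run_symbols trs e n \<and> run M x (past trs e n) \<and>
     state_after M (past trs e n) = final M else n = 0)"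

lemma row_chk_iff:
  assumes r: "ready h" and C: "C \<noteq> []" "occurs T (h Ch) (code C)" and V: "j \<le> h Vh" and m: "0 < m"
    and trs: "set trs = delta M"
  shows "row_chk m M trs T h h' \<longleftrightarrow> (\<exists>x n. T ! h Vh = MARK \<and> length x = j \<and> value_of x = h Xh \<and>
    occurs T (Suc (h Vh)) (map Bit (node_values m C x)) \<and> wf_circuit j C \<and> Suc (h Xh) < length T \<and>
    (circuit_eval m C x \<longrightarrow> Suc (h Kh) < length T) \<and>
    row_end M trs x (circuit_eval m C x) (h Vh + Suc j + length C) n \<and>
    h' = h(Bh := h Vh, Vh := h Vh + Suc j + length C + n, Xh := Suc (h Xh),
      Kh := h Kh + of_bool (circuit_eval m C x)))"
proof -
  note h = readyD[OF r]
  define v where "v = h Vh"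
  define e where "e = v + Suc j + length C"
  define g1 where "g1 = h(Bh := v, Vh := Suc v)"
  define g2 where "g2 = h(Bh := v, Vh := e, Xh := Suc (h Xh))"
  define tail where "tail = (test Vh {Bit False} ;; right Vh \<squnion>
       test Vh {Bit True} ;; right Vh ;; right Kh ;; run_chk M trs)"
  have "row_chk m M trs T h h' \<longleftrightarrow> T ! v = MARK \<and> Suc v < length T \<and>
    (value_chk ;; gates True (eval_chk m) ;; right Xh ;; left Vh ;; tail) T g1 h'"
  proof -
    have "copy Bh Vh T h g \<longleftrightarrow> g = h(Bh := v)" for g
      using copy_iff[of h Bh Vh g] h(2,3) by (simp add: v_def)
    then show ?thesis using insideD[OF h(2), of Vh]
      by (simp add: row_chk_def tail_def[symmetric] seq_iff[of "copy i k" for i k] g1_def v_def del: exec(4-))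
  qed
  also have "\<dots> \<longleftrightarrow> T ! v = MARK \<and> Suc v < length T \<and>
    (\<exists>x. length x = j \<and> occurs T (Suc v) (map Bit x) \<and> value_of x = h Xh) \<and>
    circuit_ok (eval_rule m) True v (Suc v + j) C \<and> Suc (h Xh) < length T \<and> (left Vh ;; tail) T g2 h'"
  proof (intro conj_cong refl)
    assume "Suc v < length T"
    then have r1: "ready g1" using r h by (simp add: ready_def idle_def g1_def v_def)
    have g1: "g1 Vh = Suc v" "g1 Xh = h Xh" "g1 Bh = v" "g1 Ch = h Ch" by (simp_all add: g1_def)
    note h1 = readyD[OF r1]
    have "(value_chk ;; gates True (eval_chk m) ;; right Xh ;; left Vh ;; tail) T g1 h' \<longleftrightarrow>
      (\<exists>x. length x = j \<and> occurs T (Suc v) (map Bit x) \<and> value_of x = h Xh) \<and>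
      (gates True (eval_chk m) ;; right Xh ;; left Vh ;; tail) T g1 h'"
      unfolding seq_iff[of value_chk] value_chk_iff[OF r1] g1 by blast
    moreover have "gates True (eval_chk m) T g1 g \<longleftrightarrow> circuit_ok (eval_rule m) True v (Suc v + j) C \<and>
        g = g1(Vh := e)" for g
      using gates_code_iff[OF h1(1) eval_chk_spec[OF m] h1(4,5) C(1), of True g] C(2) unfolding g1 by (simp add: e_def)
    then have "(gates True (eval_chk m) ;; right Xh ;; left Vh ;; tail) T g1 h' \<longleftrightarrow>
      circuit_ok (eval_rule m) True v (Suc v + j) C \<and> (right Xh ;; left Vh ;; tail) T (g1(Vh := e)) h'"
      unfolding seq_iff[of "gates r P" for r P] by (simp del: exec)
    moreover have "(right Xh ;; left Vh ;; tail) T (g1(Vh := e)) h' \<longleftrightarrow>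
      Suc (h Xh) < length T \<and> (left Vh ;; tail) T g2 h'"
    proof -
      have "g1(Vh := e, Xh := Suc (h Xh)) = g2" by (simp add: g1_def g2_def)
      then show ?thesis unfolding exec(2) by (simp add: g1(2) del: exec)
    qed
    ultimately show "(value_chk ;; gates True (eval_chk m) ;; right Xh ;; left Vh ;; tail) T g1 h' \<longleftrightarrow>
      (\<exists>x. length x = j \<and> occurs T (Suc v) (map Bit x) \<and> value_of x = h Xh) \<and>
      circuit_ok (eval_rule m) True v (Suc v + j) C \<and> Suc (h Xh) < length T \<and> (left Vh ;; tail) T g2 h'"
      by blast
  qed
  also have "\<dots> \<longleftrightarrow> (\<exists>x. T ! v = MARK \<and> length x = j \<and> value_of x = h Xh \<and>
    occurs T (Suc v) (map Bit (node_values m C x)) \<and> wf_circuit j C \<and> Suc (h Xh) < length T \<and>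
    (left Vh ;; tail) T g2 h')"
  proof -
    have "occurs T (Suc v) (map Bit x)" "Suc v < length T"
      if "occurs T (Suc v) (map Bit (node_values m C x))" for x
    proof -
      obtain u where "node_values m C x = x @ u" using node_values_append by blast
      then show "occurs T (Suc v) (map Bit x)" using that by (simp add: occurs_append)
      show "Suc v < length T" using occurs_less[OF that] by simp
    qed
    then show ?thesis using circuit_ok_eval_iff[OF C(1), of _ v m] by blast
  qed
  also have "\<dots> \<longleftrightarrow> (\<exists>x n. T ! v = MARK \<and> length x = j \<and> value_of x = h Xh \<and>
    occurs T (Suc v) (map Bit (node_values m C x)) \<and> wf_circuit j C \<and> Suc (h Xh) < length T \<and>
    (circuit_eval m C x \<longrightarrow> Suc (h Kh) < length T) \<and>
    row_end M trs x (circuit_eval m C x) e n \<and>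
    h' = h(Bh := v, Vh := e + n, Xh := Suc (h Xh), Kh := h Kh + of_bool (circuit_eval m C x)))"
  proof (intro ex_cong1)
    fix x
    have regroup: "(B' \<Longrightarrow> D' \<Longrightarrow> F' \<Longrightarrow> W = (\<exists>n. Q n)) \<Longrightarrow>
        (A \<and> B' \<and> C' \<and> D' \<and> E \<and> F' \<and> W) = (\<exists>n. A \<and> B' \<and> C' \<and> D' \<and> E \<and> F' \<and> Q n)"
      for A B' C' D' E F' W and Q :: "nat \<Rightarrow> bool" by blast
    show "(T ! v = MARK \<and> length x = j \<and> value_of x = h Xh \<and>
        occurs T (Suc v) (map Bit (node_values m C x)) \<and> wf_circuit j C \<and> Suc (h Xh) < length T \<and>
        (left Vh ;; tail) T g2 h') \<longleftrightarrow>
      (\<exists>n. T ! v = MARK \<and> length x = j \<and> value_of x = h Xh \<and>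
        occurs T (Suc v) (map Bit (node_values m C x)) \<and> wf_circuit j C \<and> Suc (h Xh) < length T \<and>
        (circuit_eval m C x \<longrightarrow> Suc (h Kh) < length T) \<and> row_end M trs x (circuit_eval m C x) e n \<and>
        h' = h(Bh := v, Vh := e + n, Xh := Suc (h Xh), Kh := h Kh + of_bool (circuit_eval m C x)))"
    proof (rule regroup)
    assume x: "length x = j" "occurs T (Suc v) (map Bit (node_values m C x))" and X: "Suc (h Xh) < length T"
    define b where "b = circuit_eval m C x"
    have e: "e < length T" "0 < e" using occurs_less[OF x(2)] x(1) by (simp_all add: e_def)
    have lenC: "0 < length C" using C(1) by simp
    have out: "T ! (e - 1) = Bit b"
    proof -
      have "T ! (Suc v + (j + length C - 1)) = Bit (node_values m C x ! (j + length C - 1))"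
        using x lenC by (simp add: occurs_def)
      moreover have "Suc v + (j + length C - 1) = e - 1" using lenC by (simp add: e_def)
      ultimately show ?thesis unfolding b_def circuit_eval_nth[OF C(1)] x(1) by simp
    qed
    have g2: "g2 Vh = e" "g2 Kh = h Kh" by (simp_all add: g2_def)
    have upd: "g2(Vh := e - 1, Vh := Suc (e - 1)) = g2" using e(2) g2(1) by (simp add: fun_eq_iff)
    have sub: "left Vh T g2 (g2(Vh := e - 1))" using e(2) g2(1) by (simp add: left_def)
    have "(left Vh ;; tail) T g2 h' \<longleftrightarrow> tail T (g2(Vh := e - 1)) h'"
      unfolding exec(3) g2(1) using e(2) by simp
    also have "\<dots> \<longleftrightarrow> (if b then (right Kh ;; run_chk M trs) T g2 h' else h' = g2)"
    proof -
      have "e - 1 < length T" "Suc (e - 1) = e" using e by simp_all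
      then show ?thesis unfolding tail_def using out upd e
        by (cases b) (simp_all add: right_def)
    qed
    also have "\<dots> \<longleftrightarrow> (\<exists>n. (b \<longrightarrow> Suc (h Kh) < length T) \<and> row_end M trs x b e n \<and>
      h' = h(Bh := v, Vh := e + n, Xh := Suc (h Xh), Kh := h Kh + of_bool b))"
    proof (cases b)
      case False
      have "g2 = h(Bh := v, Vh := e, Xh := Suc (h Xh), Kh := h Kh)" by (simp add: g2_def fun_eq_iff)
      then show ?thesis using False by (simp add: row_end_def)
    next
      case True
      define g3 where "g3 = g2(Kh := Suc (h Kh))"
      have "run_chk M trs T g3 h' \<longleftrightarrow> (\<exists>n. row_end M trs x b e n \<and>
          h' = h(Bh := v, Vh := e + n, Xh := Suc (h Xh), Kh := h Kh + of_bool b))" if "Suc (h Kh) < length T"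
      proof -
        have "v < length T" using insideD[OF h(2)] by (simp add: v_def)
        then have "ready g3" using r e X that by (simp add: ready_def idle_def g3_def g2_def)
        moreover have "g3 Bh = v" "g3 Vh = e" by (simp_all add: g3_def g2_def)
        moreover have "occurs T (Suc v) (map Bit x)"
        proof -
          obtain u where "node_values m C x = x @ u" using node_values_append by blast
          then show ?thesis using x(2) by (simp add: occurs_append)
        qed
        moreover have "j \<le> e" by (simp add: e_def)
        moreover have "g3(Vh := y) = h(Bh := v, Vh := y, Xh := Suc (h Xh), Kh := h Kh + of_bool b)" for y
          using True by (simp add: g3_def g2_def fun_eq_iff)
        ultimately show ?thesis
          using run_chk_iff[of g3 x trs M h'] x(1) e(2) out True trs by (simp add: row_end_def)
      qed
      then show ?thesis using True unfolding exec(2) g2(2) g3_def[symmetric] by (auto simp: right_def)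
    qed
    finally show "(left Vh ;; tail) T g2 h' \<longleftrightarrow>
     (\<exists>n. (circuit_eval m C x \<longrightarrow> Suc (h Kh) < length T) \<and> row_end M trs x (circuit_eval m C x) e n \<and>
      h' = h(Bh := v, Vh := e + n, Xh := Suc (h Xh), Kh := h Kh + of_bool (circuit_eval m C x)))"
      unfolding b_def .
    qed
  qed
  finally show ?thesis unfolding v_def e_def .
qed

end


section \<open>The complete check of a witness\<close>

definition header_chk :: check where
  "header_chk = right Dh ;; star (test Dh {Bit True} ;; right Dh) ;; test Dh {Bit False} ;; right Dh"

primrec repeat :: "nat \<Rightarrow> check \<Rightarrow> check" where
  "repeat 0 P = skip"
| "repeat (Suc n) P = P ;; repeat n P"

text \<open>Starting from 1, \<open>c\<close> multiplications put \<open>(j + 2) ^ c\<close> into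
  \<open>Zh\<close>, a budget from which each bit of the witness takes one unit. This bound keeps
  the search polynomial and, in the end, the size of the circuits.\<close>

definition length_chk :: "nat \<Rightarrow> check" where
  "length_chk c = copy Qh Dh ;; right Zh ;; repeat c times_length ;;
     star (test Qh (range Bit) ;; right Qh ;; left Zh) ;; test Qh {STOP} ;; copy Vh Qh ;; right Vh ;;
     home Qh ;; home Zh"

text \<open>One bit more than the input length is read, since the census can be as large as
  \<open>2 ^ j\<close>.\<close>

definition census_chk :: check where
  "census_chk = along (read_bit Dh) ;; read_bit Dh ;; copy Uh Zh ;; home Zh"

text \<open>\<open>Xh\<close> equal to \<open>2 ^ j\<close> means that every input has had its row;
  only then is the count in \<open>Kh\<close> the census of the circuit.\<close>

definition end_chk :: check where
  "end_chk = right Zh ;; along double ;; eq Zh Xh ;; home Zh ;; eq Uh Kh"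

definition witness_chk :: "nat \<Rightarrow> nat \<Rightarrow> 'a tm_scheme \<Rightarrow> transition list \<Rightarrow> check" where
  "witness_chk c m M trs = length_chk c ;; census_chk ;; depth_chk ;; star (row_chk m M trs) ;; end_chk"

lemma realizable_witness_chk: "realizable (header_chk ;; witness_chk c m M trs)"
proof -
  have "realizable (repeat c times_length)" by (induction c) (simp_all only: repeat.simps realizable_intros)
  then show ?thesis
    unfolding witness_chk_def header_chk_def length_chk_def census_chk_def end_chk_def
    by (intro realizable_intros)
qed

definition accepted :: "nat \<Rightarrow> circuit \<Rightarrow> nat \<Rightarrow> bool list set" where
  "accepted m C j = {x. length x = j \<and> circuit_eval m C x}"

text \<open>
  The lexicographic order of these words ranks a larger census first, then a smaller depth: the
  depth bound \<open>d\<close> is coded as \<open>0\<^sup>d 1\<close>.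
\<close>

definition witness :: "bool list \<Rightarrow> nat \<Rightarrow> circuit \<Rightarrow> bool list" where
  "witness r d C = r @ replicate d False @ [True] @ encode_circuit C"

text \<open>Of the language only an inclusion is required: a circuit that misses members is a
  legitimate witness, merely with a smaller census. This one-sidedness is what keeps the condition
  within NE.\<close>

definition witness_for :: "nat \<Rightarrow> nat \<Rightarrow> language \<Rightarrow> nat \<Rightarrow> bool list \<Rightarrow> nat \<Rightarrow> circuit \<Rightarrow> bool" where
  "witness_for c m A j r d C \<longleftrightarrow> length r = Suc j \<and> length (witness r d C) \<le> (j + 2) ^ c \<and>
     wf_circuit j C \<and> circuit_depth j C \<le> d \<and> accepted m C j \<subseteq> A \<and> value_of r = card (accepted m C j)"

lemma finite_lists_length: "finite {x :: bool list. length x = j}"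
  using finite_lists_length_eq[of "UNIV :: bool set" j] by simp

text \<open>The set whose size \<open>Kh\<close> has reached once the inputs with numbers below
  \<open>X\<close> have had their rows.\<close>

definition accepted_below :: "nat \<Rightarrow> circuit \<Rightarrow> nat \<Rightarrow> nat \<Rightarrow> bool list set" where
  "accepted_below m C j X = {x \<in> accepted m C j. value_of x < X}"

lemma finite_accepted_below: "finite (accepted_below m C j X)"
  by (rule finite_subset[OF _ finite_lists_length[of j]]) (auto simp: accepted_below_def accepted_def)

lemma accepted_below_0 [simp]: "accepted_below m C j 0 = {}"
  by (simp add: accepted_below_def)

lemma accepted_below_top: "accepted_below m C j (2 ^ j) = accepted m C j"
  using value_of_less by (auto simp: accepted_below_def accepted_def)

lemma accepted_below_Suc:
  assumes "length x = j"
  shows "accepted_below m C j (Suc (value_of x)) =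
    (if circuit_eval m C x then insert x else id) (accepted_below m C j (value_of x))"
proof -
  have "y = x" if "length y = j" "value_of y = value_of x" for y
    using value_of_inj[of y x] that assms by simp
  then show ?thesis using assms by (auto simp: accepted_below_def accepted_def less_Suc_eq)
qed

lemma card_accepted_below_Suc:
  assumes "length x = j"
  shows "card (accepted_below m C j (Suc (value_of x))) =
    card (accepted_below m C j (value_of x)) + of_bool (circuit_eval m C x)"
proof -
  have "x \<notin> accepted_below m C j (value_of x)" by (simp add: accepted_below_def)
  then show ?thesis unfolding accepted_below_Suc[OF assms] using finite_accepted_below by simp
qed

lemma card_accepted_below_le: "card (accepted_below m C j X) \<le> X"
proof -
  have "inj_on value_of (accepted_below m C j X)"
    by (rule inj_onI) (auto simp: accepted_below_def accepted_def intro: value_of_inj)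
  moreover have "value_of ` accepted_below m C j X \<subseteq> {..<X}" by (auto simp: accepted_below_def)
  ultimately show ?thesis by (metis card_image card_lessThan card_mono finite_lessThan)
qed

context headed_track
begin

text \<open>From a positive start the products only grow, so room for the last one is room for
  all.\<close>

lemma repeat_times_length_iff:
  assumes "inside h" "h Jh = 0" "h Yh = 0" "0 < h Zh"
  shows "repeat c times_length T h h' \<longleftrightarrow> (j + 2) ^ c * h Zh < length T \<and> h' = h(Zh := (j + 2) ^ c * h Zh)"
  using assms
proof (induction c arbitrary: h)
  case 0
  then show ?case by (simp add: skip_def)
next
  case (Suc c)
  define z where "z = (j + 2) * h Zh"
  define g where "g = h(Zh := z)"
  have upd: "g(Zh := y) = h(Zh := y)" for y by (simp add: g_def)
  have z: "(j + 2) ^ c * z = (j + 2) ^ Suc c * h Zh" by (simp only: z_def power_Suc mult_ac)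
  have le: "z \<le> (j + 2) ^ c * z" using mult_le_mono1[of 1 "(j + 2) ^ c" z] by simp
  have "0 < z" using Suc.prems(4) by (simp add: z_def)
  have IH: "repeat c times_length T g h' \<longleftrightarrow> (j + 2) ^ c * z < length T \<and> h' = h(Zh := (j + 2) ^ c * z)"
    if "z < length T"
  proof -
    have g: "inside g" "g Jh = 0" "g Yh = 0" "g Zh = z" using Suc.prems that by (simp_all add: g_def)
    then have "repeat c times_length T g h' \<longleftrightarrow> (j + 2) ^ c * g Zh < length T \<and> h' = g(Zh := (j + 2) ^ c * g Zh)"
      using \<open>0 < z\<close> by (intro Suc.IH) (simp_all only:)
    then show ?thesis by (simp only: upd g(4))
  qed
  have "repeat (Suc c) times_length T h h' \<longleftrightarrow> z < length T \<and> repeat c times_length T g h'"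
    unfolding g_def repeat.simps seq_iff times_length_iff[OF Suc.prems(1-3)] z_def by (simp del: exec)
  then show ?case using IH le unfolding z[symmetric] by (meson le_less_trans)
qed

lemma length_chk_iff:
  assumes "ready h"
  shows "length_chk c T h h' \<longleftrightarrow> (\<exists>y. occurs T (h Dh) (map Bit y @ [STOP]) \<and> length y \<le> (j + 2) ^ c \<and>
    (j + 2) ^ c < length T \<and> h' = h(Vh := h Dh + length y + 1))"
proof -
  note h = readyD[OF assms]
  define q where "q = h Dh"
  define N where "N = (j + 2) ^ c"
  define F where "F n = h(Qh := q + n, Zh := N - n)" for n
  have q: "q < length T" using h(2) by (simp add: q_def)
  have loop: "star (test Qh (range Bit) ;; right Qh ;; left Zh) T (F 0) g \<longleftrightarrow>
    (\<exists>n. (\<forall>m<n. T ! (q + m) \<in> range Bit \<and> Suc (q + m) < length T \<and> m < N) \<and> g = F n)" for g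
  proof (rule star_family)
    fix m g assume c: "\<And>l. l < m \<Longrightarrow> T ! (q + l) \<in> range Bit \<and> Suc (q + l) < length T \<and> l < N"
    have "q + m < length T" using q c[of "m - 1"] by (cases m) auto
    moreover have "(F m)(Qh := Suc (q + m), Zh := N - m - 1) = F (Suc m)" by (rule ext) (simp add: F_def)
    moreover have "F m Qh = q + m" "F m Zh = N - m" by (simp_all add: F_def)
    ultimately show "(test Qh (range Bit) ;; right Qh ;; left Zh) T (F m) g \<longleftrightarrow>
      (T ! (q + m) \<in> range Bit \<and> Suc (q + m) < length T \<and> m < N) \<and> g = F (Suc m)"
      by (simp add: left_def)
  qed simp
  have start: "length_chk c T h h' \<longleftrightarrow> N < length T \<and> (star (test Qh (range Bit) ;; right Qh ;; left Zh) ;;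
     test Qh {STOP} ;; copy Vh Qh ;; right Vh ;; home Qh ;; home Zh) T (F 0) h'"
  proof -
    define g where "g = h(Qh := q, Zh := 1)"
    have g: "inside g" "g Jh = 0" "g Yh = 0" "g Zh = 1" using h q long by (simp_all add: g_def)
    have "copy Qh Dh T h g' \<longleftrightarrow> g' = h(Qh := q)" for g'
      using copy_iff[of h Qh Dh g'] h(3) q by (simp add: q_def)
    then have "length_chk c T h h' \<longleftrightarrow> (repeat c times_length ;; star (test Qh (range Bit) ;; right Qh ;; left Zh) ;;
       test Qh {STOP} ;; copy Vh Qh ;; right Vh ;; home Qh ;; home Zh) T g h'"
      unfolding length_chk_def seq_iff[of "copy Qh Dh"] exec(2) using long h(7)
      by (simp add: g_def del: exec)
    moreover have "repeat c times_length T g g' \<longleftrightarrow> N < length T \<and> g' = F 0" for g'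
      using repeat_times_length_iff[of g c g'] g by (simp add: N_def F_def) (simp add: g_def)
    ultimately show ?thesis unfolding seq_iff[of "repeat c P" for P] by (simp del: exec)
  qed
  have fin: "(test Qh {STOP} ;; copy Vh Qh ;; right Vh ;; home Qh ;; home Zh) T (F n) h' \<longleftrightarrow>
      T ! (q + n) = STOP \<and> Suc (q + n) < length T \<and> h' = h(Vh := q + n + 1)" for n
  proof -
    have F: "F n Qh = q + n" "F n Ah = 0" using h by (simp_all add: F_def)
    have upd: "(F n)(Vh := x, Vh := Suc (q + n), Qh := 0, Zh := 0) = h(Vh := q + n + 1)" for x
      using h by (simp add: F_def fun_eq_iff)
    have "copy Vh Qh T (F n) g \<longleftrightarrow> q + n < length T \<and> g = (F n)(Vh := q + n)" for g
      using copy_iff[of "F n" Vh Qh g] F by simp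
    then have "(copy Vh Qh ;; right Vh ;; home Qh ;; home Zh) T (F n) h' \<longleftrightarrow>
       Suc (q + n) < length T \<and> h' = h(Vh := q + n + 1)"
      unfolding seq_iff[of "copy Vh Qh"] exec(2) seq_iff[of "home i" for i] home_iff
      using upd by auto
    then show ?thesis unfolding exec(1) F(1) by auto
  qed
  have "length_chk c T h h' \<longleftrightarrow> N < length T \<and> (\<exists>n. (\<forall>m<n. T ! (q + m) \<in> range Bit \<and> Suc (q + m) < length T \<and> m < N) \<and>
    T ! (q + n) = STOP \<and> Suc (q + n) < length T \<and> h' = h(Vh := q + n + 1))"
    unfolding start seq_iff[of "star P" for P] loop ex_family fin ..
  also have "\<dots> \<longleftrightarrow> (\<exists>y. occurs T q (map Bit y @ [STOP]) \<and> length y \<le> N \<and>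
    N < length T \<and> h' = h(Vh := q + length y + 1))"
  proof (intro iffI; elim conjE exE)
    fix n
    assume a: "N < length T" "\<forall>m<n. T ! (q + m) \<in> range Bit \<and> Suc (q + m) < length T \<and> m < N"
      "T ! (q + n) = STOP" "Suc (q + n) < length T" "h' = h(Vh := q + n + 1)"
    define y where "y = map (\<lambda>m. T ! (q + m) = Bit True) [0..<n]"
    have "T ! (q + m) = Bit (y ! m)" if "m < n" for m
    proof -
      from a(2) that obtain b where "T ! (q + m) = Bit b" by blast
      then show ?thesis using that by (simp add: y_def)
    qed
    then have "occurs T q (map Bit y @ [STOP])" using a(3,4) by (simp add: occurs_snoc y_def) (simp add: occurs_def)
    moreover have "length y = n" by (simp add: y_def)
    moreover have "\<not> N < n" using a(2) by blast
    ultimately show "\<exists>y. occurs T q (map Bit y @ [STOP]) \<and> length y \<le> N \<and>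
      N < length T \<and> h' = h(Vh := q + length y + 1)" using a by (intro exI[of _ y]) simp
  next
    fix y
    assume a: "occurs T q (map Bit y @ [STOP])" "length y \<le> N" "N < length T" "h' = h(Vh := q + length y + 1)"
    from a(1) have "occurs T q (map Bit y)" "T ! (q + length y) = STOP" "Suc (q + length y) < length T"
      by (simp_all add: occurs_snoc)
    moreover from this(1) have "T ! (q + m) = Bit (y ! m)" if "m < length y" for m
      using that by (simp add: occurs_def)
    ultimately show "N < length T \<and> (\<exists>n. (\<forall>m<n. T ! (q + m) \<in> range Bit \<and> Suc (q + m) < length T \<and> m < N) \<and>
      T ! (q + n) = STOP \<and> Suc (q + n) < length T \<and> h' = h(Vh := q + n + 1))"
      using a by (intro conjI exI[of _ "length y"]) auto
  qed
  finally show ?thesis unfolding q_def N_def .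
qed

lemma census_chk_iff:
  assumes "ready h"
  shows "census_chk T h h' \<longleftrightarrow> (\<exists>r. length r = Suc j \<and> occurs T (h Dh) (map Bit r) \<and> value_of r < length T \<and>
    h' = h(Dh := h Dh + Suc j, Uh := value_of r))"
proof -
  note h = readyD[OF assms]
  define q where "q = h Dh"
  have "along (read_bit Dh) T h g \<longleftrightarrow> (\<exists>x. (length x = j \<and> occurs T q (map Bit x) \<and>
    value_of x < length T) \<and> g = h(Dh := q + j, Zh := value_of x))" for g
    using read_bits_iff[OF h(2,8,7,4), of Dh g] by (simp add: q_def conj_assoc)
  then have "census_chk T h h' \<longleftrightarrow> (\<exists>x. (length x = j \<and> occurs T q (map Bit x) \<and> value_of x < length T) \<and>
    (read_bit Dh ;; copy Uh Zh ;; home Zh) T (h(Dh := q + j, Zh := value_of x)) h')"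
    unfolding census_chk_def seq_iff[of "along P" for P] by (simp only: ex_family)
  also have "\<dots> \<longleftrightarrow> (\<exists>x b. (length x = j \<and> occurs T q (map Bit x)) \<and> T ! (q + j) = Bit b \<and> Suc (q + j) < length T \<and>
    value_of (x @ [b]) < length T \<and> h' = h(Dh := Suc (q + j), Uh := value_of (x @ [b])))"
  proof (intro ex_cong1)
    fix x
    define v where "v = value_of x"
    define g where "g = h(Dh := q + j, Zh := v)"
    have "(read_bit Dh ;; copy Uh Zh ;; home Zh) T g h' \<longleftrightarrow> (\<exists>b. T ! (q + j) = Bit b \<and> Suc (q + j) < length T \<and>
      2 * v + of_bool b < length T \<and> h' = h(Dh := Suc (q + j), Uh := 2 * v + of_bool b))"
      if "q + j < length T" "v < length T"
    proof -
      have g: "inside g" "g Yh = 0" "g Dh = q + j" "g Zh = v" "g Ah = 0" using h that by (simp_all add: g_def)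
      have "(copy Uh Zh ;; home Zh) T (g(Dh := Suc (q + j), Zh := w)) h' \<longleftrightarrow> h' = h(Dh := Suc (q + j), Uh := w)"
        if "w < length T" for w
      proof -
        have "g(Dh := Suc (q + j), Zh := w, Uh := w, Zh := 0) = h(Dh := Suc (q + j), Uh := w)"
          using h(7) by (simp add: g_def fun_eq_iff)
        then show ?thesis
          using copy_iff[of "g(Dh := Suc (q + j), Zh := w)" Uh Zh] that g(5)
          unfolding seq_iff home_iff by simp
      qed
      moreover have "read_bit Dh T g g' \<longleftrightarrow> (\<exists>b. (T ! (q + j) = Bit b \<and> 2 * v + of_bool b < length T \<and>
          Suc (q + j) < length T) \<and> g' = g(Dh := Suc (q + j), Zh := 2 * v + of_bool b))" for g'
        using read_bit_iff[OF g(1,2), of Dh g'] unfolding g(3,4) by (simp add: conj_assoc)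
      ultimately show ?thesis unfolding seq_iff[of "read_bit Dh"]
        by (simp only: ex_family) (intro ex_cong1, blast)
    qed
    note step = this
    have q: "q + j < length T" if "occurs T q (map Bit x)" "length x = j"
      using occurs_less[OF that(1)] that(2) by simp
    have v: "v < length T" if "2 * v + of_bool b < length T" for b :: bool using that by simp
    show "((length x = j \<and> occurs T q (map Bit x) \<and> value_of x < length T) \<and>
      (read_bit Dh ;; copy Uh Zh ;; home Zh) T (h(Dh := q + j, Zh := value_of x)) h') \<longleftrightarrow>
      (\<exists>b. (length x = j \<and> occurs T q (map Bit x)) \<and> T ! (q + j) = Bit b \<and> Suc (q + j) < length T \<and>
      value_of (x @ [b]) < length T \<and> h' = h(Dh := Suc (q + j), Uh := value_of (x @ [b])))"
      unfolding value_of_snoc v_def[symmetric] g_def[symmetric]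
    proof (intro iffI; elim conjE exE)
      assume "length x = j" "occurs T q (map Bit x)" "v < length T"
        "(read_bit Dh ;; copy Uh Zh ;; home Zh) T g h'"
      then show "\<exists>b. (length x = j \<and> occurs T q (map Bit x)) \<and> T ! (q + j) = Bit b \<and> Suc (q + j) < length T \<and>
        2 * v + of_bool b < length T \<and> h' = h(Dh := Suc (q + j), Uh := 2 * v + of_bool b)"
        using step[OF q] by blast
    next
      fix b
      assume a: "length x = j" "occurs T q (map Bit x)" "T ! (q + j) = Bit b" "Suc (q + j) < length T"
        "2 * v + of_bool b < length T" "h' = h(Dh := Suc (q + j), Uh := 2 * v + of_bool b)"
      then have "(read_bit Dh ;; copy Uh Zh ;; home Zh) T g h'"
        by (intro step[OF q v, THEN iffD2] exI[of _ b] conjI)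
      with a v show "(length x = j \<and> occurs T q (map Bit x) \<and> v < length T) \<and>
        (read_bit Dh ;; copy Uh Zh ;; home Zh) T g h'" by blast
    qed
  qed
  also have "\<dots> \<longleftrightarrow> (\<exists>r. length r = Suc j \<and> occurs T q (map Bit r) \<and> value_of r < length T \<and>
    h' = h(Dh := q + Suc j, Uh := value_of r))"
  proof (intro iffI; elim exE conjE)
    fix x b
    assume a: "length x = j" "occurs T q (map Bit x)" "T ! (q + j) = Bit b" "Suc (q + j) < length T"
      "value_of (x @ [b]) < length T" "h' = h(Dh := Suc (q + j), Uh := value_of (x @ [b]))"
    then have "occurs T q (map Bit (x @ [b]))" by (simp add: occurs_snoc)
    with a show "\<exists>r. length r = Suc j \<and> occurs T q (map Bit r) \<and> value_of r < length T \<and>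
      h' = h(Dh := q + Suc j, Uh := value_of r)" by (intro exI[of _ "x @ [b]"]) simp
  next
    fix r
    assume a: "length r = Suc j" "occurs T q (map Bit r)" "value_of r < length T"
      "h' = h(Dh := q + Suc j, Uh := value_of r)"
    then obtain x b where r: "r = x @ [b]" by (cases r rule: rev_cases) auto
    with a show "\<exists>x b. (length x = j \<and> occurs T q (map Bit x)) \<and> T ! (q + j) = Bit b \<and> Suc (q + j) < length T \<and>
      value_of (x @ [b]) < length T \<and> h' = h(Dh := Suc (q + j), Uh := value_of (x @ [b]))"
      by (intro exI[of _ x] exI[of _ b]) (simp add: occurs_snoc)
  qed
  finally show ?thesis unfolding q_def .
qed

lemma end_chk_iff:
  assumes "ready h"
  shows "end_chk T h h' \<longleftrightarrow> h Xh = 2 ^ j \<and> h Uh = h Kh \<and> h' = h"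
proof -
  note h = readyD[OF assms]
  define F :: "nat \<Rightarrow> heads" where "F n = h(Zh := 2 ^ n)" for n
  have powers: "along double T (F 0) g \<longleftrightarrow> (\<forall>n<j. (2::nat) ^ Suc n < length T) \<and> g = F j" for g
  proof (rule along_iff)
    fix m p g assume c: "\<And>l. l < m \<Longrightarrow> (2::nat) ^ Suc l < length T" and p: "p < length T"
    have "(2::nat) ^ m < length T" using c[of "m - 1"] long by (cases m) auto
    then have i: "inside ((F m)(Jh := p))" using h(2) p by (simp add: F_def)
    have "((F m)(Jh := p)) Yh = 0" "((F m)(Jh := p)) Zh = 2 ^ m" using h(8) by (simp_all add: F_def)
    moreover have "((F m)(Jh := p))(Zh := 2 * 2 ^ m) = (F (Suc m))(Jh := p)" by (rule ext) (simp add: F_def)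
    ultimately show "double T ((F m)(Jh := p)) g \<longleftrightarrow> (2::nat) ^ Suc m < length T \<and> g = (F (Suc m))(Jh := p)"
      using double_iff[OF i, of g] by simp
  qed (simp_all add: F_def h(4))
  have "end_chk T h h' \<longleftrightarrow> (along double ;; eq Zh Xh ;; home Zh ;; eq Uh Kh) T (F 0) h'"
    unfolding end_chk_def exec(2) using h(7) long by (simp add: F_def del: exec)
  also have "\<dots> \<longleftrightarrow> (\<forall>n<j. (2::nat) ^ Suc n < length T) \<and> (eq Zh Xh ;; home Zh ;; eq Uh Kh) T (F j) h'"
    unfolding seq_iff[of "along P" for P] powers by (simp del: exec)
  also have "(eq Zh Xh ;; home Zh ;; eq Uh Kh) T (F j) h' \<longleftrightarrow> h Xh = 2 ^ j \<and> h Uh = h Kh \<and> h' = h"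
  proof -
    have "eq Zh Xh T (F j) g \<longleftrightarrow> h Xh = 2 ^ j \<and> g = F j" for g
      using eq_iff[of "F j" Zh Xh g] h(3) insideD[OF h(2), of Xh] by (auto simp: F_def)
    moreover have "(F j)(Zh := 0) = h" using h(7) by (simp add: F_def fun_eq_iff)
    moreover have "eq Uh Kh T h h' \<longleftrightarrow> h Uh = h Kh \<and> h' = h"
      using eq_iff[of h Uh Kh h'] h(2,3) by simp
    ultimately show ?thesis
      by (simp add: seq_iff[of "eq i k" for i k] seq_iff[of "home i" for i] home_iff)
  qed
  \<comment> \<open>The powers up to \<open>2 ^ j\<close> fit on the track because
    \<open>2 ^ j\<close> is itself the position of a head.\<close>
  also have "(\<forall>n<j. (2::nat) ^ Suc n < length T) \<and> h Xh = 2 ^ j \<and> h Uh = h Kh \<and> h' = h \<longleftrightarrow>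
      h Xh = 2 ^ j \<and> h Uh = h Kh \<and> h' = h"
  proof -
    have "(2::nat) ^ Suc n < length T" if "n < j" "h Xh = 2 ^ j" for n
    proof -
      have "(2::nat) ^ Suc n \<le> 2 ^ j" using that(1) by (intro power_increasing) auto
      then show ?thesis using that(2) insideD[OF h(2), of Xh] by simp
    qed
    then show ?thesis by blast
  qed
  finally show ?thesis .
qed

end


section \<open>Soundness and completeness of certificates\<close>

lemma upt_split: "t \<le> n \<Longrightarrow> [0..<n] = [0..<t] @ [t..<n]"
  using upt_add_eq_append[of 0 t "n - t"] by simp

lemma occurs_concat:
  assumes "occurs T p (concat (map f [0..<n]))" "t < n"
  shows "occurs T (p + length (concat (map f [0..<t]))) (f t)"
proof -
  have "[0..<n] = [0..<t] @ t # [Suc t..<n]"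
    using upt_split[of t n] upt_conv_Cons[of t n] assms(2) by simp
  then show ?thesis using assms(1) by (simp add: occurs_append)
qed

text \<open>The list \<open>trs\<close> may contain a transition several times; any of its indices
  will do.\<close>

definition trans_code :: "transition list \<Rightarrow> transition \<Rightarrow> symbol" where
  "trans_code trs \<tau> = trans_symbol (SOME n. n < length trs \<and> trs ! n = \<tau>)"

lemma trans_code:
  assumes "\<tau> \<in> set trs"
  shows "is_trans trs (trans_code trs \<tau>)" "decode trs (trans_code trs \<tau>) = \<tau>"
proof -
  have "\<exists>n. n < length trs \<and> trs ! n = \<tau>" using assms by (auto simp: in_set_conv_nth)
  from someI_ex[OF this] show "is_trans trs (trans_code trs \<tau>)" "decode trs (trans_code trs \<tau>) = \<tau>"
    by (auto simp: trans_code_def is_trans_def)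
qed

lemma run_set: "run M x \<tau>s \<Longrightarrow> set \<tau>s \<subseteq> delta M"
  by (induction \<tau>s) auto

definition row :: "nat \<Rightarrow> circuit \<Rightarrow> transition list \<Rightarrow> (bool list \<Rightarrow> transition list) \<Rightarrow> bool list \<Rightarrow> symbol list" where
  "row m C trs \<tau>s x = MARK # map Bit (node_values m C x) @
     (if circuit_eval m C x then map (trans_code trs) (rev (\<tau>s x)) else [])"

context headed_track
begin

lemma long_strict: "j + 2 < length T"
  using occurs_less[OF header] by simp

lemma past_run:
  assumes "occurs T e (map (trans_code trs) (rev \<tau>s))" "set \<tau>s \<subseteq> set trs"
  shows "past trs e (length \<tau>s) = \<tau>s" "\<forall>i<length \<tau>s. is_trans trs (T ! (e + i))"
proof -
  have nth: "T ! (e + i) = trans_code trs (rev \<tau>s ! i)" "rev \<tau>s ! i \<in> set trs" if "i < length \<tau>s" for i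
    using assms that by (auto simp: occurs_def rev_nth)
  show "\<forall>i<length \<tau>s. is_trans trs (T ! (e + i))"
    using nth trans_code(1) by metis
  show "past trs e (length \<tau>s) = \<tau>s"
  proof (rule nth_equalityI)
    fix l assume "l < length (past trs e (length \<tau>s))"
    then have l: "l < length \<tau>s" by simp
    then have i: "length \<tau>s - Suc l < length \<tau>s" by simp
    have "e + length \<tau>s - Suc l = e + (length \<tau>s - Suc l)" using l by simp
    then have "past trs e (length \<tau>s) ! l = decode trs (T ! (e + (length \<tau>s - Suc l)))"
      using nth_past[OF l] by simp
    also have "\<dots> = rev \<tau>s ! (length \<tau>s - Suc l)"
      unfolding nth(1)[OF i] using trans_code(2) nth(2)[OF i] by blast
    also have "\<dots> = \<tau>s ! l" using l by (simp add: rev_nth)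
    finally show "past trs e (length \<tau>s) ! l = \<tau>s ! l" .
  qed simp
qed

definition row_step :: "nat \<Rightarrow> circuit \<Rightarrow> bool list \<Rightarrow> nat \<Rightarrow> heads \<Rightarrow> heads" where
  "row_step m C x n h = h(Bh := h Vh, Vh := h Vh + Suc j + length C + n, Xh := Suc (h Xh),
     Kh := h Kh + of_bool (circuit_eval m C x))"

lemma row_step_simps [simp]:
  "row_step m C x n h Vh = h Vh + Suc j + length C + n" "row_step m C x n h Xh = Suc (h Xh)"
  "row_step m C x n h Kh = h Kh + of_bool (circuit_eval m C x)" "row_step m C x n h Ch = h Ch"
  "row_step m C x n h Uh = h Uh"
  by (simp_all add: row_step_def)

lemma row_step_ready:
  assumes "ready h" "h Vh + Suc j + length C + n < length T" "Suc (h Xh) < length T"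
    "circuit_eval m C x \<longrightarrow> Suc (h Kh) < length T"
  shows "ready (row_step m C x n h)"
proof -
  note h = readyD[OF assms(1)]
  have "h Kh + of_bool (circuit_eval m C x) < length T"
    using assms(4) insideD[OF h(2), of Kh] by (cases "circuit_eval m C x") simp_all
  moreover have "h Vh < length T" using h(2) by simp
  ultimately show ?thesis using assms h by (simp add: ready_def idle_def row_step_def)
qed

lemma row_end_bound:
  assumes "occurs T (Suc v) (map Bit (node_values m C x))" "length x = j" "row_end M trs x b (v + Suc j + length C) n"
  shows "v + Suc j + length C + n < length T"
proof (cases b)
  case True
  then show ?thesis using assms(3) by (simp add: row_end_def run_symbols_def)
next
  case False
  then show ?thesis using assms(3) occurs_less[OF assms(1)] assms(2) by (simp add: row_end_def)
qed

text \<open>The conclusion is the loop invariant. Well-formedness becomes known with the first row,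
  hence the guard \<open>0 < g Xh\<close>.\<close>

lemma rows_sound:
  assumes h0: "ready h0" "h0 Xh = 0" "h0 Kh = 0" "j \<le> h0 Vh"
    and C: "C \<noteq> []" "occurs T (h0 Ch) (code C)" and m: "0 < m" and M: "wf_tm M" "set trs = delta M"
    and star: "star (row_chk m M trs) T h0 g"
  shows "ready g \<and> g Uh = h0 Uh \<and> g Kh = card (accepted_below m C j (g Xh)) \<and>
    (\<forall>x\<in>accepted_below m C j (g Xh). \<exists>n. accepts_in M x n) \<and> (0 < g Xh \<longrightarrow> wf_circuit j C)"
proof -
  define I where "I g \<longleftrightarrow> ready g \<and> g Ch = h0 Ch \<and> g Uh = h0 Uh \<and> j \<le> g Vh \<and>
    g Kh = card (accepted_below m C j (g Xh)) \<and>
    (\<forall>x\<in>accepted_below m C j (g Xh). \<exists>n. accepts_in M x n) \<and> (0 < g Xh \<longrightarrow> wf_circuit j C)" for g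
  have "I g" using star unfolding star_def
  proof (induction rule: rtranclp_induct)
    case base
    then show ?case using h0 by (simp add: I_def)
  next
    case (step g g')
    have g: "ready g" "g Ch = h0 Ch" "g Uh = h0 Uh" "j \<le> g Vh" "g Kh = card (accepted_below m C j (g Xh))"
      "\<forall>x\<in>accepted_below m C j (g Xh). \<exists>n. accepts_in M x n"
      using step.IH by (simp_all add: I_def)
    obtain x n where x: "length x = j" "value_of x = g Xh" "occurs T (Suc (g Vh)) (map Bit (node_values m C x))"
      "wf_circuit j C" "Suc (g Xh) < length T" "circuit_eval m C x \<longrightarrow> Suc (g Kh) < length T"
      "row_end M trs x (circuit_eval m C x) (g Vh + Suc j + length C) n" "g' = row_step m C x n g"
      using step.hyps(2) row_chk_iff[OF g(1) C(1) _ g(4) m M(2), of g'] C(2) unfolding g(2) row_step_def by blast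
    have "ready g'" unfolding x(8)
      by (rule row_step_ready[OF g(1) row_end_bound[OF x(3,1,7)] x(5,6)])
    moreover have X: "g' Xh = Suc (value_of x)" using x(2,8) by simp
    moreover have "g' Kh = card (accepted_below m C j (g' Xh))"
      unfolding X card_accepted_below_Suc[OF x(1)] using x(2,8) g(5) by simp
    moreover have "\<exists>n. accepts_in M y n" if "y \<in> accepted_below m C j (g' Xh)" for y
    proof (cases "y \<in> accepted_below m C j (g Xh)")
      case True
      then show ?thesis using g(6) by blast
    next
      case False
      have "accepted_below m C j (g' Xh) =
          (if circuit_eval m C x then insert x else id) (accepted_below m C j (g Xh))"
        using accepted_below_Suc[OF x(1), of m C] unfolding X x(2) .
      then have "y = x \<and> circuit_eval m C x"
        using that False by (auto split: if_splits)
      then show ?thesis using x(7) accepts_iff_run[OF M(1)] by (auto simp: row_end_def)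
    qed
    ultimately show ?case unfolding I_def using x(4,8) g by simp
  qed
  then show ?thesis by (simp add: I_def)
qed

lemma witness_sound:
  assumes m: "0 < m" and M: "wf_tm M" "set trs = delta M"
    and chk: "witness_chk c m M trs T ((\<lambda>_. 0)(Dh := j + 2)) h'"
  shows "\<exists>r d C. witness_for c m {x. \<exists>n. accepts_in M x n} j r d C \<and>
    occurs T (j + 2) (map Bit (witness r d C) @ [STOP])"
proof -
  define h :: heads where "h = (\<lambda>_. 0)(Dh := j + 2)"
  have h: "ready h" "h Dh = j + 2" using long_strict by (simp_all add: h_def ready_def idle_def inside_def)
  obtain h1 h2 h3 h4 where s: "length_chk c T h h1" "census_chk T h1 h2" "depth_chk T h2 h3"
    "star (row_chk m M trs) T h3 h4" "end_chk T h4 h'"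
    using chk unfolding witness_chk_def seq_iff h_def[symmetric] by blast
  obtain y where y: "occurs T (j + 2) (map Bit y @ [STOP])" "length y \<le> (j + 2) ^ c"
    and h1: "h1 = h(Vh := h Dh + length y + 1)"
    using s(1) unfolding length_chk_iff[OF h(1)] h(2) by blast
  have "h Dh + length y + 1 < length T" using occurs_less[OF y(1)] h(2) by simp
  then have r1: "ready h1" using h(1) unfolding h1 by (simp add: ready_def idle_def)
  have h1D: "h1 Dh = j + 2" "h1 Vh = j + 2 + length y + 1" using h(2) by (simp_all add: h1)
  obtain r where r: "length r = Suc j" "occurs T (j + 2) (map Bit r)" "value_of r < length T"
    and h2: "h2 = h1(Dh := h1 Dh + Suc j, Uh := value_of r)"
    using s(2) unfolding census_chk_iff[OF r1] h1D by blast
  have "h1 Dh + Suc j < length T" using occurs_less[OF r(2)] r(1) h1D by simp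
  then have r2: "ready h2" using r1 r(3) unfolding h2 by (simp add: ready_def idle_def)
  have h2D: "h2 Dh = j + 2 + Suc j" "h2 Uh = value_of r" "h2 Vh = h1 Vh" "h2 Xh = 0" "h2 Kh = 0"
    using h1D by (simp_all add: h2 h1 h_def)
  obtain d C where C: "C \<noteq> []" "occurs T (h2 Dh) (map Bit (replicate d False @ [True]) @ code C)"
    "layers_ok (h2 Vh) d C" and h3: "h3 = h2(Ch := h2 Dh + d + 1, Dh := h2 Dh + d,
      Bh := h2 Vh + d * (Suc j + length C), Vh := h2 Vh + Suc d * (Suc j + length C))"
    using s(3) unfolding depth_chk_iff[OF r2] by blast
  have code: "occurs T (h2 Dh + d + 1) (code C)"
    using C(2) unfolding occurs_append[of T "h2 Dh" "map Bit (replicate d False @ [True])"] by simp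
  have bound: "h2 Vh + Suc d * (Suc j + length C) < length T"
    using C(3) by (simp add: layers_ok_def Let_def circuit_ok_def add.commute add.left_commute)
  then have "h2 Vh + d * (Suc j + length C) < length T" by simp
  moreover have "h2 Dh + d + 1 < length T" using occurs_less[OF code] by simp
  ultimately have r3: "ready h3" using r2 bound unfolding h3 by (simp add: ready_def idle_def)
  have h3D: "h3 Xh = 0" "h3 Kh = 0" "j \<le> h3 Vh" "h3 Ch = h2 Dh + d + 1" "h3 Uh = value_of r"
    using h2D h1D by (simp_all add: h3)
  have I: "ready h4" "h4 Uh = value_of r" "h4 Kh = card (accepted_below m C j (h4 Xh))"
    "\<forall>x\<in>accepted_below m C j (h4 Xh). \<exists>n. accepts_in M x n" "0 < h4 Xh \<longrightarrow> wf_circuit j C"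
    using rows_sound[OF r3 h3D(1-3) C(1) _ m M s(4)] code h3D(4,5) by simp_all
  have e: "h4 Xh = 2 ^ j" "h4 Uh = h4 Kh" using s(5) unfolding end_chk_iff[OF I(1)] by simp_all
  \<comment> \<open>Some row has been checked, as \<open>2 ^ j\<close> is positive even for the
    empty input.\<close>
  have wf: "wf_circuit j C" using I(5) e(1) by simp
  have occ: "occurs T (j + 2) (map Bit (witness r d C) @ [STOP])"
  proof -
    have "map Bit (witness r d C) @ [STOP] = map Bit r @ map Bit (replicate d False @ [True]) @ code C"
      by (simp add: witness_def)
    then show ?thesis using r(1,2) C(2) h2D(1) by (simp add: occurs_append)
  qed
  \<comment> \<open>The length was measured on \<open>y\<close>, while census, depth bound and
    circuit were parsed separately; both readings end at the same \<open>STOP\<close>.\<close>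
  have "y = witness r d C" by (rule bits_unique[OF y(1) occ])
  then have "witness_for c m {x. \<exists>n. accepts_in M x n} j r d C"
    unfolding witness_for_def using r(1) y(2) wf layers_depth[OF C(3) wf] I(2-4) e
    by (auto simp: accepted_below_top)
  then show ?thesis using occ by blast
qed

lemma rows_complete:
  assumes h0: "ready h0" "h0 Xh = 0" "h0 Kh = 0" "j \<le> h0 Vh"
    and C: "wf_circuit j C" "occurs T (h0 Ch) (code C)" and m: "0 < m" and M: "set trs = delta M"
    and runs: "\<And>x. x \<in> accepted m C j \<Longrightarrow> run M x (\<tau>s x) \<and> state_after M (\<tau>s x) = final M"
    and rows: "occurs T (h0 Vh) (concat (map (\<lambda>t. row m C trs \<tau>s (bits_of j t)) [0..<2 ^ j]))"
    and room: "2 * (h0 Vh + length (concat (map (\<lambda>t. row m C trs \<tau>s (bits_of j t)) [0..<2 ^ j]))) < length T"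
      "2 ^ j + 1 < length T"
  shows "t \<le> 2 ^ j \<Longrightarrow> \<exists>g. star (row_chk m M trs) T h0 g \<and> ready g \<and> g Ch = h0 Ch \<and> g Uh = h0 Uh \<and>
    g Vh = h0 Vh + length (concat (map (\<lambda>t. row m C trs \<tau>s (bits_of j t)) [0..<t])) \<and> g Xh = t \<and>
    g Kh = card (accepted_below m C j t)"
proof (induction t)
  case 0
  then show ?case using h0 by (intro exI[of _ h0]) (simp add: star_refl)
next
  case (Suc t)
  define w where "w t = row m C trs \<tau>s (bits_of j t)" for t
  note rows = rows[folded w_def] and room = room[folded w_def]
  obtain g where g: "star (row_chk m M trs) T h0 g" "ready g" "g Ch = h0 Ch" "g Uh = h0 Uh"
    "g Vh = h0 Vh + length (concat (map w [0..<t]))" "g Xh = t" "g Kh = card (accepted_below m C j t)"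
    using Suc unfolding w_def by auto
  define x where "x = bits_of j t"
  define b where "b = circuit_eval m C x"
  define n where "n = (if b then length (\<tau>s x) else 0)"
  define e where "e = g Vh + Suc j + length C"
  have C0: "C \<noteq> []" using C(1) by (simp add: wf_circuit_def)
  have x: "length x = j" "value_of x = t" using Suc.prems by (simp_all add: x_def value_of_bits_of)
  have occ: "occurs T (g Vh) (w t)" unfolding g(5) using Suc.prems by (intro occurs_concat[OF rows]) simp
  have lenw: "length (w t) = Suc j + length C + n"
    using x(1) by (simp add: w_def row_def x_def[symmetric] b_def[symmetric] n_def)
  have parts: "T ! g Vh = MARK" "occurs T (Suc (g Vh)) (map Bit (node_values m C x))"
    "b \<Longrightarrow> occurs T e (map (trans_code trs) (rev (\<tau>s x)))"
    using occ x(1) by (simp_all add: w_def row_def x_def[symmetric] b_def[symmetric] occurs_Cons occurs_append e_def add.assoc)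
  have Vle: "g Vh + length (w t) \<le> h0 Vh + length (concat (map w [0..<2 ^ j]))"
  proof -
    have "[0..<2 ^ j] = [0..<Suc t] @ [Suc t..<2 ^ j]"
      by (rule upt_split[OF Suc.prems])
    then show ?thesis unfolding g(5) by simp
  qed
  have row_end: "row_end M trs x b e n"
  proof (cases b)
    case True
    have n: "n = length (\<tau>s x)" using True by (simp add: n_def)
    have "x \<in> accepted m C j" using True x(1) by (simp add: accepted_def b_def)
    from runs[OF this] have r: "run M x (\<tau>s x)" "state_after M (\<tau>s x) = final M" by simp_all
    note p = past_run[OF parts(3)[OF True], of, OF subset_trans[OF run_set[OF r(1)] equalityD2[OF M]]]
    have "e + n = g Vh + length (w t)" by (simp add: lenw e_def)
    then have "2 * (e + n) < length T" using Vle room(1) by simp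
    then show ?thesis unfolding row_end_def run_symbols_def using True p r n by simp
  qed (simp add: row_end_def n_def)
  have X: "Suc (g Xh) < length T" using Suc.prems g(6) room(2) by simp
  \<comment> \<open>The count never exceeds the number of rows, so there is room for
    \<open>Kh\<close> whenever there is room for \<open>Xh\<close>.\<close>
  have K: "circuit_eval m C x \<longrightarrow> Suc (g Kh) < length T"
    using card_accepted_below_le[of m C j t] X unfolding g(6,7) by simp
  have "row_chk m M trs T g (row_step m C x n g)"
  proof -
    have code: "occurs T (g Ch) (code C)" and V: "j \<le> g Vh" and v: "value_of x = g Xh"
      using C(2) g(3,5,6) h0(4) x(2) by simp_all
    show ?thesis
      by (rule row_chk_iff[OF g(2) C0 code V m M, THEN iffD2], intro exI[of _ x] exI[of _ n] conjI
        parts(1,2) x(1) v C(1) X K row_end[unfolded e_def b_def] row_step_def)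
  qed
  then have "star (row_chk m M trs) T h0 (row_step m C x n g)" by (rule star_snoc[OF g(1)])
  moreover have "ready (row_step m C x n g)"
    using row_step_ready[OF g(2) row_end_bound[OF parts(2) x(1) row_end[unfolded e_def]] X K] .
  moreover have "card (accepted_below m C j (Suc t)) = g Kh + of_bool (circuit_eval m C x)"
    using card_accepted_below_Suc[OF x(1), of m C] unfolding x(2) g(7) .
  ultimately show ?case unfolding w_def[symmetric]
    using g lenw by (intro exI[of _ "row_step m C x n g"]) simp
qed

text \<open>The first room condition serves the doubling of positions in \<open>step_chk\<close>,
  the second the budget of \<open>length_chk\<close>. The third covers the census, whose
  \<open>j + 1\<close> bits have a value below \<open>2 ^ (j + 1)\<close>, and the counter
  \<open>Xh\<close>.\<close>

lemma witness_complete: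
  assumes wit: "witness_for c m A j r d C" and m: "0 < m" and M: "set trs = delta M"
    and runs: "\<And>x. x \<in> accepted m C j \<Longrightarrow> run M x (\<tau>s x) \<and> state_after M (\<tau>s x) = final M"
    and T: "occurs T (j + 2) (map Bit (witness r d C) @ STOP # concat (map (layer_row j C) [0..<Suc d]) @ rows)"
    and rows: "rows = concat (map (\<lambda>t. row m C trs \<tau>s (bits_of j t)) [0..<2 ^ j])"
    and room: "2 * (j + 3 + length (witness r d C) + Suc d * (Suc j + length C) + length rows) < length T"
      "(j + 2) ^ c < length T" "2 ^ (j + 1) + 1 < length T"
  shows "\<exists>h'. witness_chk c m M trs T ((\<lambda>_. 0)(Dh := j + 2)) h'"
proof -
  define y where "y = witness r d C"
  define L where "L = Suc j + length C"
  define v where "v = j + 2 + length y + 1"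
  note w = wit[unfolded witness_for_def, folded y_def]
  have len: "length r = Suc j" "length y \<le> (j + 2) ^ c" and C: "wf_circuit j C" "circuit_depth j C \<le> d"
    and val: "value_of r = card (accepted m C j)" using w by simp_all
  have C0: "C \<noteq> []" using C(1) by (simp add: wf_circuit_def)
  have "length (layer_row j C t) = L" for t by (simp add: layer_row_def L_def)
  then have lenL: "length (concat (map (layer_row j C) [0..<t])) = t * L" for t by (induction t) simp_all
  from T[folded y_def] have all: "occurs T (j + 2) ((map Bit y @ [STOP]) @ concat (map (layer_row j C) [0..<Suc d]) @ rows)"
    by simp
  have occ1: "occurs T (j + 2) (map Bit y @ [STOP])" and
    all2: "occurs T v (concat (map (layer_row j C) [0..<Suc d]) @ rows)"
    using all unfolding occurs_append[of T "j + 2" "map Bit y @ [STOP]"] by (simp_all add: v_def)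
  have occ: "occurs T (j + 2) (map Bit y @ [STOP])"
    "occurs T v (concat (map (layer_row j C) [0..<Suc d]))" "occurs T (v + Suc d * L) rows"
    using occ1 all2[unfolded occurs_append lenL] by blast+
  have layer: "occurs T (v + t * L) (layer_row j C t)" if "t \<le> d" for t
    using occurs_concat[OF occ(2), of t] that unfolding lenL by simp
  have y_eq: "map Bit y @ [STOP] = map Bit r @ map Bit (replicate d False @ [True]) @ code C"
    by (simp add: y_def witness_def)
  have r: "occurs T (j + 2) (map Bit r)" "occurs T (j + 2 + Suc j) (map Bit (replicate d False @ [True]) @ code C)"
    using occ(1) len(1) unfolding y_eq occurs_append[of T "j + 2"] by simp_all
  have code: "occurs T (j + 2 + Suc j + d + 1) (code C)"
    using r(2) unfolding occurs_append[of T "j + 2 + Suc j" "map Bit (replicate d False @ [True])"] by simp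
  have layers: "layers_ok v d C"
    by (rule layers_complete[OF C]) (use layer in \<open>simp add: L_def\<close>)
  define h :: heads where "h = (\<lambda>_. 0)(Dh := j + 2)"
  define h1 where "h1 = h(Vh := h Dh + length y + 1)"
  define h2 where "h2 = h1(Dh := h1 Dh + Suc j, Uh := value_of r)"
  define h3 where "h3 = h2(Ch := h2 Dh + d + 1, Dh := h2 Dh + d, Bh := h2 Vh + d * L, Vh := h2 Vh + Suc d * L)"
  have h: "ready h" "h Dh = j + 2" using long_strict by (simp_all add: h_def ready_def idle_def inside_def)
  have s1: "length_chk c T h h1"
    by (rule length_chk_iff[OF h(1), THEN iffD2],
      intro exI[of _ y] conjI occ(1)[folded h(2)] len(2) room(2) h1_def)
  have "h Dh + length y + 1 < length T" using occurs_less[OF occ(1)] h(2) by simp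
  then have r1: "ready h1" using h(1) unfolding h1_def by (simp add: ready_def idle_def)
  have h1: "h1 Dh = j + 2" "h1 Vh = v" using h(2) by (simp_all add: h1_def v_def)
  have vr: "value_of r < length T"
    using value_of_less[of r] room(3) len(1) by simp
  have s2: "census_chk T h1 h2"
    by (rule census_chk_iff[OF r1, THEN iffD2],
      intro exI[of _ r] conjI len(1) r(1)[folded h1(1)] vr h2_def)
  have "h1 Dh + Suc j < length T" using occurs_less[OF r(1)] len(1) h1 by simp
  then have r2: "ready h2" using r1 vr unfolding h2_def by (simp add: ready_def idle_def)
  have h2: "h2 Dh = j + 2 + Suc j" "h2 Uh = value_of r" "h2 Vh = v" "h2 Xh = 0" "h2 Kh = 0"
    using h1 by (simp_all add: h2_def h1_def h_def)
  have s3: "depth_chk T h2 h3"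
    by (rule depth_chk_iff[OF r2, THEN iffD2],
      intro exI[of _ d] exI[of _ C] conjI C0 r(2)[folded h2(1)] layers[folded h2(3)] h3_def[unfolded L_def])
  have bound: "v + Suc d * L < length T" using occurs_less[OF occ(2)] unfolding lenL .
  then have "v + d * L < length T" by simp
  moreover have "h2 Dh + d + 1 < length T" using occurs_less[OF code] h2(1) by simp
  ultimately have r3: "ready h3" using r2 bound h2(3) unfolding h3_def by (simp add: ready_def idle_def)
  have h3: "h3 Xh = 0" "h3 Kh = 0" "j \<le> h3 Vh" "h3 Ch = j + 2 + Suc j + d + 1" "h3 Uh = value_of r"
    "h3 Vh = v + Suc d * L"
    using h2 by (simp_all add: h3_def v_def)
  obtain h4 where h4: "star (row_chk m M trs) T h3 h4" "ready h4" "h4 Uh = value_of r" "h4 Xh = 2 ^ j"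
    "h4 Kh = card (accepted_below m C j (2 ^ j))"
  proof -
    have "2 * (h3 Vh + length rows) < length T" using room(1) unfolding h3(6) v_def y_def L_def by simp
    moreover have "(2::nat) ^ j + 1 < length T" using room(3) by (simp add: less_le_trans)
    ultimately show ?thesis
      using rows_complete[OF r3 h3(1-3) C(1) code[folded h3(4)] m M runs occ(3)[folded h3(6), unfolded rows], of "2 ^ j"] that
      unfolding rows h3(5) by auto
  qed
  have s5: "end_chk T h4 h4" unfolding end_chk_iff[OF h4(2)] using h4 val by (simp add: accepted_below_top)
  have "witness_chk c m M trs T h h4"
    unfolding witness_chk_def seq_iff
    by (rule exI, rule conjI, rule s1, rule exI, rule conjI, rule s2, rule exI, rule conjI, rule s3,
      rule exI, rule conjI, rule h4(1), rule s5)
  then show ?thesis unfolding h_def by blast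
qed

end


section \<open>Membership of the prefix language in NE\<close>

lemma header_chk_iff:
  assumes "T ! 0 = LM" "1 < length T"
  shows "header_chk T (\<lambda>_. 0) g \<longleftrightarrow>
    (\<exists>j. occurs T 0 (LM # replicate j (Bit True) @ [Bit False]) \<and> g = (\<lambda>_. 0)(Dh := j + 2))"
proof -
  define F :: "nat \<Rightarrow> heads" where "F n = (\<lambda>_. 0)(Dh := Suc n)" for n
  have loop: "star (test Dh {Bit True} ;; right Dh) T (F 0) g \<longleftrightarrow>
    (\<exists>n. (\<forall>m<n. T ! Suc m = Bit True \<and> Suc (Suc m) < length T) \<and> g = F n)" for g
  proof (rule star_family)
    fix m g assume c: "\<And>l. l < m \<Longrightarrow> T ! Suc l = Bit True \<and> Suc (Suc l) < length T"
    have "Suc m < length T" using c[of "m - 1"] assms(2) by (cases m) auto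
    moreover have "(F m)(Dh := Suc (Suc m)) = F (Suc m)" "F m Dh = Suc m" by (simp_all add: F_def)
    ultimately show "(test Dh {Bit True} ;; right Dh) T (F m) g \<longleftrightarrow>
      (T ! Suc m = Bit True \<and> Suc (Suc m) < length T) \<and> g = F (Suc m)"
      by (simp add: right_def)
  qed simp
  have "header_chk T (\<lambda>_. 0) g \<longleftrightarrow> (star (test Dh {Bit True} ;; right Dh) ;; test Dh {Bit False} ;; right Dh) T (F 0) g"
    unfolding header_chk_def exec(2) using assms(2) by (simp add: F_def del: exec)
  also have "\<dots> \<longleftrightarrow> (\<exists>n. (\<forall>m<n. T ! Suc m = Bit True \<and> Suc (Suc m) < length T) \<and>
      T ! Suc n = Bit False \<and> Suc (Suc n) < length T \<and> g = (\<lambda>_. 0)(Dh := n + 2))"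
    unfolding seq_iff[of "star P" for P] loop ex_family by (auto simp: F_def right_def)
  also have "\<dots> \<longleftrightarrow> (\<exists>j. occurs T 0 (LM # replicate j (Bit True) @ [Bit False]) \<and> g = (\<lambda>_. 0)(Dh := j + 2))"
    by (intro ex_cong1) (auto simp: occurs_Cons occurs_snoc occurs_replicate assms(1))
  finally show ?thesis .
qed

text \<open>The unary header makes the input length a part of the word, so that one oracle serves
  all lengths.\<close>

definition prefixes_of :: "nat \<Rightarrow> nat \<Rightarrow> language \<Rightarrow> language" where
  "prefixes_of c m A = {z. \<exists>j r d C s. witness_for c m A j r d C \<and>
     z @ s = replicate j True @ False # witness r d C}"

lemma length_encode_circuit: "length C \<le> length (encode_circuit C)"
proof (induction C)
  case (Cons g C)
  obtain ty ws where "g = (ty, ws)" by fastforce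
  then have "1 \<le> length (encode_gate g)" by (cases ty) auto
  then show ?case using Cons by (simp add: encode_circuit_def)
qed (simp add: encode_circuit_def)

lemma length_concat_le:
  "(\<And>t. t < n \<Longrightarrow> length (f t) \<le> k) \<Longrightarrow> length (concat (map f [0..<n])) \<le> n * k"
proof (induction n)
  case (Suc n)
  then have "length (concat (map f [0..<n])) \<le> n * k" "length (f n) \<le> k" by simp_all
  then show ?case by simp
qed simp

lemma prefix_header:
  assumes "z @ s = replicate j True @ False # y"
  shows "z = replicate (length z) True \<or> j \<le> length z"
proof (cases "j \<le> length z")
  case False
  have "z = take (length z) (replicate j True @ False # y)" using assms by (metis append_eq_conv_conj)
  also have "\<dots> = replicate (length z) True" using False by simp
  finally show ?thesis by simp
qed simp

text \<open>The track begins with the input \<open>z\<close> and continues with the guess. A guess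
  that completes \<open>z\<close> to a header with a witness and then supplies rows and runs proves
  \<open>z\<close> to be a prefix.\<close>

theorem prefixes_of_NE:
  assumes M: "wf_tm M" "A = {x. \<exists>n. accepts_in M x n}"
    and short: "\<And>x. x \<in> A \<Longrightarrow> \<exists>n \<le> 2 ^ (a * length x + a). accepts_in M x n"
    and m: "0 < m" and wit: "\<And>j. \<exists>r d C. witness_for c m A j r d C"
  shows "prefixes_of c m A \<in> NE"
proof -
  obtain trs where trs: "set trs = delta M" using M(1) by (meson finite_list wf_tm_def)
  define G where "G = range Bit \<union> {MARK, STOP} \<union> trans_symbol ` {..<length trs}"
  define P where "P = header_chk ;; witness_chk c m M trs"
  define q where "q = c + a + 3"
  have G: "finite G" "LM \<notin> G" "RM \<notin> G" by (auto simp: G_def trans_symbol_def)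
  show ?thesis
  proof (rule NE_if_realizable[of P G _ "2 * q + 5"])
    show "realizable P" unfolding P_def by (rule realizable_witness_chk)
    show "finite G" "LM \<notin> G" "RM \<notin> G" by (rule G)+
  next
    fix z w h
    assume w: "w \<in> lists G" and p: "P (track (map Bit z @ w)) (\<lambda>_. 0) h"
    define T where "T = track (map Bit z @ w)"
    have T0: "T ! 0 = LM" "1 < length T" by (simp_all add: T_def track_def)
    obtain j where hd: "occurs T 0 (LM # replicate j (Bit True) @ [Bit False])"
      and chk: "witness_chk c m M trs T ((\<lambda>_. 0)(Dh := j + 2)) h"
      using p unfolding P_def seq_iff T_def[symmetric] header_chk_iff[OF T0] by blast
    interpret headed_track T j
    proof
      fix p assume p: "p < length T" "T ! p = LM"
      show "p = 0"
      proof (rule ccontr)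
        assume "p \<noteq> 0"
        then have "T ! p \<in> set (map Bit z @ w @ [RM])"
          using p(1) by (auto simp: T_def track_def nth_Cons' simp del: set_append intro!: nth_mem)
        then show False using p(2) w G by auto
      qed
    qed (rule hd)
    obtain r d C where wf: "witness_for c m A j r d C"
      and occ: "occurs T (j + 2) (map Bit (witness r d C) @ [STOP])"
      using witness_sound[OF m M(1) trs chk] unfolding M(2) by blast
    define f where "f = replicate j True @ False # witness r d C"
    have full: "occurs T 1 (map Bit f @ [STOP])"
    proof -
      have "map Bit f @ [STOP] = (replicate j (Bit True) @ [Bit False]) @ (map Bit (witness r d C) @ [STOP])"
        by (simp add: f_def)
      moreover have "occurs T 1 (replicate j (Bit True) @ [Bit False])" using hd by (simp add: occurs_Cons)
      moreover have "1 + length (replicate j (Bit True) @ [Bit False]) = j + 2" by simp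
      ultimately show ?thesis using occ by (simp only: occurs_append)
    qed
    have nth: "T ! Suc i = Bit (z ! i)" if "i < length z" for i
      using that by (simp add: T_def track_def nth_append)
    have fnth: "T ! Suc i = Bit (f ! i)" if "i < length f" for i
      using full that by (simp add: occurs_snoc) (simp add: occurs_def)
    have stop: "T ! Suc (length f) = STOP" using full by (simp add: occurs_snoc)
    \<comment> \<open>\<open>z\<close> consists of bits, so it cannot extend over the
      \<open>STOP\<close> behind the witness.\<close>
    have len: "length z \<le> length f"
    proof (rule ccontr)
      assume "\<not> length z \<le> length f"
      then show False using nth[of "length f"] stop by simp
    qed
    have "z = take (length z) f"
    proof (rule nth_equalityI)
      fix i assume i: "i < length z"
      then have "Bit (z ! i) = Bit (f ! i)" using nth[of i] fnth[of i] len by simp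
      then show "z ! i = take (length z) f ! i" using i by simp
    qed (use len in simp)
    then have "z @ drop (length z) f = f" by (metis append_take_drop_id)
    then show "z \<in> prefixes_of c m A" unfolding prefixes_of_def f_def using wf by blast
  next
    fix z assume "z \<in> prefixes_of c m A"
    then obtain j0 r0 d0 C0 s0 where z0: "witness_for c m A j0 r0 d0 C0"
      "z @ s0 = replicate j0 True @ False # witness r0 d0 C0" unfolding prefixes_of_def by blast
    \<comment> \<open>The certificate is exponential in \<open>j\<close> but has to be exponential
      in \<open>length z\<close>, so \<open>j \<le> length z\<close> must be arranged. A word
      \<open>z\<close> with fewer than \<open>j0\<close> symbols consists of ones only, and it is
      also a prefix for \<open>j = length z\<close>, because every length has a witness.\<close>
    obtain j r d C s where wf: "witness_for c m A j r d C" and z: "z @ s = replicate j True @ False # witness r d C"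
      and j: "j \<le> length z"
    proof (cases "j0 \<le> length z")
      case True
      then show ?thesis using that[OF z0] by blast
    next
      case False
      then have zr: "z = replicate (length z) True" using prefix_header[OF z0(2)] by blast
      obtain r d C where w: "witness_for c m A (length z) r d C" using wit by blast
      have "z @ (False # witness r d C) = replicate (length z) True @ False # witness r d C"
        using zr by simp
      then show ?thesis using that[OF w] by blast
    qed
    define y where "y = witness r d C"
    \<comment> \<open>A common bound for the length of the witness, the lengths of the runs and the
      number of inputs; \<open>q\<close> collects the exponents of all of them.\<close>
    define E where "E = (2::nat) ^ (q * (j + 1))"
    note w = wf[unfolded witness_for_def, folded y_def]
    have y: "length y \<le> (j + 2) ^ c" and acc: "accepted m C j \<subseteq> A" using w by simp_all
    have Cy: "length C \<le> length y" "d \<le> length y"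
      using length_encode_circuit[of C] by (simp_all add: y_def witness_def)
    have j2: "j + 2 \<le> 2 ^ (j + 1)" using less_exp[of "j + 1"] by simp
    have powE: "(2::nat) ^ e \<le> E" if "e \<le> q * (j + 1)" for e
      unfolding E_def using that by (intro power_increasing) auto
    have E: "(j + 2) ^ c \<le> E" "2 ^ (a * j + a) \<le> E" "2 ^ j \<le> E" "2 ^ (j + 1) \<le> E" "j + 3 \<le> E" "1 \<le> E"
    proof -
      have "(j + 2) ^ c \<le> (2 ^ (j + 1)) ^ c" by (rule power_mono[OF j2]) simp
      also have "\<dots> = 2 ^ ((j + 1) * c)" by (rule power_mult[symmetric])
      also have "\<dots> \<le> E" by (rule powE) (simp add: q_def algebra_simps)
      finally show "(j + 2) ^ c \<le> E" .
      show "2 ^ (a * j + a) \<le> E" "2 ^ j \<le> E" "2 ^ (j + 1) \<le> E" "1 \<le> E"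
        using powE[of "a * j + a"] powE[of j] powE[of "j + 1"] powE[of 0] by (simp_all add: q_def algebra_simps)
      have "j + 3 \<le> 2 ^ (j + 2)" using j2 by simp
      also have "\<dots> \<le> E" by (rule powE) (simp add: q_def algebra_simps)
      finally show "j + 3 \<le> E" .
    qed
    have "\<forall>x\<in>accepted m C j. \<exists>\<tau>. run M x \<tau> \<and> state_after M \<tau> = final M \<and> length \<tau> \<le> E"
    proof
      fix x assume x: "x \<in> accepted m C j"
      then obtain n where "n \<le> 2 ^ (a * length x + a)" "accepts_in M x n" using short acc by blast
      moreover have "length x = j" using x by (simp add: accepted_def)
      ultimately show "\<exists>\<tau>. run M x \<tau> \<and> state_after M \<tau> = final M \<and> length \<tau> \<le> E"
        using accepts_iff_run[OF M(1)] E(2) le_trans by metis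
    qed
    then obtain \<tau>s where \<tau>s: "\<And>x. x \<in> accepted m C j \<Longrightarrow> run M x (\<tau>s x) \<and> state_after M (\<tau>s x) = final M"
      and short_runs: "\<And>x. x \<in> accepted m C j \<Longrightarrow> length (\<tau>s x) \<le> E"
      by (metis (mono_tags))
    define rows where "rows = concat (map (\<lambda>t. row m C trs \<tau>s (bits_of j t)) [0..<2 ^ j])"
    define layers where "layers = concat (map (layer_row j C) [0..<Suc d])"
    define core where "core = j + 3 + length y + Suc d * (Suc j + length C) + length rows"
    \<comment> \<open>The padding behind the last row: \<open>2 * core\<close> is for the doublings,
      the other terms are for the budget of \<open>length_chk\<close> and for the value of the
      census.\<close>
    define N where "N = 2 * core + (j + 2) ^ c + 2 ^ (j + 1) + 2"
    define u where "u = map Bit (replicate j True @ False # y) @ STOP # layers @ rows @ replicate N (Bit False)"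
    define v where "v = drop (length z) u"
    define T where "T = track u"
    have "length (layer_row j C t) = Suc j + length C" for t by (simp add: layer_row_def)
    then have lenL: "length layers = Suc d * (Suc j + length C)"
      unfolding layers_def by (induction d) simp_all
    have "map Bit z @ map Bit s = map Bit (replicate j True @ False # y)"
      using arg_cong[OF z, of "map Bit"] by (simp add: y_def)
    then have "u = map Bit z @ (map Bit s @ STOP # layers @ rows @ replicate N (Bit False))"
      unfolding u_def by (metis append.assoc)
    then have uv: "u = map Bit z @ v" by (simp add: v_def)
    have lenu: "length u + 1 = core + N" by (simp add: u_def core_def lenL)
    have bitG: "Bit b \<in> G" for b by (simp add: G_def)
    have uG: "set u \<subseteq> G"
    proof -
      have "set (layer_row j C t) \<subseteq> G" for t by (auto simp: layer_row_def G_def)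
      then have "set layers \<subseteq> G" unfolding layers_def by auto
      moreover have "set (row m C trs \<tau>s x) \<subseteq> G" if "length x = j" for x
      proof -
        have "trans_code trs t \<in> G" if "circuit_eval m C x" "t \<in> set (\<tau>s x)" for t
        proof -
          have "x \<in> accepted m C j" using that(1) \<open>length x = j\<close> by (simp add: accepted_def)
          then have "t \<in> set trs" using \<tau>s run_set that(2) trs by blast
          from trans_code(1)[OF this] obtain n where "n < length trs" "trans_code trs t = trans_symbol n"
            unfolding is_trans_def by blast
          then show ?thesis by (simp add: G_def)
        qed
        moreover have "MARK \<in> G" by (simp add: G_def)
        ultimately show ?thesis using bitG unfolding row_def
          by (auto simp del: split_paired_All split_paired_Ex simp: image_subset_iff)
      qed
      then have "set (row m C trs \<tau>s (bits_of j t)) \<subseteq> G" for t by simp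
      then have "set rows \<subseteq> G" unfolding rows_def by (simp add: UN_subset_iff)
      ultimately show ?thesis by (auto simp: u_def G_def)
    qed
    have T0: "T ! 0 = LM" "1 < length T" by (simp_all add: T_def track_def u_def)
    have lenT: "length T = core + N + 1" using lenu by (simp add: T_def track_def)
    have occT: "occurs T 0 (LM # u)" unfolding T_def track_def occurs_def by (auto simp: nth_Cons' nth_append)
    have "LM # u = (LM # replicate j (Bit True) @ [Bit False]) @
        ((map Bit y @ STOP # layers @ rows) @ replicate N (Bit False))"
      by (simp add: u_def)
    from occT[unfolded this occurs_append[of T 0]] have hd: "occurs T 0 (LM # replicate j (Bit True) @ [Bit False])"
      and body: "occurs T (j + 2) ((map Bit y @ STOP # layers @ rows) @ replicate N (Bit False))"
      by (simp_all only: length_append length_Cons list.size length_replicate add_0 add_0_right add_Suc_right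
        One_nat_def numeral_2_eq_2)
    interpret headed_track T j
    proof
      fix p assume p: "p < length T" "T ! p = LM"
      show "p = 0"
      proof (rule ccontr)
        assume "p \<noteq> 0"
        then have "T ! p \<in> set (u @ [RM])"
          using p(1) by (auto simp: T_def track_def nth_Cons' simp del: set_append intro!: nth_mem)
        then show False using p(2) uG G by auto
      qed
    qed (rule hd)
    have "\<exists>h'. witness_chk c m M trs T ((\<lambda>_. 0)(Dh := j + 2)) h'"
    proof (rule witness_complete[OF wf m trs \<tau>s])
      show "occurs T (j + 2) (map Bit (witness r d C) @ STOP # concat (map (layer_row j C) [0..<Suc d]) @ rows)"
        using body unfolding occurs_append[of T "j + 2" "map Bit y @ STOP # layers @ rows"]
        unfolding layers_def y_def by blast
      show "rows = concat (map (\<lambda>t. row m C trs \<tau>s (bits_of j t)) [0..<2 ^ j])" by (rule rows_def)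
      show "2 * (j + 3 + length (witness r d C) + Suc d * (Suc j + length C) + length rows) < length T"
        unfolding y_def[symmetric] core_def[symmetric] lenT N_def by simp
    qed (unfold lenT N_def core_def, simp_all)
    then obtain h' where "witness_chk c m M trs T ((\<lambda>_. 0)(Dh := j + 2)) h'" by blast
    moreover have "header_chk T (\<lambda>_. 0) ((\<lambda>_. 0)(Dh := j + 2))"
      unfolding header_chk_iff[OF T0] using hd by blast
    ultimately have "P T (\<lambda>_. 0) h'" unfolding P_def seq_iff by blast
    moreover have "v \<in> lists G" using uG unfolding v_def by (auto dest: in_set_dropD)
    moreover have "length v \<le> 2 ^ ((2 * q + 5) * length z + (2 * q + 5))"
    proof -
      have "length rows \<le> 2 ^ j * (3 * E)" unfolding rows_def
      proof (rule length_concat_le)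
        fix t :: nat assume "t < 2 ^ j"
        have "bits_of j t \<in> accepted m C j" if "circuit_eval m C (bits_of j t)"
          using that by (simp add: accepted_def)
        then have "length (row m C trs \<tau>s (bits_of j t)) \<le> 1 + j + length C + E"
          using short_runs[of "bits_of j t"] by (auto simp: row_def)
        also have "\<dots> \<le> 3 * E" using Cy(1) y E(1,5) by linarith
        finally show "length (row m C trs \<tau>s (bits_of j t)) \<le> 3 * E" .
      qed
      also have "\<dots> \<le> E * (3 * E)" using E(3) by (intro mult_le_mono1)
      finally have r: "length rows \<le> 3 * (E * E)" by simp
      have "Suc d * (Suc j + length C) \<le> (2 * E) * (2 * E)"
        using Cy y E(1,5,6) by (intro mult_le_mono) linarith+
      then have l: "Suc d * (Suc j + length C) \<le> 4 * (E * E)" by simp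
      have E2: "E \<le> E * E" using E(6) by simp
      have "core \<le> 9 * (E * E)" unfolding core_def using r l E(1,5) y E2 by linarith
      \<comment> \<open>\<open>core\<close> enters three times, which contributes 27, and the other
        summands contribute at most 4. Rounding up to a power of two gives the 5 in the
        exponent.\<close>
      then have "core + N \<le> 32 * (E * E)" unfolding N_def using E(1,4,6) E2 by linarith
      then have "length v \<le> 32 * (E * E)" unfolding v_def using lenu by simp
      also have "32 * (E * E) = 2 ^ (5 + 2 * (q * (j + 1)))"
      proof -
        have "E * E = 2 ^ (2 * (q * (j + 1)))"
          unfolding E_def power_add[symmetric] by (simp only: mult_2)
        moreover have "(32::nat) = 2 ^ 5" by simp
        ultimately show ?thesis by (simp only: power_add)
      qed
      also have "\<dots> \<le> 2 ^ ((2 * q + 5) * length z + (2 * q + 5))"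
      proof (rule power_increasing)
        have "2 * (q * (j + 1)) \<le> 2 * (q * (length z + 1))" using j by (intro mult_le_mono2) simp
        moreover have "2 * (q * (length z + 1)) + 5 + 5 * length z = (2 * q + 5) * length z + (2 * q + 5)"
          by (simp add: algebra_simps)
        ultimately show "5 + 2 * (q * (j + 1)) \<le> (2 * q + 5) * length z + (2 * q + 5)"
          by linarith
      qed simp
      finally show ?thesis .
    qed
    ultimately show "\<exists>w\<in>lists G. length w \<le> 2 ^ ((2 * q + 5) * length z + (2 * q + 5)) \<and>
        (\<exists>h. P (track (map Bit z @ w)) (\<lambda>_. 0) h)"
      unfolding T_def uv by blast
  qed
qed


section \<open>Greedy search with an oracle\<close>

text \<open>The words that the search passes through. The true bit is tried first, so the search
  follows the lexicographically largest branch.\<close>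

inductive greedy :: "(bool list \<Rightarrow> bool) \<Rightarrow> bool list \<Rightarrow> bool" for P where
  greedy_Nil: "greedy P []"
| greedy_True: "greedy P a \<Longrightarrow> P (a @ [True]) \<Longrightarrow> greedy P (a @ [True])"
| greedy_False: "greedy P a \<Longrightarrow> \<not> P (a @ [True]) \<Longrightarrow> P (a @ [False]) \<Longrightarrow> greedy P (a @ [False])"

definition stuck :: "(bool list \<Rightarrow> bool) \<Rightarrow> bool list \<Rightarrow> bool" where
  "stuck P a \<longleftrightarrow> greedy P a \<and> \<not> P (a @ [True]) \<and> \<not> P (a @ [False])"

lemma greedy_holds: "greedy P a \<Longrightarrow> P [] \<Longrightarrow> P a"
  by (induction rule: greedy.induct) simp_all

text \<open>A false bit is appended only after the true one has been refused. This is the source of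
  maximality.\<close>

lemma greedy_prefix_not_True:
  "greedy P a \<Longrightarrow> a = p @ False # s \<Longrightarrow> \<not> P (p @ [True])"
proof (induction arbitrary: s rule: greedy.induct)
  case greedy_Nil
  then show ?case by simp
next
  case (greedy_True a)
  then show ?case by (cases s rule: rev_cases) auto
next
  case (greedy_False a)
  then show ?case by (cases s rule: rev_cases) auto
qed

text \<open>The first \<open>Suc j\<close> bits are the census; the zeros after them, with the one
  that ends them, are the depth bound.\<close>

definition output_of :: "nat \<Rightarrow> bool list \<Rightarrow> bool list" where
  "output_of j a = tl (dropWhile Not (drop (Suc j) a))"

text \<open>The input tape is reused as a counter: with the added cell \<open>Aux 0\<close> it has
  as many cells as the census has bits, and its head moves left by one cell per bit. On the blank
  cell to the left of the input the zeros of the depth bound are skipped. The one that ends them is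
  recorded there as \<open>Aux 1\<close>, which switches the output on.\<close>

fun mode_act :: "symbol \<Rightarrow> bool \<Rightarrow> (symbol \<times> move) \<times> (symbol \<times> move)" where
  "mode_act (Bit c) b = ((Bit c, Move_Left), (Blank, Move_Stay))"
| "mode_act Blank b = ((if b then Aux 1 else Blank, Move_Stay), (Blank, Move_Stay))"
| "mode_act (Aux n) b = (if n = 0 then ((Aux n, Move_Left), (Blank, Move_Stay))
                         else ((Aux n, Move_Stay), (Bit b, Move_Right)))"

text \<open>State 0 writes the header of the query, state 5 appends a tentative true bit, and state
  1 is the query with the answers 2 and 3. A refused true bit is changed to false; a refused false
  bit ends the search in state 4.\<close>

fun search_rule :: "nat \<Rightarrow> symbol \<Rightarrow> symbol \<Rightarrow> (nat \<times> (symbol \<times> move) list) option" where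
  "search_rule q s s' =
     (if q = 0 then (case s of
         Bit b \<Rightarrow> Some (0, [(Bit b, Move_Right), (Bit True, Move_Right), (Blank, Move_Stay)])
       | Blank \<Rightarrow> Some (5, [(Aux 0, Move_Stay), (Bit False, Move_Right), (Blank, Move_Stay)])
       | Aux n \<Rightarrow> None)
      else if q = 5 then Some (1, [(s, Move_Stay), (Bit True, Move_Stay), (Blank, Move_Stay)])
      else if q = 2 then (case s' of
         Bit b \<Rightarrow> Some (5, [fst (mode_act s b), (Bit b, Move_Right), snd (mode_act s b)])
       | _ \<Rightarrow> None)
      else if q = 3 then (case s' of
         Bit b \<Rightarrow> Some (if b then (1, [(s, Move_Stay), (Bit False, Move_Stay), (Blank, Move_Stay)])
                        else (4, [(s, Move_Stay), (Bit False, Move_Stay), (Blank, Move_Stay)]))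
       | _ \<Rightarrow> None)
      else None)"

declare search_rule.simps [simp del]

definition search_symbols :: "symbol set" where
  "search_symbols = {Blank, Bit True, Bit False, Aux 0, Aux 1}"

text \<open>The head of the output tape always rests on the blank cell behind the output, so
  \<open>delta\<close> provides only for this case.\<close>

definition search_machine :: otm where
  "search_machine = \<lparr>tapes = 3, start = 0, final = 4,
     delta = {((q, [s, s', Blank]), r) |q s s' r. q < 6 \<and> s \<in> search_symbols \<and>
                s' \<in> search_symbols \<and> search_rule q s s' = Some r},
     query = 1, yes = 2, no = 3\<rparr>"

lemma search_rule_SomeD: "search_rule q s s' = Some (q', as) \<Longrightarrow> q \<noteq> 4 \<and> length as = 3"
  by (auto simp: search_rule.simps split: if_splits symbol.splits)

lemma wf_search_machine: "wf_det_otm search_machine"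
proof -
  let ?A = "({..<6} \<times> search_symbols \<times> search_symbols) :: (nat \<times> symbol \<times> symbol) set"
  have "delta search_machine \<subseteq>
      (\<lambda>(q, s, s'). ((q, [s, s', Blank]), the (search_rule q s s'))) ` ?A"
    by (force simp: search_machine_def)
  moreover have "finite ?A" by (simp add: search_symbols_def)
  ultimately have "finite (delta search_machine)" by (meson finite_imageI finite_subset)
  moreover have "single_valued (delta search_machine)"
    unfolding single_valued_def search_machine_def by fastforce
  moreover have "\<forall>((q, ss), (q', as)) \<in> delta search_machine.
       q \<noteq> final search_machine \<and> length ss = tapes search_machine \<and> length as = tapes search_machine"
    by (auto simp: search_machine_def dest: search_rule_SomeD)
  ultimately show ?thesis
    unfolding wf_det_otm_def wf_tm_def by (simp add: search_machine_def)
qed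

lemma ostep_searchI:
  assumes "search_rule q (scan T0) (scan T1) = Some (q', [a0, a1, a2])" "scan T2 = Blank"
    "q \<noteq> 1" "q < 6" "scan T0 \<in> search_symbols" "scan T1 \<in> search_symbols"
    "T0' = act a0 T0" "T1' = act a1 T1" "T2' = act a2 T2"
  shows "ostep B search_machine (q, [T0, T1, T2]) (q', [T0', T1', T2'])"
proof -
  have "((q, [scan T0, scan T1, Blank]), (q', [a0, a1, a2])) \<in> delta search_machine"
    using assms(1-6) by (simp add: search_machine_def)
  then have "step search_machine (q, [T0, T1, T2]) (q', [T0', T1', T2'])"
    using assms(2,7-9) by (auto intro!: exI[of _ "[a0, a1, a2]"])
  then show ?thesis using assms(3) by (simp add: search_machine_def)
qed

lemma ostep_searchI_query:
  "q' = (if tape_word T1 \<in> B then 2 else 3) \<Longrightarrow>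
    ostep B search_machine (1, [T0, T1, T2]) (q', [T0, T1, T2])"
  by (simp add: search_machine_def)

lemma tape_word_contents: "tape_word (contents (map Bit w), h) = w"
proof -
  have "(LEAST i. \<forall>b. contents (map Bit w) (int i) \<noteq> Bit b) = length w"
  proof (rule Least_equality)
    show "\<forall>b. contents (map Bit w) (int (length w)) \<noteq> Bit b"
      using contents_outside[of "map Bit w"] by simp
    fix i assume "\<forall>b. contents (map Bit w) (int i) \<noteq> Bit b"
    then show "length w \<le> i" using contents_nat[of i "map Bit w"] by (metis length_map not_le nth_map)
  qed
  then have "tape_word (contents (map Bit w), h) =
      map (\<lambda>i. contents (map Bit w) (int i) = Bit True) [0..<length w]"
    by (simp only: tape_word_def fst_conv)
  also have "\<dots> = map ((!) w) [0..<length w]" by (rule map_cong) simp_all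
  finally show ?thesis by (simp only: map_nth)
qed

section \<open>Configurations of the search machine\<close>

definition input_mark :: "bool list \<Rightarrow> bool list \<Rightarrow> tape" where
  "input_mark x a =
     (if length a \<le> Suc (length x) then
        ((contents (map Bit x @ [Aux 0])), int (length x) - int (length a))
      else (contents (map Bit x @ [Aux 0]), -1))"

text \<open>A true bit beyond the census means that the end of the depth bound has been passed and
  the circuit is being output.\<close>

definition mark_tape :: "bool list \<Rightarrow> bool list \<Rightarrow> tape" where
  "mark_tape x a =
     (if True \<in> set (drop (Suc (length x)) a)
      then ((fst (input_mark x a))(-1 := Aux 1), -1) else input_mark x a)"

definition word_tape :: "bool list \<Rightarrow> tape" where
  "word_tape w = (contents (map Bit w), int (length w))"

lemma contents_negative: "contents T (-1) = Blank"
  by (simp add: contents_def)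

lemma word_tape_Nil: "word_tape [] = blank_tape"
  by (simp add: word_tape_def blank_tape_contents)

lemma scan_word_tape [simp]: "scan (word_tape w) = Blank"
  using contents_outside[of "map Bit w"] by (simp add: word_tape_def)

lemma act_word_tape: "act (Bit b, Move_Right) (word_tape w) = word_tape (w @ [b])"
  using contents_snoc[of "map Bit w" "Bit b"] by (simp add: word_tape_def)

lemma act_stay: "act (scan T, Move_Stay) T = T"
  by (cases T) simp

lemma dropWhile_Not_Nil:
  assumes "True \<notin> set l"
  shows "\<And>b. b \<in> set l \<Longrightarrow> \<not> b" "dropWhile Not l = []"
proof -
  show *: "\<not> b" if "b \<in> set l" for b using assms that by (cases b) simp_all
  show "dropWhile Not l = []" unfolding dropWhile_eq_Nil_conv by (rule ballI) (rule *)
qed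

text \<open>The output can be produced bit by bit: before the end of the depth bound there is none,
  afterwards each new bit is copied.\<close>

lemma output_of_snoc:
  "output_of j (a @ [b]) =
    (if True \<in> set (drop (Suc j) a) then output_of j a @ [b] else [])"
proof -
  let ?l = "drop (Suc j) a"
  let ?r = "drop (Suc j - length a) [b]"
  have o: "output_of j (a @ [b]) = tl (dropWhile Not (?l @ ?r))"
    by (simp only: output_of_def drop_append)
  show ?thesis
  proof (cases "True \<in> set ?l")
    case True
    have "\<not> length a < Suc j"
    proof
      assume "length a < Suc j"
      then have "drop (Suc j) a = []" by simp
      with True show False by simp
    qed
    then have r: "?r = [b]" by simp
    have "dropWhile Not ?l \<noteq> []"
    proof
      assume "dropWhile Not ?l = []"
      then have "\<forall>b \<in> set ?l. \<not> b" by (simp only: dropWhile_eq_Nil_conv)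
      from bspec[OF this True] show False by simp
    qed
    moreover have "dropWhile Not (?l @ [b]) = dropWhile Not ?l @ [b]"
      by (rule dropWhile_append1[OF True]) simp
    ultimately show ?thesis using True unfolding o r by (simp add: output_of_def)
  next
    case False
    have "dropWhile Not (?l @ ?r) = dropWhile Not ?r"
      by (rule dropWhile_append2) (rule dropWhile_Not_Nil(1)[OF False])
    moreover have "tl (dropWhile Not ?r) = []" by (cases "Suc j - length a") simp_all
    ultimately show ?thesis using False unfolding o by simp
  qed
qed

lemma output_of_eq_Nil: "True \<notin> set (drop (Suc j) a) \<Longrightarrow> output_of j a = []"
  by (simp add: output_of_def dropWhile_Not_Nil(2))

lemma scan_mark_tape:
  "scan (mark_tape x a) =
     (if True \<in> set (drop (Suc (length x)) a) then Aux 1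
      else if length x < length a then Blank
      else (map Bit x @ [Aux 0]) ! (length x - length a))"
proof (cases "length x < length a")
  case True
  then show ?thesis by (auto simp: mark_tape_def input_mark_def contents_def)
next
  case False
  then have "int (length x) - int (length a) = int (length x - length a)" by simp
  moreover have "contents (map Bit x @ [Aux 0]) (int (length x - length a))
      = (map Bit x @ [Aux 0]) ! (length x - length a)"
    by (rule contents_nat) simp
  ultimately show ?thesis using False by (simp add: mark_tape_def input_mark_def)
qed

text \<open>The cases are the three phases of a witness: census, depth bound, circuit. In each, a
  single step carries counter and output over to the word extended by \<open>b\<close>.\<close>

lemma act_mark_tape:
  "act (fst (mode_act (scan (mark_tape x a)) b)) (mark_tape x a) = mark_tape x (a @ [b])"
  "act (snd (mode_act (scan (mark_tape x a)) b)) (word_tape (output_of (length x) a))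
     = word_tape (output_of (length x) (a @ [b]))"
proof -
  let ?T = "contents (map Bit x @ [Aux 0])"
  consider (out) "True \<in> set (drop (Suc (length x)) a)"
    | (skip) "True \<notin> set (drop (Suc (length x)) a)" "length x < length a"
    | (count) "length a \<le> length x" by fastforce
  then have "act (fst (mode_act (scan (mark_tape x a)) b)) (mark_tape x a) = mark_tape x (a @ [b]) \<and>
    act (snd (mode_act (scan (mark_tape x a)) b)) (word_tape (output_of (length x) a))
     = word_tape (output_of (length x) (a @ [b]))"
  proof cases
    case out
    then have l: "Suc (length x) < length a" by (metis drop_all empty_iff list.set(1) not_le)
    then have t: "mark_tape x a = (?T(-1 := Aux 1), -1)" "mark_tape x (a @ [b]) = (?T(-1 := Aux 1), -1)"
      using out by (auto simp: mark_tape_def input_mark_def)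
    have s: "scan (mark_tape x a) = Aux 1" by (simp add: t)
    show ?thesis unfolding s output_of_snoc using out t by (simp add: act_word_tape)
  next
    case skip
    have t: "mark_tape x a = (?T, -1)"
      using skip by (auto simp: mark_tape_def input_mark_def)
    have s: "scan (mark_tape x a) = Blank" by (simp add: t contents_negative)
    have u: "mark_tape x (a @ [b]) = (?T(-1 := (if b then Aux 1 else Blank)), -1)"
    proof -
      have "?T(-1 := Blank) = ?T" using contents_negative by (metis fun_upd_triv)
      then show ?thesis
        using skip by (auto simp: mark_tape_def input_mark_def)
    qed
    have "act (Blank, Move_Stay) (word_tape []) = word_tape []"
      by (metis act_stay scan_word_tape)
    then show ?thesis unfolding s output_of_snoc u using skip t by (simp add: output_of_eq_Nil)
  next
    case count
    then have t: "mark_tape x a = (?T, int (length x) - int (length a))"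
      "mark_tape x (a @ [b]) = (?T, int (length x) - int (length a) - 1)"
      by (auto simp: mark_tape_def input_mark_def)
    have nd: "True \<notin> set (drop (Suc (length x)) a)" using count by simp
    let ?s = "(map Bit x @ [Aux 0]) ! (length x - length a)"
    have s: "scan (mark_tape x a) = ?s"
      using count by (simp add: scan_mark_tape)
    have "(\<exists>c. ?s = Bit c) \<or> ?s = Aux 0"
      by (cases a) (use count in \<open>auto simp: nth_append\<close>)
    then have m: "mode_act ?s b = ((?s, Move_Left), (Blank, Move_Stay))" by auto
    have w: "act (Blank, Move_Stay) (word_tape []) = word_tape []"
      by (metis act_stay scan_word_tape)
    have "act (scan (mark_tape x a), Move_Left) (mark_tape x a) = mark_tape x (a @ [b])"
      by (simp add: t)
    then show ?thesis unfolding s output_of_snoc m using nd w by (simp add: output_of_eq_Nil)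
  qed
  then show "act (fst (mode_act (scan (mark_tape x a)) b)) (mark_tape x a) = mark_tape x (a @ [b])"
    "act (snd (mode_act (scan (mark_tape x a)) b)) (word_tape (output_of (length x) a))
     = word_tape (output_of (length x) (a @ [b]))" by blast+
qed

definition search_word :: "bool list \<Rightarrow> bool list \<Rightarrow> bool list" where
  "search_word x a = replicate (length x) True @ False # a"

definition search_config :: "nat \<Rightarrow> bool list \<Rightarrow> bool list \<Rightarrow> tape \<Rightarrow> config" where
  "search_config q x a T = (q, [mark_tape x a, T, word_tape (output_of (length x) a)])"

text \<open>The head rests on the tentative bit, so that a refused true can be overwritten by
  false.\<close>

definition query_tape :: "bool list \<Rightarrow> bool \<Rightarrow> tape" where
  "query_tape w b = (contents (map Bit (w @ [b])), int (length w))"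

lemma scan_query_tape [simp]: "scan (query_tape w b) = Bit b"
  using contents_nat[of "length w" "map Bit (w @ [b])"]
  by (simp add: query_tape_def nth_append del: map_append contents_nat)

lemma scan_mark_tape_symbols: "scan (mark_tape x a) \<in> search_symbols"
proof -
  have "(map Bit x @ [Aux 0]) ! (length x - length a) \<in> set (map Bit x @ [Aux 0])"
    by (rule nth_mem) simp
  also have "\<dots> \<subseteq> search_symbols" by (auto simp: search_symbols_def)
  finally show ?thesis by (simp add: scan_mark_tape) (simp add: search_symbols_def)
qed

lemma Bit_symbols: "Bit b \<in> search_symbols" "Blank \<in> search_symbols"
  by (cases b; simp add: search_symbols_def)+

lemma search_try:
  "ostep B search_machine (search_config 5 x a (word_tape w)) (search_config 1 x a (query_tape w True))"
  unfolding search_config_def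
proof (rule ostep_searchI)
  show "search_rule 5 (scan (mark_tape x a)) (scan (word_tape w)) =
      Some (1, [(scan (mark_tape x a), Move_Stay), (Bit True, Move_Stay), (Blank, Move_Stay)])"
    by (simp add: search_rule.simps)
  show "query_tape w True = act (Bit True, Move_Stay) (word_tape w)"
    using contents_snoc[of "map Bit w" "Bit True"] by (simp add: word_tape_def query_tape_def)
  show "word_tape (output_of (length x) a) = act (Blank, Move_Stay) (word_tape (output_of (length x) a))"
    by (metis act_stay scan_word_tape)
qed (simp_all add: scan_mark_tape_symbols Bit_symbols act_stay)

lemma search_query:
  "ostep B search_machine (search_config 1 x a (query_tape w b))
     (search_config (if w @ [b] \<in> B then 2 else 3) x a (query_tape w b))"
  unfolding search_config_def
  by (rule ostep_searchI_query) (simp add: query_tape_def tape_word_contents del: map_append)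

lemma search_yes:
  "ostep B search_machine (search_config 2 x a (query_tape w b))
     (search_config 5 x (a @ [b]) (word_tape (w @ [b])))"
  unfolding search_config_def
proof (rule ostep_searchI)
  show "search_rule 2 (scan (mark_tape x a)) (scan (query_tape w b)) =
      Some (5, [fst (mode_act (scan (mark_tape x a)) b), (Bit b, Move_Right),
                snd (mode_act (scan (mark_tape x a)) b)])"
    by (simp add: search_rule.simps)
  show "word_tape (w @ [b]) = act (Bit b, Move_Right) (query_tape w b)"
    using contents_snoc[of "map Bit w" "Bit b"]
    by (metis act.simps act_word_tape fun_upd_upd length_map map_append list.simps(8,9) query_tape_def word_tape_def)
qed (simp_all add: scan_mark_tape_symbols Bit_symbols act_mark_tape)

lemma search_no_True:
  "ostep B search_machine (search_config 3 x a (query_tape w True)) (search_config 1 x a (query_tape w False))"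
  unfolding search_config_def
proof (rule ostep_searchI)
  show "search_rule 3 (scan (mark_tape x a)) (scan (query_tape w True)) =
      Some (1, [(scan (mark_tape x a), Move_Stay), (Bit False, Move_Stay), (Blank, Move_Stay)])"
    by (simp add: search_rule.simps)
  show "query_tape w False = act (Bit False, Move_Stay) (query_tape w True)"
    using contents_snoc[of "map Bit w" "Bit True"] contents_snoc[of "map Bit w" "Bit False"]
    by (simp add: query_tape_def) (metis fun_upd_upd)
  show "word_tape (output_of (length x) a) = act (Blank, Move_Stay) (word_tape (output_of (length x) a))"
    by (metis act_stay scan_word_tape)
qed (simp_all add: scan_mark_tape_symbols Bit_symbols act_stay)

lemma search_no_False:
  "ostep B search_machine (search_config 3 x a (query_tape w False)) (search_config 4 x a (query_tape w False))"
  unfolding search_config_def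
proof (rule ostep_searchI)
  show "search_rule 3 (scan (mark_tape x a)) (scan (query_tape w False)) =
      Some (4, [(scan (mark_tape x a), Move_Stay), (Bit False, Move_Stay), (Blank, Move_Stay)])"
    by (simp add: search_rule.simps)
  show "query_tape w False = act (Bit False, Move_Stay) (query_tape w False)"
    by (metis act_stay scan_query_tape)
  show "word_tape (output_of (length x) a) = act (Blank, Move_Stay) (word_tape (output_of (length x) a))"
    by (metis act_stay scan_word_tape)
qed (simp_all add: scan_mark_tape_symbols Bit_symbols act_stay)

lemma search_extend_True:
  assumes "w @ [True] \<in> B"
  shows "(ostep B search_machine ^^ 3) (search_config 5 x a (word_tape w))
           (search_config 5 x (a @ [True]) (word_tape (w @ [True])))"
proof -
  note I = relpowp_Suc_I[where P = "ostep B search_machine"]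
  have "ostep B search_machine (search_config 1 x a (query_tape w True))
          (search_config 2 x a (query_tape w True))"
    using search_query[of B x a w True] assms by simp
  from I[OF I[OF I[OF relpowp_0_I[where P = "ostep B search_machine"] search_try] this] search_yes]
  show ?thesis unfolding numeral_3_eq_3 .
qed

lemma search_not_True:
  assumes "w @ [True] \<notin> B"
  shows "(ostep B search_machine ^^ 4) (search_config 5 x a (word_tape w))
           (search_config (if w @ [False] \<in> B then 2 else 3) x a (query_tape w False))"
proof -
  note I = relpowp_Suc_I[where P = "ostep B search_machine"]
  have "ostep B search_machine (search_config 1 x a (query_tape w True))
          (search_config 3 x a (query_tape w True))"
    using search_query[of B x a w True] assms by simp
  from I[OF I[OF I[OF I[OF relpowp_0_I[where P = "ostep B search_machine"] search_try] this]
      search_no_True] search_query]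
  have "(ostep B search_machine ^^ Suc (Suc (Suc (Suc 0)))) (search_config 5 x a (word_tape w))
           (search_config (if w @ [False] \<in> B then 2 else 3) x a (query_tape w False))" .
  moreover have "(4::nat) = Suc (Suc (Suc (Suc 0)))" by simp
  ultimately show ?thesis by metis
qed

lemma search_input:
  "i \<le> length x \<Longrightarrow> (ostep B search_machine ^^ i) (init search_machine x)
     (0, [(contents (map Bit x), int i), word_tape (replicate i True), blank_tape])"
proof (induction i)
  case 0
  then show ?case
    by (simp add: init_def search_machine_def numeral_3_eq_3 input_tape_contents word_tape_Nil)
next
  case (Suc i)
  have c: "contents (map Bit x) (int i) = Bit (x ! i)"
    using contents_nat[of i "map Bit x"] Suc.prems by simp
  have "ostep B search_machine
     (0, [(contents (map Bit x), int i), word_tape (replicate i True), blank_tape])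
     (0, [(contents (map Bit x), int (Suc i)), word_tape (replicate (Suc i) True), blank_tape])"
  proof (rule ostep_searchI)
    show "search_rule 0 (scan (contents (map Bit x), int i)) (scan (word_tape (replicate i True))) =
        Some (0, [(Bit (x ! i), Move_Right), (Bit True, Move_Right), (Blank, Move_Stay)])"
      by (simp add: search_rule.simps c)
    show "(contents (map Bit x), int (Suc i)) = act (Bit (x ! i), Move_Right) (contents (map Bit x), int i)"
      using c by (simp add: fun_upd_idem)
    show "word_tape (replicate (Suc i) True) = act (Bit True, Move_Right) (word_tape (replicate i True))"
      by (simp add: act_word_tape replicate_append_same)
    show "blank_tape = act (Blank, Move_Stay) blank_tape"
      by (simp add: blank_tape_def fun_upd_idem)
  qed (simp_all add: c Bit_symbols blank_tape_def)
  with Suc show ?case by (auto simp: relcompp_apply simp del: ostep.simps)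
qed

lemma search_start:
  "(ostep B search_machine ^^ Suc (length x)) (init search_machine x)
     (search_config 5 x [] (word_tape (search_word x [])))"
proof -
  have c: "contents (map Bit x) (int (length x)) = Blank"
    using contents_outside[of "map Bit x"] by simp
  have "ostep B search_machine
     (0, [(contents (map Bit x), int (length x)), word_tape (replicate (length x) True), blank_tape])
     (search_config 5 x [] (word_tape (search_word x [])))"
    unfolding search_config_def
  proof (rule ostep_searchI)
    show "search_rule 0 (scan (contents (map Bit x), int (length x)))
          (scan (word_tape (replicate (length x) True))) =
        Some (5, [(Aux 0, Move_Stay), (Bit False, Move_Right), (Blank, Move_Stay)])"
      by (simp add: search_rule.simps c)
    show "mark_tape x [] = act (Aux 0, Move_Stay) (contents (map Bit x), int (length x))"
      using contents_snoc[of "map Bit x" "Aux 0"] by (simp add: mark_tape_def input_mark_def)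
    show "word_tape (search_word x []) = act (Bit False, Move_Right) (word_tape (replicate (length x) True))"
      by (simp add: act_word_tape search_word_def)
    show "word_tape (output_of (length x) []) = act (Blank, Move_Stay) blank_tape"
      by (simp add: blank_tape_def fun_upd_idem output_of_def word_tape_Nil)
  qed (simp_all add: c Bit_symbols blank_tape_def)
  then show ?thesis using search_input[of "length x" x B]
    by (auto simp: relcompp_apply simp del: ostep.simps)
qed

text \<open>An accepted true bit takes three steps, an accepted false bit five.\<close>

lemma search_greedy:
  "greedy (\<lambda>a. search_word x a \<in> B) a \<Longrightarrow>
    \<exists>s \<le> 5 * length a. (ostep B search_machine ^^ s)
      (search_config 5 x [] (word_tape (search_word x []))) (search_config 5 x a (word_tape (search_word x a)))"
proof (induction rule: greedy.induct)
  case greedy_Nil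
  show ?case by (intro exI[of _ 0]) simp
next
  case (greedy_True a)
  then obtain s where s: "s \<le> 5 * length a" "(ostep B search_machine ^^ s)
      (search_config 5 x [] (word_tape (search_word x []))) (search_config 5 x a (word_tape (search_word x a)))"
    by blast
  have e: "search_word x a @ [True] = search_word x (a @ [True])" by (simp add: search_word_def)
  have "(ostep B search_machine ^^ (s + 3)) (search_config 5 x [] (word_tape (search_word x [])))
      (search_config 5 x (a @ [True]) (word_tape (search_word x (a @ [True]))))"
    using search_extend_True[of "search_word x a" B x a] greedy_True.hyps(2) s(2)
    unfolding relpowp_add relcompp_apply e by blast
  then show ?case using s(1) by (intro exI[of _ "s + 3"]) simp
next
  case (greedy_False a)
  then obtain s where s: "s \<le> 5 * length a" "(ostep B search_machine ^^ s)
      (search_config 5 x [] (word_tape (search_word x []))) (search_config 5 x a (word_tape (search_word x a)))"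
    by blast
  have e: "search_word x a @ [b] = search_word x (a @ [b])" for b by (simp add: search_word_def)
  have "(ostep B search_machine ^^ 4) (search_config 5 x a (word_tape (search_word x a)))
      (search_config 2 x a (query_tape (search_word x a) False))"
    using search_not_True[of "search_word x a" B x a] greedy_False e by simp
  from relpowp_Suc_I[where P = "ostep B search_machine", OF this search_yes]
  have "(ostep B search_machine ^^ 5) (search_config 5 x a (word_tape (search_word x a)))
      (search_config 5 x (a @ [False]) (word_tape (search_word x (a @ [False]))))"
    unfolding e by (simp only: eval_nat_numeral)
  then have "(ostep B search_machine ^^ (s + 5)) (search_config 5 x [] (word_tape (search_word x [])))
      (search_config 5 x (a @ [False]) (word_tape (search_word x (a @ [False]))))"
    using s(2) unfolding relpowp_add relcompp_apply by blast
  then show ?case using s(1) by (intro exI[of _ "s + 5"]) simp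
qed

lemma stuck_exists:
  assumes "\<And>a. P a \<Longrightarrow> length a \<le> n"
  shows "\<exists>a. stuck P a \<and> length a \<le> n"
proof -
  have len: "a = [] \<or> P a" if "greedy P a" for a using that by cases auto
  have "\<exists>a. stuck P a \<and> length a \<le> n" if "greedy P a" for a
    using that
  proof (induction "n - length a" arbitrary: a rule: less_induct)
    case less
    have la: "length a \<le> n" using len[OF less.prems] assms by auto
    show ?case
    proof (cases "P (a @ [True])")
      case True
      have "n - length (a @ [True]) < n - length a" using assms[OF True] by simp
      then show ?thesis using less.hyps greedy_True[OF less.prems True] by blast
    next
      case nT: False
      show ?thesis
      proof (cases "P (a @ [False])")
        case True
        have "n - length (a @ [False]) < n - length a" using assms[OF True] by simp
        then show ?thesis using less.hyps greedy_False[OF less.prems nT True] by blast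
      next
        case False
        then show ?thesis using nT less.prems la by (auto simp: stuck_def)
      qed
    qed
  qed
  then show ?thesis using greedy_Nil by blast
qed

lemma poly_bounded_search_time: "poly_bounded (\<lambda>n. n + 8 + 5 * (n + 2) ^ c)"
  unfolding poly_bounded_def
proof (intro exI bigoI)
  show "\<forall>\<^sub>F n in sequentially. norm (real (n + 8 + 5 * (n + 2) ^ c))
      \<le> (9 + 5 * 3 ^ c) * norm (real n ^ Suc c)"
  proof (rule eventually_sequentiallyI)
    fix n :: nat assume n: "1 \<le> n"
    have "(n + 2) ^ c \<le> (3 * n) ^ c" by (rule power_mono) (use n in auto)
    also have "\<dots> \<le> 3 ^ c * n ^ Suc c" using n by (simp add: power_mult_distrib)
    finally have "5 * (n + 2) ^ c \<le> 5 * 3 ^ c * n ^ Suc c" by simp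
    moreover have "n + 8 \<le> 9 * n ^ Suc c"
    proof -
      have "n \<le> n ^ Suc c" using n by simp
      then show ?thesis using n by linarith
    qed
    ultimately have "n + 8 + 5 * (n + 2) ^ c \<le> (9 + 5 * 3 ^ c) * n ^ Suc c"
      unfolding distrib_right by linarith
    then have "real (n + 8 + 5 * (n + 2) ^ c) \<le> real ((9 + 5 * 3 ^ c) * n ^ Suc c)"
      by (rule of_nat_mono)
    then show "norm (real (n + 8 + 5 * (n + 2) ^ c)) \<le> (9 + 5 * 3 ^ c) * norm (real n ^ Suc c)"
      by simp
  qed
qed

text \<open>Every bit of the result is settled by at most two queries, so the length bound on words
  in the oracle bounds the running time.\<close>

theorem greedy_FP:
  assumes "\<And>x a. search_word x a \<in> B \<Longrightarrow> length a \<le> (length x + 2) ^ c"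
  shows "\<exists>f \<in> FP B. \<forall>x. \<exists>a. stuck (\<lambda>a. search_word x a \<in> B) a \<and> f x = output_of (length x) a"
proof -
  have "\<exists>a. stuck (\<lambda>a. search_word x a \<in> B) a \<and> length a \<le> (length x + 2) ^ c" for x
    by (rule stuck_exists) (rule assms)
  then obtain g where g: "\<And>x. stuck (\<lambda>a. search_word x a \<in> B) (g x)"
    "\<And>x. length (g x) \<le> (length x + 2) ^ c" by metis
  have "\<exists>s \<le> length x + 8 + 5 * (length x + 2) ^ c. \<exists>ts.
      (ostep B search_machine ^^ s) (init search_machine x) (final search_machine, ts) \<and>
      tape_word (ts ! 2) = output_of (length x) (g x)" for x
  proof -
    let ?w = "search_word x (g x)"
    obtain s where s: "s \<le> 5 * length (g x)" "(ostep B search_machine ^^ s)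
        (search_config 5 x [] (word_tape (search_word x []))) (search_config 5 x (g x) (word_tape ?w))"
      using search_greedy g(1)[of x] unfolding stuck_def by blast
    have e: "?w @ [b] = search_word x (g x @ [b])" for b by (simp add: search_word_def)
    have ns: "?w @ [b] \<notin> B" for b
      using g(1)[of x] by (cases b) (simp_all add: stuck_def e)
    have "(ostep B search_machine ^^ 4) (search_config 5 x (g x) (word_tape ?w))
        (search_config 3 x (g x) (query_tape ?w False))"
      using search_not_True[of ?w B x "g x"] ns by simp
    then have "(ostep B search_machine ^^ Suc 4) (search_config 5 x (g x) (word_tape ?w))
        (search_config 4 x (g x) (query_tape ?w False))"
      using search_no_False by (rule relpowp_Suc_I)
    then have "(ostep B search_machine ^^ (Suc (length x) + (s + Suc 4))) (init search_machine x)
        (search_config 4 x (g x) (query_tape ?w False))"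
      using search_start[of x B] s(2) unfolding relpowp_add relcompp_apply by blast
    moreover have "Suc (length x) + (s + Suc 4) \<le> length x + 8 + 5 * (length x + 2) ^ c"
      using s(1) g(2)[of x] by simp
    moreover have "final search_machine = 4" by (simp add: search_machine_def)
    moreover have "tape_word (word_tape (output_of (length x) (g x))) = output_of (length x) (g x)"
      by (simp add: word_tape_def tape_word_contents)
    ultimately show ?thesis unfolding search_config_def
      by (metis (no_types, lifting) nth_Cons_0 nth_Cons_Suc numeral_2_eq_2)
  qed
  then have "(\<lambda>x. output_of (length x) (g x)) \<in> FP B"
    unfolding FP_def using wf_search_machine poly_bounded_search_time
    by (intro CollectI exI[of _ search_machine] exI[of _ "\<lambda>n. n + 8 + 5 * (n + 2) ^ c"]) blast
  then show ?thesis
  proof (rule bexI[rotated])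
    show "\<forall>x. \<exists>a. stuck (\<lambda>a. search_word x a \<in> B) a \<and> output_of (length x) (g x) = output_of (length x) a"
      by (intro allI exI conjI, rule g(1), rule refl)
  qed
qed


section \<open>The lexicographically largest witness\<close>

lemma value_of_append: "value_of (p @ s) = value_of p * 2 ^ length s + value_of s"
proof (induction s rule: rev_induct)
  case (snoc b s)
  then show ?case unfolding append_assoc[symmetric] value_of_snoc by (simp add: algebra_simps)
qed simp

lemma value_of_Cons: "value_of (b # u) = of_bool b * 2 ^ length u + value_of u"
  using value_of_append[of "[b]" u] value_of_snoc[of "[]" b] by simp

text \<open>Turns a larger census into a word that branches off with a true bit where the smaller
  one has a false bit, the situation that maximality excludes.\<close>

lemma value_of_less_split:
  assumes "length r = length r'" "value_of r < value_of r'"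
  shows "\<exists>p s s'. r = p @ False # s \<and> r' = p @ True # s'"
  using assms
proof (induction r r' rule: list_induct2)
  case Nil
  then show ?case by simp
next
  case (Cons b r b' r')
  show ?case
  proof (cases "b = b'")
    case True
    have "value_of r < value_of r'" using Cons.prems Cons.hyps True by (simp add: value_of_Cons)
    from Cons.IH[OF this] obtain p s s' where p: "r = p @ False # s" "r' = p @ True # s'"
      by blast
    show ?thesis by (rule exI[of _ "b # p"], rule exI[of _ s], rule exI[of _ s']) (simp add: p True)
  next
    case False
    have nb: "\<not> b"
    proof
      assume b: b
      with False have "\<not> b'" by simp
      with b show False using Cons.prems Cons.hyps value_of_less[of r'] by (simp add: value_of_Cons)
    qed
    with False have b': b' by simp
    show ?thesis by (rule exI[of _ "[]"], rule exI[of _ r], rule exI[of _ r']) (simp add: nb b')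
  qed
qed

lemma unary_header_inj:
  assumes "replicate i True @ False # u = replicate j True @ False # v"
  shows "i = j \<and> u = v"
proof -
  have "takeWhile id (replicate i True @ False # u) = replicate i True" for i u
    by (induction i) simp_all
  then have "i = j" using assms by (metis length_replicate)
  then show ?thesis using assms by simp
qed

text \<open>The unary header is self-delimiting, so it fixes the input length to which the witness
  belongs.\<close>

lemma search_word_prefixes_of:
  "search_word x a \<in> prefixes_of c m A \<longleftrightarrow>
    (\<exists>r d C s. witness_for c m A (length x) r d C \<and> a @ s = witness r d C)"
  (is "?L \<longleftrightarrow> ?R")
proof
  assume ?L
  then obtain j r d C s where w: "witness_for c m A j r d C"
    "search_word x a @ s = replicate j True @ False # witness r d C"
    unfolding prefixes_of_def by blast
  have "replicate (length x) True @ False # (a @ s) = replicate j True @ False # witness r d C"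
    using w(2) by (simp only: search_word_def append_assoc append_Cons)
  from unary_header_inj[OF this] have e: "length x = j" "a @ s = witness r d C" by simp_all
  then show ?R using w(1) by blast
next
  assume ?R
  then obtain r d C s where w: "witness_for c m A (length x) r d C" "a @ s = witness r d C" by blast
  have "search_word x a @ s = replicate (length x) True @ False # witness r d C"
    by (simp only: search_word_def append_assoc append_Cons w(2))
  then show ?L unfolding prefixes_of_def using w(1) by blast
qed

lemma output_of_witness: "length r = Suc j \<Longrightarrow> output_of j (witness r d C) = encode_circuit C"
proof -
  assume "length r = Suc j"
  moreover have "dropWhile Not (replicate d False @ True # w) = True # w" for w
    by (induction d) simp_all
  ultimately show ?thesis by (simp add: output_of_def witness_def)
qed

text \<open>A proper prefix of a witness can be extended by the next bit of that witness, so the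
  search stops only at a complete one.\<close>

lemma stuck_witness:
  assumes "stuck (\<lambda>a. search_word x a \<in> prefixes_of c m A) a" "witness_for c m A (length x) r0 d0 C0"
  obtains r d C where "witness_for c m A (length x) r d C" "a = witness r d C"
proof -
  let ?P = "\<lambda>a. search_word x a \<in> prefixes_of c m A"
  have "?P []" unfolding search_word_prefixes_of append_Nil using assms(2) by blast
  moreover have "greedy ?P a" using assms(1) by (simp only: stuck_def)
  ultimately have "?P a" by (rule greedy_holds[rotated])
  then obtain r d C s where w: "witness_for c m A (length x) r d C" "a @ s = witness r d C"
    unfolding search_word_prefixes_of by blast
  have "s = []"
  proof (cases s)
    case (Cons b s')
    then have e: "(a @ [b]) @ s' = witness r d C" using w(2) by simp
    have "?P (a @ [b])" unfolding search_word_prefixes_of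
      by (intro exI conjI, rule w(1), rule e)
    then show ?thesis using assms(1) by (cases b) (simp_all add: stuck_def)
  qed
  then show thesis using that w by simp
qed

lemma stuck_maximal:
  assumes "stuck (\<lambda>a. search_word x a \<in> prefixes_of c m A) (p @ False # s)"
  shows "\<not> (\<exists>r d C s'. witness_for c m A (length x) r d C \<and> witness r d C = p @ True # s')"
proof
  assume "\<exists>r d C s'. witness_for c m A (length x) r d C \<and> witness r d C = p @ True # s'"
  then obtain r d C s' where w: "witness_for c m A (length x) r d C" "witness r d C = p @ True # s'"
    by blast
  have e: "(p @ [True]) @ s' = witness r d C" by (simp add: w(2))
  have P: "search_word x (p @ [True]) \<in> prefixes_of c m A"
    unfolding search_word_prefixes_of by (intro exI conjI, rule w(1), rule e)
  have "greedy (\<lambda>a. search_word x a \<in> prefixes_of c m A) (p @ False # s)"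
    using assms by (simp only: stuck_def)
  from greedy_prefix_not_True[OF this refl] P show False by (rule notE)
qed

text \<open>The result is compared twice with the exact witness, and a first difference with false
  in the result and true in the exact witness is refuted each time. In the census this shows that
  the result counts at least as many inputs. In the depth bound it shows \<open>d \<le> d0\<close>,
  since a larger bound would still have a zero where \<open>d0\<close> zeros are followed by a
  one.\<close>

theorem stuck_optimal:
  assumes st: "stuck (\<lambda>a. search_word x a \<in> prefixes_of c m A) a"
    and w0: "witness_for c m A (length x) r0 d0 C0"
    and exact: "accepted m C0 (length x) = {y \<in> A. length y = length x}"
  obtains C where "wf_circuit (length x) C" "circuit_depth (length x) C \<le> d0"
    "accepted m C (length x) = {y \<in> A. length y = length x}"
    "output_of (length x) a = encode_circuit C" "length (encode_circuit C) \<le> (length x + 2) ^ c"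
proof -
  let ?j = "length x"
  obtain r d C where w: "witness_for c m A ?j r d C" "a = witness r d C"
    using stuck_witness[OF st w0] .
  have len: "length r = length r0" using w(1) w0 by (simp add: witness_for_def)
  have ge: "value_of r0 \<le> value_of r"
  proof (rule ccontr)
    assume "\<not> value_of r0 \<le> value_of r"
    then have "value_of r < value_of r0" by simp
    from value_of_less_split[OF len this]
    obtain p s s' where p: "r = p @ False # s" "r0 = p @ True # s'" by blast
    have a: "a = p @ False # (s @ replicate d False @ [True] @ encode_circuit C)"
      using w(2) p by (simp add: witness_def)
    have "witness r0 d0 C0 = p @ True # (s' @ replicate d0 False @ [True] @ encode_circuit C0)"
      using p by (simp add: witness_def)
    with w0 stuck_maximal[OF st[unfolded a]] show False by blast
  qed
  let ?S = "{y \<in> A. length y = ?j}"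
  have fin: "finite ?S" by (rule finite_subset[OF _ finite_lists_length[of ?j]]) auto
  have sub: "accepted m C ?j \<subseteq> ?S" using w(1) by (auto simp: witness_for_def accepted_def)
  have card: "card ?S \<le> card (accepted m C ?j)"
    using ge w(1) w0 exact by (simp add: witness_for_def)
  \<comment> \<open>A subset of the finite slice of \<open>A\<close> with at least as many elements
    is the whole slice.\<close>
  have eq: "accepted m C ?j = ?S" by (rule card_seteq[OF fin sub card])
  have "r = r0" by (rule value_of_inj[OF len]) (use w(1) w0 exact eq in \<open>simp add: witness_for_def\<close>)
  have "d \<le> d0"
  proof (rule ccontr)
    assume "\<not> d \<le> d0"
    then obtain e where "d = d0 + Suc e" by (metis less_natE not_le add_Suc_right)
    then have "replicate d False = replicate d0 False @ False # replicate e False"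
      by (simp only: replicate_add replicate_Suc)
    then have a: "a = (r @ replicate d0 False) @ False # (replicate e False @ [True] @ encode_circuit C)"
      using w(2) by (simp only: witness_def append_assoc append_Cons append_Nil)
    have "witness r0 d0 C0 = (r @ replicate d0 False) @ True # encode_circuit C0"
      using \<open>r = r0\<close> by (simp add: witness_def)
    with w0 stuck_maximal[OF st[unfolded a]] show False by blast
  qed
  show thesis
  proof (rule that)
    show "wf_circuit ?j C" using w(1) by (simp add: witness_for_def)
    show "circuit_depth ?j C \<le> d0" using w(1) \<open>d \<le> d0\<close> by (simp add: witness_for_def)
    show "accepted m C ?j = ?S" by (rule eq)
    show "output_of ?j a = encode_circuit C"
      using w by (simp add: output_of_witness witness_for_def)
    show "length (encode_circuit C) \<le> (?j + 2) ^ c"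
      using w(1) by (simp add: witness_for_def witness_def)
  qed
qed

section \<open>Sizes\<close>

lemma circuit_size_le_length: "circuit_size C \<le> length (encode_circuit C)"
proof (induction C)
  case (Cons g C)
  obtain ty ws where g: "g = (ty, ws)" by fastforce
  have "length ws \<le> length (concat (map encode_wire ws))"
    by (induction ws) (simp_all add: encode_wire_def)
  then have "1 + length ws \<le> length (encode_gate g)" by (simp add: g)
  then show ?case using Cons by (simp add: encode_circuit_def circuit_size_def g)
qed (simp add: encode_circuit_def circuit_size_def)

lemma length_le_circuit_size: "length C \<le> circuit_size C"
  by (induction C) (auto simp: circuit_size_def)

text \<open>A wire costs at most \<open>N + 2\<close> bits and a gate three more.\<close>

lemma length_encode_circuit_le:
  assumes "\<And>g w. g \<in> set C \<Longrightarrow> w \<in> set (snd g) \<Longrightarrow> w \<le> N"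
  shows "length (encode_circuit C) \<le> (N + 3) * circuit_size C"
  using assms
proof (induction C)
  case (Cons g C)
  obtain ty ws where g: "g = (ty, ws)" by fastforce
  have "\<forall>w \<in> set ws. w \<le> N" using Cons.prems[of g] by (simp add: g)
  then have "length (concat (map encode_wire ws)) \<le> (N + 3) * length ws"
    by (induction ws) (auto simp: encode_wire_def)
  moreover have "length (encode_gate g) = length (concat (map encode_wire ws)) + 3"
    by (cases ty) (simp_all add: g)
  ultimately have "length (encode_gate g) \<le> (N + 3) * (1 + length ws)" by (simp add: algebra_simps)
  moreover have "length (encode_circuit C) \<le> (N + 3) * circuit_size C"
    using Cons.IH Cons.prems by (meson list.set_intros(2))
  moreover have "length (encode_circuit (g # C)) = length (encode_gate g) + length (encode_circuit C)"
    by (simp add: encode_circuit_def)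
  moreover have "(N + 3) * circuit_size (g # C) = (N + 3) * (1 + length ws) + (N + 3) * circuit_size C"
    by (simp add: circuit_size_def g algebra_simps)
  ultimately show ?case by linarith
qed (simp add: encode_circuit_def)

lemma node_depths_le_length:
  "(\<forall>i < length C. \<forall>w \<in> set (snd (C ! i)). w < n + i) \<Longrightarrow> v \<in> set (node_depths n C) \<Longrightarrow> v \<le> length C"
proof (induction C arbitrary: v rule: rev_induct)
  case (snoc g C)
  have wf: "\<forall>i < length C. \<forall>w \<in> set (snd (C ! i)). w < n + i"
    using snoc.prems(1) by (auto simp: nth_append less_Suc_eq)
  have "\<forall>w \<in> set (snd g). w < n + length C"
    using snoc.prems(1)[rule_format, of "length C"] by simp
  then have "(!) (node_depths n C) ` set (snd g) \<subseteq> set (node_depths n C)"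
    by (auto intro!: nth_mem)
  then have "\<forall>u \<in> insert 0 ((!) (node_depths n C) ` set (snd g)). u \<le> length C"
    using snoc.IH[OF wf] by auto
  then have "Max (insert 0 ((!) (node_depths n C) ` set (snd g))) \<le> length C" by simp
  then show ?case using snoc.prems(2) snoc.IH[OF wf, of v] by (auto simp: node_depths_snoc)
qed (auto split: if_splits)

lemma circuit_depth_le_length: "wf_circuit n C \<Longrightarrow> circuit_depth n C \<le> length C"
  unfolding circuit_depth_def
proof (rule Max.boundedI)
  assume wf: "wf_circuit n C"
  have "node_depths n C \<noteq> []" using wf by (auto simp: wf_circuit_def simp flip: length_greater_0_conv)
  then show "set (node_depths n C) \<noteq> {}" by simp
  show "v \<le> length C" if "v \<in> set (node_depths n C)" for v
    using node_depths_le_length[OF _ that] wf by (simp add: wf_circuit_def)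
qed simp

text \<open>Unary wire numbers make the code quadratic in the size of the circuit; the depth in
  unary costs no more than the number of gates.\<close>

lemma length_witness_le:
  assumes "wf_circuit j C" "length r = Suc j" "circuit_size C \<le> X" "j + 2 \<le> X"
  shows "length (witness r (circuit_depth j C) C) \<le> 8 * X ^ 2"
proof -
  have L: "length C \<le> X" using length_le_circuit_size assms(3) by (rule le_trans)
  have d: "circuit_depth j C \<le> X" using circuit_depth_le_length[OF assms(1)] L by simp
  have "length (encode_circuit C) \<le> (j + length C + 3) * circuit_size C"
  proof (rule length_encode_circuit_le)
    fix g w assume gw: "g \<in> set C" "w \<in> set (snd g)"
    then obtain i where i: "i < length C" "C ! i = g" unfolding in_set_conv_nth by blast
    have "\<forall>w \<in> set (snd (C ! i)). w < j + i" using assms(1) i(1) by (simp add: wf_circuit_def)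
    then have "w < j + i" using gw(2) i(2) by simp
    then show "w \<le> j + length C" using i(1) by simp
  qed
  also have "\<dots> \<le> (3 * X) * X" using L assms(3,4) by (intro mult_mono) auto
  finally have e: "length (encode_circuit C) \<le> 3 * X ^ 2" by (simp add: power2_eq_square)
  have "X \<le> X ^ 2" using assms(4) by (simp add: power2_eq_square)
  then show ?thesis using e d assms(2,4) by (simp add: witness_def)
qed

text \<open>The base \<open>j + 2\<close> is at least 2, so a larger exponent absorbs the constant
  factor and the finitely many values outside the asymptotic range.\<close>

lemma poly_boundedE:
  assumes "poly_bounded f"
  obtains c where "1 \<le> c" "\<And>j. f j \<le> (j + 2) ^ c"
proof -
  obtain e where "(\<lambda>n. real (f n)) \<in> O(\<lambda>n. real n ^ e)" using assms by (auto simp: poly_bounded_def)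
  then obtain K where "\<forall>\<^sub>F n in sequentially. norm (real (f n)) \<le> K * norm (real n ^ e)"
    by (rule landau_o.bigE)
  then obtain N where N: "\<And>n. N \<le> n \<Longrightarrow> real (f n) \<le> K * real n ^ e"
    by (auto simp: eventually_sequentially)
  obtain k1 where k1: "K < 2 ^ k1" using real_arch_pow[of 2 K] by auto
  define k2 where "k2 = (\<Sum>n<N. f n)"
  have f2: "f n \<le> 2 ^ k2" if "n < N" for n
  proof -
    have "f n \<le> k2" unfolding k2_def using that by (intro member_le_sum) auto
    also have "k2 \<le> 2 ^ k2" using less_exp[of k2] by simp
    finally show ?thesis .
  qed
  have "f j \<le> (j + 2) ^ (Suc (k1 + k2 + e))" for j
  proof (cases "j < N")
    case True
    have "f j \<le> 2 ^ k2" using f2 True .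
    also have "\<dots> \<le> (j + 2) ^ k2" by (rule power_mono) simp_all
    also have "\<dots> \<le> (j + 2) ^ (Suc (k1 + k2 + e))" by (rule power_increasing) simp_all
    finally show ?thesis .
  next
    case False
    then have "real (f j) \<le> K * real j ^ e" using N by simp
    also have "\<dots> \<le> 2 ^ k1 * real j ^ e" using k1 by (intro mult_right_mono) simp_all
    also have "\<dots> = real (2 ^ k1 * j ^ e)" by simp
    finally have "f j \<le> 2 ^ k1 * j ^ e" unfolding of_nat_le_iff .
    also have "\<dots> \<le> (j + 2) ^ k1 * (j + 2) ^ e" by (intro mult_mono power_mono) simp_all
    also have "\<dots> = (j + 2) ^ (k1 + e)" by (simp add: power_add)
    also have "\<dots> \<le> (j + 2) ^ (Suc (k1 + k2 + e))" by (rule power_increasing) simp_all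
    finally show ?thesis .
  qed
  then show thesis using that[of "Suc (k1 + k2 + e)"] by simp
qed

lemma poly_boundedI:
  assumes "\<And>j. f j \<le> (j + 2) ^ c"
  shows "poly_bounded f"
  unfolding poly_bounded_def
proof (intro exI bigoI)
  show "\<forall>\<^sub>F n in sequentially. norm (real (f n)) \<le> 3 ^ c * norm (real n ^ c)"
  proof (rule eventually_sequentiallyI)
    fix n :: nat assume n: "1 \<le> n"
    have "f n \<le> (3 * n) ^ c" by (rule le_trans[OF assms power_mono]) (use n in auto)
    then have "real (f n) \<le> real ((3 * n) ^ c)" by (rule of_nat_mono)
    then show "norm (real (f n)) \<le> 3 ^ c * norm (real n ^ c)" by (simp add: power_mult_distrib)
  qed
qed

text \<open>A bound for all lengths instead of almost all: the finitely many exceptional values are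
  absorbed by the constant term of the exponent.\<close>

lemma exponential_bound:
  assumes "f \<in> O(\<lambda>n. real n)" "\<And>n. real (t n) \<le> 2 powr f n"
  obtains a where "\<And>n. t n \<le> 2 ^ (a * n + a)"
proof -
  obtain K where "\<forall>\<^sub>F n in sequentially. norm (f n) \<le> K * norm (real n)"
    using assms(1) by (rule landau_o.bigE)
  then obtain N where N: "\<And>n. N \<le> n \<Longrightarrow> \<bar>f n\<bar> \<le> K * real n" by (auto simp: eventually_sequentially)
  obtain k1 :: nat where k1: "K < real k1" using reals_Archimedean2 by blast
  define k2 where "k2 = (\<Sum>n<N. t n)"
  let ?a = "k1 + k2"
  have "t n \<le> 2 ^ (?a * n + ?a)" for n
  proof (cases "n < N")
    case True
    have "t n \<le> k2" unfolding k2_def using True by (intro member_le_sum) auto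
    also have "k2 \<le> 2 ^ k2" using less_exp[of k2] by simp
    also have "\<dots> \<le> 2 ^ (?a * n + ?a)" by (rule power_increasing) simp_all
    finally show ?thesis .
  next
    case False
    have "f n \<le> K * real n" using N[of n] False by simp
    also have "\<dots> \<le> real k1 * real n" using k1 by (intro mult_right_mono) simp_all
    also have "\<dots> = real (k1 * n)" by simp
    also have "\<dots> \<le> real (?a * n + ?a)" by (rule of_nat_mono) (simp add: algebra_simps)
    finally have "2 powr f n \<le> 2 powr real (?a * n + ?a)" by simp
    also have "\<dots> = real (2 ^ (?a * n + ?a))" by (subst powr_realpow) simp_all
    finally have "real (t n) \<le> real (2 ^ (?a * n + ?a))" using assms(2)[of n] by linarith
    then show ?thesis unfolding of_nat_le_iff .
  qed
  then show thesis by (rule that)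
qed

section \<open>Uniform circuits\<close>

text \<open>The nonuniform family supplies the modulus, the polynomial length bound and, for each
  length, an exact witness to compare with; the machines are built without access to its circuits.
  Depths are dominated pointwise, so the asymptotic bound carries over with its unknown
  constant.\<close>

lemma uniform_if_nonuniform:
  assumes NE: "A \<in> NE" and acc: "has_ACC_circuits k A"
  shows "has_PNE_uniform_ACC_circuits k A"
proof -
  obtain t f where tf: "f \<in> O(\<lambda>n. real n)" "\<And>n. real (t n) \<le> 2 powr f n" "A \<in> NTIME t"
    using NE by (auto simp: NE_def)
  obtain a where a: "\<And>n. t n \<le> 2 ^ (a * n + a)" using exponential_bound[OF tf(1,2)] by blast
  obtain M :: tm where M: "wf_tm M" "A = {x. \<exists>s. accepts_in M x s}"
    "\<forall>x\<in>A. \<exists>s \<le> t (length x). accepts_in M x s"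
    using tf(3) unfolding NTIME_def by blast
  have time: "\<exists>n \<le> 2 ^ (a * length x + a). accepts_in M x n" if "x \<in> A" for x
    using M(3) that a le_trans by blast
  obtain m C0 where m: "m \<ge> 2" and C0: "ACC_family k C0" "family_decides m C0 A"
    using acc by (auto simp: has_ACC_circuits_def)
  have wf0: "wf_circuit j (C0 j)" for j using C0(1) by (simp add: ACC_family_def)
  have acc0: "accepted m (C0 j) j = {y \<in> A. length y = j}" for j
    using C0(2) by (auto simp: accepted_def family_decides_def)
  obtain c where c: "1 \<le> c" "\<And>j. circuit_size (C0 j) \<le> (j + 2) ^ c"
    using poly_boundedE[of "\<lambda>j. circuit_size (C0 j)"] C0(1) by (auto simp: ACC_family_def)
  \<comment> \<open>With \<open>X = (j + 2) ^ c\<close> the witness has at most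
    \<open>8 * X ^ 2\<close> bits, and 8 is at most \<open>(j + 2) ^ 3\<close>.\<close>
  define e where "e = 3 + 2 * c"
  define r0 where "r0 j = bits_of (Suc j) (card (accepted m (C0 j) j))" for j
  have len0: "length (r0 j) = Suc j" for j by (simp only: r0_def length_bits_of)
  have w0: "witness_for e m A j (r0 j) (circuit_depth j (C0 j)) (C0 j)" for j
  proof -
    have "card (accepted m (C0 j) j) \<le> card {x :: bool list. length x = j}"
      by (rule card_mono[OF finite_lists_length]) (auto simp: accepted_def)
    also have "\<dots> = 2 ^ j" using card_lists_length_eq[of "UNIV :: bool set" j] by simp
    finally have "card (accepted m (C0 j) j) < 2 ^ Suc j"
      using zero_less_power[of "2::nat" j] by (simp only: power_Suc) linarith
    then have v: "value_of (r0 j) = card (accepted m (C0 j) j)" unfolding r0_def by (rule value_of_bits_of)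
    have "j + 2 \<le> (j + 2) ^ c" using power_increasing[of 1 c "j + 2"] c(1) by simp
    then have "length (witness (r0 j) (circuit_depth j (C0 j)) (C0 j)) \<le> 8 * ((j + 2) ^ c) ^ 2"
      by (rule length_witness_le[OF wf0 len0 c(2)])
    also have "\<dots> \<le> (j + 2) ^ 3 * ((j + 2) ^ c) ^ 2"
      using power_mono[of 2 "j + 2" 3] by (intro mult_right_mono) simp_all
    also have "\<dots> = (j + 2) ^ e" by (simp add: e_def power_add power_mult mult.commute flip: power_mult)
    finally show ?thesis using wf0 len0 v acc0[of j] by (simp add: witness_for_def)
  qed
  let ?B = "prefixes_of e m A"
  have B: "?B \<in> NE"
  proof (rule prefixes_of_NE[OF M(1,2)])
    show "\<exists>n \<le> 2 ^ (a * length x + a). accepts_in M x n" if "x \<in> A" for x by (rule time[OF that])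
    show "0 < m" using m by simp
    show "\<exists>r d C. witness_for e m A j r d C" for j using w0 by blast
  qed
  have bound: "length b \<le> (length x + 2) ^ e" if sw: "search_word x b \<in> ?B" for x b
  proof -
    obtain r d C s where w: "witness_for e m A (length x) r d C" "b @ s = witness r d C"
      using sw unfolding search_word_prefixes_of by blast
    have "length b + length s = length (witness r d C)" by (simp only: w(2) flip: length_append)
    then have "length b \<le> length (witness r d C)" by simp
    also have "\<dots> \<le> (length x + 2) ^ e" using w(1) by (simp add: witness_for_def)
    finally show ?thesis .
  qed
  obtain F where F: "F \<in> FP ?B"
    "\<And>x. \<exists>b. stuck (\<lambda>b. search_word x b \<in> ?B) b \<and> F x = output_of (length x) b"
    using greedy_FP[of ?B e] bound by blast
  have "\<exists>C. wf_circuit j C \<and> circuit_depth j C \<le> circuit_depth j (C0 j) \<and>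
      accepted m C j = {y \<in> A. length y = j} \<and>
      F (replicate j True) = encode_circuit C \<and> length (encode_circuit C) \<le> (j + 2) ^ e" for j
  proof -
    define x where "x = replicate j True"
    have j: "length x = j" by (simp add: x_def)
    obtain b where b: "stuck (\<lambda>b. search_word x b \<in> ?B) b" "F x = output_of (length x) b"
      using F(2) by blast
    obtain C where "wf_circuit (length x) C" "circuit_depth (length x) C \<le> circuit_depth j (C0 j)"
      "accepted m C (length x) = {y \<in> A. length y = length x}"
      "output_of (length x) b = encode_circuit C" "length (encode_circuit C) \<le> (length x + 2) ^ e"
      by (rule stuck_optimal[OF b(1), of "r0 j" "circuit_depth j (C0 j)" "C0 j"]) (simp_all only: j w0 acc0)
    then show ?thesis using b(2) by (intro exI[of _ C]) (simp add: j flip: x_def)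
  qed
  then obtain C where C: "\<And>j. wf_circuit j (C j)" "\<And>j. circuit_depth j (C j) \<le> circuit_depth j (C0 j)"
    "\<And>j. accepted m (C j) j = {y \<in> A. length y = j}"
    "\<And>j. F (replicate j True) = encode_circuit (C j)" "\<And>j. length (encode_circuit (C j)) \<le> (j + 2) ^ e"
    by meson
  have "poly_bounded (\<lambda>j. circuit_size (C j))"
    by (rule poly_boundedI) (rule le_trans[OF circuit_size_le_length C(5)])
  moreover have "(\<lambda>j. real (circuit_depth j (C j))) \<in> O(\<lambda>j. ln (real j) ^ k)"
  proof (rule landau_o.big_trans)
    show "(\<lambda>j. real (circuit_depth j (C j))) \<in> O(\<lambda>j. real (circuit_depth j (C0 j)))"
      by (rule landau_o.big_mono) (use C(2) in simp)
    show "(\<lambda>j. real (circuit_depth j (C0 j))) \<in> O(\<lambda>j. ln (real j) ^ k)"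
      using C0(1) by (simp add: ACC_family_def)
  qed
  ultimately have "ACC_family k C" using C(1) by (simp add: ACC_family_def)
  moreover have "family_decides m C A"
    unfolding family_decides_def
  proof
    fix x show "x \<in> A \<longleftrightarrow> circuit_eval m (C (length x)) x"
      using C(3)[of "length x"] by (auto simp: accepted_def)
  qed
  moreover have "PNE_uniform C"
    unfolding PNE_uniform_def FP_NE_def using B F(1) C(4) by blast
  ultimately show ?thesis using m unfolding has_PNE_uniform_ACC_circuits_def by blast
qed

theorem theorem1:
  fixes k :: nat
  shows "(\<forall>A\<in>NE. has_ACC_circuits k A) \<longleftrightarrow> (\<forall>A\<in>NE. has_PNE_uniform_ACC_circuits k A)"
proof
  assume "\<forall>A\<in>NE. has_ACC_circuits k A"
  then show "\<forall>A\<in>NE. has_PNE_uniform_ACC_circuits k A" using uniform_if_nonuniform by blast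
next
  assume "\<forall>A\<in>NE. has_PNE_uniform_ACC_circuits k A"
  then show "\<forall>A\<in>NE. has_ACC_circuits k A"
    unfolding has_PNE_uniform_ACC_circuits_def has_ACC_circuits_def by blast
qed

end
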